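(* Let $\mathcal F$ be an intersecting family in one of the known finite circle geometries of order $q$, that is, an ovoidal circle geometry of order $q$ or a Minkowski plane $\mathrm{CM}(2,q,\varphi)$. If $$|\mathcal F|\ge \frac1{\sqrt2}q^2+2\sqrt2\,q+8,$$ then all circles of $\mathcal F$ go through a common point, or, in case of a Laguerre plane of even order, all circles of $\mathcal F$ go through a common point or through a common nucleus.
   Context: A circle geometry is an incidence structure $(\mathcal P,\mathcal B)$ (points and blocks, each block being a subset of $\mathcal P$; blocks are called circles) together with $\rho\in\{0,1,2\}$ parallel relations (partitions of $\mathcal P$ into parallel classes; two points are parallel if they lie in the same parallel class of some parallel relation) such that: (1) three distinct pairwise non-parallel points lie on a unique circle; (2) given a circle $c$, a point $P\in c$ and a point $Q\notin c$ not parallel with $P$, there is a unique circle through $P$ and $Q$ meeting $c$ only in $P$; (3) every circle contains a unique point of each parallel class; (4) two parallel classes from different parallel relations meet in a unique point; (5) each circle has at least three points, and there exist a circle and a point not on it. It is a Möbius, Laguerre or Minkowski plane if $\rho=0,1,2$ respectively. A finite one has order $q$ if every circle has $q+1$ points. Ovoidal circle geometries of order $q$. An oval is a set of $q+1$ points in $\mathrm{PG}(2,q)$, no three on a line. Let $\mathcal Q$ be one of the following sets in $\mathrm{PG}(3,q)$: an ovoid (a set of $q^2+1$ points, no three on a line, such that the tangent lines at each of its points form a plane; the last condition is automatic for $q>2$); an oval cone (take an oval $\mathcal O$ in a plane and a point $R$, the vertex, not in this plane; the union of all lines through $R$ meeting $\mathcal O$); a hyperbolic quadric $\mathcal Q^+(3,q)$.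 A plane $\pi$ is an oval plane if $\pi\cap\mathcal Q$ is an oval in $\pi$. The points of the geometry are the points of $\mathcal Q$ (excluding the vertex for an oval cone), and the circles are the sets $\pi\cap\mathcal Q$ with $\pi$ an oval plane. These geometries are a Möbius, Laguerre, Minkowski plane respectively, and are called ovoidal. Nuclei. If $q$ is even, an oval in a plane has a nucleus: the point $N$ of the plane such that the tangent lines (lines meeting the oval in exactly one point) in that plane are exactly the lines through $N$. For an ovoidal Laguerre plane of even order, the nucleus of a circle $\pi\cap\mathcal Q$ is the nucleus of this oval in $\pi$; a circle goes through a nucleus $N$ if its nucleus is $N$. The planes $\mathrm{CM}(2,q,\varphi)$. Let $q$ be a prime power and $\varphi$ a field automorphism of $\mathbb F_q$. For $M\in\mathrm{PGL}(2,q)$ define $f_M$ on $\mathrm{PG}(1,q)$ by $f_M(x)=Mx$ if $M\in\mathrm{PSL}(2,q)$ and $f_M(x)=Mx^\varphi$ otherwise ($\varphi$ applied coordinatewise). The points of $\mathrm{CM}(2,q,\varphi)$ are $\mathrm{PG}(1,q)\times\mathrm{PG}(1,q)$ and the circles are the graphs $\{(x,f_M(x)) : x\in\mathrm{PG}(1,q)\}$, $M\in\mathrm{PGL}(2,q)$. An intersecting family is a set of circles any two of which have non-empty intersection. *)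

theory Defs
  imports "HOL-Analysis.Analysis"
begin

text \<open>
  The field with \<open>q\<close> elements is a type \<open>'a :: {field, finite}\<close> with \<open>q = CARD('a)\<close>.
  The subspaces of \<open>PG(n-1,q)\<close> are the linear subspaces of \<open>'a ^ 'n\<close>, \<open>n = CARD('n)\<close>,
  and a point lies on a line or in a plane if it is contained in it as a subspace.
\<close>

definition pg_point :: "('a::field ^ 'n) set \<Rightarrow> bool" where
  "pg_point P \<longleftrightarrow> vec.subspace P \<and> vec.dim P = 1"

definition pg_line :: "('a::field ^ 'n) set \<Rightarrow> bool" where
  "pg_line l \<longleftrightarrow> vec.subspace l \<and> vec.dim l = 2"

definition pg_plane :: "('a::field ^ 'n) set \<Rightarrow> bool" where
  "pg_plane \<pi> \<longleftrightarrow> vec.subspace \<pi> \<and> vec.dim \<pi> = 3"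

definition no_three_collinear :: "('a::field ^ 'n) set set \<Rightarrow> bool" where
  "no_three_collinear S \<longleftrightarrow>
     (\<forall>A\<in>S. \<forall>B\<in>S. \<forall>C\<in>S. A \<noteq> B \<and> A \<noteq> C \<and> B \<noteq> C \<longrightarrow>
        \<not> (\<exists>l. pg_line l \<and> A \<subseteq> l \<and> B \<subseteq> l \<and> C \<subseteq> l))"

definition tangent_line :: "('a::field ^ 'n) set set \<Rightarrow> ('a ^ 'n) set \<Rightarrow> bool" where
  "tangent_line S l \<longleftrightarrow> pg_line l \<and> (\<exists>!P. P \<in> S \<and> P \<subseteq> l)"

definition oval_in :: "('a::{field,finite} ^ 'n) set \<Rightarrow> ('a ^ 'n) set set \<Rightarrow> bool" where
  "oval_in \<pi> S \<longleftrightarrow> pg_plane \<pi> \<and> (\<forall>P\<in>S. pg_point P \<and> P \<subseteq> \<pi>) \<and>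
     card S = CARD('a) + 1 \<and> no_three_collinear S"

definition nucleus_in ::
    "('a::field ^ 'n) set \<Rightarrow> ('a ^ 'n) set set \<Rightarrow> ('a ^ 'n) set \<Rightarrow> bool" where
  "nucleus_in \<pi> S N \<longleftrightarrow> pg_point N \<and> N \<subseteq> \<pi> \<and>
     {l. tangent_line S l \<and> l \<subseteq> \<pi>} = {l. pg_line l \<and> l \<subseteq> \<pi> \<and> N \<subseteq> l}"

definition ovoid :: "('a::{field,finite} ^ 4) set set \<Rightarrow> bool" where
  "ovoid S \<longleftrightarrow> (\<forall>P\<in>S. pg_point P) \<and> card S = CARD('a)\<^sup>2 + 1 \<and> no_three_collinear S \<and>
     (\<forall>P\<in>S. \<exists>\<pi>. pg_plane \<pi> \<and> P \<subseteq> \<pi> \<and>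
        {l. tangent_line S l \<and> P \<subseteq> l} = {l. pg_line l \<and> P \<subseteq> l \<and> l \<subseteq> \<pi>})"

definition oval_cone :: "('a::{field,finite} ^ 4) set \<Rightarrow> ('a ^ 4) set set \<Rightarrow> bool" where
  "oval_cone R S \<longleftrightarrow> pg_point R \<and>
     (\<exists>\<pi> Ov. oval_in \<pi> Ov \<and> \<not> R \<subseteq> \<pi> \<and>
        S = {P. pg_point P \<and> (\<exists>l. pg_line l \<and> R \<subseteq> l \<and> (\<exists>X\<in>Ov. X \<subseteq> l) \<and> P \<subseteq> l)})"

text \<open>The zero set of \<open>x\<^sub>1 x\<^sub>2 + x\<^sub>3 x\<^sub>4\<close>, up to a change of coordinates.\<close>

definition hyperbolic_quadric :: "('a::field ^ 4) set set \<Rightarrow> bool" where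
  "hyperbolic_quadric S \<longleftrightarrow>
     (\<exists>A :: 'a ^ 4 ^ 4. invertible A \<and>
        S = {P. pg_point P \<and>
                (\<forall>v\<in>P. (A *v v) $ 1 * (A *v v) $ 2 + (A *v v) $ 3 * (A *v v) $ 4 = 0)})"

definition plane_section :: "('a::field ^ 4) set set \<Rightarrow> ('a ^ 4) set \<Rightarrow> ('a ^ 4) set set" where
  "plane_section S \<pi> = {P\<in>S. P \<subseteq> \<pi>}"

definition oval_plane :: "('a::{field,finite} ^ 4) set set \<Rightarrow> ('a ^ 4) set \<Rightarrow> bool" where
  "oval_plane S \<pi> \<longleftrightarrow> pg_plane \<pi> \<and> oval_in \<pi> (plane_section S \<pi>)"

definition ovoidal_circles :: "('a::{field,finite} ^ 4) set set \<Rightarrow> ('a ^ 4) set set set" where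
  "ovoidal_circles S = {plane_section S \<pi> | \<pi>. oval_plane S \<pi>}"

text \<open>
  A circle determines its plane, as it has at least three points and no three are collinear;
  so the existential quantifier below ranges over a single plane.
\<close>

definition circle_through_nucleus ::
    "('a::{field,finite} ^ 4) set set \<Rightarrow> ('a ^ 4) set set \<Rightarrow> ('a ^ 4) set \<Rightarrow> bool" where
  "circle_through_nucleus S c N \<longleftrightarrow>
     (\<exists>\<pi>. oval_plane S \<pi> \<and> c = plane_section S \<pi> \<and> nucleus_in \<pi> c N)"

definition field_automorphism :: "('a::field \<Rightarrow> 'a) \<Rightarrow> bool" where
  "field_automorphism \<phi> \<longleftrightarrow> bij \<phi> \<and>
     (\<forall>x y. \<phi> (x + y) = \<phi> x + \<phi> y) \<and> (\<forall>x y. \<phi> (x * y) = \<phi> x * \<phi> y)"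

text \<open>
  An element of \<open>PGL(2,q)\<close> is given by an invertible matrix; it lies in \<open>PSL(2,q)\<close>, the image
  of \<open>SL(2,q)\<close>, if the matrix is a nonzero scalar multiple of one of determinant 1.
  Neither this nor \<open>CM_map\<close> below depends on the matrix chosen to represent the element.
\<close>

definition represents_PSL :: "'a::field ^ 2 ^ 2 \<Rightarrow> bool" where
  "represents_PSL M \<longleftrightarrow> (\<exists>k N. k \<noteq> 0 \<and> det N = 1 \<and> M = mat k ** N)"

definition CM_map ::
    "('a::field \<Rightarrow> 'a) \<Rightarrow> 'a ^ 2 ^ 2 \<Rightarrow> ('a ^ 2) set \<Rightarrow> ('a ^ 2) set" where
  "CM_map \<phi> M x =
     (if represents_PSL M then (\<lambda>v. M *v v) ` x
      else (\<lambda>v. M *v (\<chi> i. \<phi> (v $ i))) ` x)"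

definition CM_points :: "(('a::field ^ 2) set \<times> ('a ^ 2) set) set" where
  "CM_points = {x. pg_point x} \<times> {x. pg_point x}"

definition CM_circles ::
    "('a::field \<Rightarrow> 'a) \<Rightarrow> (('a ^ 2) set \<times> ('a ^ 2) set) set set" where
  "CM_circles \<phi> = {{(x, CM_map \<phi> M x) | x. pg_point x} | M. invertible M}"

definition intersecting_family :: "'p set set \<Rightarrow> 'p set set \<Rightarrow> bool" where
  "intersecting_family circles F \<longleftrightarrow> F \<subseteq> circles \<and> (\<forall>c\<in>F. \<forall>d\<in>F. c \<inter> d \<noteq> {})"

end

theory Submission
  imports Defs
begin

text \<open>Let \<open>c\<close> be a circle missing a point \<open>P\<close> that lies on many circles of the family \<open>F\<close>. Weighting a circle \<open>l\<close> through
  \<open>P\<close> by the number of its points on \<open>c\<close> (tangents counted suitably), a second-moment estimate bounds the number of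
  members of \<open>F\<close> through \<open>P\<close>, so a point on sufficiently many members lies on all of them. Such a point exists by
  counting incident pairs of members of \<open>F\<close>: two distinct members share two points unless they are tangent.
  In Laguerre planes of even order the tangency problem disappears once the nucleus is added to the oval,
  which is why a common nucleus appears as an alternative.\<close>

text \<open>The constant 1/sqrt 2 is the balance of two estimates. Write f = |F|. Pair counting
  yields a point P on m members with m at least about 2f/q, and as long as some member misses P, the
  second-moment inequality reads, to leading order, (f - m) m \<le> q^3. At m = 2f/q this becomes 2
  f^2 / q \<le> q^3 up to lower terms, which fails beyond f = q^2 / sqrt 2. Larger m does not help:
  at most about q^2 / 2 circles through P meet a given circle off P, and the defect of the
  inequality is a concave quadratic in m, so it need only be examined at both ends.

  The obstacle is the number of circles touching two given ones. Parity bounds it by q - 1, or by 2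
  (q - 1) for odd q with no or two parallel relations. That factor 2 is absorbed by splitting the
  circles into two types that touching preserves, each exactly half of all circles. In Minkowski
  planes the type is the square class of a determinant; for ovoids it comes from a symmetric
  bilinear form built out of the tangent planes.\<close>

lemma sum_count_swap:
  assumes "finite A" "finite B"
  shows "(\<Sum>a\<in>A. real (card {b\<in>B. R a b})) = (\<Sum>b\<in>B. real (card {a\<in>A. R a b}))"
proof -
  have "(\<Sum>a\<in>A. card {b\<in>B. R a b}) = (\<Sum>b\<in>B. card {a\<in>A. R a b})"
    by (rule sum_multicount_gen) (use assms in auto)
  then show ?thesis
    unfolding of_nat_sum[symmetric] by (rule arg_cong)
qed

text \<open>A bijection given by a relation that is functional in both directions. It is used where
  the correspondence is an incidence and no map needs to be named.\<close>

lemma card_eq_by_unique: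
  assumes "finite A" "finite B"
    and "\<And>a. a \<in> A \<Longrightarrow> card {b\<in>B. R a b} = 1"
    and "\<And>b. b \<in> B \<Longrightarrow> card {a\<in>A. R a b} = 1"
  shows "card A = card B"
  using sum_multicount[of A B R 1] assms by simp

lemma card_1I: "x \<in> A \<Longrightarrow> (\<And>y. y \<in> A \<Longrightarrow> y = x) \<Longrightarrow> card A = 1"
  by (metis card_1_singleton_iff One_nat_def empty_iff insert_iff subsetI subset_antisym)

section \<open>Circle planes described by incidence counts\<close>

text \<open>\<open>np\<close> stands for distinct and non-parallel, \<open>K\<close> is the number
  of points on a circle, \<open>r\<close> turns out to be the number of circles through two
  non-parallel points, and \<open>\<rho>\<close> is the number of parallel relations. The tangency
  axiom is replaced by point counts, from which it is recovered below with \<open>e\<close> circles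
  in place of one. The case \<open>e = 1\<close>, \<open>K = q + 1\<close> is an ordinary plane;
  \<open>e = 0\<close>, \<open>K = q + 2\<close> is a Laguerre plane of even order whose circles
  have been extended by a nucleus, so that nothing touches any more.\<close>

locale circle_plane =
  fixes V :: "'p set" and C :: "'p set set" and np :: "'p \<Rightarrow> 'p \<Rightarrow> bool"
    and q K r e \<rho> :: nat
  assumes finV: "finite V" and q2: "q \<ge> 2"
    and Ke: "K + e = q + 2" and e1: "e \<le> 1" and r\<rho>: "r + \<rho> = q + 1" and \<rho>2: "\<rho> \<le> 2"
    and e0: "e = 0 \<Longrightarrow> r = q"
    and circ_sub: "c \<in> C \<Longrightarrow> c \<subseteq> V"
    and circ_card: "c \<in> C \<Longrightarrow> card c = K"
    and np_sym: "np x y \<Longrightarrow> np y x"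
    and np_irrefl: "\<not> np x x"
    and circ_np: "c \<in> C \<Longrightarrow> x \<in> c \<Longrightarrow> y \<in> c \<Longrightarrow> x \<noteq> y \<Longrightarrow> np x y"
    and circ3: "x \<in> V \<Longrightarrow> y \<in> V \<Longrightarrow> z \<in> V \<Longrightarrow> np x y \<Longrightarrow> np x z \<Longrightarrow> np y z \<Longrightarrow>
                  \<exists>!c. c \<in> C \<and> x \<in> c \<and> y \<in> c \<and> z \<in> c"
    and circ_off: "c \<in> C \<Longrightarrow> x \<in> V \<Longrightarrow> x \<notin> c \<Longrightarrow> card {y\<in>c. np x y} + \<rho> = K"
    and np_card: "x \<in> V \<Longrightarrow> card {y\<in>V. np x y} = q * (K - 1)"
    and np2_card: "x \<in> V \<Longrightarrow> y \<in> V \<Longrightarrow> np x y \<Longrightarrow> card {z\<in>V. np x z \<and> np y z} = r * (K - 2)"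
begin

lemma K3: "K \<ge> 3"
  using q2 Ke e1 by linarith

lemma finC: "finite C"
  using circ_sub finV by (meson Pow_iff finite_Pow_iff finite_subset subsetI)

lemma fin_circ: "c \<in> C \<Longrightarrow> finite c"
  using circ_sub finV finite_subset by blast

lemma circ_unique:
  assumes "c \<in> C" "d \<in> C" "x \<in> c \<inter> d" "y \<in> c \<inter> d" "z \<in> c \<inter> d" "x \<noteq> y" "x \<noteq> z" "y \<noteq> z"
  shows "c = d"
  using circ3[of x y z] circ_np[of c] circ_sub[of c] assms by blast

lemma card_inter_le2:
  assumes "c \<in> C" "d \<in> C" "c \<noteq> d"
  shows "card (c \<inter> d) \<le> 2"
proof (rule ccontr)
  assume "\<not> card (c \<inter> d) \<le> 2"
  then obtain T where "T \<subseteq> c \<inter> d" "card T = 3"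
    by (metis not_less_eq_eq numeral_2_eq_2 numeral_3_eq_3 obtain_subset_with_card_n)
  then obtain x y z where "x \<in> c \<inter> d" "y \<in> c \<inter> d" "z \<in> c \<inter> d" "x \<noteq> y" "x \<noteq> z" "y \<noteq> z"
    by (auto simp: card_3_iff)
  then show False using circ_unique assms by blast
qed

lemma circ_np_Int:
  assumes "c \<in> C" "x \<in> c"
  shows "{z\<in>V. np x z} \<inter> c = c - {x}"
proof
  show "{z\<in>V. np x z} \<inter> c \<subseteq> c - {x}" using np_irrefl by blast
  show "c - {x} \<subseteq> {z\<in>V. np x z} \<inter> c" using circ_np circ_sub assms by blast
qed

text \<open>Double count the pairs of a circle through \<open>x\<close>, \<open>y\<close> and a
  third point on it: each admissible third point determines one circle, and each circle carries
  \<open>K - 2\<close> such points.\<close>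

lemma card_circ_through2:
  assumes "x \<in> V" "y \<in> V" "np x y"
  shows "card {c\<in>C. x \<in> c \<and> y \<in> c} = r"
proof -
  let ?Z = "{z\<in>V. np x z \<and> np y z}" and ?D = "{c\<in>C. x \<in> c \<and> y \<in> c}"
  have xy: "x \<noteq> y" using assms np_irrefl by blast
  have 1: "card {z\<in>?Z. z \<in> c} = K - 2" if "c \<in> ?D" for c
  proof -
    have "{z\<in>?Z. z \<in> c} = ({z\<in>V. np x z} \<inter> c) \<inter> ({z\<in>V. np y z} \<inter> c)" by blast
    then have "{z\<in>?Z. z \<in> c} = c - {x, y}"
      using circ_np_Int[of c x] circ_np_Int[of c y] that by auto
    then show ?thesis using that xy circ_card[of c] fin_circ[of c] by (simp add: card_Diff_subset)
  qed
  have 2: "card {c\<in>?D. z \<in> c} = 1" if "z \<in> ?Z" for z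
  proof -
    have "\<exists>!c. c \<in> {c\<in>?D. z \<in> c}"
      using circ3[of x y z] assms that by auto
    then show ?thesis by (meson card_1I)
  qed
  have "(\<Sum>c\<in>?D. card {z\<in>?Z. z \<in> c}) = 1 * card ?Z"
    using sum_multicount[of ?D ?Z "\<lambda>c z. z \<in> c" 1] finC finV 2 by simp
  then have "card ?D * (K - 2) = r * (K - 2)"
    using 1 np2_card[OF assms] by simp
  then show ?thesis using K3 by simp
qed

lemma card_circ_through:
  assumes "x \<in> V"
  shows "card {c\<in>C. x \<in> c} = q * r"
proof -
  let ?Z = "{z\<in>V. np x z}" and ?D = "{c\<in>C. x \<in> c}"
  have 1: "card {z\<in>?Z. z \<in> c} = K - 1" if "c \<in> ?D" for c
  proof -
    have "{z\<in>?Z. z \<in> c} = {z\<in>V. np x z} \<inter> c" by blast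
    then have "{z\<in>?Z. z \<in> c} = c - {x}"
      using circ_np_Int that by simp
    then show ?thesis using that circ_card[of c] fin_circ[of c] by simp
  qed
  have 2: "card {c\<in>?D. z \<in> c} = r" if "z \<in> ?Z" for z
  proof -
    have "{c\<in>?D. z \<in> c} = {c\<in>C. x \<in> c \<and> z \<in> c}" by auto
    then show ?thesis using card_circ_through2[of x z] that assms by simp
  qed
  have "(\<Sum>c\<in>?D. card {z\<in>?Z. z \<in> c}) = r * card ?Z"
    using sum_multicount[of ?D ?Z "\<lambda>c z. z \<in> c" r] finC finV 2 by simp
  then have "card ?D * (K - 1) = (q * r) * (K - 1)"
    using 1 np_card[OF assms] by (simp add: mult.commute)
  then show ?thesis using K3 by simp
qed

lemma card_off: "c \<in> C \<Longrightarrow> x \<in> V \<Longrightarrow> x \<notin> c \<Longrightarrow> card {y\<in>c. np x y} = r + 1 - e"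
  using circ_off[of c x] Ke r\<rho> by linarith

lemma r1: "r \<ge> 1" "r \<ge> e" "q \<le> r + 1" "r \<le> q + 1"
  using r\<rho> \<rho>2 q2 e1 by linarith+

text \<open>The tangency axiom in counting form. Of the \<open>r\<close> circles through
  \<open>X\<close> and \<open>Q\<close>, those that meet \<open>c\<close> again correspond to the
  points of \<open>c\<close> other than \<open>X\<close> that are not parallel to \<open>Q\<close>.
  There are \<open>r - e\<close> such points, and the remaining circles touch.\<close>

lemma card_tangent_through:
  assumes "c \<in> C" "X \<in> c" "Q \<in> V" "Q \<notin> c" "np X Q"
  shows "card {d\<in>C. Q \<in> d \<and> c \<inter> d = {X}} = e"
proof -
  define D where "D = {d\<in>C. X \<in> d \<and> Q \<in> d}"
  define Y where "Y = {y\<in>c. np Q y} - {X}"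
  define S where "S = {d\<in>D. \<exists>y\<in>Y. y \<in> d}"
  define T where "T = {d\<in>C. Q \<in> d \<and> c \<inter> d = {X}}"
  have XV: "X \<in> V" and QX: "np Q X" using assms circ_sub np_sym by blast+
  have Dc: "d \<in> C" "X \<in> d" "Q \<in> d" "c \<noteq> d" if "d \<in> D" for d
    using that assms by (auto simp: D_def)
  have Yc: "y \<in> c" "y \<noteq> X" "np Q y" if "y \<in> Y" for y
    using that by (auto simp: Y_def)
  have fin: "finite D" "finite S" "finite Y" "finite T"
    using finC fin_circ[OF assms(1)] by (auto simp: D_def S_def Y_def T_def)
  have "card S = card Y"
  proof (rule card_eq_by_unique[OF fin(2,3)])
    fix d assume "d \<in> S"
    then have d: "d \<in> D" by (simp add: S_def)
    from \<open>d \<in> S\<close> obtain y where y: "y \<in> Y" "y \<in> d" by (auto simp: S_def)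
    show "card {y\<in>Y. y \<in> d} = 1"
    proof (rule card_1I)
      show "y \<in> {y\<in>Y. y \<in> d}" using y by simp
      fix z assume "z \<in> {y\<in>Y. y \<in> d}"
      then show "z = y"
        using circ_unique[of c d X y z] Dc[OF d] Yc[of y] Yc[of z] y assms(1,2) by auto
    qed
  next
    fix y assume y: "y \<in> Y"
    have "np X y" using Yc[OF y] circ_np[of c X y] assms by blast
    then have "\<exists>!d. d \<in> C \<and> X \<in> d \<and> Q \<in> d \<and> y \<in> d"
      using circ3[of X Q y] Yc[OF y] assms XV circ_sub[of c] by blast
    moreover have "{d\<in>S. y \<in> d} = {d. d \<in> C \<and> X \<in> d \<and> Q \<in> d \<and> y \<in> d}"
      using y by (auto simp: S_def D_def)
    ultimately show "card {d\<in>S. y \<in> d} = 1" by (metis (mono_tags, lifting) card_1I mem_Collect_eq)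
  qed
  moreover have "card Y = r - e"
    using card_off[of c Q] assms QX fin_circ[of c] r1 e1 by (simp add: Y_def card_Diff_singleton)
  moreover have "D = S \<union> T"
  proof
    show "S \<union> T \<subseteq> D" using assms by (auto simp: S_def T_def D_def)
    show "D \<subseteq> S \<union> T"
    proof
      fix d assume d: "d \<in> D"
      show "d \<in> S \<union> T"
      proof (cases "c \<inter> d = {X}")
        case True
        then show ?thesis using Dc[OF d] by (simp add: T_def)
      next
        case False
        then obtain y where y: "y \<in> c" "y \<in> d" "y \<noteq> X" using Dc[OF d] assms by blast
        then have "np Q y" using circ_np[of d Q y] Dc[OF d] assms by blast
        then show ?thesis using y d by (auto simp: S_def Y_def)
      qed
    qed
  qed
  moreover have "S \<inter> T = {}" by (auto simp: S_def T_def Y_def)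
  moreover have "card D = r" using card_circ_through2[OF XV \<open>Q \<in> V\<close> \<open>np X Q\<close>] by (simp add: D_def)
  ultimately have "r = (r - e) + card T"
    using card_Un_disjoint[of S T] fin by simp
  then show ?thesis using r1 unfolding T_def by linarith
qed

text \<open>Each of the (q - 1)(K - 1) points off \<open>c\<close> that are not parallel to
  \<open>X\<close> lies on \<open>e\<close> of these circles, and each of these circles carries
  \<open>K - 1\<close> such points.\<close>

lemma card_tangent_at:
  assumes "c \<in> C" "X \<in> c"
  shows "card {d\<in>C. c \<inter> d = {X}} = e * (q - 1)"
proof -
  let ?Z = "{z\<in>V. np X z} - c" and ?D = "{d\<in>C. c \<inter> d = {X}}"
  have XV: "X \<in> V" using assms circ_sub by blast
  have 1: "card {z\<in>?Z. z \<in> d} = K - 1" if "d \<in> ?D" for d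
  proof -
    have "{z\<in>?Z. z \<in> d} = ({z\<in>V. np X z} \<inter> d) - c" by blast
    then have "{z\<in>?Z. z \<in> d} = d - {X}"
      using that circ_np_Int[of d X] by auto
    moreover have "X \<in> d" using that by blast
    ultimately show ?thesis using that circ_card[of d] fin_circ[of d] by simp
  qed
  have 2: "card {d\<in>?D. z \<in> d} = e" if "z \<in> ?Z" for z
  proof -
    have "{d\<in>?D. z \<in> d} = {d\<in>C. z \<in> d \<and> c \<inter> d = {X}}" by auto
    then show ?thesis using card_tangent_through[of c X z] that assms by simp
  qed
  have "{z\<in>V. np X z} \<inter> c = c - {X}"
    using assms circ_np_Int by blast
  then have cZ: "card ?Z = q * (K - 1) - (K - 1)"
    using np_card[OF XV] finV assms circ_card[of c] fin_circ[of c]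
    by (subst card_Diff_subset_Int) auto
  have "(\<Sum>d\<in>?D. card {z\<in>?Z. z \<in> d}) = e * card ?Z"
    using sum_multicount[of ?D ?Z "\<lambda>c z. z \<in> c" e] finC finV 2 by simp
  then have "card ?D * (K - 1) = (e * (q - 1)) * (K - 1)"
    using 1 cZ by (simp add: algebra_simps diff_mult_distrib)
  then show ?thesis using K3 by simp
qed

text \<open>A second common point of \<open>c\<close> and \<open>g\<close> would lie on two circles
  touching \<open>d\<close> at \<open>X\<close>, against the uniqueness of tangents. So touching at
  a fixed point, together with equality, is an equivalence relation.\<close>

lemma tangent_trans:
  assumes "c \<in> C" "d \<in> C" "g \<in> C" "c \<inter> d = {X}" "d \<inter> g = {X}" "c \<noteq> g"
  shows "c \<inter> g = {X}"
proof (rule ccontr)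
  assume "c \<inter> g \<noteq> {X}"
  then obtain Y where Y: "Y \<in> c" "Y \<in> g" "Y \<noteq> X" using assms by blast
  have "np X Y" "Y \<in> V" "Y \<notin> d" using Y assms circ_np[of c X Y] circ_sub[of c] by blast+
  then have "card {h\<in>C. Y \<in> h \<and> d \<inter> h = {X}} \<le> 1"
    using card_tangent_through[of d X Y] assms e1 by auto
  moreover have "{c, g} \<subseteq> {h\<in>C. Y \<in> h \<and> d \<inter> h = {X}}" using assms Y by auto
  then have "card {c, g} \<le> card {h\<in>C. Y \<in> h \<and> d \<inter> h = {X}}"
    using finC by (intro card_mono) auto
  ultimately show False using assms by simp
qed

text \<open>Count the pairs of a point of \<open>c\<close> and a non-parallel point off
  \<open>c\<close>. The form with the factor \<open>r\<close> on the left is the one shared by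
  \<open>e = 0\<close> and \<open>e = 1\<close>.\<close>

lemma card_V:
  assumes "c \<in> C"
  shows "card V * r = K * (q * (q - 1) + r)"
proof -
  have 1: "card {x\<in>V - c. np y x} = (q - 1) * (K - 1)" if "y \<in> c" for y
  proof -
    have "{x\<in>V. np y x} \<inter> c = c - {y}"
      using that assms circ_np_Int by blast
    moreover have "{x\<in>V - c. np y x} = {x\<in>V. np y x} - c" by auto
    ultimately have "card {x\<in>V - c. np y x} = q * (K - 1) - (K - 1)"
      using np_card[of y] finV that assms circ_card[of c] fin_circ[of c] circ_sub[of c]
      by (simp add: card_Diff_subset_Int subset_iff)
    then show ?thesis by (simp add: diff_mult_distrib)
  qed
  have "(\<Sum>y\<in>c. card {x\<in>V - c. np y x}) = (r + 1 - e) * card (V - c)"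
  proof (rule sum_multicount)
    show "\<forall>x\<in>V - c. card {y\<in>c. np y x} = r + 1 - e"
    proof
      fix x assume "x \<in> V - c"
      moreover have "{y\<in>c. np y x} = {y\<in>c. np x y}" using np_sym by blast
      ultimately show "card {y\<in>c. np y x} = r + 1 - e"
        using card_off[OF assms, of x] by simp
    qed
  qed (use finV fin_circ assms in auto)
  moreover have "(\<Sum>y\<in>c. card {x\<in>V - c. np y x}) = K * ((q - 1) * (K - 1))"
    using 1 circ_card[OF assms] by simp
  moreover have "card (V - c) = card V - K" "K \<le> card V"
    using circ_sub[OF assms] circ_card[OF assms] fin_circ[OF assms] finV
    by (auto simp: card_Diff_subset intro: card_mono)
  ultimately have *: "K * ((q - 1) * (K - 1)) = (r + 1 - e) * (card V - K)" by simp
  obtain v where v: "card V = v + K" using \<open>K \<le> card V\<close> by (metis add.commute le_Suc_ex)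
  show ?thesis
  proof (cases "e = 0")
    case True
    then have "r = q" "K = q + 2" using e0 Ke by auto
    then have "(q + 1) * v = (q + 1) * ((q + 2) * (q - 1))" using * v True by (simp add: algebra_simps)
    then have "v = (q + 2) * (q - 1)" by (metis Suc_eq_plus1 mult_cancel1 nat.simps(3))
    moreover obtain p where "q = Suc p" using q2 by (cases q) auto
    ultimately show ?thesis using v \<open>r = q\<close> \<open>K = q + 2\<close> by (simp add: algebra_simps)
  next
    case False
    then have "e = 1" "K = q + 1" using e1 Ke by auto
    then have "r * v = (q + 1) * ((q - 1) * q)" using * v by simp
    moreover obtain p where "q = Suc p" using q2 by (cases q) auto
    ultimately show ?thesis using v \<open>K = q + 1\<close> by (simp add: algebra_simps)
  qed
qed

lemma card_C:
  assumes "C \<noteq> {}"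
  shows "card C = q\<^sup>2 * (q - 1) + q * r"
proof -
  obtain c where c: "c \<in> C" using assms by blast
  have "(\<Sum>x\<in>V. card {d\<in>C. x \<in> d}) = K * card C"
  proof (rule sum_multicount)
    show "\<forall>d\<in>C. card {x\<in>V. x \<in> d} = K"
    proof
      fix d assume "d \<in> C"
      moreover have "{x\<in>V. x \<in> d} = d" using circ_sub \<open>d \<in> C\<close> by blast
      ultimately show "card {x\<in>V. x \<in> d} = K" using circ_card by simp
    qed
  qed (use finV finC in auto)
  then have "card V * (q * r) = K * card C" using card_circ_through by simp
  moreover have "card V * (q * r) = K * (q * (q * (q - 1) + r))"
    using card_V[OF c] by (metis mult.assoc mult.commute)
  ultimately have "K * card C = K * (q * (q * (q - 1) + r))" by (simp only:)
  then have "card C = q * (q * (q - 1) + r)" using K3 by simp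
  then show ?thesis by (simp add: power2_eq_square distrib_left mult.assoc)
qed

text \<open>The size of the range of all moment sums below; the dependence on \<open>r\<close> has
  cancelled.\<close>

lemma card_C_off:
  assumes "P \<in> V" "C \<noteq> {}"
  shows "card {c\<in>C. P \<notin> c} = q\<^sup>2 * (q - 1)"
proof -
  have "{c\<in>C. P \<notin> c} = C - {c\<in>C. P \<in> c}" by auto
  then have "card {c\<in>C. P \<notin> c} = card C - card {c\<in>C. P \<in> c}"
    using finC by (simp add: card_Diff_subset)
  then show ?thesis using card_C card_circ_through assms by simp
qed

end

section \<open>Moments of intersection numbers over the circles missing a point\<close>

definition touching :: "'p set \<Rightarrow> 'p set \<Rightarrow> bool" where
  "touching c d \<longleftrightarrow> card (c \<inter> d) = 1"

lemma touching_sym: "touching c d \<longleftrightarrow> touching d c"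
  by (simp add: touching_def Int_commute)

lemma touchingE: "touching c d \<Longrightarrow> (\<And>X. c \<inter> d = {X} \<Longrightarrow> thesis) \<Longrightarrow> thesis"
  by (metis touching_def card_1_singletonE)


lemma Int_singleton_notin: "l \<inter> c = {x} \<Longrightarrow> P \<in> l \<Longrightarrow> P \<noteq> x \<Longrightarrow> P \<notin> c"
  by blast

context circle_plane
begin

abbreviation off :: "'p \<Rightarrow> 'p set set" where
  "off P \<equiv> {c\<in>C. P \<notin> c}"

lemma fin_off: "finite (off P)"
  using finC by simp

lemma real_K: "real K = real q + 2 - real e"
  using Ke by linarith

lemma card_circ_minus: "l \<in> C \<Longrightarrow> P \<in> l \<Longrightarrow> card (l - {P}) = K - 1"
  using circ_card fin_circ by simp

lemma card_off_through:
  assumes "l \<in> C" "P \<in> l" "x \<in> l - {P}"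
  shows "real (card {c\<in>off P. x \<in> c}) = real r * (real q - 1)"
proof -
  have V: "x \<in> V" "P \<in> V" "np x P" using assms circ_sub circ_np[of l x P] by blast+
  have "{c\<in>off P. x \<in> c} = {c\<in>C. x \<in> c} - {c\<in>C. x \<in> c \<and> P \<in> c}" by blast
  then have "card {c\<in>off P. x \<in> c} = q * r - r"
    using finC card_circ_through[of x] card_circ_through2[of x P] V
    by (simp add: card_Diff_subset Collect_mono)
  moreover have "q * r \<ge> r" using q2 by simp
  ultimately show ?thesis by (simp add: algebra_simps)
qed

lemma sum_inter:
  assumes "l \<in> C" "P \<in> l"
  shows "(\<Sum>c\<in>off P. real (card (l \<inter> c))) = (real K - 1) * (real r * (real q - 1))"
proof -
  have "(\<Sum>c\<in>off P. real (card (l \<inter> c))) = (\<Sum>c\<in>off P. real (card {x\<in>l - {P}. x \<in> c}))"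
  proof (rule sum.cong)
    fix c assume "c \<in> off P"
    then have "l \<inter> c = {x\<in>l - {P}. x \<in> c}" by blast
    then show "real (card (l \<inter> c)) = real (card {x\<in>l - {P}. x \<in> c})" by (rule arg_cong)
  qed simp
  also have "\<dots> = (\<Sum>x\<in>l - {P}. real (card {c\<in>off P. x \<in> c}))"
    by (rule sum_count_swap) (use fin_off fin_circ assms in auto)
  also have "\<dots> = (\<Sum>x\<in>l - {P}. real r * (real q - 1))"
    using card_off_through[OF assms] by (intro sum.cong) auto
  also have "\<dots> = (real K - 1) * (real r * (real q - 1))"
    using card_circ_minus[OF assms] K3 by simp
  finally show ?thesis .
qed

lemma sum_touching:
  assumes "l \<in> C" "P \<in> l"
  shows "(\<Sum>c\<in>off P. of_bool (touching l c)) = (real K - 1) * (real e * (real q - 1))"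
proof -
  have "(\<Sum>c\<in>off P. of_bool (touching l c)) = (\<Sum>c\<in>off P. real (card {x\<in>l - {P}. l \<inter> c = {x}}))"
  proof (rule sum.cong)
    fix c assume c: "c \<in> off P"
    show "of_bool (touching l c) = real (card {x\<in>l - {P}. l \<inter> c = {x}})"
    proof (cases "touching l c")
      case True
      then obtain X where X: "l \<inter> c = {X}" by (rule touchingE)
      then have "{x\<in>l - {P}. l \<inter> c = {x}} = {X}" using c by blast
      then show ?thesis using True by simp
    next
      case False
      then have "{x\<in>l - {P}. l \<inter> c = {x}} = {}" by (auto simp: touching_def)
      then show ?thesis by (simp only: False of_bool_eq card.empty of_nat_0)
    qed
  qed simp
  also have "\<dots> = (\<Sum>x\<in>l - {P}. real (card {c\<in>off P. l \<inter> c = {x}}))"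
    by (rule sum_count_swap) (use fin_off fin_circ assms in auto)
  also have "\<dots> = (\<Sum>x\<in>l - {P}. real e * (real q - 1))"
  proof (rule sum.cong)
    fix x assume x: "x \<in> l - {P}"
    then have "{c\<in>off P. l \<inter> c = {x}} = {c\<in>C. l \<inter> c = {x}}" using assms Int_singleton_notin[of l _ x P] by auto
    then show "real (card {c\<in>off P. l \<inter> c = {x}}) = real e * (real q - 1)"
      using card_tangent_at[of l x] assms x q2 by simp
  qed simp
  also have "\<dots> = (real K - 1) * (real e * (real q - 1))"
    using card_circ_minus[OF assms] K3 by simp
  finally show ?thesis .
qed

lemma sum_if_const:
  assumes "finite A"
  shows "(\<Sum>y\<in>A. if Q y then (k::real) else 0) = k * real (card {y\<in>A. Q y})"
  using assms by (simp add: sum.If_cases Int_def)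

lemma card_Int_through:
  assumes "l \<in> C" "l' \<in> C" "P \<in> l" "P \<in> l'"
  shows "real (card ((l - {P}) \<inter> l')) = real (card (l \<inter> l')) - 1"
    and "real (card ((l - {P}) - l')) = real K - real (card (l \<inter> l'))"
    and "real (card (l' - l)) = real K - real (card (l \<inter> l'))"
proof -
  have fin: "finite l" "finite l'" using assms fin_circ by auto
  have "(l - {P}) \<inter> l' = (l \<inter> l') - {P}" by blast
  then show "real (card ((l - {P}) \<inter> l')) = real (card (l \<inter> l')) - 1"
    using assms fin card_Suc_Diff1[of "l \<inter> l'" P] by simp
  have "(l - {P}) - l' = l - (l \<inter> l')" using assms by blast
  then show "real (card ((l - {P}) - l')) = real K - real (card (l \<inter> l'))"
    using assms fin circ_card[of l] card_mono[of l "l \<inter> l'"] by (simp add: card_Diff_subset)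
  have "l' - l = l' - (l \<inter> l')" by blast
  then show "real (card (l' - l)) = real K - real (card (l \<inter> l'))"
    using assms fin circ_card[of l'] card_mono[of l' "l \<inter> l'"] by (simp add: card_Diff_subset)
qed

lemma sum_split_Int:
  assumes "finite A" "\<And>x. x \<in> A \<inter> B \<Longrightarrow> f x = (k::real)" "\<And>x. x \<in> A - B \<Longrightarrow> f x = k'"
  shows "sum f A = real (card (A \<inter> B)) * k + real (card (A - B)) * k'"
  using sum.Int_Diff[OF assms(1), of f B] assms(2,3) by simp

lemma card_np_minus:
  assumes "l' \<in> C" "x \<in> V" "x \<notin> l'" "P \<in> l'" "np x P"
  shows "real (card {y\<in>l' - {P}. np x y}) = real r - real e"
proof -
  have "{y\<in>l' - {P}. np x y} = {y\<in>l'. np x y} - {P}" by blast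
  then have "card {y\<in>l' - {P}. np x y} = r - e"
    using card_off[of l' x] assms fin_circ[of l'] r1 e1 by simp
  then show ?thesis using r1 by simp
qed

text \<open>The sum counts, for \<open>x\<close> on \<open>l\<close> and \<open>y\<close> on
  \<open>l'\<close> different from \<open>P\<close>, the circles off \<open>P\<close> through both.
  There are r (q - 1) of them if x = y, r - 1 if \<open>x\<close> and \<open>y\<close> are distinct
  and non-parallel (the circle through \<open>P\<close> is excluded), and none if they are distinct
  and parallel. The two summands separate the \<open>x\<close> on \<open>l'\<close> from the
  \<open>x\<close> off \<open>l'\<close>.\<close>

lemma sum_inter_inter:
  assumes "l \<in> C" "l' \<in> C" "P \<in> l" "P \<in> l'"
  defines "j \<equiv> real (card (l \<inter> l'))"
  shows "(\<Sum>c\<in>off P. real (card (l \<inter> c)) * real (card (l' \<inter> c)))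
    = (j - 1) * (real r * (real q - 1) + (real r - 1) * (real K - 2))
      + (real K - j) * ((real r - 1) * (real r - real e))"
proof -
  let ?L = "l - {P}" and ?L' = "l' - {P}"
  have fin: "finite ?L" "finite ?L'" using assms fin_circ by auto
  have PV: "P \<in> V" using assms circ_sub by blast
  have "(\<Sum>c\<in>off P. real (card (l \<inter> c)) * real (card (l' \<inter> c)))
      = (\<Sum>c\<in>off P. real (card {p\<in>?L \<times> ?L'. fst p \<in> c \<and> snd p \<in> c}))"
  proof (rule sum.cong)
    fix c assume "c \<in> off P"
    then have "{p\<in>?L \<times> ?L'. fst p \<in> c \<and> snd p \<in> c} = (l \<inter> c) \<times> (l' \<inter> c)" by auto
    then show "real (card (l \<inter> c)) * real (card (l' \<inter> c))
        = real (card {p\<in>?L \<times> ?L'. fst p \<in> c \<and> snd p \<in> c})"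
      by (simp only: card_cartesian_product of_nat_mult)
  qed simp
  also have "\<dots> = (\<Sum>p\<in>?L \<times> ?L'. real (card {c\<in>off P. fst p \<in> c \<and> snd p \<in> c}))"
    by (rule sum_count_swap) (use fin fin_off in auto)
  also have "\<dots> = (\<Sum>x\<in>?L. \<Sum>y\<in>?L'. real (card {c\<in>off P. x \<in> c \<and> y \<in> c}))"
    by (simp add: sum.cartesian_product case_prod_beta)
  also have "\<dots> = real (card (?L \<inter> l')) * (real r * (real q - 1) + (real r - 1) * (real K - 2))
      + real (card (?L - l')) * ((real r - 1) * (real r - real e))"
  proof (rule sum_split_Int)
    have val: "real (card {c\<in>off P. x \<in> c \<and> y \<in> c}) = (if np x y then real r - 1 else 0)"
      if x: "x \<in> ?L" and y: "y \<in> ?L'" and xy: "x \<noteq> y" for x y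
    proof (cases "np x y")
      case True
      have V: "x \<in> V" "y \<in> V" "np P x" "np P y" using x y assms circ_sub circ_np by blast+
      have "\<exists>!c. c \<in> C \<and> P \<in> c \<and> x \<in> c \<and> y \<in> c" using circ3[of P x y] V PV True by blast
      then have "card {c\<in>C. P \<in> c \<and> x \<in> c \<and> y \<in> c} = 1"
        by (metis (mono_tags, lifting) card_1I mem_Collect_eq)
      moreover have "{c\<in>off P. x \<in> c \<and> y \<in> c}
          = {c\<in>C. x \<in> c \<and> y \<in> c} - {c\<in>C. P \<in> c \<and> x \<in> c \<and> y \<in> c}" by blast
      ultimately have "card {c\<in>off P. x \<in> c \<and> y \<in> c} = r - 1"
        using finC card_circ_through2[OF V(1,2) True] by (simp add: card_Diff_subset Collect_mono)
      then show ?thesis using True r1 by simp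
    next
      case False
      then have "{c\<in>off P. x \<in> c \<and> y \<in> c} = {}" using circ_np xy by blast
      then show ?thesis using False by (simp only: card.empty of_nat_0 if_False)
    qed
    show "(\<Sum>y\<in>?L'. real (card {c\<in>off P. x \<in> c \<and> y \<in> c}))
        = real r * (real q - 1) + (real r - 1) * (real K - 2)" if x: "x \<in> ?L \<inter> l'" for x
    proof -
      have "x \<in> ?L'" using x by blast
      then have "(\<Sum>y\<in>?L'. real (card {c\<in>off P. x \<in> c \<and> y \<in> c}))
          = real (card {c\<in>off P. x \<in> c \<and> x \<in> c})
            + (\<Sum>y\<in>?L' - {x}. real (card {c\<in>off P. x \<in> c \<and> y \<in> c}))"
        by (rule sum.remove[OF fin(2)])
      also have "(\<Sum>y\<in>?L' - {x}. real (card {c\<in>off P. x \<in> c \<and> y \<in> c})) = (\<Sum>y\<in>?L' - {x}. real r - 1)"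
      proof (rule sum.cong)
        fix y assume y: "y \<in> ?L' - {x}"
        then have "np x y" using x circ_np[of l' x y] assms by blast
        moreover have "x \<in> ?L" "y \<in> ?L'" "x \<noteq> y" using x y by auto
        ultimately show "real (card {c\<in>off P. x \<in> c \<and> y \<in> c}) = real r - 1"
          using val[of x y] by simp
      qed simp
      also have "\<dots> = (real K - 2) * (real r - 1)"
        using \<open>x \<in> ?L'\<close> fin card_circ_minus[of l' P] assms K3 by simp
      also have "real (card {c\<in>off P. x \<in> c \<and> x \<in> c}) = real r * (real q - 1)"
        using card_off_through[of l P x] assms x by simp
      finally show ?thesis by simp
    qed
    show "(\<Sum>y\<in>?L'. real (card {c\<in>off P. x \<in> c \<and> y \<in> c})) = (real r - 1) * (real r - real e)"
      if x: "x \<in> ?L - l'" for x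
    proof -
      have V: "x \<in> V" "np x P" "x \<notin> l'" using x assms circ_sub circ_np[of l x P] by blast+
      have "(\<Sum>y\<in>?L'. real (card {c\<in>off P. x \<in> c \<and> y \<in> c})) = (\<Sum>y\<in>?L'. if np x y then real r - 1 else 0)"
      proof (rule sum.cong)
        fix y assume "y \<in> ?L'"
        moreover have "x \<in> ?L" "x \<noteq> y" using x \<open>y \<in> ?L'\<close> by auto
        ultimately show "real (card {c\<in>off P. x \<in> c \<and> y \<in> c}) = (if np x y then real r - 1 else 0)"
          using val by blast
      qed simp
      also have "\<dots> = (real r - 1) * real (card {y\<in>?L'. np x y})"
        by (rule sum_if_const[OF fin(2)])
      finally show ?thesis using card_np_minus[of l' x P] V assms by simp
    qed
  qed (use fin in auto)
  finally show ?thesis using card_Int_through(1,2)[OF assms(1-4)] by (simp only: j_def)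
qed

text \<open>The same count with "\<open>x\<close> lies on \<open>c\<close>" sharpened to
  "\<open>c\<close> touches \<open>l\<close> at \<open>x\<close>". For y \<noteq> x there are
  \<open>e\<close> such circles through \<open>y\<close> if \<open>y\<close> is off \<open>l\<close>
  and not parallel to \<open>x\<close>, and none otherwise. The factor \<open>r + 1 - e - j\<close>
  counts the points of \<open>l'\<close> outside \<open>l\<close> that are not parallel to an
  \<open>x\<close> off \<open>l'\<close>.\<close>

lemma sum_touching_inter:
  assumes "l \<in> C" "l' \<in> C" "P \<in> l" "P \<in> l'"
  defines "j \<equiv> real (card (l \<inter> l'))"
  shows "(\<Sum>c\<in>off P. of_bool (touching l c) * real (card (l' \<inter> c)))
    = (j - 1) * (real e * (real q - 1) + real e * (real K - j))
      + (real K - j) * (real e * (real r + 1 - real e - j))"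
proof -
  let ?L = "l - {P}" and ?L' = "l' - {P}"
  have fin: "finite ?L" "finite ?L'" using assms fin_circ by auto
  have PV: "P \<in> V" using assms circ_sub by blast
  have "(\<Sum>c\<in>off P. of_bool (touching l c) * real (card (l' \<inter> c)))
      = (\<Sum>c\<in>off P. real (card {p\<in>?L \<times> ?L'. l \<inter> c = {fst p} \<and> snd p \<in> c}))"
  proof (rule sum.cong)
    fix c assume c: "c \<in> off P"
    show "of_bool (touching l c) * real (card (l' \<inter> c))
        = real (card {p\<in>?L \<times> ?L'. l \<inter> c = {fst p} \<and> snd p \<in> c})"
    proof (cases "touching l c")
      case True
      then obtain X where X: "l \<inter> c = {X}" by (rule touchingE)
      then have "{p\<in>?L \<times> ?L'. l \<inter> c = {fst p} \<and> snd p \<in> c} = {X} \<times> (l' \<inter> c)"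
        using c by (auto simp: set_eq_iff)
      then have "card {p\<in>?L \<times> ?L'. l \<inter> c = {fst p} \<and> snd p \<in> c} = card (l' \<inter> c)"
        by (simp only: card_cartesian_product_singleton)
      then show ?thesis by (simp only: True of_bool_eq mult_1)
    next
      case False
      then have "{p\<in>?L \<times> ?L'. l \<inter> c = {fst p} \<and> snd p \<in> c} = {}" by (auto simp: touching_def)
      then show ?thesis by (simp only: False of_bool_eq card.empty of_nat_0 mult_zero_left)
    qed
  qed simp
  also have "\<dots> = (\<Sum>p\<in>?L \<times> ?L'. real (card {c\<in>off P. l \<inter> c = {fst p} \<and> snd p \<in> c}))"
    by (rule sum_count_swap) (use fin fin_off in auto)
  also have "\<dots> = (\<Sum>x\<in>?L. \<Sum>y\<in>?L'. real (card {c\<in>off P. l \<inter> c = {x} \<and> y \<in> c}))"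
    by (simp add: sum.cartesian_product case_prod_beta)
  also have "\<dots> = real (card (?L \<inter> l')) * (real e * (real q - 1) + real e * (real K - j))
      + real (card (?L - l')) * (real e * (real r + 1 - real e - j))"
  proof (rule sum_split_Int)
    have val: "real (card {c\<in>off P. l \<inter> c = {x} \<and> y \<in> c}) = (if y \<notin> l \<and> np x y then real e else 0)"
      if x: "x \<in> ?L" and y: "y \<in> ?L'" and xy: "x \<noteq> y" for x y
    proof (cases "y \<notin> l \<and> np x y")
      case True
      have "y \<in> V" using y assms circ_sub by blast
      moreover have "{c\<in>off P. l \<inter> c = {x} \<and> y \<in> c} = {c\<in>C. y \<in> c \<and> l \<inter> c = {x}}"
        using x assms Int_singleton_notin[of l _ x P] by auto
      ultimately show ?thesis using card_tangent_through[of l x y] x assms True by auto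
    next
      case False
      have "\<not> (l \<inter> c = {x} \<and> y \<in> c)" if "c \<in> C" for c
      proof
        assume c: "l \<inter> c = {x} \<and> y \<in> c"
        then have "x \<in> c" by blast
        then have "np x y" using circ_np[OF that _ _ xy] c by simp
        then have "y \<in> l \<inter> c" using False c by blast
        then have "y \<in> {x}" using c by (simp only:)
        then show False using xy by simp
      qed
      then have "{c\<in>off P. l \<inter> c = {x} \<and> y \<in> c} = {}" by blast
      then show ?thesis using False by (simp only: card.empty of_nat_0 if_False)
    qed
    show "(\<Sum>y\<in>?L'. real (card {c\<in>off P. l \<inter> c = {x} \<and> y \<in> c}))
        = real e * (real q - 1) + real e * (real K - j)" if x: "x \<in> ?L \<inter> l'" for x
    proof -
      have "x \<in> ?L'" using x by blast
      then have "(\<Sum>y\<in>?L'. real (card {c\<in>off P. l \<inter> c = {x} \<and> y \<in> c}))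
          = real (card {c\<in>off P. l \<inter> c = {x} \<and> x \<in> c})
            + (\<Sum>y\<in>?L' - {x}. real (card {c\<in>off P. l \<inter> c = {x} \<and> y \<in> c}))"
        by (rule sum.remove[OF fin(2)])
      also have "(\<Sum>y\<in>?L' - {x}. real (card {c\<in>off P. l \<inter> c = {x} \<and> y \<in> c}))
          = (\<Sum>y\<in>?L' - {x}. if y \<notin> l then real e else 0)"
      proof (rule sum.cong)
        fix y assume y: "y \<in> ?L' - {x}"
        then have "np x y" using x circ_np[of l' x y] assms by blast
        moreover have "x \<in> ?L" "y \<in> ?L'" "x \<noteq> y" using x y by auto
        ultimately show "real (card {c\<in>off P. l \<inter> c = {x} \<and> y \<in> c}) = (if y \<notin> l then real e else 0)"
          using val[of x y] by simp
      qed simp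
      also have "\<dots> = real e * real (card {y\<in>?L' - {x}. y \<notin> l})"
        by (rule sum_if_const) (use fin in auto)
      also have "{y\<in>?L' - {x}. y \<notin> l} = l' - l" using x assms by blast
      also have "real (card (l' - l)) = real K - j"
        using card_Int_through(3)[OF assms(1-4)] by (simp only: j_def)
      also have "{c\<in>off P. l \<inter> c = {x} \<and> x \<in> c} = {c\<in>C. l \<inter> c = {x}}"
        using x assms Int_singleton_notin[of l _ x P] by auto
      also have "real (card {c\<in>C. l \<inter> c = {x}}) = real e * (real q - 1)"
        using card_tangent_at[of l x] x assms q2 by simp
      finally show ?thesis .
    qed
    show "(\<Sum>y\<in>?L'. real (card {c\<in>off P. l \<inter> c = {x} \<and> y \<in> c})) = real e * (real r + 1 - real e - j)"
      if x: "x \<in> ?L - l'" for x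
    proof -
      have V: "x \<in> V" "np x P" "x \<notin> l'" using x assms circ_sub circ_np[of l x P] by blast+
      have "(\<Sum>y\<in>?L'. real (card {c\<in>off P. l \<inter> c = {x} \<and> y \<in> c}))
          = (\<Sum>y\<in>?L'. if y \<notin> l \<and> np x y then real e else 0)"
      proof (rule sum.cong)
        fix y assume "y \<in> ?L'"
        moreover have "x \<in> ?L" "x \<noteq> y" using x \<open>y \<in> ?L'\<close> by auto
        ultimately show "real (card {c\<in>off P. l \<inter> c = {x} \<and> y \<in> c}) = (if y \<notin> l \<and> np x y then real e else 0)"
          using val by blast
      qed simp
      also have "\<dots> = real e * real (card {y\<in>?L'. y \<notin> l \<and> np x y})"
        by (rule sum_if_const[OF fin(2)])
      also have "{y\<in>?L'. y \<notin> l \<and> np x y} = {y\<in>l'. np x y} - (l \<inter> l')" using assms by blast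
      also have "real (card ({y\<in>l'. np x y} - (l \<inter> l'))) = real r + 1 - real e - j"
      proof -
        have "l \<inter> l' \<subseteq> {y\<in>l'. np x y}" using x circ_np[of l x] assms by blast
        then show ?thesis
          using card_off[of l' x] V assms fin_circ[of l'] r1 e1
            card_mono[of "{y\<in>l'. np x y}" "l \<inter> l'"]
          by (simp add: card_Diff_subset finite_subset j_def)
      qed
      finally show ?thesis .
    qed
  qed (use fin in auto)
  finally show ?thesis using card_Int_through(1,2)[OF assms(1-4)] by (simp only: j_def)
qed

end

section \<open>Weights and the second-moment inequality\<close>

context circle_plane
begin

text \<open>Counting a point of contact twice makes the weight two-valued: for distinct circles it
  is 2 if they meet and 0 if they are disjoint.\<close>

definition wt :: "'p set \<Rightarrow> 'p set \<Rightarrow> real" where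
  "wt l c = real (card (l \<inter> c)) + of_bool (touching l c)"

lemma not_touching_e0:
  assumes "e = 0" "c \<in> C" "d \<in> C"
  shows "\<not> touching c d"
proof
  assume "touching c d"
  then obtain X where X: "c \<inter> d = {X}" by (rule touchingE)
  then have "card {d\<in>C. c \<inter> d = {X}} = 0" using card_tangent_at[of c X] assms by auto
  then show False using X assms finC by simp
qed

lemma card_inter_cases:
  assumes "c \<in> C" "d \<in> C" "c \<noteq> d"
  obtains "c \<inter> d = {}" "wt c d = 0" | "touching c d" "card (c \<inter> d) = 1" "wt c d = 2"
    | "\<not> touching c d" "card (c \<inter> d) = 2" "wt c d = 2"
proof -
  have "finite (c \<inter> d)" using fin_circ assms by blast
  moreover have "card (c \<inter> d) \<le> 2" by (rule card_inter_le2[OF assms])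
  ultimately consider "c \<inter> d = {}" | "card (c \<inter> d) = 1" | "card (c \<inter> d) = 2"
    by (metis One_nat_def card_0_eq le_SucE numeral_2_eq_2 le_zero_eq)
  then show thesis
    by cases (use that in \<open>auto simp: touching_def wt_def\<close>)
qed

lemma real_e: "real e = 0 \<or> real e = 1"
  using e1 by (cases e) auto

text \<open>The two values of \<open>e\<close> lead to the same formula, because (K - 1)(r + e) = q
  (r + 1) in both cases.\<close>

lemma sum_wt:
  assumes "l \<in> C" "P \<in> l"
  shows "(\<Sum>c\<in>off P. wt l c) = real q * (real q - 1) * (real r + 1)"
proof -
  have "(\<Sum>c\<in>off P. wt l c) = (real K - 1) * (real q - 1) * (real r + real e)"
    using sum_inter[OF assms] sum_touching[OF assms] by (simp add: wt_def sum.distrib algebra_simps)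
  then show ?thesis using real_e real_K e0 by (auto simp: algebra_simps)
qed

lemma card_off_real:
  assumes "l \<in> C" "P \<in> l"
  shows "real (card (off P)) = (real q)\<^sup>2 * (real q - 1)"
  using card_C_off[of P] assms circ_sub q2 by fastforce

text \<open>As the weight is 0 or 2, its square is twice the weight, and the second moment reduces
  to the first.\<close>

lemma sum_wt_sq:
  assumes "l \<in> C" "P \<in> l"
  shows "(\<Sum>c\<in>off P. (wt l c - r / q)\<^sup>2) = (real q - 1) * (2 * (real q - r) * (r + 1) + (real r)\<^sup>2)"
proof -
  have "(\<Sum>c\<in>off P. (wt l c - r / q)\<^sup>2) = (\<Sum>c\<in>off P. (2 - 2 * (r / q)) * wt l c + (r / q)\<^sup>2)"
  proof (rule sum.cong)
    fix c assume "c \<in> off P"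
    then have "c \<in> C" "l \<noteq> c" using assms by auto
    then show "(wt l c - r / q)\<^sup>2 = (2 - 2 * (r / q)) * wt l c + (r / q)\<^sup>2"
      by (cases rule: card_inter_cases[OF assms(1)]) (auto simp: power2_eq_square algebra_simps)
  qed simp
  also have "\<dots> = (2 - 2 * (r / q)) * (\<Sum>c\<in>off P. wt l c) + (r / q)\<^sup>2 * ((real q)\<^sup>2 * (real q - 1))"
    using card_off_real[OF assms] by (simp add: sum.distrib sum_distrib_left)
  also have "\<dots> = (real q - 1) * (2 * (real q - r) * (r + 1) + (real r)\<^sup>2)"
  proof -
    have "(r / q)\<^sup>2 * ((real q)\<^sup>2 * (real q - 1)) = (real r)\<^sup>2 * (real q - 1)" using q2 by (simp add: power_divide)
    moreover have "(2 - 2 * (r / q)) * real q = 2 * (real q - r)" using q2 by (simp add: algebra_simps)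
    then have "(2 - 2 * (r / q)) * (real q * z) = 2 * (real q - r) * z" for z by (metis mult.assoc)
    then have "(2 - 2 * (r / q)) * (\<Sum>c\<in>off P. wt l c)
        = 2 * (real q - r) * ((real q - 1) * (real r + 1))"
      unfolding sum_wt[OF assms] by (metis mult.assoc)
    ultimately show ?thesis by (simp add: algebra_simps)
  qed
  finally show ?thesis .
qed

text \<open>The shift r/q is not the mean (r + 1)/q. It is chosen so that for circles
  \<open>l\<close>, \<open>l'\<close> meeting in two points everything cancels except their common
  touching circles. If \<open>l\<close> and \<open>l'\<close> touch, the additional surplus is r^2 -
  2 r (q - 1) - q, which is negative since r \<le> q + 1 \<le> 2 (q - 1); this is where q \<ge> 3
  enters.\<close>

lemma sum_wt_wt:
  assumes "q \<ge> 3" "l \<in> C" "l' \<in> C" "P \<in> l" "P \<in> l'" "l \<noteq> l'"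
    and h: "real (card {c\<in>C. touching l c \<and> touching l' c}) \<le> h * (real q - 1)"
  shows "(\<Sum>c\<in>off P. (wt l c - r / q) * (wt l' c - r / q)) \<le> h * (real q - 1)"
proof -
  define a where "a = real r / real q"
  have aq: "real r = a * real q" using q2 by (simp add: a_def)
  define j where "j = real (card (l \<inter> l'))"
  define N where "N = (real q)\<^sup>2 * (real q - 1)"
  define S where "S = real (card {c\<in>C. touching l c \<and> touching l' c})"
  have j12: "j = 2 \<or> (j = 1 \<and> e = 1)"
  proof (cases rule: card_inter_cases[OF assms(2,3,6)])
    case 1 then show ?thesis using assms by blast
  next
    case 2 then show ?thesis using not_touching_e0[of l l'] assms e1 by (auto simp: j_def)
  next
    case 3 then show ?thesis by (simp add: j_def)
  qed
  have j': "real (card (l' \<inter> l)) = j" by (simp add: j_def Int_commute)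
  have 5: "(\<Sum>c\<in>off P. of_bool (touching l c) * of_bool (touching l' c)) \<le> S"
  proof -
    have "(\<Sum>c\<in>off P. of_bool (touching l c) * of_bool (touching l' c))
        = real (card (off P \<inter> {c. touching l c \<and> touching l' c}))"
      using finC by (simp flip: of_bool_conj)
    also have "\<dots> \<le> S" unfolding S_def of_nat_le_iff by (rule card_mono) (use finC in auto)
    finally show ?thesis .
  qed
  have "(\<Sum>c\<in>off P. (wt l c - a) * (wt l' c - a))
      = (\<Sum>c\<in>off P. real (card (l \<inter> c)) * real (card (l' \<inter> c)))
        + (\<Sum>c\<in>off P. of_bool (touching l c) * real (card (l' \<inter> c)))
        + (\<Sum>c\<in>off P. of_bool (touching l' c) * real (card (l \<inter> c)))
        + (\<Sum>c\<in>off P. of_bool (touching l c) * of_bool (touching l' c))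
        - a * (\<Sum>c\<in>off P. wt l c) - a * (\<Sum>c\<in>off P. wt l' c) + (\<Sum>c\<in>off P. a * a)"
    unfolding sum_distrib_left sum.distrib[symmetric] sum_subtractf[symmetric]
    by (rule sum.cong) (auto simp: wt_def algebra_simps)
  also have "\<dots> \<le> ((j - 1) * (real r * (real q - 1) + (real r - 1) * (real K - 2))
        + (real K - j) * ((real r - 1) * (real r - real e)))
      + 2 * ((j - 1) * (real e * (real q - 1) + real e * (real K - j))
        + (real K - j) * (real e * (real r + 1 - real e - j)))
      + S - 2 * a * (real q * (real q - 1) * (real r + 1)) + a * a * N"
    using 5
    unfolding sum_inter_inter[OF assms(2-5)] sum_touching_inter[OF assms(2-5)]
      sum_touching_inter[OF assms(3,2,5,4)] sum_wt[OF assms(2,4)] sum_wt[OF assms(3,5)] j' j_def[symmetric]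
      sum_constant card_off_real[OF assms(2,4)] N_def[symmetric]
    by (simp add: algebra_simps)
  also have "\<dots> \<le> h * (real q - 1)"
  proof -
    have Sh: "S \<le> h * (real q - 1)" using h by (simp add: S_def)
    consider "e = 0" "j = 2" | "e = 1" "j = 2" | "e = 1" "j = 1" using j12 e1 by (cases e) auto
    then show ?thesis
    proof cases
      case 1
      then have "real e = 0" "real K = real q + 2" "real r = real q" "a = 1" using real_K e0 q2 by (auto simp: a_def)
      then show ?thesis using 1 Sh by (simp add: N_def algebra_simps power2_eq_square)
    next
      case 2
      then have "real e = 1" "real K = real q + 1" using real_K by auto
      then show ?thesis using 2 Sh by (simp add: aq N_def algebra_simps power2_eq_square)
    next
      case 3
      then have eK: "real e = 1" "real K = real q + 1" using real_K by auto
      have "real r * (real q + 1) \<le> real r * (2 * (real q - 1)) " using assms(1) by (intro mult_left_mono) auto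
      moreover have "real r * real r \<le> real r * (real q + 1)" using r1 by (intro mult_left_mono) auto
      ultimately have "a * real q * (a * real q) \<le> a * real q * (2 * (real q - 1))" by (simp add: aq)
      moreover have "real q \<ge> 0" by simp
      ultimately show ?thesis using 3 eK Sh by (simp add: aq N_def algebra_simps power2_eq_square)
    qed
  qed
  finally show ?thesis by (simp add: a_def)
qed

text \<open>On \<open>T\<close> every shifted weight is 2 - r/q, so the sum \<open>y c\<close> of
  the shifted weights over \<open>L\<close> is constant there. Its square sum over \<open>T\<close>
  is at most the one over all circles off \<open>P\<close>, and expanding the latter leaves the
  diagonal moments of \<open>sum_wt_sq\<close> and the mixed moments of
  \<open>sum_wt_wt\<close>.\<close>

lemma mixing:
  assumes q3: "q \<ge> 3" and L: "L \<subseteq> {c\<in>C. P \<in> c}" and T: "T \<subseteq> off P"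
    and meet: "\<And>l c. l \<in> L \<Longrightarrow> c \<in> T \<Longrightarrow> l \<inter> c \<noteq> {}" and h0: "h \<ge> 0"
    and h: "\<And>l l'. l \<in> L \<Longrightarrow> l' \<in> L \<Longrightarrow> l \<noteq> l' \<Longrightarrow>
      real (card {c\<in>C. touching l c \<and> touching l' c}) \<le> h * (real q - 1)"
  shows "card T * (card L * (2 - r / q))\<^sup>2
    \<le> card L * ((real q - 1) * (2 * (real q - r) * (r + 1) + (real r)\<^sup>2))
      + card L * (real (card L) - 1) * (h * (real q - 1))"
proof -
  define D where "D = (real q - 1) * (2 * (real q - r) * (r + 1) + (real r)\<^sup>2)"
  define y where "y c = (\<Sum>l\<in>L. wt l c - r / q)" for c
  have fin: "finite L" "finite T" using finC L T by (auto intro: finite_subset)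
  have "(\<Sum>c\<in>T. (y c)\<^sup>2) = (\<Sum>c\<in>T. (card L * (2 - r / q))\<^sup>2)"
  proof (rule sum.cong)
    fix c assume c: "c \<in> T"
    have "y c = (\<Sum>l\<in>L. 2 - r / q)"
      unfolding y_def
    proof (rule sum.cong)
      fix l assume l: "l \<in> L"
      have "l \<in> C" "c \<in> C" "l \<noteq> c" using l c L T by auto
      then show "wt l c - r / q = 2 - r / q"
        using meet[OF l c] by (cases rule: card_inter_cases) auto
    qed simp
    then show "(y c)\<^sup>2 = (card L * (2 - r / q))\<^sup>2" by simp
  qed simp
  then have "card T * (card L * (2 - r / q))\<^sup>2 = (\<Sum>c\<in>T. (y c)\<^sup>2)" by simp
  also have "\<dots> \<le> (\<Sum>c\<in>off P. (y c)\<^sup>2)" by (rule sum_mono2) (use T finC in auto)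
  also have "\<dots> = (\<Sum>c\<in>off P. \<Sum>l\<in>L. \<Sum>l'\<in>L. (wt l c - r / q) * (wt l' c - r / q))"
    by (simp add: y_def power2_eq_square sum_product)
  also have "\<dots> = (\<Sum>l\<in>L. \<Sum>l'\<in>L. \<Sum>c\<in>off P. (wt l c - r / q) * (wt l' c - r / q))"
    by (subst sum.swap, rule sum.cong[OF refl], rule sum.swap)
  also have "\<dots> \<le> (\<Sum>l\<in>L. D + (real (card L) - 1) * (h * (real q - 1)))"
  proof (rule sum_mono)
    fix l assume l: "l \<in> L"
    have "(\<Sum>l'\<in>L. \<Sum>c\<in>off P. (wt l c - r / q) * (wt l' c - r / q))
        = (\<Sum>c\<in>off P. (wt l c - r / q) * (wt l c - r / q))
          + (\<Sum>l'\<in>L - {l}. \<Sum>c\<in>off P. (wt l c - r / q) * (wt l' c - r / q))"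
      by (rule sum.remove[OF fin(1) l])
    also have "(\<Sum>c\<in>off P. (wt l c - r / q) * (wt l c - r / q)) = D"
      using sum_wt_sq[of l P] l L by (auto simp: D_def power2_eq_square)
    also have "(\<Sum>l'\<in>L - {l}. \<Sum>c\<in>off P. (wt l c - r / q) * (wt l' c - r / q))
        \<le> (\<Sum>l'\<in>L - {l}. h * (real q - 1))"
    proof (rule sum_mono)
      fix l' assume "l' \<in> L - {l}"
      then show "(\<Sum>c\<in>off P. (wt l c - r / q) * (wt l' c - r / q)) \<le> h * (real q - 1)"
        using l L h[of l l'] by (intro sum_wt_wt[OF q3]) auto
    qed
    also have "\<dots> = (real (card L) - 1) * (h * (real q - 1))"
      using l fin card_Suc_Diff1[of L l] by simp
    finally show "(\<Sum>l'\<in>L. \<Sum>c\<in>off P. (wt l c - r / q) * (wt l' c - r / q))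
      \<le> D + (real (card L) - 1) * (h * (real q - 1))" by simp
  qed
  finally show ?thesis by (simp add: D_def algebra_simps)
qed

end

section \<open>Pencils of touching circles and common tangents\<close>

context circle_plane
begin

text \<open>For \<open>l\<close> through \<open>X\<close> this is the class of \<open>l\<close>
  under touching at \<open>X\<close>. For \<open>e = 1\<close> its \<open>q\<close> members cover
  each point not parallel to \<open>X\<close> exactly once.\<close>

definition pencil :: "'p \<Rightarrow> 'p set \<Rightarrow> 'p set set" where
  "pencil X l = {c\<in>C. c = l \<or> l \<inter> c = {X}}"

definition tangents :: "'p \<Rightarrow> 'p set \<Rightarrow> 'p set set" where
  "tangents X c = {t\<in>C. X \<in> t \<and> touching c t}"

lemma fin_pencil: "finite (pencil X l)" "finite (tangents X l)"
  using finC by (auto simp: pencil_def tangents_def)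

lemma not_touching_refl: "c \<in> C \<Longrightarrow> \<not> touching c c"
  using circ_card[of c] K3 by (simp add: touching_def)

lemma pencil_eq:
  assumes "l \<in> C" "g \<in> pencil X l"
  shows "pencil X g = pencil X l"
proof (cases "g = l")
  case False
  then have g: "g \<in> C" "l \<inter> g = {X}" using assms by (auto simp: pencil_def)
  then have g': "g \<inter> l = {X}" by blast
  show ?thesis
  proof (intro set_eqI iffI)
    fix c assume "c \<in> pencil X g"
    then have c: "c \<in> C" "c = g \<or> g \<inter> c = {X}" by (auto simp: pencil_def)
    then show "c \<in> pencil X l"
      using tangent_trans[of l g c X] g assms(1) by (auto simp: pencil_def)
  next
    fix c assume "c \<in> pencil X l"
    then have c: "c \<in> C" "c = l \<or> l \<inter> c = {X}" by (auto simp: pencil_def)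
    then show "c \<in> pencil X g"
      using tangent_trans[of g l c X] g g' assms(1) by (auto simp: pencil_def)
  qed
qed simp

lemma card_pencil:
  assumes "e = 1" "l \<in> C" "X \<in> l"
  shows "card (pencil X l) = q"
proof -
  have "l \<inter> l \<noteq> {X}" using not_touching_refl[OF assms(2)] by (auto simp: touching_def)
  then have "pencil X l = insert l {c\<in>C. l \<inter> c = {X}}" "l \<notin> {c\<in>C. l \<inter> c = {X}}"
    using assms by (auto simp: pencil_def)
  then show ?thesis using card_tangent_at[of l X] assms finC q2 by simp
qed

lemma card_tangents:
  assumes "e = 1" "c \<in> C" "X \<in> V" "X \<notin> c"
  shows "card (tangents X c) = r"
proof -
  have "card (tangents X c) = card {y\<in>c. np X y}"
  proof (rule card_eq_by_unique)
    fix t assume t: "t \<in> tangents X c"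
    then obtain y where y: "c \<inter> t = {y}" by (auto simp: tangents_def elim: touchingE)
    have "np X y" using t y circ_np[of t X y] assms by (auto simp: tangents_def)
    then have "{y\<in>{y\<in>c. np X y}. c \<inter> t = {y}} = {y}" using y by auto
    then show "card {y\<in>{y\<in>c. np X y}. c \<inter> t = {y}} = 1" by simp
  next
    fix y assume y: "y \<in> {y\<in>c. np X y}"
    then have "{t\<in>tangents X c. c \<inter> t = {y}} = {t\<in>C. X \<in> t \<and> c \<inter> t = {y}}"
      by (auto simp: tangents_def touching_def)
    then show "card {t\<in>tangents X c. c \<inter> t = {y}} = 1"
      using card_tangent_through[of c y X] assms y np_sym by auto
  qed (use fin_pencil fin_circ assms in auto)
  then show ?thesis using card_off[of c X] assms by simp
qed

text \<open>Distinct circles share at most two points, so the odd terms of the sum are those of the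
  touching circles.\<close>

lemma parity_touching:
  assumes "finite A" "A \<subseteq> C" "l \<in> C" "l \<notin> A"
  shows "even (\<Sum>c\<in>A. card (l \<inter> c)) \<longleftrightarrow> even (card {c\<in>A. touching l c})"
proof -
  have "{c\<in>A. odd (card (l \<inter> c))} = {c\<in>A. touching l c}"
  proof (intro Collect_cong conj_cong refl)
    fix c assume c: "c \<in> A"
    then have "card (l \<inter> c) \<le> 2" using card_inter_le2[of l c] assms by blast
    then show "odd (card (l \<inter> c)) = touching l c"
      unfolding touching_def by (metis One_nat_def even_zero le_SucE le_zero_eq numeral_2_eq_2 odd_one even_numeral)
  qed
  then show ?thesis using even_sum_iff[OF assms(1), of "\<lambda>c. card (l \<inter> c)"] by simp
qed

text \<open>The pencil partitions the points not parallel to \<open>X\<close>, so the sum is the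
  number of such points on \<open>l'\<close>.\<close>

lemma sum_pencil:
  assumes "e = 1" "l \<in> C" "l' \<in> C" "X \<in> l" "X \<notin> l'"
  shows "(\<Sum>c\<in>pencil X l. card (l' \<inter> c)) = r"
proof -
  let ?Y = "{y\<in>l'. np X y}"
  have XV: "X \<in> V" using assms circ_sub by blast
  have Xc: "X \<in> c" "c \<in> C" if "c \<in> pencil X l" for c
    using that assms by (auto simp: pencil_def)
  have "(\<Sum>c\<in>pencil X l. card (l' \<inter> c)) = (\<Sum>c\<in>pencil X l. card {y\<in>?Y. y \<in> c})"
  proof (rule sum.cong)
    fix c assume c: "c \<in> pencil X l"
    have "l' \<inter> c = {y\<in>?Y. y \<in> c}"
      using circ_np[of c X] Xc[OF c] assms by auto
    then show "card (l' \<inter> c) = card {y\<in>?Y. y \<in> c}" by simp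
  qed simp
  also have "\<dots> = 1 * card ?Y"
  proof (rule sum_multicount)
    show "\<forall>y\<in>?Y. card {c\<in>pencil X l. y \<in> c} = 1"
    proof
      fix y assume y: "y \<in> ?Y"
      show "card {c\<in>pencil X l. y \<in> c} = 1"
      proof (cases "y \<in> l")
        case True
        have "y \<noteq> X" using y assms by blast
        then have "{c\<in>pencil X l. y \<in> c} = {l}" using True assms by (auto simp: pencil_def)
        then show ?thesis by simp
      next
        case False
        then have "{c\<in>pencil X l. y \<in> c} = {c\<in>C. y \<in> c \<and> l \<inter> c = {X}}" by (auto simp: pencil_def)
        then show ?thesis using card_tangent_through[of l X y] False y assms circ_sub by auto
      qed
    qed
  qed (use fin_pencil fin_circ assms in auto)
  finally show ?thesis using card_off[of l' X] assms XV by simp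
qed

lemma tangents_in_pencil:
  assumes "X \<in> l"
  shows "{c\<in>pencil X l. touching l' c} = {c\<in>tangents X l'. c \<in> pencil X l}"
  using assms by (auto simp: pencil_def tangents_def)

text \<open>Over a pencil at \<open>X\<close> the intersection numbers with \<open>l'\<close> add up
  to the odd number \<open>r\<close>, so each pencil contains a circle touching \<open>l'\<close>.
  Summing over all \<open>q * r\<close> circles \<open>g\<close> through \<open>X\<close> gives
  \<open>q * r\<close> again, because there are \<open>r\<close> tangents from \<open>X\<close> to
  \<open>l'\<close> and each lies in the pencils of \<open>q\<close> circles. Hence every pencil
  contains exactly one.\<close>

lemma pencil_tangents_odd:
  assumes "e = 1" "odd r" "l \<in> C" "l' \<in> C" "X \<in> l" "X \<notin> l'"
  shows "card {c\<in>pencil X l. touching l' c} = 1"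
proof -
  let ?B = "{g\<in>C. X \<in> g}"
  have XV: "X \<in> V" using assms circ_sub by blast
  have ge: "card {c\<in>tangents X l'. c \<in> pencil X g} \<ge> 1" if "g \<in> ?B" for g
  proof -
    have "odd (card {c\<in>pencil X g. touching l' c})"
      using parity_touching[of "pencil X g" l'] sum_pencil[of g l' X] assms that fin_pencil
      by (auto simp: pencil_def)
    then show ?thesis using tangents_in_pencil[of X g l'] that by (auto intro: Suc_leI odd_pos)
  qed
  have "(\<Sum>g\<in>?B. card {c\<in>tangents X l'. c \<in> pencil X g}) = q * card (tangents X l')"
  proof (rule sum_multicount)
    show "\<forall>c\<in>tangents X l'. card {g\<in>?B. c \<in> pencil X g} = q"
    proof
      fix c assume c: "c \<in> tangents X l'"
      then have "{g\<in>?B. c \<in> pencil X g} = pencil X c"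
        by (auto simp: pencil_def tangents_def)
      then show "card {g\<in>?B. c \<in> pencil X g} = q"
        using card_pencil[of c X] c assms by (simp add: tangents_def)
    qed
  qed (use finC fin_pencil in auto)
  then have "(\<Sum>g\<in>?B. card {c\<in>tangents X l'. c \<in> pencil X g}) = (\<Sum>g\<in>?B. 1)"
    using card_tangents[of l' X] card_circ_through[OF XV] assms XV by simp
  then have "\<forall>g\<in>?B. 1 = card {c\<in>tangents X l'. c \<in> pencil X g}"
    using sum_mono_inv[of "\<lambda>_. 1" ?B "\<lambda>g. card {c\<in>tangents X l'. c \<in> pencil X g}"] ge finC by auto
  then show ?thesis using tangents_in_pencil[of X l l'] assms by simp
qed

lemma card_parallel:
  assumes "c \<in> C" "x \<in> V" "x \<notin> c"
  shows "card {y\<in>c. \<not> np x y} = \<rho>"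
proof -
  have "{y\<in>c. \<not> np x y} = c - {y\<in>c. np x y}" by blast
  then show ?thesis using circ_off[OF assms] circ_card[OF assms(1)] fin_circ[OF assms(1)]
    by (simp add: card_Diff_subset)
qed

text \<open>Now \<open>r\<close> is even and parity over a pencil produces nothing. Instead take a
  member \<open>g\<close> touching \<open>l'\<close> and a second point \<open>Z\<close> on it. The
  circles through \<open>X\<close> and \<open>Z\<close> have an even number of points of
  \<open>l'\<close> in total, so an even number of them touch \<open>l'\<close>; besides
  \<open>g\<close> there is another one, which lies outside the pencil because it meets
  \<open>g\<close> in \<open>X\<close> and \<open>Z\<close>. Distinct \<open>Z\<close> give distinct
  tangents, and these use up all but at most two of the \<open>r\<close> tangents from
  \<open>X\<close>.\<close>

lemma pencil_tangents_even:
  assumes e: "e = 1" and "odd q" "even \<rho>" and l: "l \<in> C" "l' \<in> C" "X \<in> l" "X \<notin> l'"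
  shows "card {c\<in>pencil X l. touching l' c} \<le> 2"
proof (cases "{c\<in>pencil X l. touching l' c} = {}")
  case False
  then obtain g where g: "g \<in> pencil X l" "touching l' g" by blast
  then have gC: "g \<in> C" "X \<in> g" using l by (auto simp: pencil_def)
  obtain Y where Y: "l' \<inter> g = {Y}" using g by (elim touchingE)
  have XY: "X \<noteq> Y" using Y l by blast
  have XV: "X \<in> V" using l circ_sub by blast
  let ?p = "{p\<in>l'. \<not> np X p}"
  \<comment> \<open>The parity count needs the points of \<open>l'\<close> parallel to
    \<open>X\<close> and those parallel to \<open>Z\<close> to be disjoint sets. The points of
    \<open>g\<close> violating this are set aside; there are at most
    \<open>\<rho> * (\<rho> - 1)\<close> of them, hence none for \<rho> = 0 and at most two for
    \<rho> = 2.\<close>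
  define bad where "bad = {Z\<in>g - {X}. \<exists>p\<in>?p. \<not> np p Z}"
  define good where "good = g - {X, Y} - bad"
  have fin: "finite g" "finite l'" "finite bad" using fin_circ gC l by (auto simp: bad_def)
  have finp: "finite ?p" using fin by simp
  have "bad = (\<Union>p\<in>?p. {Z\<in>g. \<not> np p Z} - {X})" by (auto simp: bad_def)
  then have "card bad \<le> (\<Sum>p\<in>?p. card ({Z\<in>g. \<not> np p Z} - {X}))"
    using card_UN_le[OF finp, of "\<lambda>p. {Z\<in>g. \<not> np p Z} - {X}"] by (simp only:)
  also have "\<dots> = (\<Sum>p\<in>?p. \<rho> - 1)"
  proof (rule sum.cong)
    fix p assume p: "p \<in> ?p"
    then have "p \<notin> g" using circ_np[of g X p] gC l by blast
    moreover have "\<not> np p X" "p \<in> V" using p np_sym circ_sub l by blast+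
    ultimately show "card ({Z\<in>g. \<not> np p Z} - {X}) = \<rho> - 1"
      using card_parallel[of g p] gC fin by simp
  qed simp
  also have "\<dots> = \<rho> * (\<rho> - 1)" using card_parallel[of l' X] l XV by simp
  finally have bad: "card bad \<le> \<rho> * (\<rho> - 1)" .
  have "card (g - {X, Y}) = q - 1"
  proof -
    have "Y \<in> g" using Y by blast
    then show ?thesis using circ_card[of g] gC XY Ke e by (simp add: card_Diff_subset)
  qed
  moreover have "card (g - {X, Y}) - card bad \<le> card good"
    unfolding good_def by (rule diff_card_le_card_Diff[OF fin(3)])
  ultimately have good: "q - 1 \<le> card good + \<rho> * (\<rho> - 1)" using bad by linarith
  let ?T = "{t\<in>tangents X l'. t \<notin> pencil X g}"
  have Tne: "1 \<le> card {t\<in>?T. Z \<in> t}" if Z: "Z \<in> good" for Z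
  proof -
    have ZV: "Z \<in> V" "Z \<in> g" "Z \<noteq> X" "Z \<notin> l'" "np X Z"
      using Z gC circ_sub Y circ_np[of g X Z] by (auto simp: good_def)
    let ?A = "{c\<in>C. X \<in> c \<and> Z \<in> c}" and ?y = "{y\<in>l'. np X y \<and> np Z y}"
    have "card ?y + 2 * \<rho> = q + 1"
    proof -
      have *: "{y\<in>l'. \<not> np X y} \<inter> {y\<in>l'. \<not> np Z y} = {}"
      proof -
        have "np p Z" if "p \<in> ?p" for p using that Z by (auto simp: good_def bad_def)
        then show ?thesis using np_sym by blast
      qed
      have "?y \<union> ({y\<in>l'. \<not> np X y} \<union> {y\<in>l'. \<not> np Z y}) = l'"
        "?y \<inter> ({y\<in>l'. \<not> np X y} \<union> {y\<in>l'. \<not> np Z y}) = {}" by blast+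
      then have "card l' = card ?y + card ({y\<in>l'. \<not> np X y} \<union> {y\<in>l'. \<not> np Z y})"
        using card_Un_disjoint[of ?y "{y\<in>l'. \<not> np X y} \<union> {y\<in>l'. \<not> np Z y}"] fin by auto
      also have "card ({y\<in>l'. \<not> np X y} \<union> {y\<in>l'. \<not> np Z y}) = \<rho> + \<rho>"
        using card_Un_disjoint[OF _ _ *] card_parallel[of l' X] card_parallel[of l' Z] XV ZV l fin by simp
      finally show ?thesis using circ_card[of l'] l Ke e by simp
    qed
    then have ev: "even (card ?y)" using \<open>odd q\<close> by presburger
    have "(\<Sum>c\<in>?A. card (l' \<inter> c)) = (\<Sum>c\<in>?A. card {y\<in>?y. y \<in> c})"
    proof (rule sum.cong)
      fix c assume c: "c \<in> ?A"
      have "l' \<inter> c = {y\<in>?y. y \<in> c}"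
        using circ_np[of c X] circ_np[of c Z] c l ZV by blast
      then show "card (l' \<inter> c) = card {y\<in>?y. y \<in> c}" by simp
    qed simp
    also have "\<dots> = 1 * card ?y"
    proof (rule sum_multicount)
      show "\<forall>y\<in>?y. card {c\<in>?A. y \<in> c} = 1"
      proof
        fix y assume y: "y \<in> ?y"
        then have "\<exists>!c. c \<in> C \<and> X \<in> c \<and> Z \<in> c \<and> y \<in> c"
          using circ3[of X Z y] XV ZV circ_sub l by blast
        moreover have "{c\<in>?A. y \<in> c} = {c. c \<in> C \<and> X \<in> c \<and> Z \<in> c \<and> y \<in> c}" by blast
        ultimately show "card {c\<in>?A. y \<in> c} = 1" by (metis (mono_tags, lifting) card_1I mem_Collect_eq)
      qed
    qed (use finC fin in auto)
    finally have "even (card {c\<in>?A. touching l' c})"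
      using ev parity_touching[of ?A l'] finC l by simp
    moreover have gA: "g \<in> {c\<in>?A. touching l' c}" using gC ZV g by simp
    ultimately obtain t where t: "t \<in> {c\<in>?A. touching l' c}" "t \<noteq> g"
      using finC by (metis (no_types, lifting) card_1I odd_one)
    then have "t \<in> {t\<in>?T. Z \<in> t}"
      using ZV gC by (auto simp: tangents_def pencil_def)
    then show ?thesis using fin_pencil by (auto simp: Suc_le_eq card_gt_0_iff)
  qed
  have "card good \<le> (\<Sum>Z\<in>good. card {t\<in>?T. Z \<in> t})"
    using sum_mono[of good "\<lambda>_. 1" "\<lambda>Z. card {t\<in>?T. Z \<in> t}"] Tne by simp
  also have "\<dots> = (\<Sum>t\<in>?T. card {Z\<in>good. Z \<in> t})"
    by (rule sum_multicount_gen) (use fin fin_pencil in \<open>auto simp: good_def\<close>)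
  also have "\<dots> \<le> (\<Sum>t\<in>?T. 1)"
  proof (rule sum_mono)
    fix t assume t: "t \<in> ?T"
    then have tC: "t \<in> C" "t \<noteq> g" "X \<in> t" using gC by (auto simp: tangents_def pencil_def)
    have "insert X {Z\<in>good. Z \<in> t} \<subseteq> g \<inter> t" using gC tC by (auto simp: good_def)
    then have "card (insert X {Z\<in>good. Z \<in> t}) \<le> 2"
      using card_inter_le2[of g t] card_mono[of "g \<inter> t"] gC tC fin by (metis finite_Int le_trans)
    moreover have "X \<notin> {Z\<in>good. Z \<in> t}" by (simp add: good_def)
    ultimately show "card {Z\<in>good. Z \<in> t} \<le> 1" using fin by (simp add: good_def)
  qed
  finally have "card good \<le> card ?T" by simp
  moreover have "card ?T + card {c\<in>tangents X l'. c \<in> pencil X l} = r"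
  proof -
    have "?T \<union> {c\<in>tangents X l'. c \<in> pencil X l} = tangents X l'" "?T \<inter> {c\<in>tangents X l'. c \<in> pencil X l} = {}"
      using pencil_eq[OF l(1) g(1)] by auto
    then show ?thesis using card_tangents[of l' X] card_Un_disjoint[of ?T "{c\<in>tangents X l'. c \<in> pencil X l}"]
        fin_pencil e l XV by auto
  qed
  ultimately have le: "card {c\<in>pencil X l. touching l' c} + q - 1 \<le> r + \<rho> * (\<rho> - 1)"
    using tangents_in_pencil[OF l(3)] good by simp
  \<comment> \<open>For both values the remainder r + \<rho> (\<rho> - 1) - (q - 1) equals
    2.\<close>
  have "\<rho> = 0 \<or> \<rho> = 2" using \<rho>2 \<open>even \<rho>\<close> by presburger
  then show ?thesis using le r\<rho> q2 by auto
next
  case True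
  then show ?thesis by (simp only: card.empty)
qed

text \<open>Sort the common touching circles by their point of contact \<open>X\<close> with
  \<open>l\<close>. If \<open>l\<close> and \<open>l'\<close> meet in two points, those two
  contribute nothing, by transitivity of touching at a point, and each of the other q - 1 points
  contributes at most \<open>h\<close>. If \<open>l\<close> and \<open>l'\<close> touch at
  \<open>P\<close>, then \<open>P\<close> contributes at most q - 2, and each other point only h -
  1, since \<open>l\<close> itself already is a member of its pencil that touches
  \<open>l'\<close>.\<close>

lemma common_tangents:
  assumes e: "e = 1" and h: "h = 1 \<or> h = (2::nat)" and l: "l \<in> C" "l' \<in> C" "l \<noteq> l'" "l \<inter> l' \<noteq> {}"
    and \<tau>: "\<And>X. X \<in> l \<Longrightarrow> X \<notin> l' \<Longrightarrow> card {c\<in>pencil X l. touching l' c} \<le> h"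
  shows "card {c\<in>C. touching l c \<and> touching l' c} \<le> h * (q - 1)"
proof -
  let ?S = "\<lambda>X. {c\<in>C. l \<inter> c = {X} \<and> touching l' c}"
  have fin: "finite l" "finite l'" using fin_circ l by auto
  have "{c\<in>C. touching l c \<and> touching l' c} = (\<Union>X\<in>l. ?S X)"
  proof (intro subset_antisym subsetI)
    fix c assume c: "c \<in> {c\<in>C. touching l c \<and> touching l' c}"
    then obtain X where "l \<inter> c = {X}" by (auto elim: touchingE)
    then show "c \<in> (\<Union>X\<in>l. ?S X)" using c by blast
  qed (auto simp: touching_def)
  then have le: "card {c\<in>C. touching l c \<and> touching l' c} \<le> (\<Sum>X\<in>l. card (?S X))"
    using card_UN_le[OF fin(1), of ?S] by simp
  have sub: "?S X \<subseteq> {c\<in>pencil X l. touching l' c}" for X by (auto simp: pencil_def)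
  have finS: "finite {c\<in>pencil X l. touching l' c}" for X using fin_pencil by simp
  show ?thesis
  proof (cases rule: card_inter_cases[OF l(1-3)])
    case 1
    then show ?thesis using l by blast
  next
    case 2
    then obtain P where P: "l \<inter> l' = {P}" by (elim touchingE)
    have "(\<Sum>X\<in>l. card (?S X)) = card (?S P) + (\<Sum>X\<in>l - {P}. card (?S X))"
      by (rule sum.remove) (use fin P in auto)
    also have "\<dots> \<le> (q - 2) + (\<Sum>X\<in>l - {P}. h - 1)"
    proof (intro add_mono sum_mono)
      have "?S P \<subseteq> {c\<in>C. l \<inter> c = {P}} - {l'}" using not_touching_refl l by blast
      then have "card (?S P) \<le> card ({c\<in>C. l \<inter> c = {P}} - {l'})" by (rule card_mono[rotated]) (use finC in auto)
      also have "\<dots> = card {c\<in>C. l \<inter> c = {P}} - 1"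
        by (rule card_Diff_singleton) (use P l in simp)
      also have "P \<in> l" using P by blast
      then have "card {c\<in>C. l \<inter> c = {P}} - 1 = q - 2"
        using card_tangent_at[of l P] l e by simp
      finally show "card (?S P) \<le> q - 2" .
    next
      fix X assume X: "X \<in> l - {P}"
      then have Xl: "X \<in> l" "X \<notin> l'" using P by blast+
      have "l \<notin> ?S X" using not_touching_refl[of l] l by (auto simp: touching_def)
      moreover have "l \<in> {c\<in>pencil X l. touching l' c}" using l 2 touching_sym by (auto simp: pencil_def)
      ultimately have "?S X \<subseteq> {c\<in>pencil X l. touching l' c} - {l}" using sub by blast
      then have "card (?S X) \<le> card ({c\<in>pencil X l. touching l' c} - {l})"
        by (rule card_mono[rotated]) (use finS in auto)
      also have "\<dots> \<le> h - 1"
        using \<tau>[OF Xl] \<open>l \<in> {c\<in>pencil X l. touching l' c}\<close> finS by (simp add: diff_le_mono)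
      finally show "card (?S X) \<le> h - 1" .
    qed
    also have "(\<Sum>X\<in>l - {P}. h - 1) = q * (h - 1)"
    proof -
      have "P \<in> l" using P by blast
      then show ?thesis using card_circ_minus[of l P] l(1) Ke e by simp
    qed
    also have "(q - 2) + q * (h - 1) \<le> h * (q - 1)" using h q2 by auto
    finally show ?thesis using le by linarith
  next
    case 3
    have "(\<Sum>X\<in>l. card (?S X)) = (\<Sum>X\<in>l \<inter> l'. card (?S X)) + (\<Sum>X\<in>l - l'. card (?S X))"
      by (rule sum.Int_Diff[OF fin(1)])
    also have "\<dots> \<le> (\<Sum>X\<in>l \<inter> l'. 0) + (\<Sum>X\<in>l - l'. h)"
    proof (intro add_mono sum_mono)
      fix X assume X: "X \<in> l \<inter> l'"
      have "?S X = {}"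
      proof (rule ccontr)
        assume "?S X \<noteq> {}"
        then obtain c where c: "c \<in> C" "l \<inter> c = {X}" "touching l' c" by blast
        obtain Y where Y: "l' \<inter> c = {Y}" using c by (elim touchingE)
        have "X \<in> l' \<inter> c" using c X by blast
        then have "Y = X" unfolding Y by simp
        then have "c \<inter> l' = {X}" using Y by blast
        then have "l \<inter> l' = {X}" using tangent_trans[of l c l' X] c l by blast
        then show False using 3 by (simp add: touching_def)
      qed
      then show "card (?S X) \<le> 0" by (simp only: card.empty)
    next
      fix X assume X: "X \<in> l - l'"
      then show "card (?S X) \<le> h"
        using \<tau>[of X] card_mono[OF finS sub, of X] by simp
    qed
    also have "\<dots> = h * (q - 1)"
    proof -
      have "l - l' = l - (l \<inter> l')" by blast
      then have "card (l - l') = q - 1"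
        using 3 circ_card[of l] l fin Ke e by (simp add: card_Diff_subset)
      then show ?thesis by simp
    qed
    finally show ?thesis using le by linarith
  qed
qed

text \<open>Some member \<open>c\<close> of \<open>D\<close> misses \<open>P\<close>, since a member
  through \<open>P\<close> can be exchanged for a circle touching it elsewhere. The \<open>r\<close>
  circles through \<open>P\<close> touching \<open>c\<close> belong to \<open>D\<close> together
  with their whole pencils at \<open>P\<close>, each of size \<open>q\<close>. A pencil contains at
  most two of these tangents, so at least q r / 2 different circles through \<open>P\<close>
  arise.\<close>

lemma card_closed_through:
  assumes e: "e = 1" and "odd q" "even \<rho>" and D: "D \<subseteq> C" "D \<noteq> {}"
    and closed: "\<And>c d. c \<in> D \<Longrightarrow> d \<in> C \<Longrightarrow> touching c d \<Longrightarrow> d \<in> D" and P: "P \<in> V"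
  shows "q * r \<le> 2 * card {c\<in>D. P \<in> c}"
proof -
  obtain c where c: "c \<in> D" "P \<notin> c"
  proof -
    obtain c where c: "c \<in> D" using D by blast
    show thesis
    proof (cases "P \<in> c")
      case True
      have "card (c - {P}) = K - 1" using card_circ_minus[of c P] c D True by blast
      then have "card (c - {P}) \<noteq> 0" using K3 by simp
      then have "c - {P} \<noteq> {}" by (metis card.empty)
      then obtain X where X: "X \<in> c" "X \<noteq> P" by blast
      then have "card {d\<in>C. c \<inter> d = {X}} \<noteq> 0" using card_tangent_at[of c X] c D e q2 by auto
      then obtain d where d: "d \<in> C" "c \<inter> d = {X}" by (metis (mono_tags, lifting) Collect_empty_eq card.empty)
      then have "d \<in> D" using closed[OF c d(1)] by (simp add: touching_def)
      moreover have "P \<notin> d" using Int_singleton_notin[OF d(2) True] X by blast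
      ultimately show thesis by (rule that)
    qed (use c that in blast)
  qed
  have cC: "c \<in> C" using c D by blast
  let ?B = "{g\<in>D. P \<in> g}"
  have "(\<Sum>g\<in>?B. card {t\<in>tangents P c. t \<in> pencil P g}) = q * card (tangents P c)"
  proof (rule sum_multicount)
    show "\<forall>t\<in>tangents P c. card {g\<in>?B. t \<in> pencil P g} = q"
    proof
      fix t assume t: "t \<in> tangents P c"
      then have tC: "t \<in> C" "P \<in> t" "t \<in> D" using closed[OF c(1)] by (auto simp: tangents_def)
      have "{g\<in>?B. t \<in> pencil P g} = pencil P t"
      proof (intro subset_antisym subsetI)
        fix g assume "g \<in> {g\<in>?B. t \<in> pencil P g}"
        then show "g \<in> pencil P t" using D by (auto simp: pencil_def)
      next
        fix g assume g: "g \<in> pencil P t"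
        then have "g \<in> D" using closed[OF tC(3), of g] tC by (auto simp: pencil_def touching_def)
        then show "g \<in> {g\<in>?B. t \<in> pencil P g}" using g tC by (auto simp: pencil_def)
      qed
      then show "card {g\<in>?B. t \<in> pencil P g} = q" using card_pencil[of t P] tC e by simp
    qed
  qed (use finite_subset[OF D(1) finC] fin_pencil in auto)
  then have "q * r = (\<Sum>g\<in>?B. card {t\<in>tangents P c. t \<in> pencil P g})"
    using card_tangents[OF e cC P c(2)] by simp
  also have "\<dots> \<le> (\<Sum>g\<in>?B. 2)"
  proof (rule sum_mono)
    fix g assume g: "g \<in> ?B"
    then show "card {t\<in>tangents P c. t \<in> pencil P g} \<le> 2"
      using pencil_tangents_even[OF e assms(2,3), of g c P] tangents_in_pencil[of P g c] D cC c by auto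
  qed
  finally show ?thesis by simp
qed

text \<open>The complement of \<open>D\<close> is closed under touching too. At each point both sets
  have at least half of the circles, hence exactly half, and summation over the points gives the
  claim.\<close>

lemma card_closed:
  assumes e: "e = 1" and "odd q" "even \<rho>" and D: "D \<subseteq> C" "D \<noteq> {}" "D \<noteq> C"
    and closed: "\<And>c d. c \<in> D \<Longrightarrow> d \<in> C \<Longrightarrow> touching c d \<Longrightarrow> d \<in> D"
  shows "2 * card D = card C"
proof -
  have fD: "finite D" using finC D finite_subset by blast
  have *: "2 * card {c\<in>D. P \<in> c} = q * r" if P: "P \<in> V" for P
  proof -
    have "q * r \<le> 2 * card {c\<in>C - D. P \<in> c}"
      by (rule card_closed_through[OF assms(1-3)]) (use D closed touching_sym P in blast)+
    moreover have "q * r \<le> 2 * card {c\<in>D. P \<in> c}"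
      by (rule card_closed_through[OF assms(1-3)]) (use D closed P in blast)+
    moreover have "card {c\<in>D. P \<in> c} + card {c\<in>C - D. P \<in> c} = q * r"
    proof -
      have "{c\<in>D. P \<in> c} \<union> {c\<in>C - D. P \<in> c} = {c\<in>C. P \<in> c}" "{c\<in>D. P \<in> c} \<inter> {c\<in>C - D. P \<in> c} = {}"
        using D by blast+
      then show ?thesis
        using card_Un_disjoint[of "{c\<in>D. P \<in> c}" "{c\<in>C - D. P \<in> c}"] card_circ_through[OF P] finC fD by simp
    qed
    ultimately show ?thesis by linarith
  qed
  have cnt: "(\<Sum>x\<in>V. card {d\<in>E. x \<in> d}) = K * card E" if E: "E \<subseteq> C" for E
  proof (rule sum_multicount)
    show "\<forall>d\<in>E. card {x\<in>V. x \<in> d} = K"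
    proof
      fix d assume "d \<in> E"
      then have "d \<in> C" using E by blast
      moreover from this have "{x\<in>V. x \<in> d} = d" using circ_sub by blast
      ultimately show "card {x\<in>V. x \<in> d} = K" using circ_card by simp
    qed
  qed (use finV finite_subset[OF E finC] in auto)
  have "K * (2 * card D) = (\<Sum>x\<in>V. 2 * card {d\<in>D. x \<in> d})"
    using cnt[OF D(1)] by (simp flip: sum_distrib_left)
  also have "\<dots> = (\<Sum>x\<in>V. card {d\<in>C. x \<in> d})" using * card_circ_through by (intro sum.cong) auto
  also have "\<dots> = K * card C" by (rule cnt) simp
  finally show ?thesis using K3 by simp
qed

end

section \<open>Real inequalities behind the size bound\<close>

text \<open>The value at \<open>m\<close> is the linear interpolation of the two end values plus the
  nonnegative term A (m - a)(b - m).\<close>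

lemma concave_quadratic_pos:
  fixes a b :: real
  assumes "A \<ge> 0" "a \<le> m" "m \<le> b"
    and "B * a - A * a\<^sup>2 - c > 0" "B * b - A * b\<^sup>2 - c > 0"
  shows "B * m - A * m\<^sup>2 - c > 0"
proof (cases "a = b")
  case True
  then have "m = a" using assms by simp
  then show ?thesis using assms by simp
next
  case False
  then have ab: "b - a > 0" using assms by simp
  have "(b - a) * (B * m - A * m\<^sup>2 - c) = (b - m) * (B * a - A * a\<^sup>2 - c)
      + (m - a) * (B * b - A * b\<^sup>2 - c) + A * ((m - a) * (b - m) * (b - a))"
    by (simp add: power2_eq_square algebra_simps)
  moreover have "A * ((m - a) * (b - m) * (b - a)) \<ge> 0" using assms ab by simp
  moreover have "(b - m) * (B * a - A * a\<^sup>2 - c) + (m - a) * (B * b - A * b\<^sup>2 - c) > 0"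
  proof (cases "m = a")
    case True
    then show ?thesis using assms ab by simp
  next
    case False
    then have "(m - a) * (B * b - A * b\<^sup>2 - c) > 0" using assms by simp
    moreover have "(b - m) * (B * a - A * a\<^sup>2 - c) \<ge> 0" using assms by simp
    ultimately show ?thesis by linarith
  qed
  ultimately have "(b - a) * (B * m - A * m\<^sup>2 - c) > 0" by linarith
  then show ?thesis using ab by (simp add: zero_less_mult_iff)
qed

text \<open>This polynomial is 2000 times the lower estimate used in
  \<open>size_contradiction\<close> at the upper end of the range of \<open>m\<close>, where sqrt 2
  is replaced by 1.414. Its coefficients in powers of x - 8 are all positive; the values 3 to 7 are
  evaluated.\<close>

lemma quintic_pos:
  fixes n :: nat
  assumes "n \<ge> 3"
  defines "x \<equiv> real n"
  shows "207 * x^5 - 2258 * x^4 + 3449 * x^3 + 18258 * x\<^sup>2 - 9656 * x - 14000 > 0"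
proof (cases "n \<ge> 8")
  case True
  define y where "y = x - 8"
  have "y \<ge> 0" using True by (simp add: y_def x_def)
  have "207 * x^5 - 2258 * x^4 + 3449 * x^3 + 18258 * x\<^sup>2 - 9656 * x - 14000
      = 207 * y^5 + 6022 * y^4 + 63673 * y^3 + 293802 * y\<^sup>2 + 559656 * y + 377360"
    unfolding y_def by (simp add: eval_nat_numeral algebra_simps)
  also have "\<dots> > 0" using \<open>y \<ge> 0\<close> by (simp add: add_nonneg_pos)
  finally show ?thesis .
next
  case False
  then have "n \<in> {3, 4, 5, 6, 7}" using assms(1) by auto
  then show ?thesis by (auto simp: x_def)
qed

text \<open>Here \<open>m\<close> is the number of members through the heavy point: pair counting
  supplies its lower end, \<open>card_meeting_le\<close> its upper end, and \<open>le\<close> is the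
  inequality of \<open>mixing_bound\<close>. Collected on one side, \<open>le\<close> denies the
  positivity of a concave quadratic in \<open>m\<close>, which is therefore tested at the two ends
  only.\<close>

lemma size_contradiction:
  fixes n :: nat and f m :: real
  defines "q \<equiv> real n"
  assumes n: "n \<ge> 3" and f: "f \<ge> 1 / sqrt 2 * q\<^sup>2 + 2 * sqrt 2 * q + 8"
    and m: "sqrt 2 * q + 3 \<le> m" "m \<le> (q + 1) * (q + 2) / 2"
    and le: "(f - m) * m * (q - 1) \<le> q\<^sup>2 * (q\<^sup>2 - 3 + 2 * (m - 1))"
  shows False
proof -
  define s where "s = sqrt 2"
  have q: "q \<ge> 3" using n by (simp add: q_def)
  have ss: "s * s = 2" by (simp add: s_def)
  have s1: "s \<ge> 1414 / 1000" unfolding s_def by (rule real_le_rsqrt) (simp add: power2_eq_square)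
  have s2: "s \<le> 3 / 2" unfolding s_def by (rule real_le_lsqrt) (simp_all add: power2_eq_square)
  define f0 where "f0 = s / 2 * q\<^sup>2 + 2 * s * q + 8"
  have "1 / s = s / 2" using ss s1 by (simp add: field_simps)
  then have inv: "1 / sqrt 2 = s / 2" by (simp add: s_def)
  have f0: "f0 \<le> f" using f unfolding inv f0_def s_def .
  have "s * q \<ge> 0" using s1 q by simp
  have m0: "m > 0" using m(1) \<open>s * q \<ge> 0\<close> by (simp add: s_def)
  let ?b = "(q + 1) * (q + 2) / 2"
  have "(f0 * (q - 1) - 2 * q\<^sup>2) * m - (q - 1) * m\<^sup>2 - q\<^sup>2 * (q\<^sup>2 - 5) > 0"
  proof (rule concave_quadratic_pos)
    show "s * q + 3 \<le> m" using m by (simp add: s_def)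
    \<comment> \<open>The coefficient of q^4 vanishes because s^2 = 2. This is the balance that
      fixes the leading coefficient 1/sqrt 2; the inequality is then decided by the terms of lower
      order.\<close>
    have "(f0 * (q - 1) - 2 * q\<^sup>2) * (s * q + 3) - (q - 1) * (s * q + 3)\<^sup>2 - q\<^sup>2 * (q\<^sup>2 - 5)
        = q^4 * (s * s / 2 - 1) + q^3 * (s * s - s * s / 2 + 3 * s / 2 - 2 * s)
          + q\<^sup>2 * (8 * s - s * s - 3 * s / 2 - 1) + q * (15 - 8 * s) - 15"
      unfolding f0_def
      by (simp add: power2_eq_square power3_eq_cube power4_eq_xxxx algebra_simps add_divide_distrib diff_divide_distrib)
    also have "\<dots> = q^3 * (1 - s / 2) + q\<^sup>2 * (13 * s / 2 - 3) + q * (15 - 8 * s) - 15"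
      unfolding ss by (simp add: algebra_simps)
    also have "\<dots> > 0"
    proof -
      have "q^3 * (1 - s / 2) \<ge> 0" "q * (15 - 8 * s) \<ge> 0" using s2 q by simp_all
      moreover have "9 * (13 * s / 2 - 3) \<le> q\<^sup>2 * (13 * s / 2 - 3)"
        using power_mono[of 3 q 2] q s1 by (intro mult_right_mono) auto
      moreover have "9 * (13 * s / 2 - 3) > 15" using s1 by simp
      ultimately show ?thesis
        by (smt (verit, best))
    qed
    finally show "(f0 * (q - 1) - 2 * q\<^sup>2) * (s * q + 3) - (q - 1) * (s * q + 3)\<^sup>2 - q\<^sup>2 * (q\<^sup>2 - 5) > 0" .
    have "f0 \<ge> 707 / 1000 * q\<^sup>2 + 2828 / 1000 * q + 8"
    proof -
      have "1414 / 1000 * q\<^sup>2 \<le> s * q\<^sup>2" "1414 / 1000 * q \<le> s * q" using s1 q by (intro mult_right_mono; simp)+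
      then show ?thesis by (simp add: f0_def)
    qed
    then have le1: "(f0 * (q - 1) - 2 * q\<^sup>2) * ?b - (q - 1) * ?b\<^sup>2 - q\<^sup>2 * (q\<^sup>2 - 5)
      \<ge> ((707 / 1000 * q\<^sup>2 + 2828 / 1000 * q + 8) * (q - 1) - 2 * q\<^sup>2) * ?b - (q - 1) * ?b\<^sup>2 - q\<^sup>2 * (q\<^sup>2 - 5)"
      using q by (intro diff_mono mult_right_mono order_refl) auto
    have eq1: "((707 / 1000 * q\<^sup>2 + 2828 / 1000 * q + 8) * (q - 1) - 2 * q\<^sup>2) * ?b - (q - 1) * ?b\<^sup>2 - q\<^sup>2 * (q\<^sup>2 - 5)
      = (207 * q^5 - 2258 * q^4 + 3449 * q^3 + 18258 * q\<^sup>2 - 9656 * q - 14000) / 2000"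
      by (simp add: power2_eq_square power3_eq_cube power4_eq_xxxx power_numeral_reduce field_simps)
    have pos1: "207 * q^5 - 2258 * q^4 + 3449 * q^3 + 18258 * q\<^sup>2 - 9656 * q - 14000 > 0"
      using quintic_pos[OF n] by (simp add: q_def)
    show "(f0 * (q - 1) - 2 * q\<^sup>2) * ?b - (q - 1) * ?b\<^sup>2 - q\<^sup>2 * (q\<^sup>2 - 5) > 0"
      by (rule less_le_trans[OF _ le1]) (simp only: eq1, rule divide_pos_pos[OF pos1], simp)
  qed (use q m in auto)
  moreover have "f0 * (m * (q - 1)) \<le> f * (m * (q - 1))"
    using f0 m0 q by (intro mult_right_mono) auto
  ultimately show False using le by (simp add: power2_eq_square algebra_simps)
qed

section \<open>Touching pairs, heavy points and the common-point theorem\<close>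

context circle_plane
begin

lemma card_touching:
  assumes "e = 1" "c \<in> C"
  shows "real (card {d\<in>C. touching c d}) = (real q)\<^sup>2 - 1"
proof -
  let ?D = "{d\<in>C. touching c d}"
  have "(\<Sum>X\<in>c. card {d\<in>?D. c \<inter> d = {X}}) = 1 * card ?D"
  proof (rule sum_multicount)
    show "\<forall>d\<in>?D. card {X\<in>c. c \<inter> d = {X}} = 1"
    proof
      fix d assume "d \<in> ?D"
      then obtain X where X: "c \<inter> d = {X}" by (auto elim: touchingE)
      then have "{X\<in>c. c \<inter> d = {X}} = {X}" by blast
      then show "card {X\<in>c. c \<inter> d = {X}} = 1" by simp
    qed
  qed (use finC fin_circ assms in auto)
  moreover have "card {d\<in>?D. c \<inter> d = {X}} = q - 1" if "X \<in> c" for X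
  proof -
    have "{d\<in>?D. c \<inter> d = {X}} = {d\<in>C. c \<inter> d = {X}}" by (auto simp: touching_def)
    then show ?thesis using card_tangent_at[of c X] assms that by simp
  qed
  ultimately have "card ?D = (q + 1) * (q - 1)" using circ_card[of c] assms Ke by simp
  then show ?thesis using q2 by (simp add: power2_eq_square algebra_simps)
qed

definition tpairs :: "'p set set \<Rightarrow> real" where
  "tpairs G = (\<Sum>c\<in>G. real (card {d\<in>G. touching c d}))"

text \<open>A variance estimate over \<open>D\<close> for \<open>t x\<close>, the number of members
  of \<open>G\<close> touching \<open>x\<close>. Its first moment is known exactly and its second
  moment is bounded through the common touching circles. The number
  \<open>\<beta> = h * g / q\<close> approximates the mean of \<open>t\<close> on \<open>D\<close>,
  as |D| is about q^3 / h. The deviation over \<open>G\<close> is recovered from the squares by q z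
  \<le> z^2 + q^2 / 4. In the applications \<open>D\<close> is the set of all circles with h = 1, or
  one of two types with h = 2.\<close>

lemma tpairs_le:
  assumes e: "e = 1" and D: "D \<subseteq> C" "h * real (card D) = real (card C)" and h: "h \<ge> 1"
    and closed: "\<And>c d. c \<in> D \<Longrightarrow> d \<in> C \<Longrightarrow> touching c d \<Longrightarrow> d \<in> D"
    and G: "G \<subseteq> D"
    and ct: "\<And>c d. c \<in> G \<Longrightarrow> d \<in> G \<Longrightarrow> c \<noteq> d \<Longrightarrow>
      real (card {x\<in>C. touching c x \<and> touching d x}) \<le> h * (real q - 1)"
  shows "q * tpairs G \<le> 3 * h * (real (card G))\<^sup>2 / q + card G * ((real q)\<^sup>2 - 1 - h * (real q - 1) + (real q)\<^sup>2 / 4)"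
proof (cases "G = {}")
  case True
  then show ?thesis by (simp add: tpairs_def)
next
  case False
  define g k where "g = real (card G)" and "k = (real q)\<^sup>2 - 1"
  define t where "t x = real (card {d\<in>G. touching x d})" for x
  define \<beta> where "\<beta> = h * g / q"
  have fin: "finite D" "finite G" using finC D G by (meson finite_subset)+
  have GC: "c \<in> C" if "c \<in> G" for c using that G D by blast
  have q0: "real q > 0" using q2 by simp
  have deg: "real (card {x\<in>D. touching x d}) = k" if "d \<in> G" for d
  proof -
    have "{x\<in>D. touching x d} = {x\<in>C. touching d x}"
      using closed[of d] that G D touching_sym by blast
    then show ?thesis using card_touching[OF e GC[OF that]] by (simp add: k_def)
  qed
  have s1: "(\<Sum>x\<in>D. t x) = g * k"
    unfolding t_def using deg by (subst sum_count_swap[OF fin]) (simp add: g_def)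
  have s2: "(\<Sum>x\<in>D. (t x)\<^sup>2) \<le> g * (k + (g - 1) * (h * (real q - 1)))"
  proof -
    have "(\<Sum>x\<in>D. (t x)\<^sup>2) = (\<Sum>x\<in>D. real (card {p\<in>G \<times> G. touching x (fst p) \<and> touching x (snd p)}))"
    proof (rule sum.cong)
      fix x
      have "{p\<in>G \<times> G. touching x (fst p) \<and> touching x (snd p)} = {d\<in>G. touching x d} \<times> {d\<in>G. touching x d}" by auto
      then show "(t x)\<^sup>2 = real (card {p\<in>G \<times> G. touching x (fst p) \<and> touching x (snd p)})"
        by (simp only: t_def card_cartesian_product of_nat_mult power2_eq_square)
    qed simp
    also have "\<dots> = (\<Sum>p\<in>G \<times> G. real (card {x\<in>D. touching x (fst p) \<and> touching x (snd p)}))"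
      by (rule sum_count_swap) (use fin in auto)
    also have "\<dots> = (\<Sum>c\<in>G. \<Sum>d\<in>G. real (card {x\<in>D. touching x c \<and> touching x d}))"
      by (simp add: sum.cartesian_product case_prod_beta)
    also have "\<dots> \<le> (\<Sum>c\<in>G. k + (g - 1) * (h * (real q - 1)))"
    proof (rule sum_mono)
      fix c assume c: "c \<in> G"
      have "(\<Sum>d\<in>G. real (card {x\<in>D. touching x c \<and> touching x d}))
          = real (card {x\<in>D. touching x c \<and> touching x c})
            + (\<Sum>d\<in>G - {c}. real (card {x\<in>D. touching x c \<and> touching x d}))"
        by (rule sum.remove[OF fin(2) c])
      also have "\<dots> \<le> k + (\<Sum>d\<in>G - {c}. h * (real q - 1))"
      proof (intro add_mono sum_mono)
        show "real (card {x\<in>D. touching x c \<and> touching x c}) \<le> k" using deg[OF c] by simp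
      next
        fix d assume d: "d \<in> G - {c}"
        have "card {x\<in>D. touching x c \<and> touching x d} \<le> card {x\<in>C. touching c x \<and> touching d x}"
          by (rule card_mono) (use finC D touching_sym in auto)
        then have "real (card {x\<in>D. touching x c \<and> touching x d}) \<le> real (card {x\<in>C. touching c x \<and> touching d x})"
          by simp
        also have "\<dots> \<le> h * (real q - 1)" using ct[of c d] c d by blast
        finally show "real (card {x\<in>D. touching x c \<and> touching x d}) \<le> h * (real q - 1)" .
      qed
      also have "(\<Sum>d\<in>G - {c}. h * (real q - 1)) = (g - 1) * (h * (real q - 1))"
        using card_Suc_Diff1[OF fin(2) c] by (simp add: g_def)
      finally show "(\<Sum>d\<in>G. real (card {x\<in>D. touching x c \<and> touching x d})) \<le> k + (g - 1) * (h * (real q - 1))" .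
    qed
    also have "\<dots> = g * (k + (g - 1) * (h * (real q - 1)))" by (simp add: g_def)
    finally show ?thesis .
  qed
  have n: "\<beta>\<^sup>2 * real (card D) = h * g\<^sup>2 * (real q - 1 + r / q)"
  proof -
    have "C \<noteq> {}" using False G D by blast
    then have "real (card C) = (real q)\<^sup>2 * (real q - 1) + q * r"
      using card_C q2 by simp
    moreover have "(real q)\<^sup>2 * (real q - 1 + r / q) = (real q)\<^sup>2 * (real q - 1) + q * r"
      using q0 by (simp add: power2_eq_square distrib_left)
    ultimately have "h * real (card D) = (real q)\<^sup>2 * (real q - 1 + r / q)"
      using D by simp
    moreover have "\<beta>\<^sup>2 * real (card D) = h * g\<^sup>2 / (real q)\<^sup>2 * (h * real (card D))"
      by (simp add: \<beta>_def power2_eq_square)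
    ultimately have "\<beta>\<^sup>2 * real (card D) = h * g\<^sup>2 / (real q)\<^sup>2 * ((real q)\<^sup>2 * (real q - 1 + r / q))" by simp
    then show ?thesis using q0 by simp
  qed
  have "q * (tpairs G - g * \<beta>) = (\<Sum>x\<in>G. q * (t x - \<beta>))"
    by (simp add: tpairs_def t_def g_def sum_subtractf sum_distrib_left algebra_simps)
  also have "\<dots> \<le> (\<Sum>x\<in>G. (t x - \<beta>)\<^sup>2 + (real q)\<^sup>2 / 4)"
  proof (rule sum_mono)
    fix x
    have "0 \<le> (t x - \<beta> - q / 2)\<^sup>2" by simp
    then show "q * (t x - \<beta>) \<le> (t x - \<beta>)\<^sup>2 + (real q)\<^sup>2 / 4"
      by (simp add: power2_eq_square algebra_simps)
  qed
  also have "\<dots> = (\<Sum>x\<in>G. (t x - \<beta>)\<^sup>2) + g * ((real q)\<^sup>2 / 4)" by (simp add: sum.distrib g_def)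
  also have "(\<Sum>x\<in>G. (t x - \<beta>)\<^sup>2) \<le> (\<Sum>x\<in>D. (t x - \<beta>)\<^sup>2)"
    by (rule sum_mono2) (use fin G in auto)
  also have "(\<Sum>x\<in>D. (t x - \<beta>)\<^sup>2) = (\<Sum>x\<in>D. (t x)\<^sup>2) - 2 * \<beta> * (\<Sum>x\<in>D. t x) + \<beta>\<^sup>2 * real (card D)"
  proof -
    have "(\<Sum>x\<in>D. (t x - \<beta>)\<^sup>2) = (\<Sum>x\<in>D. (t x)\<^sup>2 - 2 * \<beta> * t x + \<beta>\<^sup>2)"
      by (rule sum.cong) (simp_all add: power2_eq_square algebra_simps)
    then show ?thesis by (simp add: sum.distrib sum_subtractf sum_distrib_left)
  qed
  finally have "q * tpairs G \<le> q * (g * \<beta>) + g * (k + (g - 1) * (h * (real q - 1))) - 2 * \<beta> * (g * k)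
      + h * g\<^sup>2 * (real q - 1 + r / q) + g * ((real q)\<^sup>2 / 4)"
    using s2 unfolding s1 n by (simp add: algebra_simps)
  also have "\<dots> = h * g\<^sup>2 * ((2 + real r - real q) / q) + g * (k - h * (real q - 1) + (real q)\<^sup>2 / 4)"
    using q0 by (simp add: \<beta>_def k_def power2_eq_square field_simps)
  \<comment> \<open>The 3 is the bound for 2 + r - q that follows from r \<le> q + 1.\<close>
  also have "\<dots> \<le> h * g\<^sup>2 * (3 / q) + g * (k - h * (real q - 1) + (real q)\<^sup>2 / 4)"
    using r1 q0 h by (intro add_mono mult_left_mono divide_right_mono) (auto simp: g_def)
  finally show ?thesis by (simp add: g_def k_def algebra_simps)
qed

text \<open>With \<open>n X\<close> the number of members through \<open>X\<close>, the sum of the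
  squares of \<open>n\<close> is the sum of card (c \<inter> d) over ordered pairs: \<open>K\<close>
  on the diagonal, and elsewhere at least 2, less 1 if the pair touches. It is also at most the
  maximum of \<open>n\<close> times the sum K |F| of all its values, so a point attaining the
  maximum will do.\<close>

lemma heavy_point:
  assumes F: "F \<subseteq> C" "F \<noteq> {}" and meet: "\<And>c d. c \<in> F \<Longrightarrow> d \<in> F \<Longrightarrow> c \<inter> d \<noteq> {}"
  obtains P where "P \<in> V"
    "real (card F) * (real K + 2 * (real (card F) - 1)) - tpairs F \<le> real (card {c\<in>F. P \<in> c}) * (real K * real (card F))"
proof -
  define f where "f = real (card F)"
  define n where "n P = card {c\<in>F. P \<in> c}" for P
  have fin: "finite F" using F finC finite_subset by blast
  obtain c where c: "c \<in> F" using F by blast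
  then have "c \<noteq> {}" using circ_card[of c] F K3 by auto
  then have "V \<noteq> {}" using circ_sub c F by blast
  define m where "m = Max (n ` V)"
  have "m \<in> n ` V" using \<open>V \<noteq> {}\<close> finV by (simp add: m_def)
  then obtain P where P: "P \<in> V" "m = n P" by blast
  have s1: "(\<Sum>X\<in>V. real (n X)) = K * f"
  proof -
    have "(\<Sum>X\<in>V. real (n X)) = (\<Sum>c\<in>F. real (card {X\<in>V. X \<in> c}))"
      unfolding n_def by (rule sum_count_swap[OF finV fin])
    also have "\<dots> = (\<Sum>c\<in>F. real K)"
    proof (rule sum.cong)
      fix c assume "c \<in> F"
      then have "{X\<in>V. X \<in> c} = c" "card c = K" using F circ_sub circ_card by blast+
      then show "real (card {X\<in>V. X \<in> c}) = real K" by simp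
    qed simp
    finally show ?thesis by (simp add: f_def)
  qed
  have s2: "(\<Sum>X\<in>V. (real (n X))\<^sup>2) = (\<Sum>c\<in>F. \<Sum>d\<in>F. real (card (c \<inter> d)))"
  proof -
    have "(\<Sum>X\<in>V. (real (n X))\<^sup>2) = (\<Sum>X\<in>V. real (card {p\<in>F \<times> F. X \<in> fst p \<and> X \<in> snd p}))"
    proof (rule sum.cong)
      fix X
      have "{p\<in>F \<times> F. X \<in> fst p \<and> X \<in> snd p} = {c\<in>F. X \<in> c} \<times> {c\<in>F. X \<in> c}" by auto
      then show "(real (n X))\<^sup>2 = real (card {p\<in>F \<times> F. X \<in> fst p \<and> X \<in> snd p})"
        by (simp only: n_def card_cartesian_product of_nat_mult power2_eq_square)
    qed simp
    also have "\<dots> = (\<Sum>p\<in>F \<times> F. real (card {X\<in>V. X \<in> fst p \<and> X \<in> snd p}))"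
      by (rule sum_count_swap) (use finV fin in auto)
    also have "\<dots> = (\<Sum>p\<in>F \<times> F. real (card (fst p \<inter> snd p)))"
    proof (rule sum.cong)
      fix p assume "p \<in> F \<times> F"
      then have "fst p \<in> C" using F by auto
      then have "{X\<in>V. X \<in> fst p \<and> X \<in> snd p} = fst p \<inter> snd p" using circ_sub by blast
      then show "real (card {X\<in>V. X \<in> fst p \<and> X \<in> snd p}) = real (card (fst p \<inter> snd p))" by simp
    qed simp
    finally show ?thesis by (simp add: sum.cartesian_product case_prod_beta)
  qed
  have "f * (real K + 2 * (f - 1)) - tpairs F
      = (\<Sum>c\<in>F. (real K + 2 * (f - 1)) - real (card {d\<in>F. touching c d}))"
    by (simp add: tpairs_def f_def sum_subtractf)
  also have "\<dots> \<le> (\<Sum>c\<in>F. \<Sum>d\<in>F. real (card (c \<inter> d)))"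
  proof (rule sum_mono)
    fix c assume c: "c \<in> F"
    have "{d\<in>F. touching c d} = (F - {c}) \<inter> {d. touching c d}"
      using not_touching_refl c F by blast
    then have "real (card {d\<in>F. touching c d}) = (\<Sum>d\<in>F - {c}. of_bool (touching c d))"
      using fin by simp
    then have "(real K + 2 * (f - 1)) - real (card {d\<in>F. touching c d})
        = real K + (\<Sum>d\<in>F - {c}. 2 - of_bool (touching c d))"
      using card_Suc_Diff1[OF fin c] by (simp add: f_def sum_subtractf)
    also have "\<dots> \<le> real (card (c \<inter> c)) + (\<Sum>d\<in>F - {c}. real (card (c \<inter> d)))"
    proof (intro add_mono sum_mono)
      show "real K \<le> real (card (c \<inter> c))" using circ_card c F by auto
    next
      fix d assume d: "d \<in> F - {c}"
      then have "c \<in> C" "d \<in> C" "c \<noteq> d" using c F by auto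
      then show "2 - of_bool (touching c d) \<le> real (card (c \<inter> d))"
        using meet[of c d] c d by (cases rule: card_inter_cases) auto
    qed
    also have "\<dots> = (\<Sum>d\<in>F. real (card (c \<inter> d)))" by (rule sum.remove[OF fin c, symmetric])
    finally show "(real K + 2 * (f - 1)) - real (card {d\<in>F. touching c d}) \<le> (\<Sum>d\<in>F. real (card (c \<inter> d)))" .
  qed
  also have "\<dots> = (\<Sum>X\<in>V. (real (n X))\<^sup>2)" by (rule s2[symmetric])
  also have "\<dots> \<le> (\<Sum>X\<in>V. real m * real (n X))"
    unfolding power2_eq_square m_def using finV by (intro sum_mono mult_right_mono) auto
  also have "\<dots> = real (n P) * (K * f)" using s1 P by (simp flip: sum_distrib_left)
  finally show thesis using that[OF P(1)] by (simp add: f_def n_def)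
qed

text \<open>All circles through \<open>P\<close> together have r (r + 1 - e) incidences with
  \<open>c\<close>. If contacts are counted twice, each circle meeting \<open>c\<close> uses up two,
  and the total becomes r (r + 1) for either value of \<open>e\<close>.\<close>

lemma card_meeting_le:
  assumes "c \<in> C" "P \<in> V" "P \<notin> c"
  shows "2 * card {l\<in>C. P \<in> l \<and> l \<inter> c \<noteq> {}} \<le> (q + 1) * (q + 2)"
proof -
  let ?B = "{l\<in>C. P \<in> l}" and ?M = "{l\<in>C. P \<in> l \<and> l \<inter> c \<noteq> {}}"
  have fin: "finite ?B" "finite ?M" "finite c" using finC fin_circ assms by auto
  have "(\<Sum>l\<in>?B. card {y\<in>{y\<in>c. np P y}. y \<in> l}) = r * card {y\<in>c. np P y}"
  proof (rule sum_multicount)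
    show "\<forall>y\<in>{y\<in>c. np P y}. card {l\<in>?B. y \<in> l} = r"
    proof
      fix y assume y: "y \<in> {y\<in>c. np P y}"
      have "{l\<in>?B. y \<in> l} = {l\<in>C. P \<in> l \<and> y \<in> l}" by blast
      then show "card {l\<in>?B. y \<in> l} = r" using card_circ_through2[of P y] y assms circ_sub by auto
    qed
  qed (use fin in auto)
  moreover have "{y\<in>{y\<in>c. np P y}. y \<in> l} = c \<inter> l" if "l \<in> ?B" for l
    using that circ_np[of l P] assms by auto
  ultimately have s: "(\<Sum>l\<in>?B. card (c \<inter> l)) = r * (r + 1 - e)"
    using card_off[OF assms] by simp
  have "2 * card ?M = (\<Sum>l\<in>?M. 2)" by simp
  also have "\<dots> \<le> (\<Sum>l\<in>?M. card (c \<inter> l) + (if touching c l then 1 else 0))"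
  proof (rule sum_mono)
    fix l assume l: "l \<in> ?M"
    then have "l \<in> C" "c \<noteq> l" using assms by auto
    then show "2 \<le> card (c \<inter> l) + (if touching c l then 1 else 0)"
      using l by (cases rule: card_inter_cases[OF assms(1)]) auto
  qed
  also have "\<dots> \<le> (\<Sum>l\<in>?B. card (c \<inter> l) + (if touching c l then 1 else 0))"
    by (rule sum_mono2) (use fin in auto)
  also have "\<dots> = r * (r + 1 - e) + card (tangents P c)"
    using fin s by (simp add: sum.distrib sum.If_cases tangents_def Int_def conj_commute conj_left_commute)
  also have "\<dots> \<le> (q + 1) * (q + 2)"
  proof (cases "e = 0")
    case True
    then have "tangents P c = {}" using not_touching_e0 assms by (auto simp: tangents_def)
    then show ?thesis using True e0 by (simp add: algebra_simps)
  next
    case False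
    then have "e = 1" using e1 by simp
    then have "r * (r + 1 - e) + card (tangents P c) = r * (r + 1)"
      using card_tangents[of c P] assms by simp
    also have "\<dots> \<le> (q + 1) * (q + 2)" using r1 by (intro mult_mono) auto
    finally show ?thesis .
  qed
  finally show ?thesis .
qed

text \<open>This evaluates \<open>mixing\<close> for r = q + 1, q and q - 1. The right-hand side is
  the exact outcome for \<rho> = 0; the other two cases leave slack, which X \<ge> 3 q - 3 makes
  sufficient.\<close>

lemma mixing_bound:
  assumes q3: "q \<ge> 3" and F: "F \<subseteq> C" and meet: "\<And>c d. c \<in> F \<Longrightarrow> d \<in> F \<Longrightarrow> c \<inter> d \<noteq> {}"
    and h: "h \<ge> 0" "h \<le> 2"
    and ct: "\<And>l l'. l \<in> F \<Longrightarrow> l' \<in> F \<Longrightarrow> l \<noteq> l' \<Longrightarrow>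
      real (card {c\<in>C. touching l c \<and> touching l' c}) \<le> h * (real q - 1)"
    and m: "m = real (card {c\<in>F. P \<in> c})" "m \<ge> 1"
  shows "(real (card F) - m) * m * (real q - 1) \<le> (real q)\<^sup>2 * ((real q)\<^sup>2 - 3 + 2 * (m - 1))"
proof -
  let ?L = "{c\<in>F. P \<in> c}" and ?T = "{c\<in>F. P \<notin> c}"
  define t where "t = real (card ?T)"
  define a D where "a = real r / real q" and "D = 2 * (real q - r) * (r + 1) + (real r)\<^sup>2"
  define X where "X = (real q)\<^sup>2 - 3 + 2 * (m - 1)"
  have fin: "finite F" using F finC finite_subset by blast
  have q: "real q \<ge> 3" using q3 by simp
  have t: "t = real (card F) - m"
  proof -
    have "?L \<union> ?T = F" "?L \<inter> ?T = {}" by blast+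
    then have "card F = card ?L + card ?T" using card_Un_disjoint[of ?L ?T] fin by simp
    then show ?thesis by (simp add: t_def m)
  qed
  have "t * (m * (2 - a))\<^sup>2 \<le> m * ((real q - 1) * D) + m * (m - 1) * (h * (real q - 1))"
    unfolding t_def m(1) a_def D_def
    by (rule mixing[OF q3]) (use F meet h ct in auto)
  then have "m * (t * m * (2 - a)\<^sup>2) \<le> m * ((real q - 1) * (D + (m - 1) * h))"
    by (simp add: power2_eq_square algebra_simps)
  then have "t * m * (2 - a)\<^sup>2 \<le> (real q - 1) * (D + (m - 1) * h)" using m by simp
  also have "\<dots> \<le> (real q - 1) * (D + (m - 1) * 2)"
    using q m h by (intro mult_left_mono add_left_mono) auto
  finally have main: "t * m * (2 - a)\<^sup>2 \<le> (real q - 1) * (D + 2 * (m - 1))" by (simp add: mult.commute)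
  have q9: "(real q)\<^sup>2 \<ge> 3 * real q" using q by (simp add: power2_eq_square)
  have X0: "X \<ge> 3 * real q - 3" using q9 m by (simp add: X_def)
  have "t * m * (real q - 1) \<le> (real q)\<^sup>2 * X"
  proof -
    consider "\<rho> = 0" | "\<rho> = 1" | "\<rho> = 2" using \<rho>2 by linarith
    then show ?thesis
    proof cases
      case 1
      then have r: "real r = real q + 1" using r\<rho> by simp
      have a: "2 - a = (real q - 1) / q" using q by (simp add: a_def r field_simps)
      have D: "D + 2 * (m - 1) = X" by (simp add: D_def X_def r power2_eq_square algebra_simps)
      have "t * m * ((real q - 1) / q)\<^sup>2 \<le> (real q - 1) * X" using main unfolding a D .
      then have "t * m * (real q - 1)\<^sup>2 \<le> (real q)\<^sup>2 * ((real q - 1) * X)"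
        using q by (simp add: power_divide pos_divide_le_eq mult.commute)
      then have "(real q - 1) * (t * m * (real q - 1)) \<le> (real q - 1) * ((real q)\<^sup>2 * X)"
        by (simp add: power2_eq_square mult_ac)
      then show ?thesis using q by simp
    next
      case 2
      then have r: "real r = real q" using r\<rho> by simp
      have a: "2 - a = 1" using q by (simp add: a_def r)
      have D: "D + 2 * (m - 1) = X + 3" by (simp add: D_def X_def r)
      have "t * m \<le> (real q - 1) * (X + 3)" using main unfolding a D by simp
      then have "t * m * (real q - 1) \<le> (real q - 1) * (X + 3) * (real q - 1)"
        using q by (intro mult_right_mono) auto
      also have "\<dots> \<le> (real q)\<^sup>2 * X"
      proof -
        have "3 * (real q - 1)\<^sup>2 \<le> (2 * real q - 1) * (3 * real q - 3)"
          using q by (simp add: power2_eq_square algebra_simps)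
        also have "\<dots> \<le> (2 * real q - 1) * X" using X0 q by (intro mult_left_mono) auto
        finally show ?thesis by (simp add: power2_eq_square algebra_simps)
      qed
      finally show ?thesis .
    next
      case 3
      then have r: "real r = real q - 1" using r\<rho> by simp
      have a: "2 - a = (real q + 1) / q" using q by (simp add: a_def r field_simps)
      have D: "D + 2 * (m - 1) = X + 4" by (simp add: D_def X_def r power2_eq_square algebra_simps)
      have "t * m * ((real q + 1) / q)\<^sup>2 \<le> (real q - 1) * (X + 4)" using main unfolding a D .
      then have "t * m * (real q + 1)\<^sup>2 \<le> (real q)\<^sup>2 * ((real q - 1) * (X + 4))"
        using q by (simp add: power_divide pos_divide_le_eq mult.commute)
      then have "t * m * (real q + 1)\<^sup>2 * (real q - 1) \<le> (real q)\<^sup>2 * ((real q - 1) * (X + 4)) * (real q - 1)"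
        using q by (intro mult_right_mono) auto
      also have "\<dots> = (real q)\<^sup>2 * ((real q - 1)\<^sup>2 * (X + 4))" by (simp add: power2_eq_square)
      also have "\<dots> \<le> (real q)\<^sup>2 * ((real q + 1)\<^sup>2 * X)"
      proof (rule mult_left_mono)
        have "4 * (real q - 1)\<^sup>2 \<le> 4 * real q * (3 * real q - 3)"
          using q mult_mono[of "real q - 1" "real q" "real q - 1" "3 * real q - 3"]
          by (simp add: power2_eq_square)
        also have "\<dots> \<le> 4 * real q * X" using X0 q by (intro mult_left_mono) auto
        finally show "(real q - 1)\<^sup>2 * (X + 4) \<le> (real q + 1)\<^sup>2 * X" by (simp add: power2_eq_square algebra_simps)
      qed simp
      finally have "(real q + 1)\<^sup>2 * (t * m * (real q - 1)) \<le> (real q + 1)\<^sup>2 * ((real q)\<^sup>2 * X)" by (simp add: mult_ac)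
      then show ?thesis using q by simp
    qed
  qed
  then show ?thesis by (simp add: t X_def)
qed

text \<open>Both types are required to occur, since only proper nonempty sets closed under touching
  are shown by \<open>card_closed\<close> to contain exactly half of the circles.\<close>

definition two_types :: "('p set \<Rightarrow> bool) \<Rightarrow> bool" where
  "two_types ty \<longleftrightarrow> (\<forall>c\<in>C. \<forall>d\<in>C. touching c d \<longrightarrow> ty c = ty d) \<and> (\<exists>c\<in>C. ty c) \<and> (\<exists>c\<in>C. \<not> ty c)"

text \<open>For odd \<open>r\<close> the estimate is applied to all circles with h = 1. In the other
  case two circles may have twice as many common touching circles, but touching pairs stay inside a
  type, so each half is treated with h = 2, and the squares of the two part sizes add up to at most
  the square of |F|. The stated bound covers both cases.\<close>

lemma tpairs_bound:
  assumes e: "e = 1" and hyp: "odd r \<or> odd q \<and> even \<rho> \<and> two_types ty"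
    and F: "F \<subseteq> C" and meet: "\<And>c d. c \<in> F \<Longrightarrow> d \<in> F \<Longrightarrow> c \<inter> d \<noteq> {}"
  shows "q * tpairs F \<le> 6 * (real (card F))\<^sup>2 / q + card F * (5 / 4 * (real q)\<^sup>2 - q)"
    and "\<And>c d. c \<in> F \<Longrightarrow> d \<in> F \<Longrightarrow> c \<noteq> d \<Longrightarrow>
      real (card {x\<in>C. touching c x \<and> touching d x}) \<le> 2 * (real q - 1)"
proof -
  define f where "f = real (card F)"
  have fin: "finite F" using F finC finite_subset by blast
  have q: "real q \<ge> 2" using q2 by simp
  have real_le: "real x \<le> real h * (real q - 1)" if "x \<le> h * (q - 1)" for x h
    using of_nat_mono[OF that, where 'a=real] q by simp
  have "(q * tpairs F \<le> 6 * f\<^sup>2 / q + f * (5 / 4 * (real q)\<^sup>2 - q)) \<and>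
    (\<forall>c\<in>F. \<forall>d\<in>F. c \<noteq> d \<longrightarrow> real (card {x\<in>C. touching c x \<and> touching d x}) \<le> 2 * (real q - 1))"
  proof (cases "odd r")
    case True
    have ct: "real (card {x\<in>C. touching c x \<and> touching d x}) \<le> 1 * (real q - 1)"
      if "c \<in> F" "d \<in> F" "c \<noteq> d" for c d
      using real_le[OF common_tangents[OF e, of 1 c d]] pencil_tangents_odd[OF e True, of c d] that F meet
      by (auto simp: subset_iff)
    have "q * tpairs F \<le> 3 * 1 * (real (card F))\<^sup>2 / q
        + card F * ((real q)\<^sup>2 - 1 - 1 * (real q - 1) + (real q)\<^sup>2 / 4)"
      by (rule tpairs_le[OF e, of C]) (use F ct in auto)
    also have "\<dots> \<le> 6 * f\<^sup>2 / q + f * (5 / 4 * (real q)\<^sup>2 - q)"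
      by (intro add_mono) (auto simp: f_def divide_right_mono algebra_simps)
    finally show ?thesis using ct q by fastforce
  next
    case False
    then have h: "odd q" "even \<rho>" "two_types ty" using hyp by auto
    have ct: "real (card {x\<in>C. touching c x \<and> touching d x}) \<le> 2 * (real q - 1)"
      if "c \<in> F" "d \<in> F" "c \<noteq> d" for c d
      using real_le[OF common_tangents[OF e, of 2 c d]] pencil_tangents_even[OF e h(1,2), of c d] that F meet
      by (auto simp: subset_iff)
    define D1 D2 where "D1 = {c\<in>C. ty c}" and "D2 = {c\<in>C. \<not> ty c}"
    define F1 F2 where "F1 = {c\<in>F. ty c}" and "F2 = {c\<in>F. \<not> ty c}"
    have same: "ty c = ty d" if "c \<in> C" "d \<in> C" "touching c d" for c d
      using h(3) that by (auto simp: two_types_def)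
    have ex: "(\<exists>c\<in>C. ty c)" "(\<exists>c\<in>C. \<not> ty c)" using h(3) by (auto simp: two_types_def)
    have D: "2 * card D1 = card C" "2 * card D2 = card C"
      by (rule card_closed[OF e h(1,2)]; use ex same in \<open>auto simp: D1_def D2_def\<close>)+
    have b1: "q * tpairs F1 \<le> 3 * 2 * (real (card F1))\<^sup>2 / q
        + card F1 * ((real q)\<^sup>2 - 1 - 2 * (real q - 1) + (real q)\<^sup>2 / 4)"
      by (rule tpairs_le[OF e, of D1])
        (use F D ct same in \<open>auto simp: D1_def F1_def simp flip: of_nat_mult\<close>)
    have b2: "q * tpairs F2 \<le> 3 * 2 * (real (card F2))\<^sup>2 / q
        + card F2 * ((real q)\<^sup>2 - 1 - 2 * (real q - 1) + (real q)\<^sup>2 / 4)"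
      by (rule tpairs_le[OF e, of D2])
        (use F D ct same in \<open>auto simp: D2_def F2_def simp flip: of_nat_mult\<close>)
    have FF: "F = F1 \<union> F2" "F1 \<inter> F2 = {}" "finite F1" "finite F2"
      using fin by (auto simp: F1_def F2_def)
    then have cF: "f = real (card F1) + real (card F2)" using card_Un_disjoint[of F1 F2] by (simp add: f_def)
    have "tpairs F = tpairs F1 + tpairs F2"
    proof -
      have "{d\<in>F. touching c d} = {d\<in>F1. touching c d}" if "c \<in> F1" for c
        using that same F by (auto simp: F1_def)
      moreover have "{d\<in>F. touching c d} = {d\<in>F2. touching c d}" if "c \<in> F2" for c
        using that same F by (auto simp: F2_def)
      ultimately show ?thesis
        unfolding tpairs_def by (subst FF(1), subst sum.union_disjoint[OF FF(3,4,2)]) simp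
    qed
    then have "q * tpairs F \<le> 6 * ((real (card F1))\<^sup>2 + (real (card F2))\<^sup>2) / q
        + f * ((real q)\<^sup>2 - 1 - 2 * (real q - 1) + (real q)\<^sup>2 / 4)"
      using b1 b2 by (simp add: cF algebra_simps add_divide_distrib)
    also have "\<dots> \<le> 6 * f\<^sup>2 / q + f * (5 / 4 * (real q)\<^sup>2 - q)"
    proof (intro add_mono divide_right_mono mult_left_mono)
      show "(real (card F1))\<^sup>2 + (real (card F2))\<^sup>2 \<le> f\<^sup>2"
        by (simp add: cF power2_sum)
    qed (use q in \<open>auto simp: f_def\<close>)
    finally show ?thesis using ct by blast
  qed
  then show "q * tpairs F \<le> 6 * (real (card F))\<^sup>2 / q + card F * (5 / 4 * (real q)\<^sup>2 - q)"
    and "\<And>c d. c \<in> F \<Longrightarrow> d \<in> F \<Longrightarrow> c \<noteq> d \<Longrightarrow>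
      real (card {x\<in>C. touching c x \<and> touching d x}) \<le> 2 * (real q - 1)"
    by (auto simp: f_def)
qed

text \<open>The alternatives in \<open>hyp\<close> are three ways to control contact: nothing
  touches; parity leaves at most q - 1 circles touching two members; or there are two types and at
  most 2 (q - 1) such circles.\<close>

theorem common_point:
  assumes hyp: "e = 0 \<or> odd r \<or> odd q \<and> even \<rho> \<and> two_types ty"
    and F: "F \<subseteq> C" and meet: "\<And>c d. c \<in> F \<Longrightarrow> d \<in> F \<Longrightarrow> c \<inter> d \<noteq> {}"
    and size: "real (card F) \<ge> 1 / sqrt 2 * (real q)\<^sup>2 + 2 * sqrt 2 * real q + 8"
  shows "\<exists>P\<in>V. \<forall>c\<in>F. P \<in> c"
proof -
  define f where "f = real (card F)"
  define s where "s = sqrt 2"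
  have ss: "s * s = 2" by (simp add: s_def)
  have s1: "s \<ge> 1414 / 1000" unfolding s_def by (rule real_le_rsqrt) (simp add: power2_eq_square)
  have "1 / s = s / 2" using ss s1 by (simp add: field_simps)
  then have inv: "1 / sqrt 2 = s / 2" by (simp add: s_def)
  have f: "f \<ge> s / 2 * (real q)\<^sup>2 + 2 * s * q + 8" using size unfolding inv f_def s_def .
  have fin: "finite F" using F finC finite_subset by blast
  have f8: "f \<ge> 8" using f s1 by (smt (verit) mult_nonneg_nonneg of_nat_0_le_iff zero_le_power2 divide_nonneg_nonneg)
  then have Fne: "F \<noteq> {}" by (auto simp: f_def)
  \<comment> \<open>For q = 2 there are at most 10 circles, while the required size exceeds
    16.\<close>
  have q3: "q \<ge> 3"
  proof (rule ccontr)
    assume "\<not> q \<ge> 3"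
    then have "q = 2" using q2 by simp
    have "card F \<le> card C" by (rule card_mono[OF finC F])
    also have "card C = 4 + 2 * r" using card_C Fne F \<open>q = 2\<close> by auto
    also have "\<dots> \<le> 10" using r1 \<open>q = 2\<close> by simp
    finally have "f \<le> 10" by (simp add: f_def)
    then show False using f s1 \<open>q = 2\<close> by simp
  qed
  then have q: "real q \<ge> 3" by simp
  obtain P where P: "P \<in> V"
    "f * (real K + 2 * (f - 1)) - tpairs F \<le> real (card {c\<in>F. P \<in> c}) * (K * f)"
    unfolding f_def by (rule heavy_point[OF F Fne meet])
  define m where "m = real (card {c\<in>F. P \<in> c})"
  have "s * q + 3 \<le> m \<and> (\<exists>h\<ge>0. h \<le> 2 \<and> (\<forall>c\<in>F. \<forall>d\<in>F. c \<noteq> d \<longrightarrow>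
      real (card {x\<in>C. touching c x \<and> touching d x}) \<le> h * (real q - 1)))"
  proof (cases "e = 0")
    case True
    then have nt: "\<not> touching c d" if "c \<in> C" "d \<in> C" for c d using not_touching_e0 that by blast
    have "{d\<in>F. touching c d} = {}" if "c \<in> F" for c using nt F that by blast
    then have "tpairs F = 0" unfolding tpairs_def by (intro sum.neutral) (auto simp only: card.empty)
    then have "f * (real K + 2 * (f - 1)) \<le> f * (m * K)" using P by (simp add: m_def mult_ac)
    then have "real K + 2 * (f - 1) \<le> m * K" using f8 by simp
    moreover have "real K = real q + 2" using real_K True by simp
    ultimately have "real q + 2 * f \<le> m * (real q + 2)" by simp
    moreover have "(s * q + 3) * (real q + 2) \<le> real q + 2 * f"
    proof -
      have "(2 * s - 2) * q \<ge> 0" using s1 by simp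
      then show ?thesis using f by (simp add: power2_eq_square algebra_simps)
    qed
    ultimately have "(s * q + 3) * (real q + 2) \<le> m * (real q + 2)" by linarith
    then have "s * q + 3 \<le> m" using q by simp
    moreover have "\<forall>c\<in>F. \<forall>d\<in>F. c \<noteq> d \<longrightarrow>
      real (card {x\<in>C. touching c x \<and> touching d x}) \<le> 0 * (real q - 1)"
    proof (intro ballI impI)
      fix c d assume "c \<in> F"
      then have "{x\<in>C. touching c x \<and> touching d x} = {}" using nt F by blast
      then show "real (card {x\<in>C. touching c x \<and> touching d x}) \<le> 0 * (real q - 1)"
        by (simp only: card.empty)
    qed
    ultimately show ?thesis by (intro conjI exI[of _ 0]) auto
  next
    case False
    then have e: "e = 1" using e1 by simp
    have hyp': "odd r \<or> odd q \<and> even \<rho> \<and> two_types ty" using hyp False by blast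
    have K: "real K = real q + 1" using real_K e by simp
    have tau: "q * tpairs F \<le> 6 * f\<^sup>2 / q + f * (5 / 4 * (real q)\<^sup>2 - q)"
      using tpairs_bound(1)[OF e hyp' F meet] by (simp add: f_def)
    have "q * (f * (real q + 1 + 2 * (f - 1)) - tpairs F) \<le> q * (m * ((real q + 1) * f))"
      using P K by (intro mult_left_mono) (auto simp: m_def)
    then have "q * (f * (real q + 1 + 2 * (f - 1))) - q * tpairs F \<le> q * (m * ((real q + 1) * f))"
      by (simp only: right_diff_distrib)
    then have "q * (f * (real q + 1 + 2 * (f - 1))) \<le> q * (m * ((real q + 1) * f))
        + (6 * f\<^sup>2 / q + f * (5 / 4 * (real q)\<^sup>2 - q))"
      using tau by linarith
    then have "f * (q * (real q + 1 + 2 * (f - 1))) \<le> f * (q * (m * (real q + 1)) + 6 * f / q + (5 / 4 * (real q)\<^sup>2 - q))"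
      by (simp add: power2_eq_square algebra_simps)
    then have "q * (real q + 1 + 2 * (f - 1)) \<le> q * (m * (real q + 1)) + 6 * f / q + (5 / 4 * (real q)\<^sup>2 - q)"
      using f8 by simp
    moreover have "6 * f / q = q * (6 * f / (real q)\<^sup>2)" using q by (simp add: power2_eq_square)
    moreover have "5 / 4 * (real q)\<^sup>2 - q = q * (5 / 4 * real q - 1)" by (simp add: power2_eq_square algebra_simps)
    ultimately have "q * (real q + 1 + 2 * (f - 1)) \<le> q * (m * (real q + 1) + 6 * f / (real q)\<^sup>2 + (5 / 4 * real q - 1))"
      unfolding distrib_left by linarith
    then have "real q + 1 + 2 * (f - 1) \<le> m * (real q + 1) + 6 * f / (real q)\<^sup>2 + (5 / 4 * real q - 1)"
      using q by simp
    then have "2 * f - real q / 4 - 6 * f / (real q)\<^sup>2 \<le> m * (real q + 1)" by argo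
    \<comment> \<open>The terms 2 sqrt 2 q + 8 of the size bound pay here for the losses q/4 and 6 f
      / q^2 caused by touching pairs, and for the additive 3.\<close>
    moreover have "(s * q + 3) * (real q + 1) \<le> 2 * f - real q / 4 - 6 * f / (real q)\<^sup>2"
    proof -
      define f0 where "f0 = s / 2 * (real q)\<^sup>2 + 2 * s * q + 8"
      have q9: "(real q)\<^sup>2 \<ge> 9" using power_mono[of 3 "real q" 2] q by simp
      then have "6 / (real q)\<^sup>2 \<le> 2" using q by (simp add: divide_le_eq)
      then have "(2 - 6 / (real q)\<^sup>2) * f0 \<le> (2 - 6 / (real q)\<^sup>2) * f"
        using f by (intro mult_left_mono) (auto simp: f0_def)
      moreover have "(2 - 6 / (real q)\<^sup>2) * f0 = s * (real q)\<^sup>2 + 4 * s * q + 16 - 3 * s - 12 * s / q - 48 / (real q)\<^sup>2"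
        using q by (simp add: f0_def power2_eq_square field_simps)
      moreover have "12 * s / q \<le> 4 * s" using q s1 by (simp add: field_simps)
      moreover have "48 / (real q)\<^sup>2 \<le> 48 / 9" using q9 q by (intro divide_left_mono) auto
      moreover have "(3 * s - 13 / 4) * q \<ge> (3 * s - 13 / 4) * 3" using q s1 by (intro mult_left_mono) auto
      moreover have "(2 - 6 / (real q)\<^sup>2) * f = 2 * f - 6 * f / (real q)\<^sup>2" by (simp add: algebra_simps)
      moreover have "(s * q + 3) * (real q + 1) = s * (real q)\<^sup>2 + s * q + 3 * real q + 3"
        by (simp add: power2_eq_square algebra_simps)
      moreover have "(3 * s - 13 / 4) * q = 3 * (s * q) - 13 / 4 * real q" by (simp add: algebra_simps)
      ultimately show ?thesis using s1 by argo
    qed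
    ultimately have "(s * q + 3) * (real q + 1) \<le> m * (real q + 1)" by linarith
    then have "s * q + 3 \<le> m" using q by simp
    moreover have "\<forall>c\<in>F. \<forall>d\<in>F. c \<noteq> d \<longrightarrow>
      real (card {x\<in>C. touching c x \<and> touching d x}) \<le> 2 * (real q - 1)"
      using tpairs_bound(2)[OF e hyp' F meet] by blast
    ultimately show ?thesis by (intro conjI exI[of _ 2]) auto
  qed
  then obtain h where m: "s * q + 3 \<le> m" and h: "h \<ge> 0" "h \<le> 2" "\<And>c d. c \<in> F \<Longrightarrow> d \<in> F \<Longrightarrow> c \<noteq> d \<Longrightarrow>
      real (card {x\<in>C. touching c x \<and> touching d x}) \<le> h * (real q - 1)" by blast
  have "s * q \<ge> 0" using s1 by simp
  then have "m \<ge> 1" using m by linarith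
  then have mix: "(f - m) * m * (real q - 1) \<le> (real q)\<^sup>2 * ((real q)\<^sup>2 - 3 + 2 * (m - 1))"
    using mixing_bound[OF q3 F meet h(1,2) h(3) m_def] by (simp add: f_def)
  have "\<forall>c\<in>F. P \<in> c"
  proof (rule ccontr)
    assume "\<not> (\<forall>c\<in>F. P \<in> c)"
    then obtain c where c: "c \<in> F" "P \<notin> c" by blast
    have "card {l\<in>F. P \<in> l} \<le> card {l\<in>C. P \<in> l \<and> l \<inter> c \<noteq> {}}"
      by (rule card_mono) (use finC F meet c in auto)
    moreover have "2 * card {l\<in>C. P \<in> l \<and> l \<inter> c \<noteq> {}} \<le> (q + 1) * (q + 2)"
      by (rule card_meeting_le) (use c F P in auto)
    ultimately have "2 * card {l\<in>F. P \<in> l} \<le> (q + 1) * (q + 2)" by linarith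
    then have "real (2 * card {l\<in>F. P \<in> l}) \<le> real ((q + 1) * (q + 2))" by (rule of_nat_mono)
    then have "m \<le> (real q + 1) * (real q + 2) / 2" by (simp add: m_def algebra_simps)
    then show False
      using size_contradiction[OF q3 size[folded f_def] _ _ mix] m unfolding s_def by blast
  qed
  then show ?thesis using P by blast
qed

end

section \<open>Points of projective spaces over finite fields\<close>

abbreviation pt :: "'a::field ^ 'n \<Rightarrow> ('a ^ 'n) set" where
  "pt v \<equiv> vec.span {v}"

lemma pg_point_pt: "v \<noteq> 0 \<Longrightarrow> pg_point (pt v)"
  by (simp add: pg_point_def)

lemma pg_pointE:
  assumes "pg_point P"
  obtains v where "v \<noteq> 0" "P = pt v"
proof -
  have P: "vec.subspace P" "vec.dim P = 1" using assms by (auto simp: pg_point_def)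
  obtain B where B: "B \<subseteq> P" "vec.independent B" "P \<subseteq> vec.span B" "card B = vec.dim P"
    by (rule vec.basis_exists)
  then obtain v where v: "B = {v}" using P by (auto simp: card_1_singleton_iff)
  have "v \<noteq> 0" using B v vec.dependent_zero by blast
  moreover have "P = pt v" using B v P vec.span_minimal[of "{v}" P] by blast
  ultimately show thesis by (rule that)
qed

lemma pt_eq_iff:
  assumes "u \<noteq> 0"
  shows "pt u = pt v \<longleftrightarrow> (\<exists>k. k \<noteq> 0 \<and> u = k *s v)"
proof
  assume "pt u = pt v"
  then have "u \<in> pt v" using vec.span_base[of u "{u}"] by simp
  then obtain k where k: "u = k *s v" by (auto simp: vec.span_singleton)
  then have "k \<noteq> 0" using assms by auto
  then show "\<exists>k. k \<noteq> 0 \<and> u = k *s v" using k by blast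
next
  assume "\<exists>k. k \<noteq> 0 \<and> u = k *s v"
  then obtain k where k: "k \<noteq> 0" "u = k *s v" by blast
  have "v = inverse k *s u" using k by simp
  then show "pt u = pt v"
    using k vec.span_base[of u "{u}"] vec.span_base[of v "{v}"]
    by (intro vec.span_eq[THEN iffD2]) (metis empty_subsetI insert_subset singletonI vec.span_scale)
qed

lemma pt_subset_iff: "vec.subspace S \<Longrightarrow> pt v \<subseteq> S \<longleftrightarrow> v \<in> S"
  using vec.span_minimal[of "{v}" S] vec.span_base[of v "{v}"] by blast

section \<open>Squares in finite fields\<close>

definition is_sq :: "'a::field \<Rightarrow> bool" where
  "is_sq x \<longleftrightarrow> (\<exists>y. x = y * y)"

lemma is_sq_mult_sq: "y \<noteq> 0 \<Longrightarrow> is_sq (y * y * x) \<longleftrightarrow> is_sq x"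
proof
  assume y: "y \<noteq> 0" and "is_sq (y * y * x)"
  then obtain z where "y * y * x = z * z" by (auto simp: is_sq_def)
  then have "x = (z / y) * (z / y)" using y by (simp add: field_simps)
  then show "is_sq x" unfolding is_sq_def by blast
next
  assume "is_sq x"
  then obtain z where "x = z * z" by (auto simp: is_sq_def)
  then have "y * y * x = (y * z) * (y * z)" by (simp add: mult_ac)
  then show "is_sq (y * y * x)" unfolding is_sq_def by blast
qed

lemma is_sq_mult: "is_sq x \<Longrightarrow> is_sq y \<Longrightarrow> is_sq (x * y)"
  unfolding is_sq_def by (metis mult.assoc mult.commute)

text \<open>Squaring is at most two-to-one on nonzero elements, so the nonzero squares together with
  their multiples by the nonsquare \<open>a\<close> exhaust the nonzero elements. The nonsquare
  \<open>b\<close> is thus \<open>a\<close> times a square.\<close>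

lemma is_sq_mult_nonsq:
  fixes a b :: "'a::{field,finite}"
  assumes "\<not> is_sq a" "\<not> is_sq b"
  shows "is_sq (a * b)"
proof -
  let ?Q = "(\<lambda>x::'a. x * x) ` (UNIV - {0})"
  have a0: "a \<noteq> 0" "b \<noteq> 0" using assms by (auto simp: is_sq_def)
  have "card (UNIV - {0::'a}) \<le> (\<Sum>y\<in>?Q. card {x\<in>UNIV - {0}. x * x = y})"
  proof -
    have "UNIV - {0::'a} = (\<Union>y\<in>?Q. {x\<in>UNIV - {0}. x * x = y})" by auto
    then show ?thesis using card_UN_le[of ?Q "\<lambda>y. {x\<in>UNIV - {0}. x * x = y}"] by simp
  qed
  also have "\<dots> \<le> (\<Sum>y\<in>?Q. 2)"
  proof (rule sum_mono)
    fix y assume "y \<in> ?Q"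
    then obtain z where z: "y = z * z" by blast
    have "{x\<in>UNIV - {0}. x * x = y} \<subseteq> {z, - z}"
      using z square_eq_iff by auto
    then have "card {x\<in>UNIV - {0}. x * x = y} \<le> card {z, - z}" by (rule card_mono[rotated]) simp
    also have "\<dots> \<le> 2" by (simp add: card_insert_if)
    finally show "card {x\<in>UNIV - {0}. x * x = y} \<le> 2" .
  qed
  finally have c: "card (UNIV - {0::'a}) \<le> 2 * card ?Q" by simp
  have "inj_on ((*) a) ?Q" using a0 by (simp add: inj_on_def)
  then have "card ((*) a ` ?Q) = card ?Q" by (rule card_image)
  moreover have "?Q \<inter> (*) a ` ?Q = {}"
  proof (rule ccontr)
    assume "?Q \<inter> (*) a ` ?Q \<noteq> {}"
    then obtain x y where "x * x = a * (y * y)" "y \<noteq> 0" by auto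
    then have "y * y * a = x * x" by (simp add: mult_ac)
    then have "is_sq (y * y * a)" unfolding is_sq_def by blast
    then show False using is_sq_mult_sq \<open>y \<noteq> 0\<close> assms by blast
  qed
  ultimately have "card (?Q \<union> (*) a ` ?Q) = 2 * card ?Q" by (simp add: card_Un_disjoint)
  then have "?Q \<union> (*) a ` ?Q = UNIV - {0}"
    using c a0 by (intro card_seteq) auto
  then have "b \<in> ?Q \<union> (*) a ` ?Q" using a0 by simp
  then obtain y where "b = a * (y * y)" using assms by (auto simp: is_sq_def)
  then have "a * b = (a * y) * (a * y)" by (simp add: mult_ac)
  then show ?thesis unfolding is_sq_def by blast
qed

lemma is_sq_mult_iff:
  fixes a b :: "'a::{field,finite}"
  assumes "a \<noteq> 0" "b \<noteq> 0"
  shows "is_sq (a * b) \<longleftrightarrow> (is_sq a \<longleftrightarrow> is_sq b)"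
proof -
  have "is_sq b" if a: "is_sq a" "is_sq (a * b)" "a \<noteq> 0" for a b :: 'a
  proof -
    obtain y where "a = y * y" using a(1) unfolding is_sq_def by blast
    then show ?thesis using a is_sq_mult_sq[of y b] by auto
  qed
  then show ?thesis using is_sq_mult is_sq_mult_nonsq assms by (metis mult.commute)
qed

text \<open>Summing all field elements before and after a shift by 1 shows that \<open>q\<close> is
  zero in the field. If 1 + 1 = 0, an odd \<open>q\<close> would equal 1 there.\<close>

lemma not_neg_self:
  fixes x :: "'a::{field,finite}"
  assumes "odd CARD('a)" "x \<noteq> 0"
  shows "- x \<noteq> x"
proof
  assume "- x = x"
  then have "x * (1 + 1) = 0" by (metis add.right_inverse distrib_left mult_1_right)
  then have 2: "(1 + 1 :: 'a) = 0" using assms by simp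
  have "y + (1 + 1) = y" for y :: 'a using 2 by simp
  have inv: "(y + 1) + 1 = y" for y :: 'a using 2 by (simp add: add.assoc)
  have "even (card (UNIV :: 'a set))"
  proof -
    have "(\<Sum>x\<in>(UNIV :: 'a set). 1 :: 'a) = of_nat CARD('a)" by simp
    moreover have "(\<Sum>x\<in>(UNIV :: 'a set). x) = (\<Sum>x\<in>(UNIV :: 'a set). x + 1)"
      by (rule sum.reindex_bij_witness[of _ "\<lambda>x. x + 1" "\<lambda>x. x - 1"]) auto
    then have "(\<Sum>x\<in>(UNIV :: 'a set). 1 :: 'a) = 0" by (simp add: sum.distrib)
    ultimately have z: "(of_nat CARD('a) :: 'a) = 0" by simp
    show ?thesis
    proof (rule ccontr)
      assume "odd CARD('a)"
      then obtain k where "CARD('a) = 2 * k + 1" by (elim oddE)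
      then have "(of_nat CARD('a) :: 'a) = (1 + 1) * of_nat k + 1" by simp
      then show False using z 2 by simp
    qed
  qed
  then show False using assms by simp
qed

text \<open>Were every element a square, squaring would be injective as well, but 1 and -1 have the
  same square.\<close>

lemma ex_nonsq:
  assumes "odd CARD('a::{field,finite})"
  shows "\<exists>x::'a. \<not> is_sq x"
proof (rule ccontr)
  assume "\<not> ?thesis"
  then have "surj (\<lambda>x::'a. x * x)" by (fastforce simp: is_sq_def surj_def)
  then have "inj (\<lambda>x::'a. x * x)" by (simp add: finite_UNIV_surj_inj)
  then have "- 1 = (1::'a)" by (simp add: inj_def)
  then show False using not_neg_self[OF assms, of 1] by simp
qed

lemma card_field_ge2: "CARD('a::{field,finite}) \<ge> 2"
proof -
  have "card {0, 1::'a} \<le> CARD('a)" by (rule card_mono) auto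
  then show ?thesis by simp
qed

section \<open>The Minkowski planes \<open>CM(2,q,\<phi>)\<close>\<close>

text \<open>The determinant with columns \<open>u\<close> and \<open>v\<close>. It serves as the
  test for equality of points on the projective line and gets multiplied by \<open>det M\<close>
  under a matrix.\<close>

definition dt :: "'a::field ^ 2 \<Rightarrow> 'a ^ 2 \<Rightarrow> 'a" where
  "dt u v = u $ 1 * v $ 2 - u $ 2 * v $ 1"

definition semi :: "('a \<Rightarrow> 'a) \<Rightarrow> 'a ^ 2 \<Rightarrow> 'a ^ 2" where
  "semi \<sigma> v = (\<chi> i. \<sigma> (v $ i))"

lemma vec2_eq_iff: "(u :: 'a ^ 2) = v \<longleftrightarrow> u $ 1 = v $ 1 \<and> u $ 2 = v $ 2"
  by (simp add: vec_eq_iff forall_2)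

lemma dt_zero: "dt 0 v = 0" "dt u 0 = 0"
  by (simp_all add: dt_def)

lemma dt_nz: "dt u v \<noteq> 0 \<Longrightarrow> u \<noteq> 0 \<and> v \<noteq> 0"
  by (auto simp: dt_def)

lemma pt_eq_dt:
  assumes "u \<noteq> 0" "v \<noteq> 0"
  shows "pt u = pt v \<longleftrightarrow> dt u v = 0"
proof
  assume "pt u = pt v"
  then obtain k where "u = k *s v" using pt_eq_iff assms by blast
  then show "dt u v = 0" by (simp add: dt_def)
next
  assume d: "dt u v = 0"
  show "pt u = pt v"
  proof (cases "v $ 1 = 0")
    case True
    then have v2: "v $ 2 \<noteq> 0" using assms by (auto simp: vec2_eq_iff)
    then have "u = (u $ 2 / v $ 2) *s v" using d True by (simp add: vec2_eq_iff dt_def)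
    moreover from this have "u $ 2 / v $ 2 \<noteq> 0" using assms by auto
    ultimately show ?thesis using pt_eq_iff[OF assms(1)] by blast
  next
    case False
    then have "u = (u $ 1 / v $ 1) *s v" using d by (simp add: vec2_eq_iff dt_def field_simps)
    moreover from this have "u $ 1 / v $ 1 \<noteq> 0" using assms by auto
    ultimately show ?thesis using pt_eq_iff[OF assms(1)] by blast
  qed
qed

lemma dt_decomp:
  assumes "dt u v \<noteq> 0"
  shows "w = (dt w v / dt u v) *s u + (dt u w / dt u v) *s v"
proof -
  have "dt u v *s w = dt w v *s u + dt u w *s v"
    by (simp add: vec2_eq_iff dt_def algebra_simps)
  then have "inverse (dt u v) *s (dt u v *s w) = inverse (dt u v) *s (dt w v *s u + dt u w *s v)" by simp
  then show ?thesis using assms by (simp add: vec.scale_right_distrib divide_inverse mult.commute)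
qed

text \<open>Express a vector of \<open>z\<close> in the basis given by the other two points and
  absorb the coefficients into the basis; they are nonzero because the points are distinct.\<close>

lemma frame2:
  assumes "pg_point x" "pg_point y" "pg_point z" "x \<noteq> y" "x \<noteq> z" "y \<noteq> z"
  obtains u v :: "'a::field ^ 2" where "dt u v \<noteq> 0" "x = pt u" "y = pt v" "z = pt (u + v)"
proof -
  obtain u where u: "u \<noteq> 0" "x = pt u" by (rule pg_pointE[OF assms(1)])
  obtain v where v: "v \<noteq> 0" "y = pt v" by (rule pg_pointE[OF assms(2)])
  obtain w where w: "w \<noteq> 0" "z = pt w" by (rule pg_pointE[OF assms(3)])
  have d: "dt u v \<noteq> 0" "dt w v \<noteq> 0" "dt u w \<noteq> 0"
    using assms(4-6) pt_eq_dt[OF u(1) v(1)] pt_eq_dt[OF w(1) v(1)] pt_eq_dt[OF u(1) w(1)] u(2) v(2) w(2) by auto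
  define \<alpha> \<beta> where "\<alpha> = dt w v / dt u v" and "\<beta> = dt u w / dt u v"
  have ab: "\<alpha> \<noteq> 0" "\<beta> \<noteq> 0" using d by (auto simp: \<alpha>_def \<beta>_def)
  show thesis
  proof (rule that)
    show "dt (\<alpha> *s u) (\<beta> *s v) \<noteq> 0"
    proof -
      have "dt (\<alpha> *s u) (\<beta> *s v) = \<alpha> * \<beta> * dt u v" by (simp add: dt_def algebra_simps)
      then show ?thesis using ab d by simp
    qed
    have sc: "pt (k *s a) = pt a" if "k \<noteq> 0" "a \<noteq> 0" for k and a :: "'a ^ 2"
      using pt_eq_iff[of "k *s a" a] that by auto
    show "x = pt (\<alpha> *s u)" "y = pt (\<beta> *s v)"
      using sc ab u v by simp_all
    show "z = pt (\<alpha> *s u + \<beta> *s v)"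
      using dt_decomp[OF d(1), of w] w by (simp add: \<alpha>_def \<beta>_def)
  qed
qed

text \<open>The two vectors could be scaled independently, but the condition on their sum forces the
  scalars to agree.\<close>

lemma frame2_unique:
  assumes d: "dt u v \<noteq> 0" and "dt u' v' \<noteq> 0" "u' + v' \<noteq> 0"
    and "pt u' = pt u" "pt v' = pt v" "pt (u' + v') = pt (u + v)"
  obtains c where "c \<noteq> 0" "u' = c *s u" "v' = c *s v"
proof -
  have nz: "u' \<noteq> 0" "v' \<noteq> 0" using dt_nz assms by blast+
  obtain a where a: "u' = a *s u" using pt_eq_iff[OF nz(1)] assms by blast
  obtain b where b: "v' = b *s v" using pt_eq_iff[OF nz(2)] assms by blast
  obtain c where c: "c \<noteq> 0" "u' + v' = c *s (u + v)" using pt_eq_iff[OF assms(3)] assms by blast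
  have "a *s u + b *s v - (c *s u + c *s v) = 0" using a b c by (simp add: vec.scale_right_distrib)
  then have e: "(a - c) *s u + (b - c) *s v = 0" by (simp add: algebra_simps)
  have "(a - c) * dt u v = dt ((a - c) *s u + (b - c) *s v) v"
    "(b - c) * dt u v = dt u ((a - c) *s u + (b - c) *s v)" by (simp_all add: dt_def algebra_simps)
  then have "(a - c) * dt u v = 0" "(b - c) * dt u v = 0" unfolding e by (simp_all only: dt_zero)
  then have "a = c" "b = c" using d by simp_all
  then show thesis using that c a b by blast
qed

text \<open>The entries come from Cramer's rule for the basis \<open>a\<close>,
  \<open>b\<close>.\<close>

lemma matrix_ex:
  assumes "dt a b \<noteq> 0"
  obtains M :: "'a::field ^ 2 ^ 2" where "M *v a = w" "M *v b = z"
proof -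
  define k where "k = inverse (dt a b)"
  have k: "k * dt a b = 1" using assms by (simp add: k_def)
  define M :: "'a ^ 2 ^ 2" where "M = (\<chi> i j. k * (if j = 1 then w $ i * b $ 2 - z $ i * a $ 2
      else z $ i * a $ 1 - w $ i * b $ 1))"
  have "(M *v a) $ i = (k * dt a b) * w $ i" "(M *v b) $ i = (k * dt a b) * z $ i" for i
    by (simp_all add: M_def matrix_vector_mult_def sum_2 dt_def algebra_simps)
  then have "M *v a = w" "M *v b = z" by (simp_all add: k vec_eq_iff)
  then show thesis by (rule that)
qed

lemma dt_mult: "dt (M *v a) (M *v b) = det M * dt a b"
  by (simp add: dt_def det_2 matrix_vector_mult_def sum_2 algebra_simps)

locale field_aut =
  fixes \<sigma> :: "'a::{field,finite} \<Rightarrow> 'a"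
  assumes aut: "field_automorphism \<sigma>"
begin

lemma add: "\<sigma> (x + y) = \<sigma> x + \<sigma> y" and mult: "\<sigma> (x * y) = \<sigma> x * \<sigma> y" and bij: "bij \<sigma>"
  using aut by (auto simp: field_automorphism_def)

lemma zero: "\<sigma> 0 = 0"
  using add[of 0 0] by (metis add_cancel_left_right)

lemma nz_iff: "\<sigma> x = 0 \<longleftrightarrow> x = 0"
  using zero bij by (metis bij_def injD)

lemma one: "\<sigma> 1 = 1"
  using mult[of 1 1] nz_iff[of 1] by simp

lemma diff: "\<sigma> (x - y) = \<sigma> x - \<sigma> y"
  using add[of "x - y" y] by simp

lemma surjE: obtains y where "\<sigma> y = x"
  using bij by (metis bij_pointE)

lemma is_sq_iff: "is_sq (\<sigma> x) \<longleftrightarrow> is_sq x"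
proof
  assume "is_sq (\<sigma> x)"
  then obtain y where y: "\<sigma> x = y * y" by (auto simp: is_sq_def)
  obtain z where "\<sigma> z = y" by (rule surjE)
  then have "\<sigma> x = \<sigma> (z * z)" using y mult by simp
  then have "x = z * z" using bij by (metis bij_def injD)
  then show "is_sq x" by (auto simp: is_sq_def)
next
  assume "is_sq x"
  then show "is_sq (\<sigma> x)" using mult by (auto simp: is_sq_def)
qed

lemma semi_simps: "semi \<sigma> (u + v) = semi \<sigma> u + semi \<sigma> v" "semi \<sigma> (k *s v) = \<sigma> k *s semi \<sigma> v"
  by (simp_all add: semi_def vec2_eq_iff add mult)

lemma dt_semi: "dt (semi \<sigma> a) (semi \<sigma> b) = \<sigma> (dt a b)"
  by (simp add: dt_def semi_def mult diff)

lemma image_pt: "(\<lambda>v. M *v semi \<sigma> v) ` pt u = pt (M *v semi \<sigma> u)"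
proof -
  have "(\<lambda>v. M *v semi \<sigma> v) ` pt u = range (\<lambda>k. \<sigma> k *s (M *v semi \<sigma> u))"
    by (simp add: vec.span_singleton image_image semi_simps vector_scalar_commute[symmetric])
  also have "\<dots> = range (\<lambda>k. k *s (M *v semi \<sigma> u))"
  proof -
    have "range (\<lambda>k. \<sigma> k *s (M *v semi \<sigma> u)) = (\<lambda>k. k *s (M *v semi \<sigma> u)) ` range \<sigma>"
      by (simp only: image_image)
    moreover have "range \<sigma> = UNIV" using bij by (simp add: bij_def)
    ultimately show ?thesis by (simp only:)
  qed
  finally show ?thesis by (simp add: vec.span_singleton)
qed

lemma dt_image: "dt (M *v semi \<sigma> a) (M *v semi \<sigma> b) = det M * \<sigma> (dt a b)"
  by (simp add: dt_mult dt_semi)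

lemma image_nz: "det M \<noteq> 0 \<Longrightarrow> u \<noteq> 0 \<Longrightarrow> M *v semi \<sigma> u \<noteq> 0"
proof -
  assume "det M \<noteq> 0" "u \<noteq> 0"
  obtain w where "dt u w \<noteq> 0"
  proof (cases "u $ 1 = 0")
    case True
    then have "dt u (vector [1, 0]) \<noteq> 0" using \<open>u \<noteq> 0\<close> by (auto simp: dt_def vec2_eq_iff)
    then show ?thesis by (rule that)
  next
    case False
    then have "dt u (vector [0, 1]) \<noteq> 0" by (simp add: dt_def)
    then show ?thesis by (rule that)
  qed
  then have "dt (M *v semi \<sigma> u) (M *v semi \<sigma> w) \<noteq> 0" using \<open>det M \<noteq> 0\<close> by (simp add: dt_image nz_iff)
  then show "M *v semi \<sigma> u \<noteq> 0" using dt_nz by blast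
qed

end

lemma field_aut_id: "field_aut id"
  by (simp add: field_aut_def field_automorphism_def)

lemma det_mat2: "det (mat k :: 'a::field ^ 2 ^ 2) = k * k"
  by (simp add: det_2 mat_def)

text \<open>A scalar \<open>k\<close> multiplies the determinant of a 2 x 2 matrix by
  \<open>k * k\<close>, so only the square class of the determinant matters.\<close>

lemma represents_PSL_iff:
  assumes "det M \<noteq> (0::'a::field)"
  shows "represents_PSL M \<longleftrightarrow> is_sq (det M)"
proof
  assume "represents_PSL M"
  then obtain k N where "M = mat k ** N" "det N = 1" by (auto simp: represents_PSL_def)
  then have "det M = k * k" by (simp add: det_mul det_mat2)
  then show "is_sq (det M)" unfolding is_sq_def by blast
next
  assume "is_sq (det M)"
  then obtain k where k: "det M = k * k" unfolding is_sq_def by blast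
  then have k0: "k \<noteq> 0" using assms by auto
  have "det (mat (inverse k) ** M) = 1" using k k0 by (simp add: det_mul det_mat2 field_simps)
  moreover have "M = mat k ** (mat (inverse k) ** M)"
  proof -
    have "mat k ** mat (inverse k) = (mat 1 :: 'a ^ 2 ^ 2)"
      using k0 by (simp add: matrix_matrix_mult_def mat_def vec_eq_iff forall_2 sum_2)
    then show ?thesis by (simp add: matrix_mul_assoc)
  qed
  ultimately show "represents_PSL M" using k0 unfolding represents_PSL_def by blast
qed

lemma card_points2: "card {x :: ('a::{field,finite} ^ 2) set. pg_point x} = CARD('a) + 1"
proof -
  let ?f = "\<lambda>t. pt (vector [t, 1] :: 'a ^ 2)"
  have nz: "(vector [t, 1] :: 'a ^ 2) \<noteq> 0" "(vector [1, 0] :: 'a ^ 2) \<noteq> 0" for t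
    by (simp_all add: vec2_eq_iff)
  have "{x :: ('a ^ 2) set. pg_point x} = insert (pt (vector [1, 0])) (range ?f)"
  proof (intro subset_antisym subsetI)
    fix x assume "x \<in> {x :: ('a ^ 2) set. pg_point x}"
    then obtain v where v: "v \<noteq> 0" "x = pt v" by (auto elim: pg_pointE)
    show "x \<in> insert (pt (vector [1, 0])) (range ?f)"
    proof (cases "v $ 2 = 0")
      case True
      then have "pt v = pt (vector [1, 0])" using pt_eq_dt[OF v(1) nz(2)] by (simp add: dt_def)
      then show ?thesis using v by simp
    next
      case False
      then have "pt v = ?f (v $ 1 / v $ 2)" using pt_eq_dt[OF v(1) nz(1)] by (simp add: dt_def)
      then show ?thesis using v by blast
    qed
  qed (use pg_point_pt[OF nz(1)] pg_point_pt[OF nz(2)] in auto)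
  moreover have "inj ?f"
    by (rule injI) (simp add: pt_eq_dt[OF nz(1) nz(1)] dt_def)
  moreover have "pt (vector [1, 0]) \<notin> range ?f"
    using pt_eq_dt[OF nz(2) nz(1)] by (auto simp: dt_def)
  ultimately show ?thesis by (simp add: card_image)
qed

context field_aut
begin

text \<open>The automorphism that \<open>CM_map\<close> actually applies for \<open>M\<close>; with
  it both branches of \<open>CM_map\<close> become the single semilinear map
  \<open>im M\<close>.\<close>

definition twist :: "'a ^ 2 ^ 2 \<Rightarrow> 'a \<Rightarrow> 'a" where
  "twist M = (if is_sq (det M) then id else \<sigma>)"

lemma twist_aut: "field_aut (twist M)"
  by (simp add: twist_def field_aut_id field_aut_axioms)

abbreviation im :: "'a ^ 2 ^ 2 \<Rightarrow> 'a ^ 2 \<Rightarrow> 'a ^ 2" where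
  "im M v \<equiv> M *v semi (twist M) v"

lemma CM_map_pt:
  assumes "det M \<noteq> 0"
  shows "CM_map \<sigma> M (pt u) = pt (im M u)"
proof -
  interpret t: field_aut "twist M" by (rule twist_aut)
  have "CM_map \<sigma> M (pt u) = (\<lambda>v. im M v) ` pt u"
    by (simp add: CM_map_def twist_def represents_PSL_iff[OF assms] semi_def)
  then show ?thesis by (simp only: t.image_pt)
qed

lemma im_nz: "det M \<noteq> 0 \<Longrightarrow> u \<noteq> 0 \<Longrightarrow> im M u \<noteq> 0"
  by (rule field_aut.image_nz[OF twist_aut])

lemma dt_im: "dt (im M a) (im M b) = det M * twist M (dt a b)"
  by (rule field_aut.dt_image[OF twist_aut])

lemmas twist_nz = field_aut.nz_iff[OF twist_aut]

lemma im_simps: "im M (u + v) = im M u + im M v" "im M (k *s v) = twist M k *s im M v"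
  by (simp_all add: field_aut.semi_simps[OF twist_aut] matrix_vector_right_distrib vector_scalar_commute)

lemma CM_map_point:
  assumes "det M \<noteq> 0" "pg_point x"
  shows "pg_point (CM_map \<sigma> M x)"
  using assms by (elim pg_pointE) (simp add: CM_map_pt pg_point_pt im_nz)

lemma CM_map_inj:
  assumes "det M \<noteq> 0" "pg_point x" "pg_point y" "CM_map \<sigma> M x = CM_map \<sigma> M y"
  shows "x = y"
proof -
  obtain u where u: "u \<noteq> 0" "x = pt u" by (rule pg_pointE[OF assms(2)])
  obtain v where v: "v \<noteq> 0" "y = pt v" by (rule pg_pointE[OF assms(3)])
  have "dt (im M u) (im M v) = 0"
    using assms u v pt_eq_dt[OF im_nz im_nz] by (simp add: CM_map_pt)
  then have "dt u v = 0" using assms by (simp add: dt_im twist_nz)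
  then show ?thesis using pt_eq_dt[OF u(1) v(1)] u v by simp
qed

lemma CM_map_surj:
  assumes "det M \<noteq> 0" "pg_point y"
  obtains x where "pg_point x" "CM_map \<sigma> M x = y"
proof -
  have "CM_map \<sigma> M ` {x. pg_point x} = {x. pg_point x}"
    by (rule endo_inj_surj) (auto intro!: inj_onI CM_map_point assms(1) dest: CM_map_inj[OF assms(1)])
  then show thesis using that assms(2) by (metis (mono_tags, lifting) imageE mem_Collect_eq)
qed

definition gr :: "'a ^ 2 ^ 2 \<Rightarrow> (('a ^ 2) set \<times> ('a ^ 2) set) set" where
  "gr M = {(x, CM_map \<sigma> M x) | x. pg_point x}"

lemma gr_iff: "(x, y) \<in> gr M \<longleftrightarrow> pg_point x \<and> y = CM_map \<sigma> M x"
  by (auto simp: gr_def)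

lemma CM_circles_gr: "CM_circles \<sigma> = {gr M | M. det M \<noteq> 0}"
  by (simp add: CM_circles_def gr_def invertible_det_nz)

lemma frame_scale:
  assumes M: "det M \<noteq> 0" and d: "dt u v \<noteq> 0" "dt w z \<noteq> 0"
    and "CM_map \<sigma> M (pt u) = pt w" "CM_map \<sigma> M (pt v) = pt z" "CM_map \<sigma> M (pt (u + v)) = pt (w + z)"
  obtains c where "c \<noteq> 0" "im M u = c *s w" "im M v = c *s z"
proof (rule frame2_unique[of w z "im M u" "im M v"])
  have "dt u (u + v) \<noteq> 0" using d by (simp add: dt_def algebra_simps)
  then have "u + v \<noteq> 0" using dt_nz by blast
  then show "im M u + im M v \<noteq> 0" using im_nz[OF M] by (simp flip: im_simps)
  show "dt (im M u) (im M v) \<noteq> 0" using M d by (simp add: dt_im twist_nz)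
  show "pt (im M u + im M v) = pt (w + z)" using assms by (simp add: CM_map_pt im_simps)
qed (use assms in \<open>simp_all add: CM_map_pt\<close>)

lemma is_sq_twist: "x \<noteq> 0 \<Longrightarrow> is_sq (twist M x * x)"
  using is_sq_mult_iff[of "\<sigma> x" x] nz_iff is_sq_iff by (auto simp: twist_def is_sq_def)

text \<open>The square class of \<open>det M\<close> can be read off the images of a frame without
  knowing which automorphism was applied: \<sigma> preserves squares and nonsquares, so
  \<open>twist M (dt u v) * dt u v\<close> is a square in either case. This breaks the apparent
  circularity between the determinant and the automorphism.\<close>

lemma type_frame:
  assumes M: "det M \<noteq> 0" and d: "dt u v \<noteq> 0" "dt w z \<noteq> 0"
    and "CM_map \<sigma> M (pt u) = pt w" "CM_map \<sigma> M (pt v) = pt z" "CM_map \<sigma> M (pt (u + v)) = pt (w + z)"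
  shows "is_sq (det M) \<longleftrightarrow> is_sq (dt w z * dt u v)"
proof -
  obtain c where c: "c \<noteq> 0" "im M u = c *s w" "im M v = c *s z" by (rule frame_scale[OF assms])
  have "det M * twist M (dt u v) = c * c * dt w z"
    using dt_im[of M u v] c by (simp add: dt_def algebra_simps)
  then have "det M * (twist M (dt u v) * dt u v) = c * c * (dt w z * dt u v)"
    by (simp add: mult_ac)
  then have "is_sq (det M * (twist M (dt u v) * dt u v)) \<longleftrightarrow> is_sq (dt w z * dt u v)"
    by (simp only: is_sq_mult_sq[OF c(1)])
  then show ?thesis
    using is_sq_mult_iff[of "det M" "twist M (dt u v) * dt u v"] is_sq_twist[of "dt u v" M] M d twist_nz
    by simp
qed

text \<open>By \<open>type_frame\<close> both matrices apply the same automorphism, and two maps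
  semilinear for the same automorphism that agree on a frame differ by a scalar.\<close>

lemma CM_unique:
  assumes M: "det M \<noteq> 0" "det N \<noteq> 0" and d: "dt u v \<noteq> 0" "dt w z \<noteq> 0"
    and "CM_map \<sigma> M (pt u) = pt w" "CM_map \<sigma> M (pt v) = pt z" "CM_map \<sigma> M (pt (u + v)) = pt (w + z)"
    and "CM_map \<sigma> N (pt u) = pt w" "CM_map \<sigma> N (pt v) = pt z" "CM_map \<sigma> N (pt (u + v)) = pt (w + z)"
  shows "gr M = gr N"
proof -
  obtain c where c: "c \<noteq> 0" "im M u = c *s w" "im M v = c *s z" by (rule frame_scale[OF M(1) d assms(5-7)])
  obtain b where b: "b \<noteq> 0" "im N u = b *s w" "im N v = b *s z" by (rule frame_scale[OF M(2) d assms(8-10)])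
  have tw: "twist M = twist N"
    using type_frame[OF M(1) d assms(5-7)] type_frame[OF M(2) d assms(8-10)] by (simp add: twist_def)
  have "CM_map \<sigma> M x = CM_map \<sigma> N x" if x: "pg_point x" for x
  proof -
    obtain a where a: "a \<noteq> 0" "x = pt a" by (rule pg_pointE[OF x])
    obtain k l where kl: "a = k *s u + l *s v" using dt_decomp[OF d(1)] by blast
    have "im M a = c *s (twist M k *s w + twist M l *s z)"
      unfolding kl by (simp only: im_simps c) (simp add: vec.scale_right_distrib mult.commute)
    moreover have "im N a = b *s (twist M k *s w + twist M l *s z)"
      unfolding kl by (simp only: im_simps b) (simp add: vec.scale_right_distrib mult.commute tw)
    ultimately have "im M a = (c / b) *s im N a" using b(1) by simp
    then have "\<exists>k. k \<noteq> 0 \<and> im M a = k *s im N a" using c(1) b(1) by (intro exI[of _ "c / b"]) simp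
    then have "pt (im M a) = pt (im N a)"
      using pt_eq_iff[OF im_nz[OF M(1) a(1)]] by blast
    then show ?thesis using a M by (simp add: CM_map_pt)
  qed
  then show ?thesis unfolding gr_def by force
qed

text \<open>The automorphism is chosen beforehand, by the square class that
  \<open>type_frame\<close> predicts; the matrix solving the resulting linear equations then turns
  out to have this class.\<close>

lemma CM_ex:
  assumes d: "dt u v \<noteq> 0" "dt w z \<noteq> 0"
  obtains M where "det M \<noteq> 0" "CM_map \<sigma> M (pt u) = pt w" "CM_map \<sigma> M (pt v) = pt z"
    "CM_map \<sigma> M (pt (u + v)) = pt (w + z)"
proof -
  define \<tau> where "\<tau> = (if is_sq (dt w z * dt u v) then id else \<sigma>)"
  interpret t: field_aut \<tau> by (simp add: \<tau>_def field_aut_id field_aut_axioms)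
  have d': "dt (semi \<tau> u) (semi \<tau> v) \<noteq> 0" using d by (simp add: t.dt_semi t.nz_iff)
  obtain M where M: "M *v semi \<tau> u = w" "M *v semi \<tau> v = z" by (rule matrix_ex[OF d'])
  have dw: "dt w z = det M * \<tau> (dt u v)" using t.dt_image[of M u v] M by simp
  then have M0: "det M \<noteq> 0" using d by auto
  have "is_sq (\<tau> (dt u v) * dt u v)"
    using is_sq_mult_iff[of "\<tau> (dt u v)" "dt u v"] t.is_sq_iff t.nz_iff d by auto
  moreover have "dt w z * dt u v = det M * (\<tau> (dt u v) * dt u v)" using dw by (simp add: mult_ac)
  ultimately have "is_sq (dt w z * dt u v) \<longleftrightarrow> is_sq (det M)"
    using is_sq_mult_iff[of "det M" "\<tau> (dt u v) * dt u v"] M0 d t.nz_iff by (simp add: mult.assoc)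
  then have "twist M = \<tau>" by (simp add: twist_def \<tau>_def)
  then have e: "im M u = w" "im M v = z" using M by simp_all
  then have "im M (u + v) = w + z" by (simp only: im_simps)
  then show thesis
    using that[OF M0] e by (simp add: CM_map_pt[OF M0])
qed

lemma CM_circ3:
  assumes x: "pg_point x1" "pg_point x2" "pg_point x3" "x1 \<noteq> x2" "x1 \<noteq> x3" "x2 \<noteq> x3"
    and y: "pg_point y1" "pg_point y2" "pg_point y3" "y1 \<noteq> y2" "y1 \<noteq> y3" "y2 \<noteq> y3"
  shows "\<exists>!c. c \<in> CM_circles \<sigma> \<and> (x1, y1) \<in> c \<and> (x2, y2) \<in> c \<and> (x3, y3) \<in> c"
proof -
  obtain u v where u: "dt u v \<noteq> 0" "x1 = pt u" "x2 = pt v" "x3 = pt (u + v)" by (rule frame2[OF x])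
  obtain w z where w: "dt w z \<noteq> 0" "y1 = pt w" "y2 = pt z" "y3 = pt (w + z)" by (rule frame2[OF y])
  obtain M where M: "det M \<noteq> 0" "CM_map \<sigma> M (pt u) = pt w" "CM_map \<sigma> M (pt v) = pt z"
    "CM_map \<sigma> M (pt (u + v)) = pt (w + z)" by (rule CM_ex[OF u(1) w(1)])
  show ?thesis
  proof (rule ex1I)
    show "gr M \<in> CM_circles \<sigma> \<and> (x1, y1) \<in> gr M \<and> (x2, y2) \<in> gr M \<and> (x3, y3) \<in> gr M"
      using M u w x by (auto simp: CM_circles_gr gr_iff)
    fix c assume c: "c \<in> CM_circles \<sigma> \<and> (x1, y1) \<in> c \<and> (x2, y2) \<in> c \<and> (x3, y3) \<in> c"
    then obtain N where N: "det N \<noteq> 0" "c = gr N" by (auto simp: CM_circles_gr)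
    show "c = gr M"
      unfolding N(2) by (rule CM_unique[OF N(1) M(1) u(1) w(1)]) (use c N M u w in \<open>auto simp: gr_iff\<close>)
  qed
qed

text \<open>Different matrices may have the same graph; the square class of the determinant is
  nevertheless a property of the circle as a set of points.\<close>

lemma gr_type:
  assumes M: "det M \<noteq> 0" "det N \<noteq> 0" and eq: "gr M = gr N"
  shows "is_sq (det M) \<longleftrightarrow> is_sq (det N)"
proof -
  have M_N: "CM_map \<sigma> N x = CM_map \<sigma> M x" if "pg_point x" for x
    using that eq gr_iff[of x "CM_map \<sigma> M x"] by metis
  define u v :: "'a ^ 2" where "u = vector [1, 0]" and "v = vector [0, 1]"
  have d: "dt u v \<noteq> 0" by (simp add: u_def v_def dt_def)
  have d2: "dt u (u + v) \<noteq> 0" "dt v (u + v) \<noteq> 0" by (simp_all add: u_def v_def dt_def)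
  have nz: "u \<noteq> 0" "v \<noteq> 0" "u + v \<noteq> 0" using d d2 dt_nz by blast+
  have p: "pg_point (pt u)" "pg_point (pt v)" "pg_point (pt (u + v))" using nz pg_point_pt by blast+
  have "pt u \<noteq> pt v" "pt u \<noteq> pt (u + v)" "pt v \<noteq> pt (u + v)" using d d2 nz by (simp_all add: pt_eq_dt)
  then have ne: "CM_map \<sigma> M (pt u) \<noteq> CM_map \<sigma> M (pt v)" "CM_map \<sigma> M (pt u) \<noteq> CM_map \<sigma> M (pt (u + v))"
    "CM_map \<sigma> M (pt v) \<noteq> CM_map \<sigma> M (pt (u + v))"
    using CM_map_inj[OF M(1)] p by blast+
  obtain w z where w: "dt w z \<noteq> 0" "CM_map \<sigma> M (pt u) = pt w" "CM_map \<sigma> M (pt v) = pt z"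
    "CM_map \<sigma> M (pt (u + v)) = pt (w + z)"
    by (rule frame2[OF CM_map_point[OF M(1) p(1)] CM_map_point[OF M(1) p(2)] CM_map_point[OF M(1) p(3)] ne])
  show ?thesis
    using type_frame[OF M(1) d w(1) w(2-4)] type_frame[OF M(2) d w(1)] w(2-4) M_N p by simp
qed

text \<open>Circles of different types never touch. With \<open>x0 = pt u\<close>, all other points
  are \<open>pt (v + t *s u)\<close>, and the two images agree there iff
  \<open>\<alpha> * t - \<beta> * \<sigma> t\<close> takes a prescribed value. This additive map is
  injective, since a nonzero element of its kernel would make \<open>det N * det M\<close> a square;
  being injective on a finite field, it is onto.\<close>

lemma gr_second_point:
  assumes M: "det M \<noteq> 0" "det N \<noteq> 0" and ty: "is_sq (det M)" "\<not> is_sq (det N)"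
    and P: "(x0, y0) \<in> gr M" "(x0, y0) \<in> gr N"
  obtains x1 y1 where "(x1, y1) \<in> gr M" "(x1, y1) \<in> gr N" "x1 \<noteq> x0"
proof -
  have tw: "twist M = id" "twist N = \<sigma>" using ty by (auto simp: twist_def)
  have "pg_point x0" using P gr_iff by blast
  then obtain u where u: "u \<noteq> 0" "x0 = pt u" by (rule pg_pointE)
  have "pt (im N u) = pt (im M u)" using P u M by (simp add: gr_iff CM_map_pt)
  then obtain k where k: "k \<noteq> 0" "im N u = k *s im M u" using pt_eq_iff[OF im_nz[OF M(2) u(1)]] by blast
  obtain v where D: "dt u v \<noteq> 0"
  proof (cases "u $ 1 = 0")
    case True
    then have "dt u (vector [1, 0]) \<noteq> 0" using u by (auto simp: dt_def vec2_eq_iff)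
    then show ?thesis by (rule that)
  next
    case False
    then have "dt u (vector [0, 1]) \<noteq> 0" by (simp add: dt_def)
    then show ?thesis by (rule that)
  qed
  define \<alpha> \<beta> where "\<alpha> = det N * \<sigma> (dt u v)" and "\<beta> = k * k * (det M * dt u v)"
  have nz: "\<alpha> \<noteq> 0" "\<beta> \<noteq> 0" using M D k by (auto simp: \<alpha>_def \<beta>_def nz_iff)
  have e1: "k * dt (im M u) (im N v) = \<alpha>"
    using dt_im[of N u v] k tw by (simp add: \<alpha>_def dt_def algebra_simps)
  have e2: "dt (im M v) (im M u) = - (det M * dt u v)"
  proof -
    have "dt (im M v) (im M u) = - dt (im M u) (im M v)" by (simp add: dt_def)
    also have "dt (im M u) (im M v) = det M * dt u v" unfolding dt_im by (simp add: tw)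
    finally show ?thesis .
  qed
  have e0: "k * dt (im M (v + t *s u)) (im N (v + t *s u)) = k * dt (im M v) (im N v) + (\<alpha> * t - \<beta> * \<sigma> t)" for t
  proof -
    have "dt (im M (v + t *s u)) (im N (v + t *s u))
        = dt (im M v) (im N v) + \<sigma> t * k * dt (im M v) (im M u) + t * dt (im M u) (im N v)"
    proof -
      have t: "twist M t = t" "twist N t = \<sigma> t" using tw by simp_all
      have "im M (v + t *s u) = im M v + t *s im M u" by (simp only: im_simps t)
      moreover have "im N (v + t *s u) = im N v + (\<sigma> t * k) *s im M u"
        by (simp only: im_simps t k(2) vector_smult_assoc)
      ultimately show ?thesis by (simp only:) (simp add: dt_def algebra_simps)
    qed
    then have "k * dt (im M (v + t *s u)) (im N (v + t *s u))
        = k * dt (im M v) (im N v) + \<sigma> t * k * k * dt (im M v) (im M u) + t * (k * dt (im M u) (im N v))"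
      by (simp add: algebra_simps)
    then show ?thesis unfolding e1 e2 by (simp add: \<beta>_def algebra_simps)
  qed
  have "inj (\<lambda>t. \<alpha> * t - \<beta> * \<sigma> t)"
  proof (rule injI)
    fix s t assume st: "\<alpha> * s - \<beta> * \<sigma> s = \<alpha> * t - \<beta> * \<sigma> t"
    define x where "x = s - t"
    have x: "\<alpha> * x = \<beta> * \<sigma> x" using st by (simp add: x_def diff algebra_simps)
    show "s = t"
    proof (rule ccontr)
      assume "s \<noteq> t"
      then have x0: "x \<noteq> 0" by (simp add: x_def)
      have sqr: "is_sq (\<sigma> y * y)" if "y \<noteq> 0" for y
        using is_sq_mult_iff[of "\<sigma> y" y] nz_iff is_sq_iff that by simp
      have "(det N * det M) * ((\<sigma> (dt u v) * dt u v) * (\<sigma> x * x)) = (\<alpha> * x) * (det M * dt u v * \<sigma> x)"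
        by (simp add: \<alpha>_def mult_ac)
      also have "\<dots> = (k * (det M * dt u v * \<sigma> x)) * (k * (det M * dt u v * \<sigma> x))"
        unfolding x by (simp add: \<beta>_def mult_ac)
      finally have "is_sq ((det N * det M) * ((\<sigma> (dt u v) * dt u v) * (\<sigma> x * x)))"
        unfolding is_sq_def by blast
      then have "is_sq (det N * det M)"
        using is_sq_mult_iff[of "det N * det M" "(\<sigma> (dt u v) * dt u v) * (\<sigma> x * x)"]
          is_sq_mult[OF sqr[OF D] sqr[OF x0]] M D x0 nz_iff by simp
      then show False using is_sq_mult_iff[OF M(2) M(1)] ty by blast
    qed
  qed
  then have "surj (\<lambda>t. \<alpha> * t - \<beta> * \<sigma> t)" by (simp add: finite_UNIV_inj_surj)
  then obtain t where t: "- (k * dt (im M v) (im N v)) = \<alpha> * t - \<beta> * \<sigma> t" unfolding surj_def by blast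
  define a where "a = v + t *s u"
  have "dt u a \<noteq> 0" using D by (simp add: a_def dt_def algebra_simps)
  then have a: "a \<noteq> 0" "pt u \<noteq> pt a" using dt_nz pt_eq_dt[OF u(1)] by blast+
  have "dt (im M a) (im N a) = 0" using e0[of t] t[symmetric] k by (simp add: a_def)
  then have "CM_map \<sigma> M (pt a) = CM_map \<sigma> N (pt a)"
    using pt_eq_dt[OF im_nz[OF M(1) a(1)] im_nz[OF M(2) a(1)]] M by (simp add: CM_map_pt)
  then show thesis
    using that[of "pt a" "CM_map \<sigma> M (pt a)"] a u pg_point_pt[OF a(1)] by (simp add: gr_iff)
qed

abbreviation cm_np :: "('a ^ 2) set \<times> ('a ^ 2) set \<Rightarrow> ('a ^ 2) set \<times> ('a ^ 2) set \<Rightarrow> bool" where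
  "cm_np p p' \<equiv> fst p \<noteq> fst p' \<and> snd p \<noteq> snd p'"

lemma card_gr:
  assumes "det M \<noteq> 0"
  shows "card (gr M) = CARD('a) + 1"
proof -
  have "gr M = (\<lambda>x. (x, CM_map \<sigma> M x)) ` {x. pg_point x}" by (auto simp: gr_def)
  then show ?thesis by (simp add: card_image inj_on_def card_points2)
qed

text \<open>Here K = q + 1, r = q - 1, e = 1 and \<rho> = 2: a point off a circle is parallel to
  exactly two of its points, one for each coordinate.\<close>

lemma CM_plane:
  "circle_plane (CM_points :: (('a ^ 2) set \<times> ('a ^ 2) set) set) (CM_circles \<sigma>) cm_np
     CARD('a) (CARD('a) + 1) (CARD('a) - 1) 1 2"
proof
  let ?P = "{x :: ('a ^ 2) set. pg_point x}"
  show q2: "2 \<le> CARD('a)" by (rule card_field_ge2)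
  then show "CARD('a) - 1 + 2 = CARD('a) + 1" by simp
  show "(1::nat) = 0 \<Longrightarrow> CARD('a) - 1 = CARD('a)" by simp
  show "c \<subseteq> CM_points" if "c \<in> CM_circles \<sigma>" for c
    using that CM_map_point by (auto simp: CM_circles_gr CM_points_def gr_def)
  show "card c = CARD('a) + 1" if "c \<in> CM_circles \<sigma>" for c
    using that card_gr by (auto simp: CM_circles_gr)
  show "cm_np x y" if "c \<in> CM_circles \<sigma>" "x \<in> c" "y \<in> c" "x \<noteq> y" for c x y
    using that by (auto simp: CM_circles_gr gr_def dest: CM_map_inj)
  show "\<exists>!c. c \<in> CM_circles \<sigma> \<and> x \<in> c \<and> y \<in> c \<and> z \<in> c"
    if "x \<in> CM_points" "y \<in> CM_points" "z \<in> CM_points" "cm_np x y" "cm_np x z" "cm_np y z" for x y z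
  proof -
    have "\<exists>!c. c \<in> CM_circles \<sigma> \<and> (fst x, snd x) \<in> c \<and> (fst y, snd y) \<in> c \<and> (fst z, snd z) \<in> c"
      by (rule CM_circ3) (use that in \<open>simp_all add: CM_points_def mem_Times_iff\<close>)
    then show ?thesis by (simp only: prod.collapse)
  qed
  show "card {y \<in> c. cm_np x y} + 2 = CARD('a) + 1"
    if c: "c \<in> CM_circles \<sigma>" and x: "x \<in> CM_points" "x \<notin> c" for c x
  proof -
    obtain M where M: "det M \<noteq> 0" "c = gr M" using c by (auto simp: CM_circles_gr)
    have p: "pg_point (fst x)" "pg_point (snd x)" using x by (auto simp: CM_points_def)
    obtain x' where x': "pg_point x'" "CM_map \<sigma> M x' = snd x" by (rule CM_map_surj[OF M(1) p(2)])
    have ne: "x' \<noteq> fst x" using x x' M gr_iff[of "fst x" "snd x" M] by auto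
    have "{y \<in> c. cm_np x y} = c - {(fst x, CM_map \<sigma> M (fst x)), (x', snd x)}"
    proof -
      have inj: "a = x'" if "pg_point a" "CM_map \<sigma> M a = snd x" for a
        using CM_map_inj[OF M(1) that(1) x'(1)] that x' by simp
      show ?thesis
      proof (intro set_eqI iffI)
        fix p assume "p \<in> {y \<in> c. cm_np x y}"
        then show "p \<in> c - {(fst x, CM_map \<sigma> M (fst x)), (x', snd x)}" by auto
      next
        fix p assume p: "p \<in> c - {(fst x, CM_map \<sigma> M (fst x)), (x', snd x)}"
        then obtain a where a: "pg_point a" "p = (a, CM_map \<sigma> M a)" using M(2) unfolding gr_def by blast
        have "a \<noteq> fst x" using p a(2) by blast
        moreover have "CM_map \<sigma> M a \<noteq> snd x"
        proof
          assume e: "CM_map \<sigma> M a = snd x"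
          then have "p = (x', snd x)" using inj[OF a(1)] a(2) by simp
          then show False using p by blast
        qed
        ultimately have "fst x \<noteq> fst p" "snd x \<noteq> snd p" unfolding a(2) by auto
        then show "p \<in> {y \<in> c. cm_np x y}" using p by blast
      qed
    qed
    moreover have "{(fst x, CM_map \<sigma> M (fst x)), (x', snd x)} \<subseteq> c" using M p x' by (auto simp: gr_iff)
    moreover have "card {(fst x, CM_map \<sigma> M (fst x)), (x', snd x)} = 2" using ne by simp
    ultimately have "card {y \<in> c. cm_np x y} = card c - 2"
      by (simp only: card_Diff_subset finite.emptyI finite.insertI)
    then show ?thesis using card_gr[OF M(1)] M(2) q2 by simp
  qed
  show "card {y \<in> CM_points. cm_np x y} = CARD('a) * (CARD('a) + 1 - 1)" if x: "x \<in> CM_points" for x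
  proof -
    have "{y \<in> CM_points. cm_np x y} = (?P - {fst x}) \<times> (?P - {snd x})"
      by (auto simp: CM_points_def)
    then show ?thesis using x by (simp add: card_cartesian_product card_Diff_singleton card_points2 CM_points_def mem_Times_iff)
  qed
  show "card {z \<in> CM_points. cm_np x z \<and> cm_np y z} = (CARD('a) - 1) * (CARD('a) + 1 - 2)"
    if "x \<in> CM_points" "y \<in> CM_points" "cm_np x y" for x y
  proof -
    have "{z \<in> CM_points. cm_np x z \<and> cm_np y z} = (?P - {fst x, fst y}) \<times> (?P - {snd x, snd y})"
      unfolding CM_points_def by (intro set_eqI) (auto simp only: mem_Collect_eq mem_Times_iff Diff_iff insert_iff empty_iff)
    moreover have c2: "card (?P - {a, b}) = CARD('a) - 1" if "a \<in> ?P" "b \<in> ?P" "a \<noteq> b" for a b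
    proof -
      have "card (?P - {a, b}) = card ?P - card {a, b}" by (rule card_Diff_subset) (use that in auto)
      then show ?thesis using that by (simp add: card_points2)
    qed
    have "card (?P - {fst x, fst y}) = CARD('a) - 1" "card (?P - {snd x, snd y}) = CARD('a) - 1"
      by (rule c2; use that in \<open>simp add: CM_points_def mem_Times_iff\<close>)+
    ultimately show ?thesis by (simp add: card_cartesian_product)
  qed
qed auto

text \<open>For even \<open>q\<close> the number r = q - 1 is odd and parity suffices. For odd
  \<open>q\<close> the types are the square classes of the determinants, which
  \<open>gr_second_point\<close> keeps apart.\<close>

theorem CM_common_point:
  assumes F: "intersecting_family (CM_circles \<sigma>) F"
    and size: "real (card F) \<ge> 1 / sqrt 2 * real CARD('a) ^ 2 + 2 * sqrt 2 * real CARD('a) + 8"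
  shows "\<exists>P\<in>CM_points. \<forall>c\<in>F. P \<in> c"
proof -
  interpret circle_plane "CM_points :: (('a ^ 2) set \<times> ('a ^ 2) set) set" "CM_circles \<sigma>" cm_np
     "CARD('a)" "CARD('a) + 1" "CARD('a) - 1" 1 2 by (rule CM_plane)
  define ty where "ty c \<longleftrightarrow> (\<exists>M. det M \<noteq> 0 \<and> is_sq (det M) \<and> c = gr M)" for c
  have ty: "ty (gr M) \<longleftrightarrow> is_sq (det M)" if "det M \<noteq> 0" for M
    using gr_type that unfolding ty_def by metis
  have "odd (CARD('a) - 1) \<or> odd CARD('a) \<and> even (2::nat) \<and> two_types ty"
  proof (cases "odd CARD('a)")
    case False
    then show ?thesis using card_field_ge2[where 'a='a] by auto
  next
    case True
    have no: False if c: "c = gr M" "d = gr N" "det M \<noteq> 0" "det N \<noteq> 0" "is_sq (det M)" "\<not> is_sq (det N)"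
      and t: "touching c d" for c d M N
    proof -
      obtain p where p: "gr M \<inter> gr N = {p}" using t c by (auto elim: touchingE)
      obtain x0 y0 where xy: "p = (x0, y0)" by fastforce
      have "(x0, y0) \<in> gr M" "(x0, y0) \<in> gr N" using p xy by blast+
      then obtain x1 y1 where "(x1, y1) \<in> gr M" "(x1, y1) \<in> gr N" "x1 \<noteq> x0"
        by (rule gr_second_point[OF c(3-6)])
      then have "(x1, y1) \<in> {p}" using p by blast
      then show False using xy \<open>x1 \<noteq> x0\<close> by simp
    qed
    have "ty c = ty d" if cd: "c \<in> CM_circles \<sigma>" "d \<in> CM_circles \<sigma>" "touching c d" for c d
    proof -
      obtain M where M: "det M \<noteq> 0" "c = gr M" using cd by (auto simp: CM_circles_gr)
      obtain N where N: "det N \<noteq> 0" "d = gr N" using cd by (auto simp: CM_circles_gr)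
      have "touching d c" using cd touching_sym by blast
      then have "is_sq (det M) = is_sq (det N)"
        using no[OF M(2) N(2) M(1) N(1)] no[OF N(2) M(2) N(1) M(1)] cd by blast
      then show ?thesis using ty M N by simp
    qed
    moreover have "\<exists>c\<in>CM_circles \<sigma>. ty c"
    proof -
      have "det (mat 1 :: 'a ^ 2 ^ 2) = 1" by simp
      moreover have "is_sq (1::'a)" unfolding is_sq_def by (rule exI[of _ 1]) simp
      ultimately have "ty (gr (mat 1))" using ty[of "mat 1"] by simp
      moreover have "gr (mat 1) \<in> CM_circles \<sigma>" by (auto simp: CM_circles_gr intro!: exI[of _ "mat 1"])
      ultimately show ?thesis by blast
    qed
    moreover have "\<exists>c\<in>CM_circles \<sigma>. \<not> ty c"
    proof -
      obtain \<nu> :: 'a where \<nu>: "\<not> is_sq \<nu>" using ex_nonsq[OF True] by blast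
      define M :: "'a ^ 2 ^ 2" where "M = vector [vector [\<nu>, 0], vector [0, 1]]"
      have "det M = \<nu>" by (simp add: M_def det_2)
      moreover have "\<nu> \<noteq> 0" using \<nu> by (auto simp: is_sq_def)
      ultimately have "\<not> ty (gr M)" "gr M \<in> CM_circles \<sigma>" using ty[of M] \<nu> by (auto simp: CM_circles_gr)
      then show ?thesis by blast
    qed
    ultimately show ?thesis using True by (auto simp: two_types_def)
  qed
  then show ?thesis
    using common_point[of ty F] F size by (auto simp: intersecting_family_def)
qed

end

section \<open>Lines and planes\<close>

definition dotp :: "'a::field ^ 'n \<Rightarrow> 'a ^ 'n \<Rightarrow> 'a" where
  "dotp n v = (\<Sum>i\<in>UNIV. n $ i * v $ i)"

lemma dotp_simps:
  "dotp n (u + v) = dotp n u + dotp n v" "dotp n (k *s v) = k * dotp n v" "dotp n 0 = 0"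
  "dotp (u + v) n = dotp u n + dotp v n" "dotp (k *s v) n = k * dotp v n" "dotp 0 n = 0"
  by (simp_all add: dotp_def sum.distrib distrib_left distrib_right sum_distrib_left mult.left_commute mult.assoc)

lemma dotp_diff: "dotp n (u - v) = dotp n u - dotp n v" "dotp (u - v) n = dotp u n - dotp v n"
  by (simp_all add: dotp_def sum_subtractf left_diff_distrib right_diff_distrib)

lemma subspace_kernel: "vec.subspace {v. dotp n v = 0}"
  by (rule vec.subspaceI) (simp_all add: dotp_simps)

lemma in_span2: "x \<in> vec.span {u, v} \<longleftrightarrow> (\<exists>a b. x = a *s u + b *s v)"
proof -
  have "x \<in> vec.span {u, v} \<longleftrightarrow> (\<exists>a. x - a *s u \<in> pt v)" by (rule vec.span_breakdown_eq)
  also have "\<dots> \<longleftrightarrow> (\<exists>a b. x - a *s u = b *s v)" by (auto simp: vec.span_singleton)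
  also have "\<dots> \<longleftrightarrow> (\<exists>a b. x = a *s u + b *s v)" by (simp add: diff_eq_eq add.commute)
  finally show ?thesis .
qed

lemma in_span3: "x \<in> vec.span {u, v, w} \<longleftrightarrow> (\<exists>a b c. x = a *s u + b *s v + c *s w)"
proof -
  have "x \<in> vec.span {u, v, w} \<longleftrightarrow> (\<exists>a. x - a *s u \<in> vec.span {v, w})" by (rule vec.span_breakdown_eq)
  also have "\<dots> \<longleftrightarrow> (\<exists>a b c. x = a *s u + (b *s v + c *s w))" by (simp add: in_span2 diff_eq_eq add.commute)
  finally show ?thesis by (simp add: add.assoc)
qed

lemma in_pt: "x \<in> pt u \<longleftrightarrow> (\<exists>k. x = k *s u)"
  by (auto simp: vec.span_singleton)

lemma span_eqI:
  assumes "vec.subspace S" "B \<subseteq> S" "vec.independent B" "card B = vec.dim S"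
  shows "S = vec.span B"
proof
  show "S \<subseteq> vec.span B"
    by (rule vec.card_ge_dim_independent) (use assms in auto)
  show "vec.span B \<subseteq> S" using assms vec.span_minimal by blast
qed

lemma indep2:
  assumes "u \<noteq> 0" "v \<notin> pt u"
  shows "vec.independent {v, u}" "card {v, u} = 2"
proof -
  have "v \<noteq> u" using assms vec.span_base by blast
  then show "vec.independent {v, u}" "card {v, u} = 2"
    using assms by (simp_all add: vec.independent_insert)
qed

lemma indep3:
  assumes "u \<noteq> 0" "v \<notin> pt u" "w \<notin> vec.span {v, u}"
  shows "vec.independent {w, v, u}" "card {w, v, u} = 3"
proof -
  have "w \<notin> {v, u}" using assms vec.span_base by blast
  then show "vec.independent {w, v, u}" "card {w, v, u} = 3"
    using assms indep2[OF assms(1,2)] by (simp_all add: vec.independent_insert)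
qed

lemma pg_line_span:
  assumes "u \<noteq> 0" "v \<notin> pt u"
  shows "pg_line (vec.span {v, u})"
  using indep2[OF assms] vec.dim_span_eq_card_independent by (metis pg_line_def vec.subspace_span)

lemma pg_line_eq:
  assumes "pg_line l" "u \<in> l" "v \<in> l" "u \<noteq> 0" "v \<notin> pt u"
  shows "l = vec.span {v, u}"
  by (rule span_eqI) (use assms indep2[OF assms(4,5)] in \<open>auto simp: pg_line_def\<close>)

lemma pg_plane_span:
  assumes "u \<noteq> 0" "v \<notin> pt u" "w \<notin> vec.span {v, u}"
  shows "pg_plane (vec.span {w, v, u})"
  using indep3[OF assms] vec.dim_span_eq_card_independent by (metis pg_plane_def vec.subspace_span)

lemma pg_plane_eq:
  assumes "pg_plane l" "u \<in> l" "v \<in> l" "w \<in> l" "u \<noteq> 0" "v \<notin> pt u" "w \<notin> vec.span {v, u}"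
  shows "l = vec.span {w, v, u}"
  by (rule span_eqI) (use assms indep3[OF assms(5-7)] in \<open>auto simp: pg_plane_def\<close>)

text \<open>Extend a basis of the plane by one vector \<open>v\<close> and take the functional that
  is 0 on the plane and 1 on \<open>v\<close>. It is obtained as the first coordinate of a linear
  map \<open>g\<close>, hence as a row of the matrix of \<open>g\<close>.\<close>

lemma plane_kernel:
  fixes \<pi> :: "('a::field ^ 4) set"
  assumes "pg_plane \<pi>"
  obtains n where "\<pi> = {v. dotp n v = 0}"
proof -
  have P: "vec.subspace \<pi>" "vec.dim \<pi> = 3" using assms by (auto simp: pg_plane_def)
  obtain B where B: "B \<subseteq> \<pi>" "vec.independent B" "\<pi> \<subseteq> vec.span B" "card B = vec.dim \<pi>"
    by (rule vec.basis_exists)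
  have sB: "vec.span B = \<pi>" using B P vec.span_minimal by blast
  have "\<pi> \<noteq> UNIV"
  proof
    assume "\<pi> = UNIV"
    then have "vec.dim \<pi> = CARD(4)" using vec_dim_card by metis
    then show False using P by simp
  qed
  then obtain v where v: "v \<notin> \<pi>" by blast
  have ind: "vec.independent (insert v B)" using B v sB by (simp add: vec.independent_insert)
  have finB: "finite B" using B P by (intro card_ge_0_finite) simp
  have "card (insert v B) = 4" using v B P finB by (subst card_insert_disjoint) auto
  then have sp: "vec.span (insert v B) = UNIV"
    using vec.card_ge_dim_independent[of "insert v B" UNIV] ind vec_dim_card[where 'n=4 and 'a='a] by auto
  obtain g :: "'a ^ 4 \<Rightarrow> 'a ^ 4" where g: "Vector_Spaces.linear (*s) (*s) g"
    "\<forall>x\<in>insert v B. g x = (if x = v then axis 1 1 else 0)"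
    using vec.linear_independent_extend[OF ind, of "\<lambda>x. if x = v then axis 1 1 else 0"] by blast
  define n where "n = matrix g $ 1"
  have n: "dotp n x = g x $ 1" for x
  proof -
    have "g x = matrix g *v x" using g(1) by (simp add: matrix_works)
    then show ?thesis by (simp add: n_def dotp_def matrix_vector_mult_def)
  qed
  have nB: "dotp n x = 0" if "x \<in> B" for x using g(2) that v B by (auto simp: n)
  have nv: "dotp n v = 1" using g(2) by (simp add: n axis_def)
  have sub: "\<pi> \<subseteq> {x. dotp n x = 0}"
    unfolding sB[symmetric] by (rule vec.span_minimal[OF _ subspace_kernel]) (use nB in blast)
  have "{x. dotp n x = 0} \<subseteq> \<pi>"
  proof
    fix x assume x: "x \<in> {x. dotp n x = 0}"
    obtain k where k: "x - k *s v \<in> \<pi>" using sp vec.span_breakdown_eq[of x v B] sB by auto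
    then have "dotp n (x - k *s v) = 0" using sub by blast
    then have "k = 0" using x nv by (simp add: dotp_diff dotp_simps)
    then show "x \<in> \<pi>" using k by simp
  qed
  then show thesis using that sub by blast
qed

section \<open>Hyperbolic quadrics\<close>

text \<open>The Segre embedding of PG(1,q) x PG(1,q), with signs arranged to satisfy the equation x1
  x2 + x3 x4 = 0.\<close>

definition segre :: "'a::field ^ 2 \<Rightarrow> 'a ^ 2 \<Rightarrow> 'a ^ 4" where
  "segre a b = (\<chi> i. if i = 1 then a $ 1 * b $ 1 else if i = 2 then a $ 2 * b $ 2
     else if i = 3 then a $ 1 * b $ 2 else - (a $ 2 * b $ 1))"

lemma vec4_eq_iff: "(u :: 'a ^ 4) = v \<longleftrightarrow> u $ 1 = v $ 1 \<and> u $ 2 = v $ 2 \<and> u $ 3 = v $ 3 \<and> u $ 4 = v $ 4"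
  by (simp add: vec_eq_iff forall_4)

lemma segre_nth [simp]:
  "segre a b $ 1 = a $ 1 * b $ 1" "segre a b $ 2 = a $ 2 * b $ 2"
  "segre a b $ 3 = a $ 1 * b $ 2" "segre a b $ 4 = - (a $ 2 * b $ 1)"
  by (simp_all add: segre_def)

lemma segre_scale: "segre (k *s a) (l *s b) = (k * l) *s segre a b"
  by (simp add: vec4_eq_iff algebra_simps)

lemma segre_add: "segre a (b + b') = segre a b + segre a b'"
  by (simp add: vec4_eq_iff algebra_simps)

lemma segre_nz: "a \<noteq> 0 \<Longrightarrow> b \<noteq> 0 \<Longrightarrow> segre a b \<noteq> 0"
  by (auto simp: vec4_eq_iff vec2_eq_iff)

text \<open>The equation says that the matrix with rows (x1, x3) and (-x4, x2) is singular, so that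
  it is an outer product of two vectors.\<close>

lemma segre_surj:
  fixes x :: "'a::field ^ 4"
  assumes "x \<noteq> 0" "x $ 1 * x $ 2 + x $ 3 * x $ 4 = 0"
  obtains a b where "a \<noteq> 0" "b \<noteq> 0" "x = segre a b"
proof -
  have "\<exists>a b. x = segre a b"
  proof -
    consider "x $ 1 \<noteq> 0" | "x $ 1 = 0" "x $ 3 \<noteq> 0" "x $ 4 = 0" | "x $ 1 = 0" "x $ 3 = 0"
      using assms(2) by force
    then show ?thesis
    proof cases
      case 1
      then have "x $ 2 = - (x $ 3 * x $ 4) / x $ 1" using assms(2) by (simp add: field_simps eq_neg_iff_add_eq_0)
      then have "x = segre (vector [x $ 1, - x $ 4]) (vector [1, x $ 3 / x $ 1])"
        using 1 by (simp add: vec4_eq_iff)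
      then show ?thesis by blast
    next
      case 2
      then have "x = segre (vector [x $ 3, x $ 2]) (vector [0, 1])" by (simp add: vec4_eq_iff)
      then show ?thesis by blast
    next
      case 3
      then have "x = segre (vector [0, 1]) (vector [- x $ 4, x $ 2])" by (simp add: vec4_eq_iff)
      then show ?thesis by blast
    qed
  qed
  then obtain a b where x: "x = segre a b" by blast
  then have "a \<noteq> 0" "b \<noteq> 0" using assms(1) by (auto simp: vec4_eq_iff)
  then show thesis using that x by blast
qed

definition rep :: "('a::field ^ 'n) set \<Rightarrow> 'a ^ 'n" where
  "rep P = (SOME v. v \<noteq> 0 \<and> P = pt v)"

lemma rep:
  assumes "pg_point P"
  shows "rep P \<noteq> 0" "P = pt (rep P)"
proof -
  have "\<exists>v. v \<noteq> 0 \<and> P = pt v" using assms by (elim pg_pointE) blast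
  then have "rep P \<noteq> 0 \<and> P = pt (rep P)" unfolding rep_def by (rule someI_ex)
  then show "rep P \<noteq> 0" "P = pt (rep P)" by auto
qed

lemma dotp_matrix: "dotp n (B *v s) = dotp (n v* B) (s :: 'a::field ^ 4)"
proof -
  have "dotp n (B *v s) = (\<Sum>i\<in>UNIV. \<Sum>j\<in>UNIV. n $ i * (B $ i $ j * s $ j))"
    by (simp add: dotp_def matrix_vector_mult_def sum_distrib_left)
  also have "\<dots> = (\<Sum>j\<in>UNIV. \<Sum>i\<in>UNIV. n $ i * (B $ i $ j * s $ j))" by (rule sum.swap)
  also have "\<dots> = dotp (n v* B) s"
    by (simp add: dotp_def vector_matrix_mult_def sum_distrib_left sum_distrib_right mult_ac)
  finally show ?thesis .
qed

text \<open>The Segre map identifies the quadric with the points of CM(2,q,id). A plane pulls back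
  to a bilinear equation \<open>dt (M *v a) b = 0\<close>, which describes the graph of
  \<open>M\<close> when \<open>M\<close> is invertible. The family is thereby transferred, with its
  size and intersections.\<close>

theorem hyperbolic_common_point:
  fixes S :: "('a::{field,finite} ^ 4) set set"
  assumes S: "hyperbolic_quadric S" and F: "intersecting_family (ovoidal_circles S) F"
    and size: "real (card F) \<ge> 1 / sqrt 2 * real CARD('a) ^ 2 + 2 * sqrt 2 * real CARD('a) + 8"
  shows "\<exists>P\<in>S. \<forall>c\<in>F. P \<in> c"
proof -
  interpret i: field_aut "id :: 'a \<Rightarrow> 'a" by (rule field_aut_id)
  obtain A :: "'a ^ 4 ^ 4" where A: "invertible A" and S_eq: "S = {P. pg_point P \<and>
      (\<forall>v\<in>P. (A *v v) $ 1 * (A *v v) $ 2 + (A *v v) $ 3 * (A *v v) $ 4 = 0)}"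
    using S by (auto simp: hyperbolic_quadric_def)
  obtain B where B: "A ** B = mat 1" "B ** A = mat 1" using A by (auto simp: invertible_def)
  have AB: "A *v (B *v v) = v" "B *v (A *v v) = v" for v
    using B by (simp_all add: matrix_vector_mul_assoc)
  define \<Phi> where "\<Phi> a b = B *v segre a b" for a b
  have \<Phi>_nz: "\<Phi> a b \<noteq> 0" if "a \<noteq> 0" "b \<noteq> 0" for a b
    using segre_nz[OF that] AB(1)[of "segre a b"] by (auto simp: \<Phi>_def)
  have \<Phi>S: "pt (\<Phi> a b) \<in> S" if "a \<noteq> 0" "b \<noteq> 0" for a b
  proof -
    have "A *v (k *s \<Phi> a b) = k *s segre a b" for k
      by (simp add: \<Phi>_def AB flip: vector_scalar_commute)
    then show ?thesis
      using \<Phi>_nz[OF that] pg_point_pt by (auto simp: S_eq in_pt algebra_simps)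
  qed
  have surj: "\<exists>a b. a \<noteq> 0 \<and> b \<noteq> 0 \<and> P = pt (\<Phi> a b)" if P: "P \<in> S" for P
  proof -
    have "pg_point P" using P by (simp add: S_eq)
    then obtain v where v: "v \<noteq> 0" "P = pt v" by (rule pg_pointE)
    have "v \<in> P" using v vec.span_base[of v "{v}"] by simp
    then have "(A *v v) $ 1 * (A *v v) $ 2 + (A *v v) $ 3 * (A *v v) $ 4 = 0" using P by (simp add: S_eq)
    moreover have "A *v v \<noteq> 0" using v AB(2)[of v] by auto
    ultimately obtain a b where "a \<noteq> 0" "b \<noteq> 0" "A *v v = segre a b" using segre_surj by blast
    then show ?thesis using v AB(2)[of v] by (auto simp: \<Phi>_def)
  qed
  define \<Psi> where "\<Psi> p = pt (\<Phi> (rep (fst p)) (rep (snd p)))" for p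
  have \<Psi>_pt: "\<Psi> (pt a, pt b) = pt (\<Phi> a b)" if "a \<noteq> 0" "b \<noteq> 0" for a b
  proof -
    have r: "rep (pt a) \<noteq> 0" "pt a = pt (rep (pt a))" "rep (pt b) \<noteq> 0" "pt b = pt (rep (pt b))"
      using rep[OF pg_point_pt[OF that(1)]] rep[OF pg_point_pt[OF that(2)]] by auto
    obtain k where k: "k \<noteq> 0" "rep (pt a) = k *s a" using pt_eq_iff[OF r(1), of a] r(2) by metis
    obtain l where l: "l \<noteq> 0" "rep (pt b) = l *s b" using pt_eq_iff[OF r(3), of b] r(4) by metis
    have "\<Phi> (rep (pt a)) (rep (pt b)) = (k * l) *s \<Phi> a b"
      unfolding k l segre_scale \<Phi>_def by (simp only: vector_scalar_commute)
    moreover from this have "\<Phi> (rep (pt a)) (rep (pt b)) \<noteq> 0" using k l \<Phi>_nz[OF that] by simp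
    ultimately have "pt (\<Phi> (rep (pt a)) (rep (pt b))) = pt (\<Phi> a b)"
      using pt_eq_iff[of "\<Phi> (rep (pt a)) (rep (pt b))" "\<Phi> a b"] k l by (metis mult_eq_0_iff)
    then show ?thesis by (simp only: \<Psi>_def fst_conv snd_conv)
  qed
  define pull where "pull c = {p \<in> CM_points. \<Psi> p \<in> c}" for c
  have cS: "c \<subseteq> S" if "c \<in> F" for c
    using that F by (auto simp: intersecting_family_def ovoidal_circles_def plane_section_def)
  have img: "\<exists>p\<in>CM_points. \<Psi> p = P" if PS: "P \<in> S" for P
  proof -
    obtain a b where ab: "a \<noteq> 0" "b \<noteq> 0" "P = pt (\<Phi> a b)" using surj[OF PS] by blast
    then have "(pt a, pt b) \<in> CM_points" using pg_point_pt[OF ab(1)] pg_point_pt[OF ab(2)] by (simp add: CM_points_def)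
    then show ?thesis using \<Psi>_pt[OF ab(1,2)] ab(3) by blast
  qed
  have pull_image: "c = \<Psi> ` pull c" if "c \<in> F" for c
    using img cS[OF that] unfolding pull_def by blast
  have circ: "pull c \<in> CM_circles id" if c: "c \<in> F" for c
  proof -
    obtain \<pi> where \<pi>: "c = plane_section S \<pi>" "oval_plane S \<pi>"
      using c F by (auto simp: intersecting_family_def ovoidal_circles_def)
    then have pl: "pg_plane \<pi>" and sub: "vec.subspace \<pi>" and no3: "no_three_collinear c"
      by (auto simp: oval_plane_def oval_in_def pg_plane_def)
    obtain n where n: "\<pi> = {v. dotp n v = 0}" by (rule plane_kernel[OF pl])
    define m where "m = n v* B"
    \<comment> \<open>The entries are read off from the requirement that
      \<open>dotp m (segre a b)\<close> be \<open>- dt (M *v a) b\<close>.\<close>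
    define M :: "'a ^ 2 ^ 2" where "M = vector [vector [- m $ 3, - m $ 2], vector [m $ 1, - m $ 4]]"
    have inc: "\<Phi> a b \<in> \<pi> \<longleftrightarrow> dt (M *v a) b = 0" for a b
    proof -
      have "dotp n (\<Phi> a b) = - dt (M *v a) b"
        by (simp add: \<Phi>_def dotp_matrix flip: m_def)
          (simp add: dotp_def sum_4 dt_def M_def matrix_vector_mult_def sum_2 algebra_simps)
      then show ?thesis by (simp add: n)
    qed
    have mem: "pt (\<Phi> a b) \<in> c \<longleftrightarrow> dt (M *v a) b = 0" if "a \<noteq> 0" "b \<noteq> 0" for a b
      using \<Phi>S[OF that] inc[of a b] pt_subset_iff[OF sub] by (simp add: \<pi>(1) plane_section_def)
    \<comment> \<open>A kernel vector \<open>a\<close> of \<open>M\<close> would put the points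
      \<open>pt (\<Phi> a b)\<close> for all \<open>b\<close> into the section. They form a line,
      and an oval contains no three points of a line.\<close>
    have M0: "det M \<noteq> 0"
    proof
      assume "det M = 0"
      then obtain a where a: "a \<noteq> 0" "M *v a = 0"
        using invertible_det_nz[of M] matrix_left_invertible_ker[of M] invertible_left_inverse[of M] by blast
      define b1 b2 :: "'a ^ 2" where "b1 = vector [1, 0]" and "b2 = vector [0, 1]"
      have nz: "b1 \<noteq> 0" "b2 \<noteq> 0" "b1 + b2 \<noteq> 0" by (auto simp: b1_def b2_def vec2_eq_iff)
      have in_c: "pt (\<Phi> a b) \<in> c" if "b \<noteq> 0" for b using mem[OF a(1) that] a(2) by (simp add: dt_zero)
      have not_in: "\<Phi> a b \<notin> pt (\<Phi> a b')" if "dt b b' \<noteq> 0" for b b'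
      proof
        assume "\<Phi> a b \<in> pt (\<Phi> a b')"
        then obtain k where "\<Phi> a b = k *s \<Phi> a b'" by (auto simp: in_pt)
        then have "A *v \<Phi> a b = A *v (k *s \<Phi> a b')" by simp
        then have "segre a b = k *s segre a b'" by (simp add: \<Phi>_def AB flip: vector_scalar_commute)
        then have "a $ 1 * b $ 1 = k * (a $ 1 * b' $ 1)" "a $ 1 * b $ 2 = k * (a $ 1 * b' $ 2)"
          "a $ 2 * b $ 2 = k * (a $ 2 * b' $ 2)" "a $ 2 * b $ 1 = k * (a $ 2 * b' $ 1)"
          by (simp_all add: vec4_eq_iff)
        then have "a $ 1 = 0 \<or> b = k *s b'" "a $ 2 = 0 \<or> b = k *s b'"
          by (auto simp: vec2_eq_iff mult.left_commute)
        then have "b = k *s b'" using a(1) by (auto simp: vec2_eq_iff)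
        then show False using that by (simp add: dt_def)
      qed
      have d: "dt b1 b2 \<noteq> 0" "dt b2 b1 \<noteq> 0" "dt (b1 + b2) b1 \<noteq> 0" "dt (b1 + b2) b2 \<noteq> 0"
        by (simp_all add: b1_def b2_def dt_def)
      have ne: "pt (\<Phi> a b) \<noteq> pt (\<Phi> a b')" if "dt b b' \<noteq> 0" for b b'
        using not_in[OF that] vec.span_base[of "\<Phi> a b" "{\<Phi> a b}"] by auto
      let ?l = "vec.span {\<Phi> a b2, \<Phi> a b1}"
      have "pg_line ?l" by (rule pg_line_span[OF \<Phi>_nz[OF a(1) nz(1)] not_in[OF d(2)]])
      moreover have "\<Phi> a (b1 + b2) = \<Phi> a b1 + \<Phi> a b2" by (simp add: \<Phi>_def segre_add matrix_vector_right_distrib)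
      then have "pt (\<Phi> a b1) \<subseteq> ?l" "pt (\<Phi> a b2) \<subseteq> ?l" "pt (\<Phi> a (b1 + b2)) \<subseteq> ?l"
        by (simp_all add: pt_subset_iff vec.span_base vec.span_add)
      ultimately show False
        using no3 in_c[OF nz(1)] in_c[OF nz(2)] in_c[OF nz(3)] ne[OF d(1)] ne[OF d(3)] ne[OF d(4)]
        unfolding no_three_collinear_def by metis
    qed
    have "pull c = i.gr M"
    proof (intro set_eqI iffI)
      fix p assume p: "p \<in> pull c"
      then have "pg_point (fst p)" "pg_point (snd p)" by (auto simp: pull_def CM_points_def)
      then obtain a b where ab: "a \<noteq> 0" "b \<noteq> 0" "p = (pt a, pt b)" by (metis pg_pointE prod.collapse)
      have "pt (\<Phi> a b) \<in> c" using p \<Psi>_pt[OF ab(1,2)] ab(3) by (simp add: pull_def)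
      then have "dt (M *v a) b = 0" using mem ab by simp
      moreover have "i.im M a = M *v a" by (simp add: i.twist_def semi_def)
      ultimately have "CM_map id M (pt a) = pt b"
        using i.CM_map_pt[OF M0, of a] pt_eq_dt[OF i.im_nz[OF M0 ab(1)] ab(2)] by simp
      then show "p \<in> i.gr M" using ab pg_point_pt[OF ab(1)] by (simp add: i.gr_iff)
    next
      fix p assume p: "p \<in> i.gr M"
      then obtain x where x: "pg_point x" "p = (x, CM_map id M x)" by (auto simp: i.gr_def)
      obtain a where a: "a \<noteq> 0" "x = pt a" by (rule pg_pointE[OF x(1)])
      have im: "i.im M a = M *v a" by (simp add: i.twist_def semi_def)
      have nz: "M *v a \<noteq> 0" using i.im_nz[OF M0 a(1)] im by simp
      have p': "p = (pt a, pt (M *v a))" using x a i.CM_map_pt[OF M0, of a] im by simp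
      have "pt (\<Phi> a (M *v a)) \<in> c" using mem[OF a(1) nz] by (simp add: dt_def)
      then show "p \<in> pull c"
        using p' \<Psi>_pt[OF a(1) nz] pg_point_pt[OF a(1)] pg_point_pt[OF nz] by (simp add: pull_def CM_points_def)
    qed
    then show ?thesis using M0 by (auto simp: i.CM_circles_gr)
  qed
  have "inj_on pull F" by (rule inj_onI) (metis pull_image)
  then have card: "card (pull ` F) = card F" by (rule card_image)
  have "intersecting_family (CM_circles id) (pull ` F)"
    unfolding intersecting_family_def
  proof (intro conjI ballI subsetI)
    fix c' d' assume "c' \<in> pull ` F" "d' \<in> pull ` F"
    then obtain c d where cd: "c \<in> F" "d \<in> F" "c' = pull c" "d' = pull d" by blast
    then obtain P where P: "P \<in> c" "P \<in> d" using F by (fastforce simp: intersecting_family_def)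
    then obtain p where "p \<in> CM_points" "\<Psi> p = P" using img cS cd by blast
    then show "c' \<inter> d' \<noteq> {}" using cd P by (auto simp: pull_def)
  qed (use circ in auto)
  then obtain p where p: "p \<in> CM_points" "\<forall>c'\<in>pull ` F. p \<in> c'"
    using i.CM_common_point[of "pull ` F"] size card by auto
  have all: "\<forall>c\<in>F. \<Psi> p \<in> c" using p by (auto simp: pull_def)
  have "pg_point (fst p)" "pg_point (snd p)" using p by (auto simp: CM_points_def)
  then have "\<Psi> p \<in> S" unfolding \<Psi>_def using \<Phi>S rep by blast
  then show ?thesis using all by blast
qed

section \<open>Ovoids\<close>

lemma of_nat_card_field: "(of_nat CARD('a) :: 'a::{field,finite}) = 0"
proof -
  have "(\<Sum>x\<in>(UNIV :: 'a set). 1 :: 'a) = of_nat CARD('a)" by simp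
  moreover have "(\<Sum>x\<in>(UNIV :: 'a set). x) = (\<Sum>x\<in>(UNIV :: 'a set). x + 1)"
    by (rule sum.reindex_bij_witness[of _ "\<lambda>x. x + 1" "\<lambda>x. x - 1"]) auto
  then have "(\<Sum>x\<in>(UNIV :: 'a set). 1 :: 'a) = 0" by (simp add: sum.distrib)
  ultimately show ?thesis by simp
qed

lemma card_squares:
  assumes "odd CARD('a::{field,finite})"
  shows "2 * card {y :: 'a. is_sq y} = CARD('a) + 1"
proof -
  let ?Q = "(\<lambda>x::'a. x * x) ` (UNIV - {0})"
  have "(\<Sum>x\<in>UNIV - {0::'a}. card {y\<in>?Q. x * x = y}) = 2 * card ?Q"
  proof (rule sum_multicount)
    show "\<forall>y\<in>?Q. card {x\<in>UNIV - {0}. x * x = y} = 2"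
    proof
      fix y assume "y \<in> ?Q"
      then obtain z where z: "z \<noteq> 0" "y = z * z" by blast
      then have "{x\<in>UNIV - {0}. x * x = y} = {z, - z}" by (auto simp: square_eq_iff)
      then show "card {x\<in>UNIV - {0}. x * x = y} = 2" using not_neg_self[OF assms z(1)] by simp
    qed
  qed auto
  moreover have "card {y\<in>?Q. x * x = y} = 1" if "x \<in> UNIV - {0}" for x
  proof -
    have "{y\<in>?Q. x * x = y} = {x * x}" using that by auto
    then show ?thesis by simp
  qed
  ultimately have "card (UNIV - {0::'a}) = 2 * card ?Q" by simp
  moreover have "card (UNIV - {0::'a}) = CARD('a) - 1" by (simp add: card_Diff_subset)
  moreover have "{y :: 'a. is_sq y} = insert 0 ?Q" by (auto simp: is_sq_def)
  moreover have "0 \<notin> ?Q" by auto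
  ultimately show ?thesis using card_field_ge2[where 'a='a] by simp
qed

text \<open>The translates of the set of squares by a nonzero element are not contained in it, as the
  number of squares is not divisible by the characteristic.\<close>

lemma ex_sq_plus_nonsq:
  fixes D :: "'a::{field,finite}"
  assumes "odd CARD('a)" "D \<noteq> 0"
  shows "\<exists>x. \<not> is_sq (x * x + D)"
proof (rule ccontr)
  assume "\<not> ?thesis"
  then have all: "is_sq (x * x + D)" for x by blast
  let ?Q = "{y :: 'a. is_sq y}"
  have "(\<lambda>y. y + D) ` ?Q \<subseteq> ?Q" using all by (auto simp: is_sq_def)
  then have "(\<lambda>y. y + D) ` ?Q = ?Q" by (intro endo_inj_surj) (auto simp: inj_on_def)
  then have "sum (\<lambda>y. y) ?Q = sum (\<lambda>y. y) ((\<lambda>y. y + D) ` ?Q)" by simp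
  also have "\<dots> = (\<Sum>y\<in>?Q. y + D)" by (subst sum.reindex) (auto simp: inj_on_def)
  finally have "(of_nat (card ?Q) :: 'a) * D = 0" by (simp add: sum.distrib)
  then have "(of_nat (card ?Q) :: 'a) = 0" using assms by simp
  moreover have "(of_nat (2 * card ?Q) :: 'a) = of_nat (CARD('a) + 1)"
    using card_squares[OF assms(1)] by (simp only:)
  ultimately show False by (simp add: of_nat_card_field)
qed

text \<open>Each element cancels against its inverse, which is a different element of the
  set.\<close>

lemma prod_inverse_closed:
  fixes A :: "'a::field set"
  assumes "finite A" "0 \<notin> A" "\<And>x. x \<in> A \<Longrightarrow> inverse x \<in> A \<and> inverse x \<noteq> x"
  shows "\<Prod>A = 1"
  using assms
proof (induction "card A" arbitrary: A rule: less_induct)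
  case less
  show ?case
  proof (cases "A = {}")
    case False
    then obtain x where x: "x \<in> A" by blast
    then have x': "inverse x \<in> A" "inverse x \<noteq> x" "x \<noteq> 0" using less.prems by auto
    let ?A = "A - {x, inverse x}"
    have A: "A = insert x (insert (inverse x) ?A)" using x x' by blast
    have "\<Prod>?A = 1"
    proof (rule less.hyps)
      show "card ?A < card A" using x less.prems(1) by (intro psubset_card_mono) auto
      show "inverse y \<in> ?A \<and> inverse y \<noteq> y" if "y \<in> ?A" for y
        using that less.prems(3)[of y] by auto
    qed (use less.prems in auto)
    moreover have "\<Prod>A = x * (inverse x * \<Prod>?A)"
      by (subst A) (use x' less.prems(1) in simp)
    ultimately show ?thesis using x' by simp
  qed simp
qed

text \<open>Wilson's theorem for finite fields: only 1 and -1 are their own inverses, all other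
  factors cancel.\<close>

lemma prod_nonzero:
  assumes "odd CARD('a::{field,finite})"
  shows "\<Prod>(UNIV - {0::'a}) = - 1"
proof -
  let ?A = "UNIV - {0, 1, - 1 :: 'a}"
  have "\<Prod>?A = 1"
  proof (rule prod_inverse_closed)
    fix x assume x: "x \<in> ?A"
    have "inverse x \<noteq> x"
    proof
      assume "inverse x = x"
      then have "x * x = 1" using x by (metis DiffD2 insertI1 right_inverse)
      then show False using x square_eq_1_iff by auto
    qed
    moreover have "inverse x \<noteq> - 1" using x by (metis DiffD2 insertCI inverse_inverse_eq inverse_minus_eq inverse_1)
    ultimately show "inverse x \<in> ?A \<and> inverse x \<noteq> x" using x by auto
  qed auto
  moreover have "UNIV - {0::'a} = insert 1 (insert (- 1) ?A)" by auto
  moreover have "(1::'a) \<notin> insert (- 1) ?A" using not_neg_self[OF assms, of 1] by auto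
  ultimately show ?thesis by simp
qed

lemma scale_in_span:
  assumes "k *s w \<in> vec.span B" "k \<noteq> 0"
  shows "w \<in> vec.span B"
proof -
  have "inverse k *s (k *s w) \<in> vec.span B" using assms(1) by (rule vec.span_scale)
  then show ?thesis using assms(2) by simp
qed

lemma coords_unique:
  assumes "u \<noteq> 0" "v \<notin> pt u" "w \<notin> vec.span {v, u}"
    and "a *s w + b *s v + c *s u = a' *s w + b' *s v + c' *s u"
  shows "a = a'" "b = b'" "c = c'"
proof -
  have "(a - a') *s w = (b' - b) *s v + (c' - c) *s u" using assms(4) by (simp add: algebra_simps)
  then have "(a - a') *s w \<in> vec.span {v, u}" unfolding in_span2 by blast
  then show a: "a = a'" using assms(3) scale_in_span[of "a - a'" w] by (metis eq_iff_diff_eq_0)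
  then have "(b - b') *s v = (c' - c) *s u" using assms(4) by (simp add: algebra_simps)
  then have "(b - b') *s v \<in> pt u" unfolding in_pt by blast
  then show b: "b = b'" using assms(2) scale_in_span[of "b - b'" v] by (metis eq_iff_diff_eq_0)
  then have "(c - c') *s u = 0" using assms(4) a by (simp add: algebra_simps)
  then show "c = c'" using assms(1) by simp
qed

lemma oval_planeI:
  assumes "pg_plane \<pi>" "no_three_collinear S" "\<And>P. P \<in> S \<Longrightarrow> pg_point P"
    "card (plane_section S \<pi>) = CARD('a::{field,finite}) + 1"
  shows "oval_plane S (\<pi> :: ('a ^ 4) set)"
  using assms by (auto simp: oval_plane_def oval_in_def plane_section_def no_three_collinear_def)

locale ovoid_space =
  fixes S :: "('a::{field,finite} ^ 4) set set"
  assumes ov: "ovoid S"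
begin

lemma S_point: "P \<in> S \<Longrightarrow> pg_point P" and S_card: "card S = CARD('a)\<^sup>2 + 1" and S_no3: "no_three_collinear S"
  using ov by (auto simp: ovoid_def)

lemma S_rep: "P \<in> S \<Longrightarrow> rep P \<noteq> 0" "P \<in> S \<Longrightarrow> pt (rep P) = P"
  using rep[OF S_point] by auto

lemma sub_iff: "P \<in> S \<Longrightarrow> vec.subspace \<pi> \<Longrightarrow> P \<subseteq> \<pi> \<longleftrightarrow> rep P \<in> \<pi>"
  using pt_subset_iff[of \<pi> "rep P"] S_rep(2) by simp

lemma indep_two:
  assumes "P \<in> S" "Q \<in> S" "P \<noteq> Q"
  shows "rep Q \<notin> pt (rep P)"
proof
  assume "rep Q \<in> pt (rep P)"
  then obtain k where k: "rep Q = k *s rep P" by (auto simp: in_pt)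
  then have "k \<noteq> 0" using S_rep(1)[OF assms(2)] by auto
  then have "pt (rep Q) = pt (rep P)" using pt_eq_iff[OF S_rep(1)[OF assms(2)]] k by blast
  then show False using assms S_rep(2) by metis
qed

lemma not_on_line:
  assumes "P \<in> S" "Q \<in> S" "R \<in> S" "P \<noteq> Q" "P \<noteq> R" "Q \<noteq> R" "pg_line l" "rep P \<in> l" "rep Q \<in> l"
  shows "rep R \<notin> l"
proof
  assume R: "rep R \<in> l"
  have sub: "vec.subspace l" using assms by (simp add: pg_line_def)
  have "P \<subseteq> l" "Q \<subseteq> l" "R \<subseteq> l" using sub_iff[OF _ sub] assms R by blast+
  then have "\<exists>l. pg_line l \<and> P \<subseteq> l \<and> Q \<subseteq> l \<and> R \<subseteq> l" using assms(7) by blast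
  moreover have "\<not> (\<exists>l. pg_line l \<and> P \<subseteq> l \<and> Q \<subseteq> l \<and> R \<subseteq> l)"
    using S_no3[unfolded no_three_collinear_def, rule_format, OF assms(1-3)] assms(4-6) by blast
  ultimately show False by blast
qed

lemma indep_three:
  assumes "P \<in> S" "Q \<in> S" "R \<in> S" "P \<noteq> Q" "P \<noteq> R" "Q \<noteq> R"
  shows "rep R \<notin> vec.span {rep Q, rep P}"
proof (rule not_on_line[OF assms])
  show "pg_line (vec.span {rep Q, rep P})"
    by (rule pg_line_span[OF S_rep(1)[OF assms(1)] indep_two[OF assms(1,2,4)]])
  show "rep P \<in> vec.span {rep Q, rep P}" "rep Q \<in> vec.span {rep Q, rep P}"
    by (simp_all only: vec.span_base insert_iff simp_thms)
qed

lemma tangent_functional: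
  assumes P: "P \<in> S"
  shows "\<exists>n. dotp n (rep P) = 0 \<and>
     (\<forall>v. v \<notin> pt (rep P) \<longrightarrow> tangent_line S (vec.span {v, rep P}) = (dotp n v = 0))"
proof -
  obtain \<pi> where \<pi>: "pg_plane \<pi>" "P \<subseteq> \<pi>"
    "{l. tangent_line S l \<and> P \<subseteq> l} = {l. pg_line l \<and> P \<subseteq> l \<and> l \<subseteq> \<pi>}"
  proof -
    have "\<forall>P\<in>S. \<exists>\<pi>. pg_plane \<pi> \<and> P \<subseteq> \<pi> \<and>
        {l. tangent_line S l \<and> P \<subseteq> l} = {l. pg_line l \<and> P \<subseteq> l \<and> l \<subseteq> \<pi>}"
      using ov unfolding ovoid_def by (elim conjE)
    then have "\<exists>\<pi>. pg_plane \<pi> \<and> P \<subseteq> \<pi> \<and>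
        {l. tangent_line S l \<and> P \<subseteq> l} = {l. pg_line l \<and> P \<subseteq> l \<and> l \<subseteq> \<pi>}"
      using P by (rule bspec)
    then show thesis by (elim exE conjE) (rule that)
  qed
  obtain n where n: "\<pi> = {v. dotp n v = 0}" by (rule plane_kernel[OF \<pi>(1)])
  have sub: "vec.subspace \<pi>" using \<pi> by (simp add: pg_plane_def)
  have P\<pi>: "rep P \<in> \<pi>" using sub_iff[OF P sub] \<pi> by blast
  show ?thesis
  proof (intro exI conjI allI impI)
    show "dotp n (rep P) = 0" using P\<pi> n by blast
    fix v assume v: "v \<notin> pt (rep P)"
    let ?l = "vec.span {v, rep P}"
    have l: "pg_line ?l" by (rule pg_line_span[OF S_rep(1)[OF P] v])
    have "P \<subseteq> ?l" using sub_iff[OF P vec.subspace_span] by (simp add: vec.span_base)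
    moreover have "?l \<in> {l. tangent_line S l \<and> P \<subseteq> l} \<longleftrightarrow> ?l \<in> {l. pg_line l \<and> P \<subseteq> l \<and> l \<subseteq> \<pi>}"
      by (simp only: \<pi>(3))
    ultimately have "tangent_line S ?l \<longleftrightarrow> ?l \<subseteq> \<pi>" using l by simp
    also have "\<dots> \<longleftrightarrow> v \<in> \<pi>"
      using vec.span_minimal[of "{v, rep P}" \<pi>] vec.span_base[of v "{v, rep P}"] sub P\<pi> by auto
    finally show "tangent_line S ?l \<longleftrightarrow> dotp n v = 0" by (simp add: n)
  qed
qed

text \<open>This functional for the tangent plane is determined only up to a nonzero scalar;
  \<open>tm\<close> below fixes the scalars coherently.\<close>

definition tf :: "('a ^ 4) set \<Rightarrow> 'a ^ 4" where
  "tf P = (SOME n. dotp n (rep P) = 0 \<and>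
     (\<forall>v. v \<notin> pt (rep P) \<longrightarrow> tangent_line S (vec.span {v, rep P}) = (dotp n v = 0)))"

lemma tf:
  assumes "P \<in> S"
  shows "dotp (tf P) (rep P) = 0"
    and "v \<notin> pt (rep P) \<Longrightarrow> tangent_line S (vec.span {v, rep P}) \<longleftrightarrow> dotp (tf P) v = 0"
proof -
  have "dotp (tf P) (rep P) = 0 \<and>
     (\<forall>v. v \<notin> pt (rep P) \<longrightarrow> tangent_line S (vec.span {v, rep P}) = (dotp (tf P) v = 0))"
    unfolding tf_def by (rule someI_ex[OF tangent_functional[OF assms]])
  then show "dotp (tf P) (rep P) = 0"
    "v \<notin> pt (rep P) \<Longrightarrow> tangent_line S (vec.span {v, rep P}) \<longleftrightarrow> dotp (tf P) v = 0" by auto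
qed

lemma tangent_at_iff:
  assumes "P \<in> S" "v \<notin> pt (rep P)"
  shows "tangent_line S (vec.span {v, rep P}) \<longleftrightarrow> (\<forall>Q\<in>S. rep Q \<in> vec.span {v, rep P} \<longrightarrow> Q = P)"
proof -
  let ?l = "vec.span {v, rep P}"
  have l: "pg_line ?l" by (rule pg_line_span[OF S_rep(1)[OF assms(1)] assms(2)])
  have P: "P \<subseteq> ?l" using sub_iff[OF assms(1) vec.subspace_span] by (simp add: vec.span_base)
  have "tangent_line S ?l \<longleftrightarrow> (\<exists>!Q. Q \<in> S \<and> Q \<subseteq> ?l)" using l by (simp add: tangent_line_def)
  also have "\<dots> \<longleftrightarrow> (\<forall>Q. Q \<in> S \<and> Q \<subseteq> ?l \<longrightarrow> Q = P)" using P assms(1) by blast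
  also have "\<dots> \<longleftrightarrow> (\<forall>Q\<in>S. rep Q \<in> ?l \<longrightarrow> Q = P)" using sub_iff[OF _ vec.subspace_span] by blast
  finally show ?thesis .
qed

lemma tf_nz:
  assumes "P \<in> S" "Q \<in> S" "P \<noteq> Q"
  shows "dotp (tf P) (rep Q) \<noteq> 0"
  using tf(2)[OF assms(1) indep_two[OF assms]] tangent_at_iff[OF assms(1) indep_two[OF assms]] assms
    vec.span_base[of "rep Q" "{rep Q, rep P}"] by auto

text \<open>The lines of \<pi> through \<open>P\<close> other than the tangent are indexed by the
  field elements \<open>t\<close>, and each of these \<open>q\<close> lines carries exactly one
  further point of \<open>S\<close>. The vector \<open>z\<close> gives the tangent direction; it
  arises from a vector of \<pi> outside the line \<open>P Q\<close> by removing a multiple of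
  \<open>rep Q\<close>.\<close>

lemma section_card:
  assumes \<pi>: "pg_plane \<pi>" and P: "P \<in> S" "Q \<in> S" "P \<noteq> Q" "P \<subseteq> \<pi>" "Q \<subseteq> \<pi>"
  shows "card (plane_section S \<pi>) = CARD('a) + 1"
proof -
  define u v n where "u = rep P" and "v = rep Q" and "n = tf P"
  define p where "p = dotp n v"
  have sub: "vec.subspace \<pi>" using \<pi> by (simp add: pg_plane_def)
  have uv: "u \<in> \<pi>" "v \<in> \<pi>" "u \<noteq> 0" "v \<notin> pt u"
    using P sub_iff[OF _ sub] S_rep indep_two by (auto simp: u_def v_def)
  have p: "p \<noteq> 0" "dotp n u = 0" using tf_nz[OF P(1-3)] tf(1)[OF P(1)] by (auto simp: p_def n_def u_def v_def)
  have "\<not> \<pi> \<subseteq> vec.span {v, u}"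
  proof
    assume "\<pi> \<subseteq> vec.span {v, u}"
    then have "vec.dim \<pi> \<le> card {v, u}" by (rule vec.dim_le_card) simp
    then show False using \<pi> indep2[OF uv(3,4)] by (simp add: pg_plane_def)
  qed
  then obtain w where w: "w \<in> \<pi>" "w \<notin> vec.span {v, u}" by blast
  define z where "z = w - (dotp n w / p) *s v"
  have z: "dotp n z = 0" "z \<in> \<pi>"
    using p w uv sub by (auto simp: z_def dotp_diff dotp_simps p_def[symmetric] vec.subspace_diff vec.subspace_scale)
  have zs: "z \<notin> vec.span {v, u}"
  proof
    assume zin: "z \<in> vec.span {v, u}"
    have "(dotp n w / p) *s v \<in> vec.span {v, u}" by (rule vec.span_scale[OF vec.span_base]) simp
    then have "z + (dotp n w / p) *s v \<in> vec.span {v, u}" by (rule vec.span_add[OF zin])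
    then show False using w by (simp add: z_def)
  qed
  have \<pi>_eq: "\<pi> = vec.span {z, v, u}" by (rule pg_plane_eq[OF \<pi> uv(1,2) z(2) uv(3,4) zs])
  let ?l = "\<lambda>t. vec.span {v + t *s z, u}" and ?A = "plane_section S \<pi> - {P}"
  have x: "dotp n (v + t *s z) = p" for t using z by (simp add: dotp_simps p_def)
  have xu: "v + t *s z \<notin> pt u" for t
  proof
    assume "v + t *s z \<in> pt u"
    then obtain k where k: "v + t *s z = k *s u" unfolding in_pt by blast
    have "dotp n (v + t *s z) = 0" unfolding k using p by (simp add: dotp_simps)
    then show False using x p by simp
  qed
  have l: "pg_line (?l t)" for t by (rule pg_line_span[OF uv(3) xu])
  have "card (UNIV :: 'a set) = card ?A"
  proof (rule card_eq_by_unique)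
    show "card {R\<in>?A. rep R \<in> ?l t} = 1" for t
    proof -
      have "\<not> tangent_line S (?l t)" using tf(2)[OF P(1), of "v + t *s z"] xu x p by (simp add: u_def n_def)
      then obtain R where R: "R \<in> S" "rep R \<in> ?l t" "R \<noteq> P"
        using tangent_at_iff[OF P(1), of "v + t *s z"] xu by (auto simp: u_def)
      have "?l t \<subseteq> \<pi>" using uv z sub
        by (intro vec.span_minimal) (auto intro: vec.subspace_add vec.subspace_scale)
      then have RA: "R \<in> ?A" using R sub_iff[OF R(1) sub] by (auto simp: plane_section_def)
      show ?thesis
      proof (rule card_1I)
        show "R \<in> {R\<in>?A. rep R \<in> ?l t}" using RA R by blast
        fix R' assume "R' \<in> {R\<in>?A. rep R \<in> ?l t}"
        then have R': "R' \<in> S" "R' \<noteq> P" "rep R' \<in> ?l t" by (auto simp: plane_section_def)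
        have "rep P \<in> ?l t" unfolding u_def[symmetric] by (simp add: vec.span_base)
        then show "R' = R" using not_on_line[OF P(1) R(1) R'(1) _ _ _ l[of t]] R R' by blast
      qed
    qed
    show "card {t \<in> UNIV. rep R \<in> ?l t} = 1" if R: "R \<in> ?A" for R
    proof -
      have RS: "R \<in> S" "R \<noteq> P" "rep R \<in> \<pi>" using R sub_iff[OF _ sub] by (auto simp: plane_section_def)
      then obtain a b c where abc: "rep R = a *s z + b *s v + c *s u" unfolding \<pi>_eq in_span3 by blast
      have "dotp n (rep R) \<noteq> 0" using tf_nz[OF P(1) RS(1)] RS by (simp add: n_def)
      then have b: "b \<noteq> 0" using z p by (auto simp: abc dotp_simps)
      have "rep R \<in> ?l t \<longleftrightarrow> t = a / b" for t
      proof
        assume "rep R \<in> ?l t"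
        then obtain \<alpha> \<gamma> where "rep R = \<alpha> *s (v + t *s z) + \<gamma> *s u" unfolding in_span2 by blast
        then have "a *s z + b *s v + c *s u = (\<alpha> * t) *s z + \<alpha> *s v + \<gamma> *s u"
          unfolding abc by (simp add: vec.scale_right_distrib add_ac)
        then have "a = \<alpha> * t" "b = \<alpha>" using coords_unique[OF uv(3,4) zs] by blast+
        then show "t = a / b" using b by simp
      next
        assume "t = a / b"
        then have "rep R = b *s (v + t *s z) + c *s u"
          using b unfolding abc by (simp add: vec.scale_right_distrib add_ac)
        then show "rep R \<in> ?l t" unfolding in_span2 by blast
      qed
      then show ?thesis by simp
    qed
  qed (auto simp: plane_section_def)
  moreover have "P \<in> plane_section S \<pi>" using P by (simp add: plane_section_def)
  moreover have "finite (plane_section S \<pi>)" by simp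
  ultimately show ?thesis using card_Suc_Diff1[of "plane_section S \<pi>" P] by simp
qed

lemma oval_planeI':
  assumes "pg_plane \<pi>" "P \<in> S" "Q \<in> S" "P \<noteq> Q" "P \<subseteq> \<pi>" "Q \<subseteq> \<pi>"
  shows "oval_plane S \<pi>"
  by (rule oval_planeI[OF assms(1) S_no3 S_point section_card[OF assms]])

lemma oval_plane_eq:
  assumes "oval_plane S \<pi>" "P \<in> plane_section S \<pi>" "Q \<in> plane_section S \<pi>" "R \<in> plane_section S \<pi>"
    "P \<noteq> Q" "P \<noteq> R" "Q \<noteq> R"
  shows "\<pi> = vec.span {rep R, rep Q, rep P}"
proof -
  have pl: "pg_plane \<pi>" and sub: "vec.subspace \<pi>" using assms by (auto simp: oval_plane_def pg_plane_def)
  have PQR: "P \<in> S" "Q \<in> S" "R \<in> S" "P \<subseteq> \<pi>" "Q \<subseteq> \<pi>" "R \<subseteq> \<pi>" using assms by (auto simp: plane_section_def)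
  show ?thesis
  proof (rule pg_plane_eq[OF pl])
    show "rep P \<in> \<pi>" "rep Q \<in> \<pi>" "rep R \<in> \<pi>" using PQR sub_iff[OF _ sub] by simp_all
    show "rep P \<noteq> 0" using S_rep PQR by simp
    show "rep Q \<notin> pt (rep P)" by (rule indep_two[OF PQR(1,2) assms(5)])
    show "rep R \<notin> vec.span {rep Q, rep P}" by (rule indep_three[OF PQR(1-3) assms(5-7)])
  qed
qed

lemma ovoid_plane:
  "circle_plane S (ovoidal_circles S) (\<noteq>) CARD('a) (CARD('a) + 1) (CARD('a) + 1) 1 0"
proof
  show "2 \<le> CARD('a)" by (rule card_field_ge2)
  show "c \<subseteq> S" "card c = CARD('a) + 1" if "c \<in> ovoidal_circles S" for c
    using that by (auto simp: ovoidal_circles_def plane_section_def oval_plane_def oval_in_def)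
  show "\<exists>!c. c \<in> ovoidal_circles S \<and> P \<in> c \<and> Q \<in> c \<and> R \<in> c"
    if "P \<in> S" "Q \<in> S" "R \<in> S" "P \<noteq> Q" "P \<noteq> R" "Q \<noteq> R" for P Q R
  proof -
    let ?\<pi> = "vec.span {rep R, rep Q, rep P}"
    have pl: "pg_plane ?\<pi>"
      by (rule pg_plane_span[OF S_rep(1)[OF that(1)] indep_two[OF that(1,2,4)] indep_three[OF that]])
    have sub: "P \<subseteq> ?\<pi>" "Q \<subseteq> ?\<pi>" "R \<subseteq> ?\<pi>"
      using sub_iff[OF _ vec.subspace_span] that by (simp_all add: vec.span_base)
    have ovp: "oval_plane S ?\<pi>" by (rule oval_planeI'[OF pl that(1,2,4) sub(1,2)])
    show ?thesis
    proof (rule ex1I)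
      show "plane_section S ?\<pi> \<in> ovoidal_circles S \<and> P \<in> plane_section S ?\<pi> \<and>
          Q \<in> plane_section S ?\<pi> \<and> R \<in> plane_section S ?\<pi>"
        using ovp sub that by (auto simp: ovoidal_circles_def plane_section_def)
      fix c assume c: "c \<in> ovoidal_circles S \<and> P \<in> c \<and> Q \<in> c \<and> R \<in> c"
      then obtain \<pi> where \<pi>: "c = plane_section S \<pi>" "oval_plane S \<pi>" by (auto simp: ovoidal_circles_def)
      have "\<pi> = ?\<pi>" by (rule oval_plane_eq[OF \<pi>(2) _ _ _ that(4-6)]) (use c \<pi>(1) in blast)+
      then show "c = plane_section S ?\<pi>" using \<pi> by simp
    qed
  qed
  show "card {y \<in> c. x \<noteq> y} + 0 = CARD('a) + 1" if c: "c \<in> ovoidal_circles S" and x: "x \<in> S" "x \<notin> c" for c x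
  proof -
    have "{y \<in> c. x \<noteq> y} = c" using x by blast
    then show ?thesis using c by (auto simp: ovoidal_circles_def oval_plane_def oval_in_def)
  qed
  show "card {y \<in> S. x \<noteq> y} = CARD('a) * (CARD('a) + 1 - 1)" if "x \<in> S" for x
  proof -
    have "{y \<in> S. x \<noteq> y} = S - {x}" by blast
    then show ?thesis using that S_card by (simp add: power2_eq_square)
  qed
  show "card {z \<in> S. x \<noteq> z \<and> y \<noteq> z} = (CARD('a) + 1) * (CARD('a) + 1 - 2)"
    if "x \<in> S" "y \<in> S" "x \<noteq> y" for x y
  proof -
    have "{z \<in> S. x \<noteq> z \<and> y \<noteq> z} = S - {x, y}" by blast
    then have "card {z \<in> S. x \<noteq> z \<and> y \<noteq> z} = CARD('a)\<^sup>2 - 1" using that S_card by (simp add: card_Diff_subset)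
    moreover obtain m where "CARD('a) = Suc m" using card_field_ge2[where 'a='a] by (cases "CARD('a)") auto
    ultimately show ?thesis by (simp add: power2_eq_square)
  qed
qed auto

end

section \<open>Lemma of tangents and polar form of an ovoid of odd order\<close>

context ovoid_space
begin

text \<open>In the plane of \<open>P\<close>, \<open>Q\<close>, \<open>R\<close> a line through
  \<open>P\<close> is described by the ratio b/a of the \<open>Q\<close>- and
  \<open>R\<close>-coordinates of its points. The remaining points of the section realise every
  nonzero ratio except that of the tangent, which is - f(R)/f(Q) for f = \<open>tf P\<close>. As the
  product of all nonzero field elements is -1, the product over the section must be
  f(Q)/f(R).\<close>

lemma tangent_prod:
  assumes odd: "odd CARD('a)" and P: "P \<in> S" "Q \<in> S" "R \<in> S" "P \<noteq> Q" "P \<noteq> R" "Q \<noteq> R"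
    and A: "A = {X\<in>S. rep X \<in> vec.span {rep R, rep Q, rep P}} - {P, Q, R}"
    and co: "\<And>X. X \<in> A \<Longrightarrow> rep X = a X *s rep R + b X *s rep Q + c X *s rep P"
  shows "(\<Prod>X\<in>A. b X / a X) * dotp (tf P) (rep R) = dotp (tf P) (rep Q)"
    and "\<And>X. X \<in> A \<Longrightarrow> a X \<noteq> 0"
proof -
  define u v w where "u = rep P" and "v = rep Q" and "w = rep R"
  have uvw: "u \<noteq> 0" "v \<notin> pt u" "w \<notin> vec.span {v, u}"
    using S_rep(1)[OF P(1)] indep_two[OF P(1,2,4)] indep_three[OF P] by (auto simp: u_def v_def w_def)
  have XA: "X \<in> S" "X \<noteq> P" "X \<noteq> Q" "X \<noteq> R" if "X \<in> A" for X using that A by auto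
  have a0: "a X \<noteq> 0" if X: "X \<in> A" for X
  proof
    assume "a X = 0"
    then have "rep X = b X *s rep Q + c X *s rep P" using co[OF X] by simp
    then have "rep X \<in> vec.span {rep Q, rep P}" unfolding in_span2 by blast
    then show False using indep_three[OF P(1,2) XA(1)[OF X] P(4)] XA[OF X] by blast
  qed
  have b0: "b X \<noteq> 0" if X: "X \<in> A" for X
  proof
    assume "b X = 0"
    then have "rep X = a X *s rep R + c X *s rep P" using co[OF X] by simp
    then have "rep X \<in> vec.span {rep R, rep P}" unfolding in_span2 by blast
    then show False using indep_three[OF P(1,3) XA(1)[OF X] P(5)] XA[OF X] by blast
  qed
  define fv fw where "fv = dotp (tf P) v" and "fw = dotp (tf P) w"
  have f: "fv \<noteq> 0" "fw \<noteq> 0" using tf_nz[OF P(1,2,4)] tf_nz[OF P(1,3,5)] by (simp_all add: fv_def fw_def v_def w_def)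
  have inj: "inj_on (\<lambda>X. b X / a X) A"
  proof (rule inj_onI)
    fix X Y assume X: "X \<in> A" and Y: "Y \<in> A" and eq: "b X / a X = b Y / a Y"
    show "X = Y"
    proof (rule ccontr)
      assume ne: "X \<noteq> Y"
      define k where "k = a Y / a X"
      have "a Y = k * a X" "b Y = k * b X" using eq a0[OF X] a0[OF Y] by (simp_all add: k_def field_simps)
      then have "rep Y = k *s rep X + (c Y - k * c X) *s rep P"
        unfolding co[OF X] co[OF Y] by (simp add: vec.scale_right_distrib vec.scale_left_diff_distrib)
      then have "rep Y \<in> vec.span {rep X, rep P}" unfolding in_span2 by blast
      then show False using indep_three[OF P(1) XA(1)[OF X] XA(1)[OF Y]] XA[OF X] XA[OF Y] ne by blast
    qed
  qed
  let ?T = "UNIV - {0} - {- fw / fv}"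
  have img: "(\<lambda>X. b X / a X) ` A \<subseteq> ?T"
  proof
    fix t assume "t \<in> (\<lambda>X. b X / a X) ` A"
    then obtain X where X: "X \<in> A" "t = b X / a X" by blast
    have "dotp (tf P) (rep X) = a X * fw + b X * fv"
      unfolding co[OF X(1)] using tf(1)[OF P(1)] by (simp add: dotp_simps fv_def fw_def v_def w_def)
    moreover have "dotp (tf P) (rep X) \<noteq> 0" using tf_nz[OF P(1) XA(1)[OF X(1)]] XA(2)[OF X(1)] by blast
    ultimately have "a X * fw + b X * fv \<noteq> 0" by simp
    moreover have "a X * fw + b X * fv = 0" if "b X / a X = - fw / fv"
    proof -
      have "b X = (- fw / fv) * a X" using that a0[OF X(1)] by (simp add: nonzero_divide_eq_eq)
      then have "b X * fv = - fw * a X" using f by simp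
      then show ?thesis by (simp add: mult.commute)
    qed
    ultimately show "t \<in> ?T" using X a0 b0 by auto
  qed
  let ?\<pi> = "vec.span {w, v, u}"
  have pl: "pg_plane ?\<pi>" by (rule pg_plane_span[OF uvw])
  have in\<pi>: "P \<subseteq> ?\<pi>" "Q \<subseteq> ?\<pi>" "R \<subseteq> ?\<pi>"
    using sub_iff[OF _ vec.subspace_span] P by (simp_all add: vec.span_base u_def v_def w_def)
  have sec: "plane_section S ?\<pi> = {X\<in>S. rep X \<in> ?\<pi>}"
    using sub_iff[OF _ vec.subspace_span] by (auto simp: plane_section_def)
  have "A = plane_section S ?\<pi> - {P, Q, R}" unfolding A sec unfolding u_def v_def w_def by (rule refl)
  moreover have "{P, Q, R} \<subseteq> plane_section S ?\<pi>" using P in\<pi> by (simp add: plane_section_def)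
  ultimately have "card A = card (plane_section S ?\<pi>) - card {P, Q, R}"
    by (simp only: card_Diff_subset finite.emptyI finite.insertI)
  then have cA: "card A = CARD('a) - 2" using section_card[OF pl P(1,2,4) in\<pi>(1,2)] P by simp
  have t0: "- fw / fv \<in> UNIV - {0}" using f by simp
  then have "card ?T = CARD('a) - 2" by (simp add: card_Diff_subset)
  then have "(\<lambda>X. b X / a X) ` A = ?T"
    using img cA card_image[OF inj] by (intro card_subset_eq) auto
  then have "\<Prod>?T = (\<Prod>X\<in>A. b X / a X)" using prod.reindex[OF inj, of "\<lambda>x. x"] by simp
  moreover have "\<Prod>(UNIV - {0::'a}) = (- fw / fv) * \<Prod>?T" by (rule prod.remove[OF _ t0]) simp
  ultimately have "(- fw / fv) * (\<Prod>X\<in>A. b X / a X) = - 1" using prod_nonzero[OF odd] by simp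
  then have "fw * (\<Prod>X\<in>A. b X / a X) = fv" using f by (simp add: field_simps)
  then show "(\<Prod>X\<in>A. b X / a X) * dotp (tf P) (rep R) = dotp (tf P) (rep Q)"
    by (simp add: fv_def fw_def v_def w_def mult.commute)
  show "\<And>X. X \<in> A \<Longrightarrow> a X \<noteq> 0" by (rule a0)
qed

text \<open>Segre's lemma of tangents. The product formula is used at each of the three points with
  the same coordinates, and the factors b/a, a/c and c/b of each remaining point multiply to
  1.\<close>

lemma lemma_of_tangents:
  assumes odd: "odd CARD('a)" and P: "P \<in> S" "Q \<in> S" "R \<in> S" "P \<noteq> Q" "P \<noteq> R" "Q \<noteq> R"
  shows "dotp (tf P) (rep Q) * dotp (tf Q) (rep R) * dotp (tf R) (rep P)
    = dotp (tf P) (rep R) * dotp (tf Q) (rep P) * dotp (tf R) (rep Q)"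
proof -
  define A where "A = {X\<in>S. rep X \<in> vec.span {rep R, rep Q, rep P}} - {P, Q, R}"
  have "\<forall>X\<in>A. \<exists>abc. rep X = fst abc *s rep R + fst (snd abc) *s rep Q + snd (snd abc) *s rep P"
    unfolding A_def in_span3 by auto
  then obtain F where F: "\<forall>X\<in>A. rep X = fst (F X) *s rep R + fst (snd (F X)) *s rep Q + snd (snd (F X)) *s rep P"
    by (rule bchoice[THEN exE])
  define a b c where "a X = fst (F X)" and "b X = fst (snd (F X))" and "c X = snd (snd (F X))" for X
  have co: "rep X = a X *s rep R + b X *s rep Q + c X *s rep P" if "X \<in> A" for X
    using F that by (simp add: a_def b_def c_def)
  have A2: "A = {X\<in>S. rep X \<in> vec.span {rep P, rep R, rep Q}} - {Q, R, P}"
    and A3: "A = {X\<in>S. rep X \<in> vec.span {rep Q, rep P, rep R}} - {R, P, Q}"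
    unfolding A_def by (simp_all add: insert_commute)
  have ne: "Q \<noteq> P" "R \<noteq> P" "R \<noteq> Q" using P by auto
  have co2: "rep X = c X *s rep P + a X *s rep R + b X *s rep Q" if "X \<in> A" for X
    using co[OF that] by (simp add: add_ac)
  have co3: "rep X = b X *s rep Q + c X *s rep P + a X *s rep R" if "X \<in> A" for X
    using co[OF that] by (simp add: add_ac)
  note t1 = tangent_prod[OF odd P A_def co]
  note t2 = tangent_prod[OF odd P(2,3,1,6) ne(1,2) A2 co2]
  note t3 = tangent_prod[OF odd P(3,1,2) ne(2,3) P(4) A3 co3]
  have "(\<Prod>X\<in>A. b X / a X) * (\<Prod>X\<in>A. a X / c X) * (\<Prod>X\<in>A. c X / b X)
      = (\<Prod>X\<in>A. (b X / a X) * (a X / c X) * (c X / b X))" by (simp only: prod.distrib)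
  also have "\<dots> = 1" by (rule prod.neutral) (use t1(2) t2(2) t3(2) in simp)
  finally have 1: "(\<Prod>X\<in>A. b X / a X) * (\<Prod>X\<in>A. a X / c X) * (\<Prod>X\<in>A. c X / b X) = 1" .
  have "((\<Prod>X\<in>A. b X / a X) * (\<Prod>X\<in>A. a X / c X) * (\<Prod>X\<in>A. c X / b X))
        * (dotp (tf P) (rep R) * dotp (tf Q) (rep P) * dotp (tf R) (rep Q))
      = ((\<Prod>X\<in>A. b X / a X) * dotp (tf P) (rep R)) * ((\<Prod>X\<in>A. a X / c X) * dotp (tf Q) (rep P))
        * ((\<Prod>X\<in>A. c X / b X) * dotp (tf R) (rep Q))" by (simp only: mult_ac)
  also have "\<dots> = dotp (tf P) (rep Q) * dotp (tf Q) (rep R) * dotp (tf R) (rep P)"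
    by (simp only: t1(1) t2(1) t3(1))
  finally show ?thesis unfolding 1 by simp
qed

definition base :: "('a ^ 4) set" where "base = (SOME P. P \<in> S)"

lemma base: "base \<in> S"
proof -
  have "S \<noteq> {}" using S_card by auto
  then show ?thesis unfolding base_def by (simp add: some_in_eq)
qed

text \<open>The scaling makes the pairing of \<open>base\<close> with every point symmetric. The
  lemma of tangents for \<open>P\<close>, \<open>Q\<close>, \<open>base\<close> then yields symmetry
  for all pairs.\<close>

definition tm :: "('a ^ 4) set \<Rightarrow> 'a ^ 4" where
  "tm P = (if P = base then tf P else (dotp (tf base) (rep P) / dotp (tf P) (rep base)) *s tf P)"

lemma tm_scale: "P \<in> S \<Longrightarrow> \<exists>k. k \<noteq> 0 \<and> tm P = k *s tf P"
proof (cases "P = base")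
  case True
  then show ?thesis by (intro exI[of _ 1]) (simp add: tm_def)
next
  case False
  assume P: "P \<in> S"
  have "dotp (tf base) (rep P) / dotp (tf P) (rep base) \<noteq> 0"
    using tf_nz[OF base P] tf_nz[OF P base] False by auto
  then show ?thesis
    by (intro exI[of _ "dotp (tf base) (rep P) / dotp (tf P) (rep base)"]) (simp add: tm_def False)
qed

lemma tm_zero_iff:
  assumes "P \<in> S"
  shows "dotp (tm P) v = 0 \<longleftrightarrow> dotp (tf P) v = 0"
proof -
  obtain k where "k \<noteq> 0" "tm P = k *s tf P" using tm_scale[OF assms] by blast
  then show ?thesis by (simp add: dotp_simps)
qed

lemma tm_sym:
  assumes odd: "odd CARD('a)" and P: "P \<in> S" "Q \<in> S"
  shows "dotp (tm P) (rep Q) = dotp (tm Q) (rep P)"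
proof -
  consider "P = Q" | "P \<noteq> Q" "P = base" | "P \<noteq> Q" "Q = base" | "P \<noteq> Q" "P \<noteq> base" "Q \<noteq> base" by blast
  then show ?thesis
  proof cases
    case 2
    then show ?thesis using tf_nz[OF P(2) base] by (auto simp: tm_def dotp_simps)
  next
    case 3
    then show ?thesis using tf_nz[OF P(1) base] by (auto simp: tm_def dotp_simps)
  next
    case 4
    note nz = tf_nz[OF P(1) base 4(2)] tf_nz[OF P(2) base 4(3)]
    have "dotp (tf P) (rep Q) * dotp (tf Q) (rep base) * dotp (tf base) (rep P)
      = dotp (tf P) (rep base) * dotp (tf Q) (rep P) * dotp (tf base) (rep Q)"
      by (rule lemma_of_tangents[OF odd P base 4])
    then have "dotp (tf base) (rep P) * dotp (tf P) (rep Q) * dotp (tf Q) (rep base)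
      = dotp (tf base) (rep Q) * dotp (tf Q) (rep P) * dotp (tf P) (rep base)" by (simp only: mult_ac)
    then show ?thesis using 4 nz by (simp add: tm_def dotp_simps frac_eq_eq)
  qed simp
qed

text \<open>The plane through three points of \<open>S\<close> contains only q + 1 of the q^2 + 1
  points.\<close>

lemma ex_basis:
  obtains P Q R T where "P \<in> S" "Q \<in> S" "R \<in> S" "T \<in> S" "P \<noteq> Q" "P \<noteq> R" "Q \<noteq> R"
    "rep T \<notin> vec.span {rep R, rep Q, rep P}"
proof -
  have "3 \<le> card S" using S_card power_mono[of 2 "CARD('a)" 2] card_field_ge2[where 'a='a] by simp
  then obtain B where "B \<subseteq> S" "card B = 3" by (rule obtain_subset_with_card_n)
  then obtain P Q R where P: "P \<in> S" "Q \<in> S" "R \<in> S" "P \<noteq> Q" "P \<noteq> R" "Q \<noteq> R"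
    by (auto simp: card_3_iff)
  let ?\<pi> = "vec.span {rep R, rep Q, rep P}"
  have pl: "pg_plane ?\<pi>"
    by (rule pg_plane_span[OF S_rep(1)[OF P(1)] indep_two[OF P(1,2,4)] indep_three[OF P]])
  have "P \<subseteq> ?\<pi>" "Q \<subseteq> ?\<pi>" using sub_iff[OF _ vec.subspace_span] P by (simp_all add: vec.span_base)
  then have "card (plane_section S ?\<pi>) = CARD('a) + 1" by (rule section_card[OF pl P(1,2,4)])
  moreover have "CARD('a) < CARD('a)\<^sup>2" using card_field_ge2[where 'a='a] by (simp add: power2_eq_square)
  ultimately have "plane_section S ?\<pi> \<noteq> S" using S_card by auto
  then obtain T where "T \<in> S" "rep T \<notin> ?\<pi>"
    using sub_iff[OF _ vec.subspace_span] by (auto simp: plane_section_def)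
  then show thesis using that P by blast
qed

text \<open>The form is defined by linear extension from four points of \<open>S\<close> forming a
  basis, with the values prescribed by \<open>tm\<close>. Symmetry of \<open>tm\<close> on the basis
  makes the form symmetric, and symmetry of \<open>tm\<close> between the basis and an arbitrary
  point then shows that the form agrees with \<open>tm\<close> at every point of \<open>S\<close>.
  In effect \<open>S\<close> lies on the quadric B x x = 0.\<close>

lemma polar_form:
  assumes odd: "odd CARD('a)"
  shows "\<exists>B :: 'a ^ 4 \<Rightarrow> 'a ^ 4 \<Rightarrow> 'a. (\<forall>a b c. B (a + b) c = B a c + B b c) \<and>
    (\<forall>k a c. B (k *s a) c = k * B a c) \<and> (\<forall>a b. B a b = B b a) \<and>
    (\<forall>P\<in>S. \<forall>v. B (rep P) v = dotp (tm P) v)"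
proof -
  obtain P Q R T where P: "P \<in> S" "Q \<in> S" "R \<in> S" "T \<in> S" "P \<noteq> Q" "P \<noteq> R" "Q \<noteq> R"
    and T: "rep T \<notin> vec.span {rep R, rep Q, rep P}" by (rule ex_basis)
  let ?B = "{rep T, rep R, rep Q, rep P}"
  have i3: "vec.independent {rep R, rep Q, rep P}" "card {rep R, rep Q, rep P} = 3"
    by (rule indep3[OF S_rep(1)[OF P(1)] indep_two[OF P(1,2,5)] indep_three[OF P(1-3,5-7)]])+
  have Tn: "rep T \<notin> {rep R, rep Q, rep P}"
  proof
    assume "rep T \<in> {rep R, rep Q, rep P}"
    then have "rep T \<in> vec.span {rep R, rep Q, rep P}" by (rule vec.span_base)
    then show False using T by contradiction
  qed
  have ind: "vec.independent ?B" by (rule vec.independent_insertI[OF T i3(1)])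
  have "card ?B = Suc (card {rep R, rep Q, rep P})" by (rule card_insert_disjoint[OF _ Tn]) simp
  then have c4: "card ?B = 4" unfolding i3(2) by simp
  have sp: "vec.span ?B = UNIV"
  proof -
    have "UNIV \<subseteq> vec.span ?B"
      by (rule vec.card_ge_dim_independent[OF subset_UNIV ind]) (unfold c4 vec_dim_card, simp)
    then show ?thesis by (rule top.extremum_uniqueI)
  qed
  have repS: "pt (rep X) = X" if "X \<in> S" for X by (rule S_rep(2)[OF that])
  obtain g :: "'a ^ 4 \<Rightarrow> 'a ^ 4" where g: "Vector_Spaces.linear (*s) (*s) g" "\<forall>x\<in>?B. g x = tm (pt x)"
    using vec.linear_independent_extend[OF ind, of "\<lambda>x. tm (pt x)"] by blast
  define G where "G = matrix g"
  have G: "G *v x = g x" for x using g(1) by (simp add: G_def matrix_works)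
  define B where "B a b = dotp (G *v a) b" for a b
  have B1: "B (a + b) c = B a c + B b c" "B (k *s a) c = k * B a c"
    "B c (a + b) = B c a + B c b" "B c (k *s a) = k * B c a" for a b c k
    by (simp_all add: B_def matrix_vector_right_distrib dotp_simps vector_scalar_commute)
  have B0: "B 0 c = 0" "B c 0 = 0" for c by (simp_all add: B_def dotp_simps)
  have gB: "B (rep X) b = dotp (tm X) b" if "X \<in> {T, R, Q, P}" for X b
  proof -
    have "X \<in> S" "rep X \<in> ?B" using that P by blast+
    then show ?thesis using bspec[OF g(2), of "rep X"] repS by (simp only: B_def G)
  qed
  have symB: "B (rep X) (rep Y) = B (rep Y) (rep X)" if "X \<in> {T, R, Q, P}" "Y \<in> {T, R, Q, P}" for X Y
  proof -
    have "X \<in> S" "Y \<in> S" using that P by blast+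
    then show ?thesis using gB[OF that(1)] gB[OF that(2)] tm_sym[OF odd, of X Y] by (simp only:)
  qed
  have s1: "B a (rep Y) = B (rep Y) a" if Y: "Y \<in> {T, R, Q, P}" for a Y
  proof -
    have "vec.subspace {a. B a (rep Y) = B (rep Y) a}"
      by (rule vec.subspaceI) (simp_all add: B1 B0)
    moreover have "?B \<subseteq> {a. B a (rep Y) = B (rep Y) a}" using symB Y by blast
    ultimately have "vec.span ?B \<subseteq> {a. B a (rep Y) = B (rep Y) a}" by (rule vec.span_minimal[rotated])
    then show ?thesis using sp by blast
  qed
  have sym: "B a b = B b a" for a b
  proof -
    have "vec.subspace {b. B a b = B b a}"
      by (rule vec.subspaceI) (simp_all add: B1 B0)
    moreover have "?B \<subseteq> {b. B a b = B b a}" using s1 by blast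
    ultimately have "vec.span ?B \<subseteq> {b. B a b = B b a}" by (rule vec.span_minimal[rotated])
    then show ?thesis using sp by blast
  qed
  have f: "B (rep X) v = dotp (tm X) v" if X: "X \<in> S" for X v
  proof -
    have "vec.subspace {v. B (rep X) v = dotp (tm X) v}"
      by (rule vec.subspaceI) (simp_all add: B1 B0 dotp_simps)
    moreover have "B (rep X) (rep Y) = dotp (tm X) (rep Y)" if Y: "Y \<in> {T, R, Q, P}" for Y
    proof -
      have "Y \<in> S" using Y P by blast
      then show ?thesis using sym[of "rep X" "rep Y"] gB[OF Y, of "rep X"] tm_sym[OF odd X, of Y] by simp
    qed
    then have "?B \<subseteq> {v. B (rep X) v = dotp (tm X) v}" by blast
    ultimately have "vec.span ?B \<subseteq> {v. B (rep X) v = dotp (tm X) v}" by (rule vec.span_minimal[rotated])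
    then show ?thesis using sp by blast
  qed
  show ?thesis by (rule exI[of _ B]) (use B1 sym f in blast)
qed

end

section \<open>Two types of circles on an ovoid of odd order\<close>

locale odd_ovoid = ovoid_space S for S :: "('a::{field,finite} ^ 4) set set" +
  fixes B :: "'a ^ 4 \<Rightarrow> 'a ^ 4 \<Rightarrow> 'a"
  assumes odd: "odd CARD('a)"
    and Badd: "B (a + b) c = B a c + B b c" and Bscale: "B (k *s a) c = k * B a c"
    and Bsym: "B a b = B b a" and Btm: "P \<in> S \<Longrightarrow> B (rep P) v = dotp (tm P) v"
begin

lemma Badd2: "B c (a + b) = B c a + B c b" and Bscale2: "B c (k *s a) = k * B c a"
  using Badd[of a b c] Bscale[of k a c] Bsym by auto

lemma Bdiff: "B (a - b) c = B a c - B b c" "B c (a - b) = B c a - B c b"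
  using Badd[of "a - b" b c] Badd2[of c "a - b" b] by auto

lemma B0: "B 0 c = 0"
  using Bscale[of 0 0 c] by simp

lemmas B_simps = Badd Badd2 Bscale Bscale2 Bdiff

lemma Btf: "P \<in> S \<Longrightarrow> B (rep P) v = 0 \<longleftrightarrow> dotp (tf P) v = 0"
  by (simp add: Btm tm_zero_iff)

lemma B_rep: "P \<in> S \<Longrightarrow> B (rep P) (rep P) = 0"
  using Btf tf(1) by blast

lemma B_rep_nz: "P \<in> S \<Longrightarrow> Q \<in> S \<Longrightarrow> P \<noteq> Q \<Longrightarrow> B (rep P) (rep Q) \<noteq> 0"
  using Btf tf_nz by blast

text \<open>A direction of the tangent at \<open>X\<close> to the section by \<pi>. The square class
  of \<open>B t t\<close> is going to be the type of that circle.\<close>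

definition touch_vec :: "('a ^ 4) set \<Rightarrow> ('a ^ 4) set \<Rightarrow> 'a ^ 4 \<Rightarrow> bool" where
  "touch_vec \<pi> X t \<longleftrightarrow> X \<in> S \<and> X \<subseteq> \<pi> \<and> t \<in> \<pi> \<and> t \<notin> pt (rep X) \<and> B (rep X) t = 0"

lemma touch_vec_indep:
  assumes "touch_vec \<pi> X t" "Y \<in> S" "Y \<noteq> X"
  shows "t \<notin> vec.span {rep Y, rep X}"
proof
  assume "t \<in> vec.span {rep Y, rep X}"
  then obtain a b where t: "t = a *s rep Y + b *s rep X" unfolding in_span2 by blast
  have X: "X \<in> S" "B (rep X) t = 0" "t \<notin> pt (rep X)" using assms by (auto simp: touch_vec_def)
  have "a * B (rep X) (rep Y) = 0" using X(2) B_rep[OF X(1)] by (simp add: t B_simps)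
  then have "a = 0" using B_rep_nz[OF X(1) assms(2)] assms(3) by auto
  then show False using X(3) t by (auto simp: in_pt)
qed

lemma touch_vec_span:
  assumes "oval_plane S \<pi>" "touch_vec \<pi> X t" "Y \<in> S" "Y \<noteq> X" "Y \<subseteq> \<pi>"
  shows "\<pi> = vec.span {t, rep Y, rep X}"
proof -
  have pl: "pg_plane \<pi>" and sub: "vec.subspace \<pi>" using assms by (auto simp: oval_plane_def pg_plane_def)
  have X: "X \<in> S" "X \<subseteq> \<pi>" "t \<in> \<pi>" using assms by (auto simp: touch_vec_def)
  show ?thesis
  proof (rule pg_plane_eq[OF pl])
    show "rep X \<in> \<pi>" "rep Y \<in> \<pi>" "t \<in> \<pi>" using X assms sub_iff[OF _ sub] by simp_all
    show "rep X \<noteq> 0" using S_rep X by simp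
    show "rep Y \<notin> pt (rep X)" by (rule indep_two) (use X assms in auto)
    show "t \<notin> vec.span {rep Y, rep X}" by (rule touch_vec_indep[OF assms(2-4)])
  qed
qed

lemma ex_other:
  assumes "oval_plane S \<pi>"
  obtains Y where "Y \<in> S" "Y \<noteq> X" "Y \<subseteq> \<pi>"
proof -
  have "card (plane_section S \<pi>) = CARD('a) + 1" using assms by (auto simp: oval_plane_def oval_in_def)
  moreover have "card (plane_section S \<pi>) \<le> 1" if "plane_section S \<pi> \<subseteq> {X}"
    using card_mono[OF _ that] by simp
  ultimately have "\<not> plane_section S \<pi> \<subseteq> {X}" using card_field_ge2[where 'a='a] by auto
  then show thesis using that by (auto simp: plane_section_def)
qed

text \<open>Two tangent directions at \<open>X\<close> differ by a factor \<open>a\<close> and a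
  multiple of \<open>rep X\<close>. The latter is isotropic and orthogonal to \<open>t\<close>, so
  \<open>B t t\<close> is only multiplied by a^2.\<close>

lemma type_same_point:
  assumes "oval_plane S \<pi>" "touch_vec \<pi> X t" "touch_vec \<pi> X t'"
  shows "is_sq (B t' t') \<longleftrightarrow> is_sq (B t t)"
proof -
  obtain Y where Y: "Y \<in> S" "Y \<noteq> X" "Y \<subseteq> \<pi>" by (rule ex_other[OF assms(1)])
  have X: "X \<in> S" "B (rep X) t = 0" "t' \<in> \<pi>" "B (rep X) t' = 0" "t' \<notin> pt (rep X)"
    using assms by (auto simp: touch_vec_def)
  obtain a b c where t': "t' = a *s t + b *s rep Y + c *s rep X"
    using X(3) unfolding touch_vec_span[OF assms(1,2) Y] in_span3 by blast
  have "b * B (rep X) (rep Y) = 0" using X(2,4) B_rep[OF X(1)] by (simp add: t' B_simps)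
  then have b: "b = 0" using B_rep_nz[OF X(1) Y(1)] Y(2) by auto
  have a: "a \<noteq> 0" using X(5) t' b by (auto simp: in_pt)
  have "B t (rep X) = 0" using X Bsym by metis
  then have "B t' t' = a * a * B t t" using X(2) B_rep[OF X(1)] by (simp add: t' b B_simps)
  then show ?thesis using is_sq_mult_sq[OF a] by simp
qed

text \<open>Subtracting a suitable multiple of \<open>rep X\<close> turns a tangent direction at
  \<open>X\<close> into one at \<open>Y\<close>, and it keeps the value of \<open>B t t\<close>
  because \<open>rep X\<close> is isotropic and orthogonal to \<open>t\<close>.\<close>

lemma type_well_defined:
  assumes \<pi>: "oval_plane S \<pi>" and t: "touch_vec \<pi> X t" "touch_vec \<pi> Y t'"
  shows "is_sq (B t' t') \<longleftrightarrow> is_sq (B t t)"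
proof (cases "X = Y")
  case True
  then show ?thesis using type_same_point assms by blast
next
  case False
  have sub: "vec.subspace \<pi>" using \<pi> by (auto simp: oval_plane_def pg_plane_def)
  have X: "X \<in> S" "B (rep X) t = 0" "t \<in> \<pi>" "X \<subseteq> \<pi>" and Y: "Y \<in> S" "Y \<subseteq> \<pi>"
    using t by (auto simp: touch_vec_def)
  have tX: "B t (rep X) = 0" using X Bsym by metis
  define p where "p = B (rep Y) (rep X)"
  have p: "p \<noteq> 0" using B_rep_nz[OF Y(1) X(1)] False by (auto simp: p_def)
  define s where "s = t - (B (rep Y) t / p) *s rep X"
  have "B (rep Y) s = 0" using p by (simp add: s_def B_simps p_def)
  moreover have "s \<in> \<pi>" using X sub sub_iff[OF X(1) sub] by (auto simp: s_def intro: vec.subspace_diff vec.subspace_scale)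
  moreover have "s \<notin> pt (rep Y)"
  proof
    assume "s \<in> pt (rep Y)"
    then obtain k where "s = k *s rep Y" by (auto simp: in_pt)
    then have "t = k *s rep Y + (B (rep Y) t / p) *s rep X" by (simp add: s_def algebra_simps)
    then have "t \<in> vec.span {rep Y, rep X}" unfolding in_span2 by blast
    then show False using touch_vec_indep[OF t(1) Y(1)] False by blast
  qed
  ultimately have "touch_vec \<pi> Y s" using Y by (simp add: touch_vec_def)
  moreover have "B s s = B t t" using X(2) tX B_rep[OF X(1)] by (simp add: s_def B_simps)
  ultimately show ?thesis using type_same_point[OF \<pi> _ t(2)] by metis
qed

definition ty :: "('a ^ 4) set set \<Rightarrow> bool" where
  "ty c \<longleftrightarrow> (\<exists>\<pi> X t. oval_plane S \<pi> \<and> c = plane_section S \<pi> \<and> touch_vec \<pi> X t \<and> is_sq (B t t))"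

lemma ty_iff:
  assumes \<pi>: "oval_plane S \<pi>" and t: "touch_vec \<pi> X t" and q: "CARD('a) \<ge> 2"
  shows "ty (plane_section S \<pi>) \<longleftrightarrow> is_sq (B t t)"
proof
  assume "ty (plane_section S \<pi>)"
  then obtain \<pi>' Y t' where *: "oval_plane S \<pi>'" "plane_section S \<pi> = plane_section S \<pi>'"
    "touch_vec \<pi>' Y t'" "is_sq (B t' t')" by (auto simp: ty_def)
  have "card (plane_section S \<pi>) \<ge> 3" using \<pi> q by (auto simp: oval_plane_def oval_in_def)
  then obtain D where D: "D \<subseteq> plane_section S \<pi>" "card D = 3" by (rule obtain_subset_with_card_n)
  then obtain P Q R where P: "P \<in> plane_section S \<pi>" "Q \<in> plane_section S \<pi>" "R \<in> plane_section S \<pi>"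
    "P \<noteq> Q" "P \<noteq> R" "Q \<noteq> R" by (auto simp: card_3_iff)
  have "\<pi> = \<pi>'" using oval_plane_eq[OF \<pi> P] oval_plane_eq[OF *(1) P[unfolded *(2)]] by simp
  then show "is_sq (B t t)" using type_well_defined[OF \<pi> t] * by blast
next
  assume "is_sq (B t t)"
  then show "ty (plane_section S \<pi>)" using \<pi> t unfolding ty_def by blast
qed

text \<open>The line in which the two planes intersect passes through \<open>X\<close> and contains
  no other point of \<open>S\<close>, so it is the tangent at \<open>X\<close> of both sections;
  \<open>t\<close> is a second vector on it. Touching circles therefore have the same type.\<close>

lemma touching_common_vec:
  assumes \<pi>: "oval_plane S \<pi>" "oval_plane S \<pi>'" and X: "plane_section S \<pi> \<inter> plane_section S \<pi>' = {X}"
  obtains t where "touch_vec \<pi> X t" "touch_vec \<pi>' X t"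
proof -
  have sub: "vec.subspace \<pi>" "vec.subspace \<pi>'" using \<pi> by (auto simp: oval_plane_def pg_plane_def)
  have XS: "X \<in> S" "X \<subseteq> \<pi>" "X \<subseteq> \<pi>'" using X by (auto simp: plane_section_def)
  have Xr: "rep X \<in> \<pi>" "rep X \<in> \<pi>'" using XS sub_iff sub by blast+
  obtain n where n: "\<pi> = {v. dotp n v = 0}" using plane_kernel \<pi>(1) by (metis oval_plane_def)
  obtain Y where Y: "Y \<in> S" "Y \<noteq> X" "Y \<subseteq> \<pi>'" by (rule ex_other[OF \<pi>(2)])
  have Yr: "rep Y \<in> \<pi>'" using Y sub_iff sub by blast
  have Yn: "dotp n (rep Y) \<noteq> 0"
  proof
    assume "dotp n (rep Y) = 0"
    then have "Y \<subseteq> \<pi>" using n sub_iff[OF Y(1) sub(1)] by blast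
    then show False using X Y by (auto simp: plane_section_def)
  qed
  have "\<not> \<pi>' \<subseteq> vec.span {rep Y, rep X}"
  proof
    assume "\<pi>' \<subseteq> vec.span {rep Y, rep X}"
    then have "vec.dim \<pi>' \<le> card {rep Y, rep X}" by (rule vec.dim_le_card) simp
    then show False using \<pi>(2) indep2(2)[OF S_rep(1)[OF XS(1)] indep_two[OF XS(1) Y(1)]] Y(2)
      by (simp add: oval_plane_def pg_plane_def)
  qed
  then obtain w where w: "w \<in> \<pi>'" "w \<notin> vec.span {rep Y, rep X}" by blast
  define t where "t = w - (dotp n w / dotp n (rep Y)) *s rep Y"
  have t1: "t \<in> \<pi>" using Yn by (simp add: n t_def dotp_diff dotp_simps)
  have t2: "t \<in> \<pi>'" using w Yr sub by (auto simp: t_def intro: vec.subspace_diff vec.subspace_scale)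
  have t3: "t \<notin> pt (rep X)"
  proof
    assume "t \<in> pt (rep X)"
    then obtain k where "t = k *s rep X" by (auto simp: in_pt)
    then have "w = (dotp n w / dotp n (rep Y)) *s rep Y + k *s rep X" by (simp add: t_def algebra_simps)
    then have "w \<in> vec.span {rep Y, rep X}" unfolding in_span2 by blast
    then show False using w by blast
  qed
  have "Z = X" if Z: "Z \<in> S" "rep Z \<in> vec.span {t, rep X}" for Z
  proof -
    have "vec.span {t, rep X} \<subseteq> \<pi>" "vec.span {t, rep X} \<subseteq> \<pi>'"
      by (rule vec.span_minimal; use t1 t2 Xr sub in simp)+
    then have "Z \<subseteq> \<pi>" "Z \<subseteq> \<pi>'" using Z sub_iff sub by blast+
    then show "Z = X" using X Z by (auto simp: plane_section_def)
  qed
  then have "tangent_line S (vec.span {t, rep X})" using tangent_at_iff[OF XS(1) t3] by blast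
  then have "B (rep X) t = 0" using tf(2)[OF XS(1) t3] Btf[OF XS(1)] by blast
  then show thesis using that XS t1 t2 t3 by (simp add: touch_vec_def)
qed

text \<open>The vectors orthogonal to two points \<open>P\<close>, \<open>Q\<close> of
  \<open>S\<close> form a two-dimensional space on which \<open>B\<close> is anisotropic. Each
  nonzero \<open>s\<close> in it is a tangent direction at \<open>P\<close> to the section by the
  plane of \<open>P\<close>, \<open>Q\<close> and \<open>s\<close>. It remains to see that the
  binary form \<open>B s s\<close> takes square and nonsquare values.\<close>

lemma ex_types: "(\<exists>c\<in>ovoidal_circles S. ty c) \<and> (\<exists>c\<in>ovoidal_circles S. \<not> ty c)"
proof -
  obtain P Q R T where P: "P \<in> S" "Q \<in> S" "R \<in> S" "T \<in> S" "P \<noteq> Q" "P \<noteq> R" "Q \<noteq> R"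
    and T: "rep T \<notin> vec.span {rep R, rep Q, rep P}" by (rule ex_basis)
  define u v where "u = rep P" and "v = rep Q"
  define p where "p = B u v"
  have p: "p \<noteq> 0" using B_rep_nz[OF P(1,2,5)] by (simp add: p_def u_def v_def)
  have vu: "B v u = p" "B u u = 0" "B v v = 0" "B u v = p"
    using Bsym B_rep P by (simp_all add: p_def u_def v_def)
  define W where "W = {s. B u s = 0 \<and> B v s = 0 \<and> s \<noteq> 0}"
  have uv: "u \<noteq> 0" "v \<notin> pt u" using S_rep(1)[OF P(1)] indep_two[OF P(1,2,5)] by (auto simp: u_def v_def)
  \<comment> \<open>A third point of the section, with coordinates a, b, c, is isotropic, which
    reads a^2 B s s + 2 b c p = 0. The coordinates b and c are nonzero, and 2 b c p is nonzero as
    \<open>q\<close> is odd, so B s s cannot vanish.\<close>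
  have key: "\<exists>\<pi>. oval_plane S \<pi> \<and> touch_vec \<pi> P s \<and> B s s \<noteq> 0" if s: "s \<in> W" for s
  proof -
    have s': "B u s = 0" "B v s = 0" "s \<noteq> 0" "B s u = 0" "B s v = 0" using s Bsym by (auto simp: W_def)
    have ns: "s \<notin> vec.span {v, u}"
    proof
      assume "s \<in> vec.span {v, u}"
      then obtain a b where ab: "s = a *s v + b *s u" unfolding in_span2 by blast
      have "a * p = 0" "b * p = 0" using s'(1,2) vu by (simp_all add: ab B_simps)
      then show False using ab p s'(3) by simp
    qed
    let ?\<pi> = "vec.span {s, v, u}"
    have pl: "pg_plane ?\<pi>" by (rule pg_plane_span[OF uv ns])
    have in\<pi>: "P \<subseteq> ?\<pi>" "Q \<subseteq> ?\<pi>"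
      using sub_iff[OF _ vec.subspace_span] P by (simp_all add: vec.span_base u_def v_def)
    have ovp: "oval_plane S ?\<pi>" by (rule oval_planeI'[OF pl P(1,2,5) in\<pi>])
    have "pt u \<subseteq> vec.span {v, u}" by (rule vec.span_mono) simp
    then have tv: "touch_vec ?\<pi> P s"
      using P(1) in\<pi> s' ns vec.span_base[of s "{s, v, u}"] by (auto simp: touch_vec_def u_def)
    have "card (plane_section S ?\<pi>) = CARD('a) + 1" using ovp by (auto simp: oval_plane_def oval_in_def)
    moreover have "card (plane_section S ?\<pi>) \<le> 2" if "plane_section S ?\<pi> \<subseteq> {P, Q}"
      using card_mono[OF _ that] P(5) by simp
    moreover have "CARD('a) \<ge> 3"
    proof -
      have "CARD('a) \<noteq> 2" using odd by auto
      then show ?thesis using card_field_ge2[where 'a='a] by linarith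
    qed
    ultimately have "\<not> plane_section S ?\<pi> \<subseteq> {P, Q}" by auto
    then obtain X where X: "X \<in> S" "X \<noteq> P" "X \<noteq> Q" "X \<subseteq> ?\<pi>" by (auto simp: plane_section_def)
    have "rep X \<in> ?\<pi>" using X sub_iff[OF X(1) vec.subspace_span] by blast
    then obtain a b c where x: "rep X = a *s s + b *s v + c *s u" unfolding in_span3 by blast
    have "B u (rep X) \<noteq> 0" "B v (rep X) \<noteq> 0"
      using B_rep_nz[OF P(1) X(1)] B_rep_nz[OF P(2) X(1)] X by (auto simp: u_def v_def)
    then have "b \<noteq> 0" "c \<noteq> 0" using s' vu by (auto simp: x B_simps)
    moreover have "a * a * B s s + (b * c * p + b * c * p) = 0"
    proof -
      have "B (rep X) (rep X) = a * a * B s s + (b * c * p + b * c * p)"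
        unfolding x using s' vu by (simp add: B_simps algebra_simps)
      then show ?thesis using B_rep[OF X(1)] by simp
    qed
    moreover have "b * c * p + b * c * p \<noteq> 0" if "b * c * p \<noteq> 0"
      using not_neg_self[OF odd that] by (simp add: add_eq_0_iff)
    ultimately have "B s s \<noteq> 0" using p by auto
    then show ?thesis using ovp tv by blast
  qed
  \<comment> \<open>Orthogonal projection onto the complement of \<open>u\<close> and
    \<open>v\<close>. The projections of \<open>R\<close> and \<open>T\<close> remain independent
    because the four points form a basis.\<close>
  define pr where "pr w = w - (B v w / p) *s u - (B u w / p) *s v" for w
  define s1 s2 where "s1 = pr (rep R)" and "s2 = pr (rep T)"
  have prW: "B u (pr w) = 0" "B v (pr w) = 0" for w using p vu by (simp_all add: pr_def B_simps)
  have comb: "a *s s1 + b *s s2 \<in> W" if "a \<noteq> 0 \<or> b \<noteq> 0" for a b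
  proof -
    have "a *s s1 + b *s s2 \<noteq> 0"
    proof
      assume 0: "a *s s1 + b *s s2 = 0"
      define cu cv where "cu = a * (B v (rep R) / p) + b * (B v (rep T) / p)"
        and "cv = a * (B u (rep R) / p) + b * (B u (rep T) / p)"
      have e: "b *s rep T = (- a) *s rep R + cv *s v + cu *s u"
      proof -
        have "b *s rep T - ((- a) *s rep R + cv *s v + cu *s u) = a *s s1 + b *s s2"
          by (simp add: s1_def s2_def pr_def cu_def cv_def vec.scale_right_diff_distrib vec.scale_left_distrib)
        then show ?thesis using 0 by simp
      qed
      then have "b *s rep T \<in> vec.span {rep R, rep Q, rep P}" unfolding in_span3 u_def v_def by blast
      then have b: "b = 0" using scale_in_span T by blast
      then have "a *s rep R = cv *s v + cu *s u" using e by (simp add: algebra_simps)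
      then have "a *s rep R \<in> vec.span {rep Q, rep P}" unfolding in_span2 u_def v_def by blast
      then have "a = 0" using scale_in_span indep_three[OF P(1-3,5-7)] by blast
      then show False using that b by simp
    qed
    then show ?thesis by (simp add: W_def B_simps prW s1_def s2_def)
  qed
  have ex_ty: "\<exists>c\<in>ovoidal_circles S. ty c \<longleftrightarrow> is_sq (B s s)" if s: "s \<in> W" for s
  proof -
    obtain \<pi> where \<pi>: "oval_plane S \<pi>" "touch_vec \<pi> P s" using key[OF s] by blast
    then show ?thesis using ty_iff[OF \<pi> card_field_ge2] by (auto simp: ovoidal_circles_def)
  qed
  \<comment> \<open>If all values \<epsilon> B s s were squares, completing the square on s1 + k s2
    would make x^2 + D a square for every x, where the discriminant D is nonzero by anisotropy. With
    \<epsilon> = 1 this yields a nonsquare value of the form, with \<epsilon> a nonsquare it yields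
    a square value.\<close>
  have mix: "\<exists>s\<in>W. \<not> is_sq (\<epsilon> * B s s)" if \<epsilon>: "\<epsilon> \<noteq> 0" for \<epsilon>
  proof (rule ccontr)
    assume "\<not> ?thesis"
    then have all: "is_sq (\<epsilon> * B s s)" if "s \<in> W" for s using that by blast
    define a b c where "a = \<epsilon> * B s1 s1" and "b = \<epsilon> * B s1 s2" and "c = \<epsilon> * B s2 s2"
    have s2W: "s2 \<in> W" using comb[of 0 1] by simp
    have c: "c \<noteq> 0" "is_sq c" using key[OF s2W] all[OF s2W] \<epsilon> by (auto simp: c_def)
    define D where "D = a * c - b * b"
    have s21: "B s2 s1 = B s1 s2" by (rule Bsym)
    have "c *s s1 + (- b) *s s2 \<in> W" by (rule comb) (use c in simp)
    from key[OF this] have "\<epsilon> * B (c *s s1 + (- b) *s s2) (c *s s1 + (- b) *s s2) \<noteq> 0" using \<epsilon> by auto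
    moreover have "\<epsilon> * B (c *s s1 + (- b) *s s2) (c *s s1 + (- b) *s s2) = c * D"
    proof -
      have "B (c *s s1 + (- b) *s s2) (c *s s1 + (- b) *s s2)
          = c * (c * B s1 s1) - c * (b * B s1 s2) - b * (c * B s1 s2) + b * (b * B s2 s2)"
        unfolding Badd Badd2 Bscale Bscale2 s21 by (simp add: algebra_simps)
      then have "\<epsilon> * B (c *s s1 + (- b) *s s2) (c *s s1 + (- b) *s s2)
          = c * (c * (\<epsilon> * B s1 s1)) - c * (b * (\<epsilon> * B s1 s2)) - b * (c * (\<epsilon> * B s1 s2)) + b * (b * (\<epsilon> * B s2 s2))"
        by (simp only:) (simp add: algebra_simps)
      then have "\<epsilon> * B (c *s s1 + (- b) *s s2) (c *s s1 + (- b) *s s2)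
          = c * (c * a) - c * (b * b) - b * (c * b) + b * (b * c)"
        by (simp only: a_def[symmetric] b_def[symmetric] c_def[symmetric])
      then show ?thesis by (simp add: D_def algebra_simps)
    qed
    ultimately have D: "D \<noteq> 0" by auto
    have "is_sq (x * x + D)" for x
    proof -
      define k where "k = (x - b) / c"
      have x: "x = c * k + b" using c by (simp add: k_def)
      have "is_sq (\<epsilon> * B (1 *s s1 + k *s s2) (1 *s s1 + k *s s2))" by (rule all, rule comb) simp
      moreover have "\<epsilon> * B (1 *s s1 + k *s s2) (1 *s s1 + k *s s2) = a + k * b + k * b + k * k * c"
        unfolding Badd Badd2 Bscale Bscale2 s21 by (simp add: a_def b_def c_def algebra_simps)
      ultimately have "is_sq (c * (a + k * b + k * b + k * k * c))" using is_sq_mult[OF c(2)] by simp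
      moreover have "c * (a + k * b + k * b + k * k * c) = x * x + D" by (simp add: x D_def algebra_simps)
      ultimately show ?thesis by simp
    qed
    then show False using ex_sq_plus_nonsq[OF odd D] by blast
  qed
  obtain \<nu> :: 'a where \<nu>: "\<not> is_sq \<nu>" using ex_nonsq[OF odd] by blast
  have \<nu>0: "\<nu> \<noteq> 0" using \<nu> by (auto simp: is_sq_def)
  obtain s where s: "s \<in> W" "\<not> is_sq (B s s)" using mix[of 1] by auto
  obtain s' where s': "s' \<in> W" "\<not> is_sq (\<nu> * B s' s')" using mix[OF \<nu>0] by blast
  then have "is_sq (B s' s')" using is_sq_mult_nonsq[OF \<nu>] by blast
  then show ?thesis using ex_ty[OF s(1)] ex_ty[OF s'(1)] s(2) by blast
qed

end

context ovoid_space
begin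

text \<open>For even \<open>q\<close> the number r = q + 1 is odd and parity suffices; for odd
  \<open>q\<close> the types are the square classes of the polar form on tangent directions.\<close>

theorem ovoid_common_point:
  assumes F: "intersecting_family (ovoidal_circles S) F"
    and size: "real (card F) \<ge> 1 / sqrt 2 * real CARD('a) ^ 2 + 2 * sqrt 2 * real CARD('a) + 8"
  shows "\<exists>P\<in>S. \<forall>c\<in>F. P \<in> c"
proof -
  interpret circle_plane S "ovoidal_circles S" "(\<noteq>)" "CARD('a)" "CARD('a) + 1" "CARD('a) + 1" 1 0
    by (rule ovoid_plane)
  have "\<exists>ty. odd (CARD('a) + 1) \<or> odd CARD('a) \<and> even (0::nat) \<and> two_types ty"
  proof (cases "odd CARD('a)")
    case True
    obtain B where B: "\<forall>a b c. B (a + b) c = B a c + B b c" "\<forall>k a c. B (k *s a) c = k * B a c"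
      "\<forall>a b. B a b = B b a" "\<forall>P\<in>S. \<forall>v. B (rep P) v = dotp (tm P) v"
      using polar_form[OF True] by (elim exE conjE)
    interpret o: odd_ovoid S B by unfold_locales (use True B in auto)
    have "o.ty c = o.ty d" if cd: "c \<in> ovoidal_circles S" "d \<in> ovoidal_circles S" "touching c d" for c d
    proof -
      obtain \<pi> where \<pi>: "c = plane_section S \<pi>" "oval_plane S \<pi>" using cd by (auto simp: ovoidal_circles_def)
      obtain \<pi>' where \<pi>': "d = plane_section S \<pi>'" "oval_plane S \<pi>'" using cd by (auto simp: ovoidal_circles_def)
      obtain X where X: "plane_section S \<pi> \<inter> plane_section S \<pi>' = {X}" using cd \<pi> \<pi>' by (auto elim: touchingE)
      obtain t where t: "o.touch_vec \<pi> X t" "o.touch_vec \<pi>' X t" by (rule o.touching_common_vec[OF \<pi>(2) \<pi>'(2) X])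
      show ?thesis
        using o.ty_iff[OF \<pi>(2) t(1) card_field_ge2] o.ty_iff[OF \<pi>'(2) t(2) card_field_ge2] \<pi> \<pi>' by simp
    qed
    then have "two_types o.ty" using o.ex_types by (auto simp: two_types_def)
    then show ?thesis using True by blast
  qed simp
  then obtain ty where "odd (CARD('a) + 1) \<or> odd CARD('a) \<and> even (0::nat) \<and> two_types ty" ..
  then show ?thesis
    using common_point[of ty F] F size by (auto simp: intersecting_family_def)
qed

end

section \<open>Ovals and their nuclei\<close>

lemma line_other:
  assumes "pg_line l"
  obtains w where "w \<in> l" "w \<notin> pt z"
proof -
  have "\<not> l \<subseteq> pt z"
  proof
    assume "l \<subseteq> pt z"
    then have "vec.dim l \<le> card {z}" by (rule vec.dim_le_card) simp
    then show False using assms by (simp add: pg_line_def)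
  qed
  then show thesis using that by blast
qed

lemma plane_other:
  assumes "pg_plane \<pi>"
  obtains w where "w \<in> \<pi>" "w \<notin> vec.span {v, u}"
proof -
  have "\<not> \<pi> \<subseteq> vec.span {v, u}"
  proof
    assume "\<pi> \<subseteq> vec.span {v, u}"
    then have "vec.dim \<pi> \<le> card {v, u}" by (rule vec.dim_le_card) simp
    moreover have "card {v, u} \<le> 2" by (simp add: card_insert_if)
    ultimately show False using assms by (simp add: pg_plane_def)
  qed
  then show thesis using that by blast
qed

locale oval_points =
  fixes \<pi> :: "('a::{field,finite} ^ 4) set" and A :: "('a ^ 4) set set"
  assumes plane: "pg_plane \<pi>" and points: "X \<in> A \<Longrightarrow> pg_point X" and in_plane: "X \<in> A \<Longrightarrow> X \<subseteq> \<pi>"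
    and arc: "no_three_collinear A" and card_A: "card A = CARD('a) + 1"
begin

lemma sub: "vec.subspace \<pi>"
  using plane by (simp add: pg_plane_def)

lemma A_rep: "X \<in> A \<Longrightarrow> rep X \<noteq> 0" "X \<in> A \<Longrightarrow> pt (rep X) = X"
  using rep[OF points] by auto

lemma A_sub_iff: "X \<in> A \<Longrightarrow> vec.subspace l \<Longrightarrow> X \<subseteq> l \<longleftrightarrow> rep X \<in> l"
  using pt_subset_iff[of l "rep X"] A_rep(2) by simp

lemma rep_in: "X \<in> A \<Longrightarrow> rep X \<in> \<pi>"
  using A_sub_iff[OF _ sub] in_plane by blast

lemma rep_notin_pt:
  assumes "X \<in> A" "y \<noteq> 0" "pt y \<noteq> X"
  shows "rep X \<notin> pt y"
proof
  assume "rep X \<in> pt y"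
  then obtain k where k: "rep X = k *s y" unfolding in_pt by blast
  then have "k \<noteq> 0" using A_rep(1)[OF assms(1)] by auto
  then have "pt (rep X) = pt y" using pt_eq_iff[OF A_rep(1)[OF assms(1)]] k by blast
  then show False using A_rep(2)[OF assms(1)] assms(3) by simp
qed

lemma two: "X \<in> A \<Longrightarrow> Y \<in> A \<Longrightarrow> X \<noteq> Y \<Longrightarrow> rep Y \<notin> pt (rep X)"
  using rep_notin_pt[of Y "rep X"] A_rep by simp

lemma three:
  assumes "X \<in> A" "Y \<in> A" "Z \<in> A" "X \<noteq> Y" "X \<noteq> Z" "Y \<noteq> Z" "pg_line l" "rep X \<in> l" "rep Y \<in> l"
  shows "rep Z \<notin> l"
proof
  assume Z: "rep Z \<in> l"
  have sl: "vec.subspace l" using assms by (simp add: pg_line_def)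
  have "X \<subseteq> l" "Y \<subseteq> l" "Z \<subseteq> l" using A_sub_iff[OF _ sl] assms Z by blast+
  then have "\<exists>l. pg_line l \<and> X \<subseteq> l \<and> Y \<subseteq> l \<and> Z \<subseteq> l" using assms(7) by blast
  moreover have "\<not> (\<exists>l. pg_line l \<and> X \<subseteq> l \<and> Y \<subseteq> l \<and> Z \<subseteq> l)"
    using arc[unfolded no_three_collinear_def, rule_format, OF assms(1-3)] assms(4-6) by blast
  ultimately show False by blast
qed

definition lines_at :: "'a ^ 4 \<Rightarrow> ('a ^ 4) set set" where
  "lines_at u = {l. pg_line l \<and> l \<subseteq> \<pi> \<and> u \<in> l}"

lemma line_in_lines_at:
  assumes "u \<in> \<pi>" "u \<noteq> 0" "v \<in> \<pi>" "v \<notin> pt u"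
  shows "vec.span {v, u} \<in> lines_at u"
proof -
  have "vec.span {v, u} \<subseteq> \<pi>" by (rule vec.span_minimal[OF _ sub]) (use assms in simp)
  moreover have "u \<in> vec.span {v, u}" by (rule vec.span_base) simp
  ultimately show ?thesis using pg_line_span[OF assms(2,4)] by (simp add: lines_at_def)
qed

lemma lines_at_eq:
  assumes "l \<in> lines_at u" "u \<noteq> 0" "v \<in> l" "v \<notin> pt u"
  shows "l = vec.span {v, u}"
  using assms pg_line_eq[of l u v] by (simp add: lines_at_def)

text \<open>At a point of the oval \<open>q\<close> of these lines are secants, so this bound leaves
  room for a single tangent.\<close>

lemma card_lines_at:
  assumes u: "u \<in> \<pi>" "u \<noteq> 0"
  shows "card (lines_at u) \<le> CARD('a) + 1"
proof -
  obtain v where v: "v \<in> \<pi>" "v \<notin> vec.span {u, u}" by (rule plane_other[OF plane])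
  then have v': "v \<notin> pt u" by simp
  obtain w where w: "w \<in> \<pi>" "w \<notin> vec.span {v, u}" by (rule plane_other[OF plane])
  have \<pi>: "\<pi> = vec.span {w, v, u}" by (rule pg_plane_eq[OF plane u(1) v(1) w(1) u(2) v' w(2)])
  have "lines_at u \<subseteq> insert (vec.span {w, u}) (range (\<lambda>t. vec.span {v + t *s w, u}))"
  proof
    fix l assume l: "l \<in> lines_at u"
    then have lp: "pg_line l" "l \<subseteq> \<pi>" "u \<in> l" "vec.subspace l" by (auto simp: lines_at_def pg_line_def)
    obtain x where x: "x \<in> l" "x \<notin> pt u" by (rule line_other[OF lp(1)])
    have "x \<in> vec.span {w, v, u}" using x(1) lp(2) \<pi> by blast
    then obtain a b c where abc: "x = a *s w + b *s v + c *s u" unfolding in_span3 by blast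
    have in_l: "x - c *s u \<in> l" by (rule vec.subspace_diff[OF lp(4) x(1) vec.subspace_scale[OF lp(4,3)]])
    show "l \<in> insert (vec.span {w, u}) (range (\<lambda>t. vec.span {v + t *s w, u}))"
    proof (cases "b = 0")
      case True
      then have a: "a \<noteq> 0" using x(2) abc by (auto simp: in_pt)
      have "inverse a *s (x - c *s u) \<in> l" by (rule vec.subspace_scale[OF lp(4) in_l])
      moreover have "inverse a *s (x - c *s u) = w" using a True by (simp add: abc)
      moreover have "w \<notin> pt u"
      proof
        assume "w \<in> pt u"
        then have "w \<in> vec.span {v, u}" using vec.span_mono[of "{u}" "{v, u}"] by blast
        then show False using w(2) by contradiction
      qed
      ultimately have "l = vec.span {w, u}" using lines_at_eq[OF l u(2)] by metis
      then show ?thesis by blast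
    next
      case False
      have "inverse b *s (x - c *s u) \<in> l" by (rule vec.subspace_scale[OF lp(4) in_l])
      moreover have "inverse b *s (x - c *s u) = v + (a / b) *s w"
        using False by (simp add: abc vec.scale_right_distrib divide_inverse mult.commute)
      moreover have "v + (a / b) *s w \<notin> pt u"
      proof
        assume "v + (a / b) *s w \<in> pt u"
        then obtain k where "v + (a / b) *s w = k *s u" unfolding in_pt by blast
        then have "(a / b) *s w + 1 *s v + 0 *s u = 0 *s w + 0 *s v + k *s u" by (simp add: add.commute)
        then have "(1::'a) = 0" by (rule coords_unique(2)[OF u(2) v' w(2)])
        then show False by simp
      qed
      ultimately have "l = vec.span {v + (a / b) *s w, u}" using lines_at_eq[OF l u(2)] by metis
      then show ?thesis by blast
    qed
  qed
  then have "card (lines_at u) \<le> card (insert (vec.span {w, u}) (range (\<lambda>t. vec.span {v + t *s w, u})))"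
    by (rule card_mono[rotated]) simp
  also have "\<dots> \<le> Suc (card (range (\<lambda>t. vec.span {v + t *s w, u})))" by (simp add: card_insert_if)
  also have "\<dots> \<le> Suc CARD('a)" by (simp add: card_image_le)
  finally show ?thesis by simp
qed

definition tan :: "('a ^ 4) set \<Rightarrow> ('a ^ 4) set \<Rightarrow> bool" where
  "tan X l \<longleftrightarrow> X \<in> A \<and> l \<in> lines_at (rep X) \<and> (\<forall>Y\<in>A. rep Y \<in> l \<longrightarrow> Y = X)"

lemma tanI:
  assumes "X \<in> A" "l \<in> lines_at (rep X)" "\<And>Y. Y \<in> A \<Longrightarrow> rep Y \<in> l \<Longrightarrow> Y = X"
  shows "tan X l"
  unfolding tan_def by (intro conjI ballI impI) (fact assms)+

lemma secants_at:
  assumes X: "X \<in> A"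
  shows "inj_on (\<lambda>Y. vec.span {rep Y, rep X}) (A - {X})"
    "(\<lambda>Y. vec.span {rep Y, rep X}) ` (A - {X}) \<subseteq> lines_at (rep X)"
    "card ((\<lambda>Y. vec.span {rep Y, rep X}) ` (A - {X})) = CARD('a)"
proof -
  show inj: "inj_on (\<lambda>Y. vec.span {rep Y, rep X}) (A - {X})"
  proof (rule inj_onI)
    fix Y Z assume Y: "Y \<in> A - {X}" and Z: "Z \<in> A - {X}" and e: "vec.span {rep Y, rep X} = vec.span {rep Z, rep X}"
    have l: "pg_line (vec.span {rep Y, rep X})" by (rule pg_line_span[OF A_rep(1)[OF X] two]) (use X Y in auto)
    have "rep X \<in> vec.span {rep Y, rep X}" "rep Y \<in> vec.span {rep Y, rep X}" by (rule vec.span_base, simp)+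
    moreover have "rep Z \<in> vec.span {rep Y, rep X}" unfolding e by (rule vec.span_base) simp
    ultimately show "Y = Z" using three[OF X, of Y Z "vec.span {rep Y, rep X}"] l Y Z by blast
  qed
  show "(\<lambda>Y. vec.span {rep Y, rep X}) ` (A - {X}) \<subseteq> lines_at (rep X)"
  proof
    fix l assume "l \<in> (\<lambda>Y. vec.span {rep Y, rep X}) ` (A - {X})"
    then obtain Y where Y: "Y \<in> A" "Y \<noteq> X" "l = vec.span {rep Y, rep X}" by blast
    show "l \<in> lines_at (rep X)"
      unfolding Y(3) by (rule line_in_lines_at[OF rep_in[OF X] A_rep(1)[OF X] rep_in[OF Y(1)] two[OF X Y(1)]]) (use Y in simp)
  qed
  show "card ((\<lambda>Y. vec.span {rep Y, rep X}) ` (A - {X})) = CARD('a)"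
    using card_image[OF inj] X card_A by simp
qed

lemma tan_not_secant: "tan X l \<Longrightarrow> l \<notin> (\<lambda>Y. vec.span {rep Y, rep X}) ` (A - {X})"
proof
  assume t: "tan X l" and "l \<in> (\<lambda>Y. vec.span {rep Y, rep X}) ` (A - {X})"
  then obtain Y where Y: "Y \<in> A" "Y \<noteq> X" "l = vec.span {rep Y, rep X}" by blast
  have "rep Y \<in> l" unfolding Y(3) by (rule vec.span_base) simp
  then show False using t Y by (simp add: tan_def)
qed

lemma tan_unique:
  assumes "tan X l" "tan X l'"
  shows "l = l'"
proof (rule ccontr)
  assume ne: "l \<noteq> l'"
  have X: "X \<in> A" using assms by (simp add: tan_def)
  let ?I = "(\<lambda>Y. vec.span {rep Y, rep X}) ` (A - {X})"
  have "insert l (insert l' ?I) \<subseteq> lines_at (rep X)"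
    using secants_at(2)[OF X] assms by (simp add: tan_def)
  then have "card (insert l (insert l' ?I)) \<le> CARD('a) + 1"
    using card_mono[of "lines_at (rep X)" "insert l (insert l' ?I)"] card_lines_at[OF rep_in[OF X] A_rep(1)[OF X]] by simp
  moreover have "card (insert l (insert l' ?I)) = CARD('a) + 2"
    using tan_not_secant[OF assms(1)] tan_not_secant[OF assms(2)] ne secants_at(3)[OF X] by simp
  ultimately show False by simp
qed

text \<open>The lines of the plane through \<open>y\<close> partition the oval, whose size q + 1 is
  odd, so one of them meets it in an odd number of points. That number is at most two, hence
  one.\<close>

lemma tan_through:
  assumes ev: "even CARD('a)" and y: "y \<in> \<pi>" "y \<noteq> 0" "pt y \<notin> A"
  obtains X l where "tan X l" "y \<in> l"
proof -
  have fin: "finite A" using card_A by (intro card_ge_0_finite) simp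
  have "(\<Sum>l\<in>lines_at y. card {X\<in>A. rep X \<in> l}) = 1 * card A"
  proof (rule sum_multicount)
    show "\<forall>X\<in>A. card {l\<in>lines_at y. rep X \<in> l} = 1"
    proof
      fix X assume X: "X \<in> A"
      have n: "rep X \<notin> pt y" by (rule rep_notin_pt[OF X y(2)]) (use y X in blast)
      show "card {l\<in>lines_at y. rep X \<in> l} = 1"
      proof (rule card_1I)
        show "vec.span {rep X, y} \<in> {l\<in>lines_at y. rep X \<in> l}"
          using line_in_lines_at[OF y(1,2) rep_in[OF X] n] vec.span_base[of "rep X" "{rep X, y}"] by simp
        fix l assume "l \<in> {l\<in>lines_at y. rep X \<in> l}"
        then show "l = vec.span {rep X, y}" using lines_at_eq[OF _ y(2) _ n] by simp
      qed
    qed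
  qed (use fin in auto)
  then have "odd (\<Sum>l\<in>lines_at y. card {X\<in>A. rep X \<in> l})" using ev card_A by simp
  moreover have "even (\<Sum>l\<in>lines_at y. card {X\<in>A. rep X \<in> l})"
    if "\<forall>l\<in>lines_at y. even (card {X\<in>A. rep X \<in> l})"
    using that by (intro dvd_sum) simp
  ultimately have "\<not> (\<forall>l\<in>lines_at y. even (card {X\<in>A. rep X \<in> l}))" by blast
  then obtain l where l: "l \<in> lines_at y" "odd (card {X\<in>A. rep X \<in> l})" by blast
  have "{X\<in>A. rep X \<in> l} \<noteq> {}"
    using l(2) by (intro notI) (simp only: card.empty dvd_0_right not_True_eq_False)
  then obtain X where X: "X \<in> A" "rep X \<in> l" by blast
  have uq: "Y = X" if Y: "Y \<in> A" "rep Y \<in> l" for Y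
  proof (rule ccontr)
    assume ne: "Y \<noteq> X"
    have "Z = X \<or> Z = Y" if "Z \<in> A" "rep Z \<in> l" for Z
      using three[OF X(1) Y(1) that(1) ne[symmetric] _ _ _ X(2) Y(2)] l(1) that by (auto simp: lines_at_def)
    then have "{X\<in>A. rep X \<in> l} = {X, Y}" using X Y by blast
    then show False using l(2) ne by simp
  qed
  have "l \<in> lines_at (rep X)" using l(1) X(2) unfolding lines_at_def by blast
  then have "tan X l" by (rule tanI[OF X(1) _ uq])
  then show thesis using l by (intro that[of X l]) (simp_all add: lines_at_def)
qed

text \<open>The \<open>q - 1\<close> points of a secant off the oval lie on tangents, which touch the oval in the
  \<open>q - 1\<close> remaining points; hence each of them lies on only one tangent.\<close>

lemma tan_secant_unique:
  assumes ev: "even CARD('a)" and P: "P \<in> A" "Q \<in> A" "P \<noteq> Q"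
  shows "\<And>X. X \<in> A - {P, Q} \<Longrightarrow> \<exists>l. tan X l"
    and "\<And>X X' l l' y. tan X l \<Longrightarrow> tan X' l' \<Longrightarrow> y \<in> l \<Longrightarrow> y \<in> l' \<Longrightarrow> y \<in> vec.span {rep Q, rep P} \<Longrightarrow>
      y \<notin> pt (rep P) \<Longrightarrow> y \<notin> pt (rep Q) \<Longrightarrow> X = X'"
proof -
  let ?m = "vec.span {rep Q, rep P}"
  have q2: "rep Q \<notin> pt (rep P)" by (rule two[OF P])
  have m: "pg_line ?m" by (rule pg_line_span[OF A_rep(1)[OF P(1)] q2])
  have mP: "rep P \<in> ?m" "rep Q \<in> ?m" by (rule vec.span_base, simp)+
  have m\<pi>: "?m \<subseteq> \<pi>" by (rule vec.span_minimal[OF _ sub]) (use rep_in P in simp)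
  \<comment> \<open>The points of the secant other than \<open>P\<close> are the
    \<open>pt (Y t)\<close>; t = 0 gives \<open>Q\<close>, and nonzero \<open>t\<close> give the q -
    1 points off the oval.\<close>
  define Y where "Y t = rep Q + t *s rep P" for t
  have Ym: "Y t \<in> ?m" for t unfolding Y_def in_span2 by (intro exI[of _ 1] exI[of _ t]) simp
  have YP: "Y t \<notin> pt (rep P)" for t
  proof
    assume "Y t \<in> pt (rep P)"
    then obtain k where "rep Q + t *s rep P = k *s rep P" unfolding in_pt Y_def by blast
    then have "rep Q = (k - t) *s rep P" by (simp add: algebra_simps)
    then show False using q2 unfolding in_pt by blast
  qed
  then have Y0: "Y t \<noteq> 0" for t using vec.span_zero by metis
  have YA: "pt (Y t) \<notin> A" if t: "t \<noteq> 0" for t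
  proof
    assume a: "pt (Y t) \<in> A"
    have yr: "rep (pt (Y t)) \<in> pt (Y t)" using A_rep(2)[OF a] vec.span_base[of "rep (pt (Y t))" "{rep (pt (Y t))}"] by simp
    moreover have "pt (Y t) \<subseteq> ?m" using pt_subset_iff[OF vec.subspace_span] Ym by blast
    ultimately have "rep (pt (Y t)) \<in> ?m" by blast
    then have "pt (Y t) = P \<or> pt (Y t) = Q" using three[OF P(1,2) a P(3) _ _ m mP] by blast
    moreover have "Y t \<in> pt (Y t)" by (rule vec.span_base) simp
    ultimately have "Y t \<in> pt (rep P) \<or> Y t \<in> pt (rep Q)" using A_rep(2) P by metis
    then obtain k where "rep Q + t *s rep P = k *s rep Q" using YP unfolding in_pt Y_def by blast
    then have "t *s rep P = (k - 1) *s rep Q" by (simp add: algebra_simps)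
    then have "t *s rep P \<in> pt (rep Q)" unfolding in_pt by blast
    then have "rep P \<in> pt (rep Q)" using scale_in_span t by blast
    then show False using two[OF P(2,1)] P(3) by blast
  qed
  have ex: "\<forall>t\<in>UNIV - {0}. \<exists>Xl. tan (fst Xl) (snd Xl) \<and> Y t \<in> snd Xl"
  proof
    fix t :: 'a assume "t \<in> UNIV - {0}"
    then have t: "t \<noteq> 0" by simp
    have "Y t \<in> \<pi>" using Ym m\<pi> by blast
    then obtain X l where "tan X l" "Y t \<in> l" by (rule tan_through[OF ev _ Y0 YA[OF t]])
    then show "\<exists>Xl. tan (fst Xl) (snd Xl) \<and> Y t \<in> snd Xl" by (intro exI[of _ "(X, l)"]) simp
  qed
  obtain G where G: "\<forall>t\<in>UNIV - {0}. tan (fst (G t)) (snd (G t)) \<and> Y t \<in> snd (G t)"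
    using bchoice[OF ex] by blast
  have noP: "X \<noteq> P \<and> X \<noteq> Q" if t: "tan X l" "y \<in> l" "y \<in> ?m" "y \<notin> pt (rep P)" "y \<notin> pt (rep Q)" for X l y
  proof -
    have lX: "l \<in> lines_at (rep X)" using t by (simp add: tan_def)
    have "l = ?m" if "X = P \<or> X = Q"
    proof -
      have "rep X \<in> ?m" "rep X \<noteq> 0" "y \<notin> pt (rep X)" using that mP A_rep(1) P t by auto
      then have "l = vec.span {y, rep X}" "?m = vec.span {y, rep X}"
        using lines_at_eq[OF lX _ t(2)] pg_line_eq[OF m _ t(3)] by blast+
      then show ?thesis by simp
    qed
    then show ?thesis using t(1) mP P unfolding tan_def by metis
  qed
  have same: "y' \<in> pt y" if t: "tan X l" "y \<in> l" "y \<in> ?m" "y \<notin> pt (rep P)" "y \<notin> pt (rep Q)" "y' \<in> l" "y' \<in> ?m" "y \<noteq> 0"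
    for X l y y'
  proof (rule ccontr)
    assume n: "y' \<notin> pt y"
    have l: "pg_line l" using t(1) by (simp add: tan_def lines_at_def)
    have "l = vec.span {y', y}" by (rule pg_line_eq[OF l t(2,6,8) n])
    moreover have "?m = vec.span {y', y}" by (rule pg_line_eq[OF m t(3,7,8) n])
    ultimately have "l = ?m" by simp
    then show False using t(1) mP P unfolding tan_def by metis
  qed
  have YQ: "Y t \<notin> pt (rep Q)" if t: "t \<noteq> 0" for t
  proof
    assume "Y t \<in> pt (rep Q)"
    then obtain k where "rep Q + t *s rep P = k *s rep Q" unfolding in_pt Y_def by blast
    then have "t *s rep P = (k - 1) *s rep Q" by (simp add: algebra_simps)
    then have "t *s rep P \<in> pt (rep Q)" unfolding in_pt by blast
    then have "rep P \<in> pt (rep Q)" using scale_in_span t by blast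
    then show False using two[OF P(2,1)] P(3) by blast
  qed
  have inj: "inj_on (\<lambda>t. fst (G t)) (UNIV - {0})"
  proof (rule inj_onI)
    fix t t' assume t: "t \<in> UNIV - {0}" "t' \<in> UNIV - {0}" and e: "fst (G t) = fst (G t')"
    have g: "tan (fst (G t)) (snd (G t))" "Y t \<in> snd (G t)" "tan (fst (G t')) (snd (G t'))" "Y t' \<in> snd (G t')"
      using G t by blast+
    have "snd (G t) = snd (G t')" using tan_unique[OF g(1)] g(3) e by simp
    then have "Y t' \<in> snd (G t)" using g(4) by simp
    then have "Y t' \<in> pt (Y t)" using same[OF g(1,2) Ym YP YQ _ Ym Y0] t by blast
    then obtain k where k: "rep Q + t' *s rep P = k *s (rep Q + t *s rep P)" unfolding in_pt Y_def by blast
    then have e2: "(1 - k) *s rep Q = (k * t - t') *s rep P" by (simp add: vec.scale_right_distrib algebra_simps)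
    then have "(1 - k) *s rep Q \<in> pt (rep P)" unfolding in_pt by blast
    then have k1: "k = 1" using scale_in_span[of "1 - k" "rep Q"] q2 by (metis eq_iff_diff_eq_0)
    then have "(t - t') *s rep P = 0" using e2 by simp
    then show "t = t'" using A_rep(1)[OF P(1)] by simp
  qed
  have img: "(\<lambda>t. fst (G t)) ` (UNIV - {0}) \<subseteq> A - {P, Q}"
  proof
    fix X assume "X \<in> (\<lambda>t. fst (G t)) ` (UNIV - {0})"
    then obtain t where t: "t \<noteq> 0" "X = fst (G t)" by blast
    have g: "tan (fst (G t)) (snd (G t))" "Y t \<in> snd (G t)" using G t by blast+
    have "X \<noteq> P \<and> X \<noteq> Q" unfolding t(2) by (rule noP[OF g Ym YP YQ[OF t(1)]])
    moreover have "X \<in> A" unfolding t(2) using g(1) by (simp add: tan_def)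
    ultimately show "X \<in> A - {P, Q}" by blast
  qed
  have finA: "finite A" using card_A by (intro card_ge_0_finite) simp
  have "card (A - {P, Q}) = CARD('a) - 1" using P card_A by (simp add: card_Diff_subset)
  moreover have "card ((\<lambda>t. fst (G t)) ` (UNIV - {0})) = CARD('a) - 1"
    using card_image[OF inj] by (simp add: card_Diff_subset)
  ultimately have surj: "(\<lambda>t. fst (G t)) ` (UNIV - {0}) = A - {P, Q}"
    using img finA by (intro card_subset_eq) auto
  show "\<exists>l. tan X l" if "X \<in> A - {P, Q}" for X
  proof -
    have "X \<in> (\<lambda>t. fst (G t)) ` (UNIV - {0})" unfolding surj by (rule that)
    then obtain t where "X = fst (G t)" "t \<in> UNIV - {0}" by (rule imageE)
    then show ?thesis using G by blast
  qed
  show "X = X'" if t: "tan X l" "tan X' l'" "y \<in> l" "y \<in> l'" "y \<in> ?m" "y \<notin> pt (rep P)" "y \<notin> pt (rep Q)"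
    for X X' l l' y
  proof -
    have y0: "y \<noteq> 0" using t(6) vec.span_zero by metis
    have key: "\<exists>s. s \<noteq> 0 \<and> X = fst (G s) \<and> Y s \<in> pt y" if a: "tan X l" "y \<in> l" for X l
    proof -
      have "X \<in> A - {P, Q}" using noP[OF a t(5-7)] a(1) by (simp add: tan_def)
      then have "X \<in> (\<lambda>t. fst (G t)) ` (UNIV - {0})" unfolding surj .
      then obtain s where s: "X = fst (G s)" "s \<in> UNIV - {0}" by (rule imageE)
      have g: "tan (fst (G s)) (snd (G s))" "Y s \<in> snd (G s)" using G s by blast+
      have "l = snd (G s)" by (rule tan_unique[OF a(1)]) (use g(1) s(1) in simp)
      then have "Y s \<in> pt y" using same[OF a t(5-7) _ Ym y0] g(2) by simp
      then show ?thesis using s by blast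
    qed
    obtain s where s: "s \<noteq> 0" "X = fst (G s)" "Y s \<in> pt y" using key[OF t(1,3)] by blast
    obtain s' where s': "s' \<noteq> 0" "X' = fst (G s')" "Y s' \<in> pt y" using key[OF t(2,4)] by blast
    obtain k k' where k: "Y s = k *s y" "Y s' = k' *s y" using s(3) s'(3) unfolding in_pt by blast
    have k0: "k \<noteq> 0" using k(1) Y0[of s] by auto
    have "Y s' = (k' / k) *s Y s" using k k0 by simp
    then have e: "rep Q + s' *s rep P = (k' / k) *s (rep Q + s *s rep P)" by (simp only: Y_def)
    define c where "c = k' / k"
    have e2: "(1 - c) *s rep Q = (c * s - s') *s rep P"
      using e unfolding c_def[symmetric] by (simp add: vec.scale_right_distrib algebra_simps)
    then have "(1 - c) *s rep Q \<in> pt (rep P)" unfolding in_pt by blast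
    then have c1: "c = 1" using scale_in_span[of "1 - c" "rep Q"] q2 by (metis eq_iff_diff_eq_0)
    then have "(s - s') *s rep P = 0" using e2 by simp
    then have "s = s'" using A_rep(1)[OF P(1)] by simp
    then show ?thesis using s s' by simp
  qed
qed

text \<open>The tangents at two points of the oval meet in \<open>y\<close>. A secant through
  \<open>y\<close> would have a point off the oval lying on tangents at two different points, which
  \<open>tan_secant_unique\<close> excludes.\<close>

lemma ex_nucleus:
  assumes ev: "even CARD('a)"
  obtains y where "y \<in> \<pi>" "y \<noteq> 0" "\<And>P Q. P \<in> A \<Longrightarrow> Q \<in> A \<Longrightarrow> P \<noteq> Q \<Longrightarrow> y \<notin> vec.span {rep Q, rep P}"
proof -
  have finA: "finite A" using card_A by (intro card_ge_0_finite) simp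
  have "card A \<ge> 3" using card_A card_field_ge2[where 'a='a] by simp
  then obtain D where D: "D \<subseteq> A" "card D = 3" by (rule obtain_subset_with_card_n)
  then obtain X Y Z where X: "X \<in> A" "Y \<in> A" "Z \<in> A" "X \<noteq> Y" "X \<noteq> Z" "Y \<noteq> Z" by (auto simp: card_3_iff)
  obtain l where l: "tan X l" using tan_secant_unique(1)[OF ev X(2,3,6), of X] X by blast
  obtain l' where l': "tan Y l'" using tan_secant_unique(1)[OF ev X(1,3,5), of Y] X by blast
  have pl: "pg_line l" "pg_line l'" "l \<subseteq> \<pi>" "l' \<subseteq> \<pi>" "rep X \<in> l" "rep Y \<in> l'" "vec.subspace l" "vec.subspace l'"
    using l l' by (auto simp: tan_def lines_at_def pg_line_def)
  have nX: "rep X \<notin> l'" using l' X unfolding tan_def by blast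
  obtain b where b: "b \<in> l'" "b \<notin> pt (rep Y)" by (rule line_other[OF pl(2)])
  have l'_eq: "l' = vec.span {b, rep Y}" by (rule pg_line_eq[OF pl(2) pl(6) b(1) A_rep(1)[OF X(2)] b(2)])
  have \<pi>_eq: "\<pi> = vec.span {rep X, b, rep Y}"
    by (rule pg_plane_eq[OF plane rep_in[OF X(2)] _ rep_in[OF X(1)] A_rep(1)[OF X(2)] b(2)])
      (use b pl nX l'_eq in blast)+
  obtain z where z: "z \<in> l" "z \<notin> pt (rep X)" by (rule line_other[OF pl(1)])
  have "z \<in> vec.span {rep X, b, rep Y}" using z(1) pl(3) \<pi>_eq by blast
  then obtain \<alpha> \<beta> \<gamma> where zz: "z = \<alpha> *s rep X + \<beta> *s b + \<gamma> *s rep Y" unfolding in_span3 by blast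
  \<comment> \<open>Removing the \<open>rep X\<close> component of \<open>z\<close> stays on the
    tangent at \<open>X\<close> and leads into the span of \<open>b\<close> and
    \<open>rep Y\<close>, the tangent at \<open>Y\<close>.\<close>
  define y where "y = z - \<alpha> *s rep X"
  have yl: "y \<in> l" unfolding y_def by (rule vec.subspace_diff[OF pl(7) z(1) vec.subspace_scale[OF pl(7,5)]])
  have "y = \<beta> *s b + \<gamma> *s rep Y" by (simp add: y_def zz)
  then have yl': "y \<in> l'" unfolding l'_eq in_span2 by blast
  have y0: "y \<noteq> 0"
  proof
    assume "y = 0"
    then have "z = \<alpha> *s rep X" by (simp add: y_def)
    then show False using z(2) unfolding in_pt by blast
  qed
  have notA: "y \<notin> pt (rep P)" if P: "P \<in> A" for P
  proof
    assume "y \<in> pt (rep P)"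
    then obtain k where k: "y = k *s rep P" unfolding in_pt by blast
    then have "k \<noteq> 0" using y0 by auto
    then have "rep P = inverse k *s y" using k by simp
    then have "rep P \<in> l" "rep P \<in> l'" using vec.subspace_scale[OF pl(7) yl] vec.subspace_scale[OF pl(8) yl'] by simp_all
    then have "P = X" "P = Y" using l l' P unfolding tan_def by blast+
    then show False using X(4) by simp
  qed
  show thesis
  proof (rule that[OF _ y0])
    show "y \<in> \<pi>" using yl pl by blast
    show "y \<notin> vec.span {rep Q, rep P}" if P: "P \<in> A" "Q \<in> A" "P \<noteq> Q" for P Q
    proof
      assume "y \<in> vec.span {rep Q, rep P}"
      then have "X = Y" using tan_secant_unique(2)[OF ev P l l' yl yl'] notA P by blast
      then show False using X(4) by contradiction
    qed
  qed
qed

text \<open>At a point \<open>X\<close> of the oval the \<open>q\<close> secants and the line to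
  \<open>y\<close> exhaust the lines of the plane, so the tangent at \<open>X\<close> is the line to
  \<open>y\<close>. Conversely, the lines joining \<open>y\<close> to the q + 1 points of the oval
  are distinct, hence all the lines through \<open>y\<close>, and each of them meets the oval
  once.\<close>

lemma nucleusI:
  assumes y: "y \<in> \<pi>" "y \<noteq> 0" and no: "\<And>P Q. P \<in> A \<Longrightarrow> Q \<in> A \<Longrightarrow> P \<noteq> Q \<Longrightarrow> y \<notin> vec.span {rep Q, rep P}"
  shows "nucleus_in \<pi> A (pt y)"
proof -
  have finA: "finite A" using card_A by (intro card_ge_0_finite) simp
  have other: "\<exists>Y\<in>A. Y \<noteq> X" for X
  proof (rule ccontr)
    assume "\<not> (\<exists>Y\<in>A. Y \<noteq> X)"
    then have "A \<subseteq> {X}" by blast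
    then have "card A \<le> 1" using card_mono[of "{X}" A] by simp
    then show False using card_A card_field_ge2[where 'a='a] by simp
  qed
  have yX: "y \<notin> pt (rep X)" if X: "X \<in> A" for X
  proof -
    obtain Y where Y: "Y \<in> A" "Y \<noteq> X" using other by blast
    have "pt (rep X) \<subseteq> vec.span {rep Y, rep X}" by (rule vec.span_mono) simp
    then show ?thesis using no[OF X Y(1)] Y(2) by blast
  qed
  have Xy: "rep X \<notin> pt y" if X: "X \<in> A" for X
  proof
    assume "rep X \<in> pt y"
    then obtain k where k: "rep X = k *s y" unfolding in_pt by blast
    then have "k \<noteq> 0" using A_rep(1)[OF X] by auto
    then have "y = inverse k *s rep X" using k by simp
    then show False using yX[OF X] unfolding in_pt by blast
  qed
  have spy: "vec.span {rep X, y} = vec.span {y, rep X}" for X by (simp add: insert_commute)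
  have tang: "tangent_line A l \<and> l \<subseteq> \<pi> \<longleftrightarrow> (\<exists>X. tan X l)" for l
  proof
    assume a: "tangent_line A l \<and> l \<subseteq> \<pi>"
    then have l: "pg_line l" "vec.subspace l" by (auto simp: tangent_line_def pg_line_def)
    obtain X where X: "X \<in> A" "X \<subseteq> l" "\<And>Y. Y \<in> A \<Longrightarrow> Y \<subseteq> l \<Longrightarrow> Y = X" using a unfolding tangent_line_def by metis
    have "tan X l"
    proof (rule tanI[OF X(1)])
      show "l \<in> lines_at (rep X)"
        using a l(1) X(2) A_sub_iff[OF X(1) l(2)] unfolding lines_at_def by blast
      show "Y = X" if "Y \<in> A" "rep Y \<in> l" for Y
        by (rule X(3)[OF that(1)]) (use A_sub_iff[OF that(1) l(2)] that(2) in blast)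
    qed
    then show "\<exists>X. tan X l" by blast
  next
    assume "\<exists>X. tan X l"
    then obtain X where X: "X \<in> A" "pg_line l" "l \<subseteq> \<pi>" "rep X \<in> l" "\<And>Y. Y \<in> A \<Longrightarrow> rep Y \<in> l \<Longrightarrow> Y = X"
      by (auto simp: tan_def lines_at_def)
    have l: "vec.subspace l" using X by (simp add: pg_line_def)
    have "\<exists>!P. P \<in> A \<and> P \<subseteq> l"
    proof (rule ex1I[of _ X])
      show "X \<in> A \<and> X \<subseteq> l" using X(1,4) A_sub_iff[OF X(1) l] by blast
      fix P assume P: "P \<in> A \<and> P \<subseteq> l"
      show "P = X" by (rule X(5)) (use P A_sub_iff[of P, OF _ l] in blast)+
    qed
    then show "tangent_line A l \<and> l \<subseteq> \<pi>" using X by (simp add: tangent_line_def)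
  qed
  have "(\<exists>X. tan X l) \<longleftrightarrow> pg_line l \<and> l \<subseteq> \<pi> \<and> pt y \<subseteq> l" for l
  proof
    assume "\<exists>X. tan X l"
    then obtain X where t: "tan X l" by blast
    then have X: "X \<in> A" "l \<in> lines_at (rep X)" by (simp_all add: tan_def)
    let ?I = "(\<lambda>Y. vec.span {rep Y, rep X}) ` (A - {X})"
    let ?n = "vec.span {y, rep X}"
    have nl: "?n \<in> lines_at (rep X)" by (rule line_in_lines_at[OF rep_in[OF X(1)] A_rep(1)[OF X(1)] y(1) yX[OF X(1)]])
    have y_n: "y \<in> ?n" by (rule vec.span_base) simp
    have nI: "?n \<notin> ?I"
    proof
      assume "?n \<in> ?I"
      then obtain Y where Y: "Y \<in> A" "Y \<noteq> X" "?n = vec.span {rep Y, rep X}" by blast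
      then have "y \<in> vec.span {rep Y, rep X}" using y_n by simp
      then show False using no[OF X(1) Y(1)] Y(2) by blast
    qed
    have "card (insert ?n ?I) = CARD('a) + 1" using nI secants_at(3)[OF X(1)] by simp
    moreover have "insert ?n ?I \<subseteq> lines_at (rep X)" using nl secants_at(2)[OF X(1)] by simp
    moreover have "card (lines_at (rep X)) \<le> CARD('a) + 1" by (rule card_lines_at[OF rep_in[OF X(1)] A_rep(1)[OF X(1)]])
    ultimately have "insert ?n ?I = lines_at (rep X)" by (intro card_seteq) simp_all
    then have "l = ?n" using X(2) tan_not_secant[OF t] by blast
    then have yl: "y \<in> l" using y_n by (rule ssubst)
    have lp: "pg_line l" "l \<subseteq> \<pi>" using X(2) unfolding lines_at_def by blast+
    then have "vec.subspace l" unfolding pg_line_def by blast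
    then have "pt y \<subseteq> l" using yl pt_subset_iff by blast
    then show "pg_line l \<and> l \<subseteq> \<pi> \<and> pt y \<subseteq> l" using lp by blast
  next
    assume a: "pg_line l \<and> l \<subseteq> \<pi> \<and> pt y \<subseteq> l"
    then have sl: "vec.subspace l" by (simp add: pg_line_def)
    have yl: "y \<in> l" using a pt_subset_iff[OF sl] by blast
    then have l: "l \<in> lines_at y" using a by (simp add: lines_at_def)
    let ?J = "(\<lambda>X. vec.span {rep X, y}) ` A"
    have uniq: "Y = X" if "X \<in> A" "Y \<in> A" "rep Y \<in> vec.span {rep X, y}" for X Y
    proof (rule ccontr)
      assume ne: "Y \<noteq> X"
      have pl: "pg_line (vec.span {rep X, y})" by (rule pg_line_span[OF y(2) Xy[OF that(1)]])
      have "rep X \<in> vec.span {rep X, y}" "y \<in> vec.span {rep X, y}" by (rule vec.span_base, simp)+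
      then have "vec.span {rep X, y} = vec.span {rep Y, rep X}"
        using pg_line_eq[OF pl _ that(3) A_rep(1)[OF that(1)] two[OF that(1,2)]] ne by blast
      then have "y \<in> vec.span {rep Y, rep X}" using \<open>y \<in> vec.span {rep X, y}\<close> by simp
      then show False using no[OF that(1,2)] ne by blast
    qed
    have "inj_on (\<lambda>X. vec.span {rep X, y}) A"
    proof (rule inj_onI)
      fix X Y assume "X \<in> A" "Y \<in> A" "vec.span {rep X, y} = vec.span {rep Y, y}"
      moreover have "rep Y \<in> vec.span {rep Y, y}" by (rule vec.span_base) simp
      ultimately show "X = Y" using uniq[of X Y] by simp
    qed
    then have "card ?J = CARD('a) + 1" using card_A by (simp add: card_image)
    moreover have "?J \<subseteq> lines_at y"
    proof
      fix l assume "l \<in> ?J"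
      then obtain X where X: "X \<in> A" "l = vec.span {rep X, y}" by blast
      show "l \<in> lines_at y" unfolding X(2) by (rule line_in_lines_at[OF y rep_in[OF X(1)] Xy[OF X(1)]])
    qed
    moreover have "card (lines_at y) \<le> CARD('a) + 1" by (rule card_lines_at[OF y])
    ultimately have "?J = lines_at y" by (intro card_seteq) simp_all
    then obtain X where X: "X \<in> A" "l = vec.span {rep X, y}" using l by blast
    have "rep X \<in> l" unfolding X(2) by (rule vec.span_base) simp
    then have "tan X l" using X uniq[OF X(1)] a by (simp add: tan_def lines_at_def)
    then show "\<exists>X. tan X l" by blast
  qed
  then have "{l. tangent_line A l \<and> l \<subseteq> \<pi>} = {l. pg_line l \<and> l \<subseteq> \<pi> \<and> pt y \<subseteq> l}"
    using tang by simp
  then show ?thesis using pg_point_pt[OF y(2)] pt_subset_iff[OF sub] y(1) by (simp add: nucleus_in_def)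
qed

end

section \<open>Laguerre planes\<close>

text \<open>\<open>H\<close> is an oval (\<open>e = 1\<close>) or a hyperoval
  (\<open>e = 0\<close>), given by one vector for each of its points. Points of the Laguerre plane
  become pairs of such a vector and a field element, and parallel means equal first
  component.\<close>

locale arc_vectors =
  fixes \<pi> :: "('a::{field,finite} ^ 4) set" and H :: "('a ^ 4) set" and K e :: nat
  assumes plane: "pg_plane \<pi>" and H_sub: "H \<subseteq> \<pi>" and H_card: "card H = K"
    and Ke: "K + e = CARD('a) + 2" and e1: "e \<le> 1"
    and arc: "x \<in> H \<Longrightarrow> y \<in> H \<Longrightarrow> z \<in> H \<Longrightarrow> x \<noteq> y \<Longrightarrow> x \<noteq> z \<Longrightarrow> y \<noteq> z \<Longrightarrow> z \<notin> vec.span {y, x}"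
begin

lemma H3: "card H \<ge> 3"
  using H_card Ke e1 card_field_ge2[where 'a='a] by linarith

lemma third:
  obtains z where "z \<in> H" "z \<noteq> x" "z \<noteq> y"
proof -
  have "\<not> H \<subseteq> {x, y}"
  proof
    assume "H \<subseteq> {x, y}"
    then have "card H \<le> card {x, y}" by (rule card_mono[rotated]) simp
    moreover have "card {x, y} \<le> 2" by (simp add: card_insert_if)
    ultimately show False using H3 by simp
  qed
  then show thesis using that by blast
qed

lemma H_two:
  assumes "x \<in> H" "y \<in> H" "x \<noteq> y"
  shows "y \<notin> pt x"
proof -
  obtain z where z: "z \<in> H" "z \<noteq> x" "z \<noteq> y" by (rule third)
  have "pt x \<subseteq> vec.span {z, x}" by (rule vec.span_mono) simp
  then show ?thesis using arc[OF assms(1) z(1) assms(2)] z assms(3) by blast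
qed

lemma H_nz:
  assumes "x \<in> H"
  shows "x \<noteq> 0"
proof -
  obtain z where z: "z \<in> H" "z \<noteq> x" "z \<noteq> x" by (rule third)
  show ?thesis using H_two[OF z(1) assms z(2)] vec.span_zero by metis
qed

text \<open>A circle is the graph of a linear functional restricted to the arc: a plane section of
  the cone that misses the vertex, written in coordinates.\<close>

definition gr :: "'a ^ 4 \<Rightarrow> (('a ^ 4) \<times> 'a) set" where
  "gr n = (\<lambda>x. (x, dotp n x)) ` H"

lemma gr_iff: "(x, a) \<in> gr n \<longleftrightarrow> x \<in> H \<and> a = dotp n x"
  by (auto simp: gr_def)

lemma card_gr: "card (gr n) = K"
  unfolding gr_def using H_card by (subst card_image) (auto simp: inj_on_def)

lemma interpolate:
  assumes "x \<in> H" "y \<in> H" "z \<in> H" "x \<noteq> y" "x \<noteq> z" "y \<noteq> z"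
  obtains n where "dotp n x = a" "dotp n y = b" "dotp n z = c"
proof -
  have ind: "vec.independent {z, y, x}" by (rule indep3(1)[OF H_nz H_two arc]) (use assms in simp_all)
  define f where "f w = (if w = x then a else if w = y then b else c) *s (axis 1 1 :: 'a ^ 4)" for w
  obtain g :: "'a ^ 4 \<Rightarrow> 'a ^ 4" where g: "Vector_Spaces.linear (*s) (*s) g" "\<forall>w\<in>{z, y, x}. g w = f w"
    using vec.linear_independent_extend[OF ind, of f] by blast
  have n: "dotp (matrix g $ 1) w = g w $ 1" for w
  proof -
    have "g w = matrix g *v w" using g(1) by (simp add: matrix_works)
    then show ?thesis by (simp add: dotp_def matrix_vector_mult_def)
  qed
  show thesis
    by (rule that[of "matrix g $ 1"]) (use g(2) assms in \<open>simp_all add: n f_def axis_def\<close>)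
qed

lemma gr_eqI:
  assumes H: "x \<in> H" "y \<in> H" "z \<in> H" "x \<noteq> y" "x \<noteq> z" "y \<noteq> z"
    and "dotp n x = dotp n' x" "dotp n y = dotp n' y" "dotp n z = dotp n' z"
  shows "gr n = gr n'"
proof -
  have \<pi>: "\<pi> = vec.span {z, y, x}"
    by (rule pg_plane_eq[OF plane _ _ _ H_nz H_two arc]) (use H H_sub in auto)
  have "dotp n w = dotp n' w" if "w \<in> H" for w
  proof -
    have "w \<in> vec.span {z, y, x}" using that H_sub \<pi> by blast
    then obtain a b c where "w = a *s z + b *s y + c *s x" unfolding in_span3 by blast
    then show ?thesis using assms(7-9) by (simp add: dotp_simps)
  qed
  then show ?thesis unfolding gr_def by (intro image_cong) auto
qed

lemma laguerre_plane:
  "circle_plane (H \<times> UNIV) (range gr) (\<lambda>p p'. fst p \<noteq> fst p') CARD('a) K CARD('a) e 1"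
proof
  show "finite (H \<times> (UNIV :: 'a set))" by simp
  show "2 \<le> CARD('a)" by (rule card_field_ge2)
  show "K + e = CARD('a) + 2" "e \<le> 1" by (fact Ke, fact e1)
  show "c \<subseteq> H \<times> UNIV" "card c = K" if "c \<in> range gr" for c
    using that card_gr by (auto simp: gr_def)
  show "fst x \<noteq> fst y" if "c \<in> range gr" "x \<in> c" "y \<in> c" "x \<noteq> y" for c x y
    using that by (auto simp: gr_def)
  show "\<exists>!c. c \<in> range gr \<and> p \<in> c \<and> p' \<in> c \<and> p'' \<in> c"
    if p: "p \<in> H \<times> UNIV" "p' \<in> H \<times> UNIV" "p'' \<in> H \<times> UNIV"
      and ne: "fst p \<noteq> fst p'" "fst p \<noteq> fst p''" "fst p' \<noteq> fst p''" for p p' p''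
  proof -
    have H: "fst p \<in> H" "fst p' \<in> H" "fst p'' \<in> H" using p by auto
    obtain n where n: "dotp n (fst p) = snd p" "dotp n (fst p') = snd p'" "dotp n (fst p'') = snd p''"
      by (rule interpolate[OF H ne])
    have mem: "q \<in> gr m \<longleftrightarrow> fst q \<in> H \<and> snd q = dotp m (fst q)" for q m
      using gr_iff[of "fst q" "snd q" m] by simp
    show ?thesis
    proof (rule ex1I)
      show "gr n \<in> range gr \<and> p \<in> gr n \<and> p' \<in> gr n \<and> p'' \<in> gr n" using n H by (simp add: mem)
      fix c assume c: "c \<in> range gr \<and> p \<in> c \<and> p' \<in> c \<and> p'' \<in> c"
      then obtain m where m: "c = gr m" by blast
      show "c = gr n" unfolding m by (rule gr_eqI[OF H ne]) (use c n in \<open>simp_all add: m mem\<close>)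
    qed
  qed
  show "card {y \<in> c. fst x \<noteq> fst y} + 1 = K" if c: "c \<in> range gr" and x: "x \<in> H \<times> UNIV" "x \<notin> c" for c x
  proof -
    obtain n where n: "c = gr n" using c by blast
    have xH: "fst x \<in> H" using x by auto
    have "{y \<in> c. fst x \<noteq> fst y} = c - {(fst x, dotp n (fst x))}" unfolding n gr_def by auto
    moreover have "(fst x, dotp n (fst x)) \<in> c" using xH by (simp add: n gr_iff)
    ultimately have "card {y \<in> c. fst x \<noteq> fst y} = K - 1" using card_gr[of n] n by simp
    then show ?thesis using H3 H_card by simp
  qed
  show "card {y \<in> H \<times> (UNIV :: 'a set). fst x \<noteq> fst y} = CARD('a) * (K - 1)" if "x \<in> H \<times> (UNIV :: 'a set)" for x
  proof -
    have "{y \<in> H \<times> (UNIV :: 'a set). fst x \<noteq> fst y} = (H - {fst x}) \<times> UNIV" by auto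
    moreover have "fst x \<in> H" using that by auto
    ultimately show ?thesis using H_card by (simp only: card_cartesian_product card_Diff_singleton mult.commute)
  qed
  show "card {z \<in> H \<times> (UNIV :: 'a set). fst x \<noteq> fst z \<and> fst y \<noteq> fst z} = CARD('a) * (K - 2)"
    if "x \<in> H \<times> (UNIV :: 'a set)" "y \<in> H \<times> (UNIV :: 'a set)" "fst x \<noteq> fst y" for x y
  proof -
    have "{z \<in> H \<times> (UNIV :: 'a set). fst x \<noteq> fst z \<and> fst y \<noteq> fst z} = (H - {fst x, fst y}) \<times> UNIV" by auto
    moreover have "card (H - {fst x, fst y}) = card H - card {fst x, fst y}"
      by (rule card_Diff_subset) (use that in auto)
    moreover have "card {fst x, fst y} = 2" using that(3) by simp
    ultimately show ?thesis using H_card by (simp only: card_cartesian_product mult.commute)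
  qed
qed auto

text \<open>In a Laguerre plane r = q, so odd \<open>q\<close> means odd \<open>r\<close>; the
  hyperoval takes care of even \<open>q\<close>.\<close>

lemma laguerre_common_point:
  assumes hyp: "e = 0 \<or> odd CARD('a)" and F: "F \<subseteq> range gr" "\<And>c d. c \<in> F \<Longrightarrow> d \<in> F \<Longrightarrow> c \<inter> d \<noteq> {}"
    and size: "real (card F) \<ge> 1 / sqrt 2 * real CARD('a) ^ 2 + 2 * sqrt 2 * real CARD('a) + 8"
  shows "\<exists>x\<in>H. \<exists>a. \<forall>c\<in>F. (x, a) \<in> c"
proof -
  interpret circle_plane "H \<times> UNIV" "range gr" "\<lambda>p p'. fst p \<noteq> fst p'" "CARD('a)" K "CARD('a)" e 1
    by (rule laguerre_plane)
  have "\<exists>P\<in>H \<times> UNIV. \<forall>c\<in>F. P \<in> c" by (rule common_point[OF _ F size]) (use hyp in blast)+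
  then show ?thesis by blast
qed

end

section \<open>Oval cones\<close>

text \<open>A point of the cone other than the vertex is \<open>pt (rep X + a *s v0)\<close> for one
  \<open>X\<close> of the oval and one scalar \<open>a\<close>, and an oval plane consists of the
  multiples of vectors x + n(x) v0 over the base plane, up to the choice of a functional n, so
  circles become graphs over the oval. For even \<open>q\<close> the oval is extended by a nucleus
  vector \<open>y\<close>; the point over \<open>y\<close> on an extended circle is the nucleus of
  that circle, so a common point over \<open>y\<close> means a common nucleus.\<close>

theorem cone_common_point:
  fixes S :: "('a::{field,finite} ^ 4) set set"
  assumes S: "oval_cone R S" and F: "intersecting_family (ovoidal_circles S) F"
    and size: "real (card F) \<ge> 1 / sqrt 2 * real CARD('a) ^ 2 + 2 * sqrt 2 * real CARD('a) + 8"
  shows "(\<exists>P\<in>S - {R}. \<forall>c\<in>F. P \<in> c) \<or> even CARD('a) \<and> (\<exists>N. \<forall>c\<in>F. circle_through_nucleus S c N)"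
proof -
  have R: "pg_point R" using S by (simp add: oval_cone_def)
  obtain \<pi> Ov where Ov: "oval_in \<pi> Ov" "\<not> R \<subseteq> \<pi>"
    and S_eq: "S = {P. pg_point P \<and> (\<exists>l. pg_line l \<and> R \<subseteq> l \<and> (\<exists>X\<in>Ov. X \<subseteq> l) \<and> P \<subseteq> l)}"
    using S unfolding oval_cone_def by (elim conjE exE)
  interpret O: oval_points \<pi> Ov using Ov(1) by unfold_locales (auto simp: oval_in_def)
  define v0 where "v0 = rep R"
  have v0: "v0 \<noteq> 0" "R = pt v0" using rep[OF R] by (simp_all add: v0_def)
  have v0\<pi>: "v0 \<notin> \<pi>" using Ov(2) v0(2) pt_subset_iff[OF O.sub] by blast
  have proj: "x = y \<and> a = b" if "x \<in> \<pi>" "y \<in> \<pi>" "x + a *s v0 = y + b *s v0" for x y a b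
  proof -
    have e: "x - y = (b - a) *s v0" using that(3) by (simp add: algebra_simps)
    have "x - y \<in> \<pi>" by (rule vec.subspace_diff[OF O.sub that(1,2)])
    then have "inverse (b - a) *s ((b - a) *s v0) \<in> \<pi>" unfolding e by (rule vec.subspace_scale[OF O.sub])
    moreover have "inverse (b - a) *s ((b - a) *s v0) = v0" if "a \<noteq> b"
    proof -
      have "inverse (b - a) * (b - a) = 1" using that by simp
      then show ?thesis by (simp only: vec.scale_scale vec.scale_one)
    qed
    ultimately have "a = b" using v0\<pi> by metis
    then show ?thesis using e by simp
  qed
  define pp where "pp x a = pt (x + a *s v0)" for x and a :: 'a
  have pp_nz: "x + a *s v0 \<noteq> 0" if "x \<in> \<pi>" "x \<noteq> 0" for x a
    using proj[of x 0 a 0] that vec.subspace_0[OF O.sub] by auto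
  have pp_eq: "\<exists>k. k \<noteq> 0 \<and> x = k *s y \<and> a = k * b" if asm: "x \<in> \<pi>" "x \<noteq> 0" "y \<in> \<pi>" "pp x a = pp y b" for x y a b
  proof -
    have "pt (x + a *s v0) = pt (y + b *s v0)" using asm(4) unfolding pp_def .
    then obtain k where k: "k \<noteq> 0" "x + a *s v0 = k *s (y + b *s v0)"
      using pt_eq_iff[OF pp_nz[OF asm(1,2), of a]] by blast
    then have "x + a *s v0 = k *s y + (k * b) *s v0" by (simp add: vec.scale_right_distrib)
    then show ?thesis using proj[OF asm(1) vec.subspace_scale[OF O.sub asm(3)]] k(1) by blast
  qed
  have line: "pg_line (vec.span {v0, rep X})" if X: "X \<in> Ov" for X
  proof (rule pg_line_span[OF O.A_rep(1)[OF X]])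
    show "v0 \<notin> pt (rep X)" using v0\<pi> O.A_rep(2)[OF X] O.in_plane[OF X] by blast
  qed
  have pp_S: "pp (rep X) a \<in> S" if X: "X \<in> Ov" for X a
  proof -
    let ?l = "vec.span {v0, rep X}"
    have "v0 \<in> ?l" "rep X \<in> ?l" by (rule vec.span_base, simp)+
    then have "R \<subseteq> ?l" "X \<subseteq> ?l" using v0(2) pt_subset_iff[OF vec.subspace_span] O.A_sub_iff[OF X vec.subspace_span] by blast+
    moreover have "rep X + a *s v0 \<in> ?l" unfolding in_span2 by (intro exI[of _ a] exI[of _ 1]) (simp add: add.commute)
    then have "pp (rep X) a \<subseteq> ?l" unfolding pp_def using pt_subset_iff[OF vec.subspace_span] by blast
    moreover have "pg_point (pp (rep X) a)" unfolding pp_def by (rule pg_point_pt[OF pp_nz[OF O.rep_in[OF X] O.A_rep(1)[OF X]]])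
    ultimately show ?thesis unfolding S_eq using line[OF X] X by blast
  qed
  have pp_R: "pp x a \<noteq> R" if asm: "x \<in> \<pi>" "x \<noteq> 0" for x a
  proof
    assume "pp x a = R"
    then have "pt (x + a *s v0) = pt v0" using v0(2) by (simp add: pp_def)
    then obtain k where "x + a *s v0 = k *s v0" using pt_eq_iff[OF pp_nz[OF asm]] by blast
    then have "x + a *s v0 = 0 + k *s v0" by simp
    then show False using proj[OF asm(1) vec.subspace_0[OF O.sub]] asm(2) by blast
  qed
  have S_cases: "P = R \<or> (\<exists>X\<in>Ov. \<exists>a. P = pp (rep X) a)" if P: "P \<in> S" for P
  proof -
    obtain l X where l: "pg_point P" "pg_line l" "R \<subseteq> l" "X \<in> Ov" "X \<subseteq> l" "P \<subseteq> l"
      using P unfolding S_eq by blast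
    have sl: "vec.subspace l" using l by (simp add: pg_line_def)
    have m: "v0 \<in> l" "rep X \<in> l" using l v0(2) pt_subset_iff[OF sl] O.A_sub_iff[OF l(4) sl] by blast+
    have "v0 \<notin> pt (rep X)" using v0\<pi> O.A_rep(2)[OF l(4)] O.in_plane[OF l(4)] by blast
    then have leq: "l = vec.span {v0, rep X}" by (rule pg_line_eq[OF l(2) m(2,1) O.A_rep(1)[OF l(4)]])
    obtain p where p: "p \<noteq> 0" "P = pt p" by (rule pg_pointE[OF l(1)])
    have "p \<in> l" using l(6) p(2) pt_subset_iff[OF sl] by blast
    then obtain a b where ab: "p = a *s v0 + b *s rep X" unfolding leq in_span2 by blast
    show ?thesis
    proof (cases "b = 0")
      case True
      then have "p = a *s v0" "a \<noteq> 0" using ab p by auto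
      then show ?thesis using pt_eq_iff[OF p(1)] p(2) v0(2) by blast
    next
      case False
      then have "p = b *s (rep X + (a / b) *s v0)" by (simp add: ab vec.scale_right_distrib add.commute)
      then have "P = pp (rep X) (a / b)" using pt_eq_iff[OF p(1)] p(2) False unfolding pp_def by blast
      then show ?thesis using l(4) by blast
    qed
  qed
  have circ: "\<exists>n \<pi>'. c = plane_section S \<pi>' \<and> oval_plane S \<pi>' \<and> c = {pp (rep X) (dotp n (rep X)) | X. X \<in> Ov} \<and>
      (\<forall>x. x + dotp n x *s v0 \<in> \<pi>')" if c: "c \<in> F" for c
  proof -
    obtain \<pi>' where \<pi>': "c = plane_section S \<pi>'" "oval_plane S \<pi>'"
      using c F by (auto simp: intersecting_family_def ovoidal_circles_def)
    have pl: "pg_plane \<pi>'" and sub: "vec.subspace \<pi>'" and no3: "no_three_collinear c" and cc: "card c = CARD('a) + 1"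
      using \<pi>' by (auto simp: oval_plane_def oval_in_def pg_plane_def)
    obtain m where m: "\<pi>' = {v. dotp m v = 0}" by (rule plane_kernel[OF pl])
    have pp_sub: "pp x a \<subseteq> \<pi>' \<longleftrightarrow> x + a *s v0 \<in> \<pi>'" for x a unfolding pp_def by (rule pt_subset_iff[OF sub])
    \<comment> \<open>The vertex belongs to \<open>S\<close> here, so planes through it must be
      excluded: together with one more point of the section such a plane would contain a whole
      generator, hence three collinear points.\<close>
    have k0: "dotp m v0 \<noteq> 0"
    proof
      assume z: "dotp m v0 = 0"
      have "\<not> c \<subseteq> {R}" using card_mono[of "{R}" c] cc card_field_ge2[where 'a='a] by auto
      then obtain P where P: "P \<in> c" "P \<noteq> R" by blast
      then have "P \<in> S" "P \<subseteq> \<pi>'" using \<pi>'(1) by (auto simp: plane_section_def)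
      then obtain X a where X: "X \<in> Ov" "P = pp (rep X) a" using S_cases P(2) by blast
      have "rep X + a *s v0 \<in> \<pi>'" using \<open>P \<subseteq> \<pi>'\<close> X(2) pp_sub by blast
      then have mX: "dotp m (rep X) = 0" using z by (simp add: m dotp_simps)
      let ?l = "vec.span {v0, rep X}"
      have in_c: "pp (rep X) t \<in> c" for t
        using pp_S[OF X(1), of t] pp_sub[of "rep X" t] mX z by (simp add: \<pi>'(1) plane_section_def m dotp_simps)
      have "R \<in> S" using R line[OF X(1)] X(1) O.A_sub_iff[OF X(1) vec.subspace_span, of "{v0, rep X}"]
          pt_subset_iff[OF vec.subspace_span, of v0 "{v0, rep X}"] vec.span_base[of v0 "{v0, rep X}"]
          vec.span_base[of "rep X" "{v0, rep X}"] v0(2) unfolding S_eq by blast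
      moreover have "R \<subseteq> \<pi>'" using z v0(2) pt_subset_iff[OF sub] by (simp add: m)
      ultimately have Rc: "R \<in> c" by (simp add: \<pi>'(1) plane_section_def)
      have in_l: "pp (rep X) t \<subseteq> ?l" for t
      proof -
        have "rep X + t *s v0 \<in> ?l" unfolding in_span2 by (intro exI[of _ t] exI[of _ 1]) (simp add: add.commute)
        then show ?thesis unfolding pp_def using pt_subset_iff[OF vec.subspace_span] by blast
      qed
      have "v0 \<in> ?l" by (rule vec.span_base) simp
      then have R_l: "R \<subseteq> ?l" unfolding v0(2) using pt_subset_iff[OF vec.subspace_span] by blast
      have ne: "pp (rep X) 0 \<noteq> pp (rep X) 1"
      proof
        assume e: "pp (rep X) 0 = pp (rep X) 1"
        obtain k where "k \<noteq> 0" "0 = k * (1 :: 'a)"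
          using pp_eq[OF O.rep_in[OF X(1)] O.A_rep(1)[OF X(1)] O.rep_in[OF X(1)] e] by blast
        then show False by simp
      qed
      have nR: "pp (rep X) 0 \<noteq> R" "pp (rep X) 1 \<noteq> R" by (rule pp_R[OF O.rep_in[OF X(1)] O.A_rep(1)[OF X(1)]])+
      have "\<not> (\<exists>l. pg_line l \<and> pp (rep X) 0 \<subseteq> l \<and> pp (rep X) 1 \<subseteq> l \<and> R \<subseteq> l)"
        using no3[unfolded no_three_collinear_def, rule_format, OF in_c[of 0] in_c[of 1] Rc] ne nR by blast
      then show False using line[OF X(1)] in_l R_l by blast
    qed
    \<comment> \<open>Solves dotp m (x + a v0) = 0 for \<open>a\<close>, so that the plane is given
      by a = dotp n x.\<close>
    define n where "n = (- inverse (dotp m v0)) *s m"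
    have "dotp (s *s m) x = s * dotp m x" for s x
      by (simp add: dotp_def sum_distrib_left mult.assoc vector_scalar_mult_def)
    then have n: "dotp n x = - inverse (dotp m v0) * dotp m x" for x unfolding n_def .
    have inc: "x + a *s v0 \<in> \<pi>' \<longleftrightarrow> a = dotp n x" for x a
    proof -
      have "x + a *s v0 \<in> \<pi>' \<longleftrightarrow> a * dotp m v0 = - dotp m x" by (simp add: m dotp_simps eq_neg_iff_add_eq_0 add.commute)
      also have "\<dots> \<longleftrightarrow> a = - dotp m x / dotp m v0" by (rule nonzero_eq_divide_eq[OF k0, symmetric])
      finally show ?thesis by (simp add: n divide_inverse mult.commute)
    qed
    have Rn: "\<not> R \<subseteq> \<pi>'" using k0 v0(2) pt_subset_iff[OF sub] by (simp add: m)
    have "c = {pp (rep X) (dotp n (rep X)) | X. X \<in> Ov}"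
    proof (intro set_eqI iffI)
      fix P assume P: "P \<in> c"
      then have PS: "P \<in> S" "P \<subseteq> \<pi>'" using \<pi>'(1) by (auto simp: plane_section_def)
      then obtain X a where X: "X \<in> Ov" "P = pp (rep X) a" using S_cases[OF PS(1)] Rn by blast
      then have "a = dotp n (rep X)" using PS(2) pp_sub inc by blast
      then show "P \<in> {pp (rep X) (dotp n (rep X)) | X. X \<in> Ov}" using X by blast
    next
      fix P assume "P \<in> {pp (rep X) (dotp n (rep X)) | X. X \<in> Ov}"
      then obtain X where X: "X \<in> Ov" "P = pp (rep X) (dotp n (rep X))" by blast
      then show "P \<in> c" using pp_S pp_sub inc by (simp add: \<pi>'(1) plane_section_def)
    qed
    then show ?thesis using \<pi>' inc by blast
  qed
  define N where "N c = (SOME n. \<exists>\<pi>'. c = plane_section S \<pi>' \<and> oval_plane S \<pi>' \<and>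
      c = {pp (rep X) (dotp n (rep X)) | X. X \<in> Ov} \<and> (\<forall>x. x + dotp n x *s v0 \<in> \<pi>'))" for c
  have N: "\<exists>\<pi>'. c = plane_section S \<pi>' \<and> oval_plane S \<pi>' \<and>
      c = {pp (rep X) (dotp (N c) (rep X)) | X. X \<in> Ov} \<and> (\<forall>x. x + dotp (N c) x *s v0 \<in> \<pi>')" if "c \<in> F" for c
    unfolding N_def by (rule someI_ex[OF circ[OF that]])
  have c_eq: "c = {pp (rep X) (dotp (N c) (rep X)) | X. X \<in> Ov}" if "c \<in> F" for c using N[OF that] by blast
  have c_im: "c = (\<lambda>X. pp (rep X) (dotp (N c) (rep X))) ` Ov" if "c \<in> F" for c
    by (rule trans[OF c_eq[OF that] Setcompr_eq_image])
  have rep_inj: "inj_on rep Ov" by (rule inj_onI) (metis O.A_rep(2))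
  \<comment> \<open>Stated for any arc containing the oval, so that it applies to the oval itself
    for odd \<open>q\<close> and to the hyperoval for even \<open>q\<close>.\<close>
  have main: "\<exists>x\<in>H. \<exists>a. \<forall>c\<in>F. a = dotp (N c) x"
    if H: "arc_vectors \<pi> H K e" "rep ` Ov \<subseteq> H" and hyp: "e = 0 \<or> odd CARD('a)" for H K e
  proof -
    interpret L: arc_vectors \<pi> H K e by (rule H(1))
    have rH: "rep X \<in> H" if "X \<in> Ov" for X using H(2) that by blast
    have inj: "inj_on (\<lambda>c. L.gr (N c)) F"
    proof (rule inj_onI)
      fix c d assume cd: "c \<in> F" "d \<in> F" "L.gr (N c) = L.gr (N d)"
      have eq: "dotp (N c) (rep X) = dotp (N d) (rep X)" if "X \<in> Ov" for X
        using L.gr_iff[of "rep X" "dotp (N c) (rep X)" "N c"] L.gr_iff[of "rep X" "dotp (N c) (rep X)" "N d"] rH[OF that] cd(3)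
        by simp
      have "(\<lambda>X. pp (rep X) (dotp (N c) (rep X))) ` Ov = (\<lambda>X. pp (rep X) (dotp (N d) (rep X))) ` Ov"
        by (rule image_cong) (simp_all only: eq)
      then show "c = d" by (rule trans[OF c_im[OF cd(1)] trans[OF _ c_im[OF cd(2), symmetric]]])
    qed
    have meet: "L.gr (N c) \<inter> L.gr (N d) \<noteq> {}" if cd: "c \<in> F" "d \<in> F" for c d
    proof -
      have "c \<inter> d \<noteq> {}" using F cd by (simp add: intersecting_family_def)
      then obtain P where P: "P \<in> c" "P \<in> d" by blast
      obtain X where X: "X \<in> Ov" "P = pp (rep X) (dotp (N c) (rep X))" using P(1) c_eq[OF cd(1)] by blast
      obtain Y where Y: "Y \<in> Ov" "P = pp (rep Y) (dotp (N d) (rep Y))" using P(2) c_eq[OF cd(2)] by blast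
      obtain k where k: "k \<noteq> 0" "rep X = k *s rep Y" "dotp (N c) (rep X) = k * dotp (N d) (rep Y)"
        using pp_eq[OF O.rep_in[OF X(1)] O.A_rep(1)[OF X(1)] O.rep_in[OF Y(1)]] X(2) Y(2) by metis
      have "X = Y" using O.two[OF Y(1) X(1)] k(2) unfolding in_pt by blast
      then have "(1 - k) *s rep X = 0" using k(2) by (simp add: vec.scale_left_diff_distrib)
      then have "1 - k = 0" using O.A_rep(1)[OF X(1)] vec.scale_eq_0_iff by blast
      then have "k = 1" by simp
      then have "dotp (N c) (rep X) = dotp (N d) (rep X)" using k(3) \<open>X = Y\<close> by simp
      then have "(rep X, dotp (N c) (rep X)) \<in> L.gr (N c) \<inter> L.gr (N d)" using rH[OF X(1)] by (simp add: L.gr_iff)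
      then show ?thesis by blast
    qed
    have "\<exists>x\<in>H. \<exists>a. \<forall>c'\<in>(\<lambda>c. L.gr (N c)) ` F. (x, a) \<in> c'"
    proof (rule L.laguerre_common_point[OF hyp])
      show "c' \<inter> d' \<noteq> {}" if "c' \<in> (\<lambda>c. L.gr (N c)) ` F" "d' \<in> (\<lambda>c. L.gr (N c)) ` F" for c' d'
        using that meet by blast
      show "1 / sqrt 2 * real CARD('a) ^ 2 + 2 * sqrt 2 * real CARD('a) + 8 \<le> real (card ((\<lambda>c. L.gr (N c)) ` F))"
        unfolding card_image[OF inj] by (rule size)
    qed blast
    then obtain x a where x: "x \<in> H" "\<forall>c\<in>F. (x, a) \<in> L.gr (N c)" by blast
    then show ?thesis using L.gr_iff by blast
  qed
  have on_oval: ?thesis if X: "X \<in> Ov" and a: "\<forall>c\<in>F. a = dotp (N c) (rep X)" for X a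
  proof -
    have "pp (rep X) a \<in> S - {R}" using pp_S[OF X] pp_R[OF O.rep_in[OF X] O.A_rep(1)[OF X]] by simp
    moreover have "pp (rep X) a \<in> c" if c: "c \<in> F" for c
    proof -
      have "pp (rep X) (dotp (N c) (rep X)) \<in> {pp (rep X) (dotp (N c) (rep X)) | X. X \<in> Ov}" using X by blast
      then show ?thesis using a c c_eq[OF c] by simp
    qed
    ultimately show ?thesis by blast
  qed
  have arc3: "rep Z \<notin> vec.span {rep Y, rep X}" if "X \<in> Ov" "Y \<in> Ov" "Z \<in> Ov" "X \<noteq> Y" "X \<noteq> Z" "Y \<noteq> Z" for X Y Z
  proof (rule O.three[OF that])
    show "pg_line (vec.span {rep Y, rep X})" by (rule pg_line_span[OF O.A_rep(1)[OF that(1)] O.two[OF that(1,2,4)]])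
    show "rep X \<in> vec.span {rep Y, rep X}" "rep Y \<in> vec.span {rep Y, rep X}" by (rule vec.span_base, simp)+
  qed
  have cO: "card (rep ` Ov) = CARD('a) + 1" using card_image[OF rep_inj] O.card_A by simp
  show ?thesis
  proof (cases "odd CARD('a)")
    case True
    have "arc_vectors \<pi> (rep ` Ov) (CARD('a) + 1) 1"
    proof
      show "pg_plane \<pi>" by (rule O.plane)
      show "rep ` Ov \<subseteq> \<pi>" using O.rep_in by blast
      show "card (rep ` Ov) = CARD('a) + 1" by (rule cO)
      show "z \<notin> vec.span {y, x}" if h: "x \<in> rep ` Ov" "y \<in> rep ` Ov" "z \<in> rep ` Ov" "x \<noteq> y" "x \<noteq> z" "y \<noteq> z" for x y z
      proof -
        obtain X Y Z where "X \<in> Ov" "x = rep X" "Y \<in> Ov" "y = rep Y" "Z \<in> Ov" "z = rep Z" using h by blast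
        then show ?thesis using arc3[of X Y Z] h by blast
      qed
    qed simp_all
    then have "\<exists>x\<in>rep ` Ov. \<exists>a. \<forall>c\<in>F. a = dotp (N c) x" by (rule main[OF _ subset_refl disjI2[OF True]])
    then obtain X a where x: "X \<in> Ov" "\<forall>c\<in>F. a = dotp (N c) (rep X)" by blast
    show ?thesis by (rule on_oval[OF x])
  next
    case False
    then have ev: "even CARD('a)" by simp
    have "\<exists>y. y \<in> \<pi> \<and> y \<noteq> 0 \<and> (\<forall>P Q. P \<in> Ov \<longrightarrow> Q \<in> Ov \<longrightarrow> P \<noteq> Q \<longrightarrow> y \<notin> vec.span {rep Q, rep P})"
    proof (rule O.ex_nucleus[OF ev])
      fix y assume y: "y \<in> \<pi>" "y \<noteq> 0"
        and no: "\<And>P Q. P \<in> Ov \<Longrightarrow> Q \<in> Ov \<Longrightarrow> P \<noteq> Q \<Longrightarrow> y \<notin> vec.span {rep Q, rep P}"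
      show ?thesis by (intro exI[of _ y] conjI allI impI y no)
    qed
    then obtain y where y0: "y \<in> \<pi>" "y \<noteq> 0"
      and no: "\<forall>P Q. P \<in> Ov \<longrightarrow> Q \<in> Ov \<longrightarrow> P \<noteq> Q \<longrightarrow> y \<notin> vec.span {rep Q, rep P}" by (elim exE conjE)
    note y = y0 no[rule_format]
    have other: "\<exists>Y\<in>Ov. Y \<noteq> X" for X
    proof (rule ccontr)
      assume "\<not> (\<exists>Y\<in>Ov. Y \<noteq> X)"
      then have "Ov \<subseteq> {X}" by blast
      then have "card Ov \<le> 1" using card_mono[of "{X}" Ov] by simp
      then show False using O.card_A card_field_ge2[where 'a='a] by simp
    qed
    have yX: "y \<notin> pt (rep X)" if X: "X \<in> Ov" for X
    proof -
      obtain Y where Y: "Y \<in> Ov" "Y \<noteq> X" using other by blast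
      have "pt (rep X) \<subseteq> vec.span {rep Y, rep X}" by (rule vec.span_mono) simp
      then show ?thesis using y(3)[OF X Y(1)] Y(2) by blast
    qed
    have yn: "y \<notin> rep ` Ov" using yX vec.span_base by blast
    have mixed: "rep Y \<notin> vec.span {rep X, y}" if XY: "X \<in> Ov" "Y \<in> Ov" "X \<noteq> Y" for X Y
    proof
      assume "rep Y \<in> vec.span {rep X, y}"
      then obtain a b where ab: "rep Y = a *s rep X + b *s y" unfolding in_span2 by blast
      show False
      proof (cases "b = 0")
        case True
        then show False using O.two[OF XY] ab unfolding in_pt by auto
      next
        case False
        have "b *s y = 1 *s rep Y + (- a) *s rep X" by (simp add: ab)
        then have "b *s y \<in> vec.span {rep Y, rep X}" unfolding in_span2 by blast
        then show False using scale_in_span[OF _ False] y(3)[OF XY] by blast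
      qed
    qed
    \<comment> \<open>The nucleus lies on no secant, so adding it to the oval gives a
      hyperoval.\<close>
    have "arc_vectors \<pi> (insert y (rep ` Ov)) (CARD('a) + 2) 0"
    proof
      show "pg_plane \<pi>" by (rule O.plane)
      show "insert y (rep ` Ov) \<subseteq> \<pi>" using O.rep_in y(1) by blast
      show "card (insert y (rep ` Ov)) = CARD('a) + 2" using yn cO by simp
      show "z \<notin> vec.span {w, x}"
        if h: "x \<in> insert y (rep ` Ov)" "w \<in> insert y (rep ` Ov)" "z \<in> insert y (rep ` Ov)" "x \<noteq> w" "x \<noteq> z" "w \<noteq> z" for x w z
      proof -
        consider "x = y" "w \<in> rep ` Ov" "z \<in> rep ` Ov" | "w = y" "x \<in> rep ` Ov" "z \<in> rep ` Ov"
          | "z = y" "x \<in> rep ` Ov" "w \<in> rep ` Ov" | "x \<in> rep ` Ov" "w \<in> rep ` Ov" "z \<in> rep ` Ov"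
          using h by blast
        then show ?thesis
        proof cases
          case 1
          then obtain W Z where "W \<in> Ov" "w = rep W" "Z \<in> Ov" "z = rep Z" by blast
          then show ?thesis using mixed[of W Z] h(6) 1(1) by blast
        next
          case 2
          then obtain X Z where "X \<in> Ov" "x = rep X" "Z \<in> Ov" "z = rep Z" by blast
          then show ?thesis using mixed[of X Z] h(5) 2(1) by (metis insert_commute)
        next
          case 3
          then obtain X W where "X \<in> Ov" "x = rep X" "W \<in> Ov" "w = rep W" by blast
          then show ?thesis using y(3)[of X W] h(4) 3(1) by blast
        next
          case 4
          then obtain X W Z where "X \<in> Ov" "x = rep X" "W \<in> Ov" "w = rep W" "Z \<in> Ov" "z = rep Z" by blast
          then show ?thesis using arc3[of X W Z] h(4-6) by blast
        qed
      qed
    qed simp_all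
    then have "\<exists>x\<in>insert y (rep ` Ov). \<exists>a. \<forall>c\<in>F. a = dotp (N c) x"
      by (rule main[OF _ subset_insertI disjI1[OF refl]])
    then obtain x a where x: "x \<in> insert y (rep ` Ov)" "\<forall>c\<in>F. a = dotp (N c) x" by blast
    show ?thesis
    proof (cases "x = y")
      case False
      then obtain X where X: "X \<in> Ov" "x = rep X" using x(1) by blast
      show ?thesis by (rule on_oval[OF X(1)]) (use x(2) X(2) in blast)
    next
      case True
      \<comment> \<open>Projection from the vertex carries the secants of \<open>c\<close> to
        secants of the oval and y + a v0 to \<open>y\<close>. As \<open>y\<close> lies on no secant
        of the oval, y + a v0 lies on none of \<open>c\<close>, and \<open>nucleusI\<close> applies
        in the plane of \<open>c\<close>.\<close>
      have "circle_through_nucleus S c (pp y a)" if c: "c \<in> F" for c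
      proof -
        obtain \<pi>' where \<pi>': "c = plane_section S \<pi>'" "oval_plane S \<pi>'" "\<forall>x. x + dotp (N c) x *s v0 \<in> \<pi>'"
          using N[OF c] by blast
        have oi: "oval_in \<pi>' c" using \<pi>'(1,2) by (simp add: oval_plane_def)
        interpret C: oval_points \<pi>' c using oi by unfold_locales (auto simp: oval_in_def)
        have ya: "a = dotp (N c) y" using x(2) c unfolding True by blast
        have "nucleus_in \<pi>' c (pt (y + a *s v0))"
        proof (rule C.nucleusI)
          show "y + a *s v0 \<in> \<pi>'" using \<pi>'(3) ya by blast
          show "y + a *s v0 \<noteq> 0" by (rule pp_nz[OF y(1,2)])
          fix P Q assume PQ: "P \<in> c" "Q \<in> c" "P \<noteq> Q"
          obtain X where X: "X \<in> Ov" "P = pp (rep X) (dotp (N c) (rep X))" using PQ(1) c_eq[OF c] by blast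
          obtain Y where Y: "Y \<in> Ov" "Q = pp (rep Y) (dotp (N c) (rep Y))" using PQ(2) c_eq[OF c] by blast
          have XY: "X \<noteq> Y"
          proof
            assume "X = Y"
            then show False using X(2) Y(2) PQ(3) by simp
          qed
          have rP: "\<exists>k b. rep P = k *s rep X + b *s v0"
          proof -
            have "pt (rep P) = pt (rep X + dotp (N c) (rep X) *s v0)" using C.A_rep(2)[OF PQ(1)] X(2) by (simp add: pp_def)
            then obtain k where "rep P = k *s (rep X + dotp (N c) (rep X) *s v0)" using pt_eq_iff[OF C.A_rep(1)[OF PQ(1)]] by blast
            then have "rep P = k *s rep X + (k * dotp (N c) (rep X)) *s v0" by (simp add: vec.scale_right_distrib)
            then show ?thesis by blast
          qed
          have rQ: "\<exists>k b. rep Q = k *s rep Y + b *s v0"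
          proof -
            have "pt (rep Q) = pt (rep Y + dotp (N c) (rep Y) *s v0)" using C.A_rep(2)[OF PQ(2)] Y(2) by (simp add: pp_def)
            then obtain k where "rep Q = k *s (rep Y + dotp (N c) (rep Y) *s v0)" using pt_eq_iff[OF C.A_rep(1)[OF PQ(2)]] by blast
            then have "rep Q = k *s rep Y + (k * dotp (N c) (rep Y)) *s v0" by (simp add: vec.scale_right_distrib)
            then show ?thesis by blast
          qed
          show "y + a *s v0 \<notin> vec.span {rep Q, rep P}"
          proof
            assume "y + a *s v0 \<in> vec.span {rep Q, rep P}"
            then obtain s t where st: "y + a *s v0 = s *s rep Q + t *s rep P" unfolding in_span2 by blast
            obtain k b where k: "rep P = k *s rep X + b *s v0" using rP by blast
            obtain l d where l: "rep Q = l *s rep Y + d *s v0" using rQ by blast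
            have e: "y + a *s v0 = ((s * l) *s rep Y + (t * k) *s rep X) + (s * d + t * b) *s v0"
              unfolding st k l by (simp add: vec.scale_right_distrib vec.scale_left_distrib add_ac)
            have "(s * l) *s rep Y + (t * k) *s rep X \<in> \<pi>"
              by (intro vec.subspace_add[OF O.sub] vec.subspace_scale[OF O.sub] O.rep_in X Y)
            then have "y = (s * l) *s rep Y + (t * k) *s rep X" by (rule proj[OF y(1) _ e, THEN conjunct1])
            then have "y \<in> vec.span {rep Y, rep X}" unfolding in_span2 by blast
            then show False using y(3)[OF X(1) Y(1) XY] by blast
          qed
        qed
        then show ?thesis using \<pi>' unfolding circle_through_nucleus_def pp_def by blast
      qed
      then show ?thesis using ev by blast
    qed
  qed
qed

theorem theorem1p3:
  fixes q :: nat
  assumes q: "q = CARD('a::{field,finite})"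
  shows "(\<forall>(S :: ('a ^ 4) set set) F.
            (ovoid S \<or> hyperbolic_quadric S) \<and>
            intersecting_family (ovoidal_circles S) F \<and>
            real (card F) \<ge> 1 / sqrt 2 * real q ^ 2 + 2 * sqrt 2 * real q + 8 \<longrightarrow>
            (\<exists>P\<in>S. \<forall>c\<in>F. P \<in> c)) \<and>
         (\<forall>R (S :: ('a ^ 4) set set) F.
            oval_cone R S \<and>
            intersecting_family (ovoidal_circles S) F \<and>
            real (card F) \<ge> 1 / sqrt 2 * real q ^ 2 + 2 * sqrt 2 * real q + 8 \<longrightarrow>
            (\<exists>P\<in>S - {R}. \<forall>c\<in>F. P \<in> c) \<or>
            (even q \<and> (\<exists>N. \<forall>c\<in>F. circle_through_nucleus S c N))) \<and>
         (\<forall>(\<phi> :: 'a \<Rightarrow> 'a) F.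
            field_automorphism \<phi> \<and>
            intersecting_family (CM_circles \<phi>) F \<and>
            real (card F) \<ge> 1 / sqrt 2 * real q ^ 2 + 2 * sqrt 2 * real q + 8 \<longrightarrow>
            (\<exists>P\<in>CM_points. \<forall>c\<in>F. P \<in> c))"
proof (intro conjI allI impI)
  fix S :: "('a ^ 4) set set" and F
  assume a: "(ovoid S \<or> hyperbolic_quadric S) \<and> intersecting_family (ovoidal_circles S) F \<and>
    1 / sqrt 2 * real q ^ 2 + 2 * sqrt 2 * real q + 8 \<le> real (card F)"
  then show "\<exists>P\<in>S. \<forall>c\<in>F. P \<in> c"
    using hyperbolic_common_point[of S F] ovoid_space.ovoid_common_point[of S F]
    by (auto simp: q ovoid_space_def)
next
  fix R and S :: "('a ^ 4) set set" and F
  assume a: "oval_cone R S \<and> intersecting_family (ovoidal_circles S) F \<and>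
    1 / sqrt 2 * real q ^ 2 + 2 * sqrt 2 * real q + 8 \<le> real (card F)"
  then show "(\<exists>P\<in>S - {R}. \<forall>c\<in>F. P \<in> c) \<or> (even q \<and> (\<exists>N. \<forall>c\<in>F. circle_through_nucleus S c N))"
    using cone_common_point[of R S F] unfolding q by blast
next
  fix \<phi> :: "'a \<Rightarrow> 'a" and F
  assume a: "field_automorphism \<phi> \<and> intersecting_family (CM_circles \<phi>) F \<and>
    1 / sqrt 2 * real q ^ 2 + 2 * sqrt 2 * real q + 8 \<le> real (card F)"
  then have "field_aut \<phi>" by (simp add: field_aut_def)
  then show "\<exists>P\<in>CM_points. \<forall>c\<in>F. P \<in> c"
    using field_aut.CM_common_point[of \<phi> F] a unfolding q by blast
qed

end
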